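(* Let $d,m,n\ge1$ be integers and $\delta>0$. There exists a constant $N=N(d,n,m,\delta)$ such that the following holds. Let $A^{\alpha\beta}=A^{\alpha\beta}(t)$, $|\alpha|=|\beta|=m$, be measurable $n\times n$ complex matrix-valued functions of $t\in\mathbb R$ only, satisfying $|A^{\alpha\beta}|\le\delta^{-1}$ and the Legendre–Hadamard condition with constant $\delta$; let $A(t)=A^{\hat\alpha\hat\alpha}(t)$ with $\hat\alpha=(m,0,\dots,0)$, and put $$\mathfrak L_0u=A(t)D_1^{2m}u+\sum_{j=2}^dD_j^{2m}u.$$ Let $r\in(0,\infty)$, $\kappa\in[64,\infty)$, $\lambda\ge0$, and $X_0=(t_0,x_0)\in\overline{\mathcal O_\infty^+}$, where $\mathcal O_\infty^+=\mathbb R\times\mathbb R^d_+$. Assume that $u\in C^\infty_{\mathrm{loc}}(\overline{\mathcal O_\infty^+})$ satisfies $$u(t,0,x')=\cdots=D_1^{m-1}u(t,0,x')=0\quad\text{on }\mathbb R\times\mathbb R^{d-1}$$ and $u_t+(-1)^m\mathfrak L_0u+\lambda u=0$ in $Q_{\kappa r}^+(X_0)$. Then $$\big(|\mathcal E(D^mu)-(\mathcal E(D^mu))_{Q_r(X_0)}|\big)_{Q_r(X_0)}\le N\kappa^{-1}\sum_{k=0}^m\lambda^{\frac12-\frac k{2m}}\big(|\mathcal E(D^ku)|^2\big)_{Q_{\kappa r}(X_0)}^{\frac12},$$ $$\big(|\mathcal E(D_1^{2m}u)-(\mathcal E(D_1^{2m}u))_{Q_r(X_0)}|\big)_{Q_r(X_0)}\le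 N\kappa^{-1}\sum_{k=0}^{2m}\lambda^{1-\frac k{2m}}\big(|\mathcal E(D^ku)|^2\big)_{Q_{\kappa r}(X_0)}^{\frac12}.$$
   Context: $\mathbb R^d_+=\{x=(x_1,x')\in\mathbb R\times\mathbb R^{d-1}:x_1>0\}$. Functions are $\mathbb C^n$-valued; $D^ku$ is the collection of all spatial derivatives of order $k$ (the first estimate is for every derivative $D^\gamma u$, $|\gamma|=m$). $C^\infty_{\mathrm{loc}}(\overline{\mathcal O_\infty^+})$ is the set of infinitely differentiable functions on $\overline{\mathcal O_\infty^+}$ (smooth up to the boundary, no growth restriction). Legendre–Hadamard condition: $\Re\big(\sum_{|\alpha|=|\beta|=m}\theta^{\mathrm{tr}}\xi^\alpha\xi^\beta A^{\alpha\beta}(t)\bar\theta\big)\ge\delta|\xi|^{2m}|\theta|^2$ for all $t\in\mathbb R$, $\xi\in\mathbb R^d$, $\theta\in\mathbb C^n$. $Q_r(t,x)=(t-r^{2m},t)\times B_r(x)$, $Q_r^+(t,x)=Q_r(t,x)\cap\mathcal O_\infty^+$; $(g)_{\mathcal D}=\frac1{|\mathcal D|}\int_{\mathcal D}g\,dx\,dt$. For $g$ defined on $\mathcal O_\infty^+$, $\mathcal Eg$ is its even extension in $x_1$: $\mathcal Eg(t,x_1,x')=g(t,|x_1|,x')$. For $\lambda=0$, $\lambda^0=1$. *)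

theory Defs
  imports "HOL-Analysis.Analysis"
begin

text \<open>
  Space is \<^typ>\<open>real ^ 'd\<close> with a finite linearly ordered index type, so that the coordinates
  come as $x_1, \dots, x_d$ with $d = $ \<^term>\<open>CARD('d)\<close>. Space-time points are pairs $(t, x)$.
\<close>

type_synonym 'd pt = "real \<times> (real ^ 'd)"

abbreviation first :: "'d::{finite,linorder}" where
  "first \<equiv> Min UNIV"

definition O_plus :: "('d::{finite,linorder}) pt set" where
  "O_plus = {z. snd z $ first > 0}"

abbreviation O_bar :: "('d::{finite,linorder}) pt set" where
  "O_bar \<equiv> closure O_plus"

lemma O_bar_eq: "(O_bar :: ('d::{finite,linorder}) pt set) = {z. snd z $ first \<ge> 0}"
proof -
  have O: "O_plus = (UNIV :: real set) \<times> {x :: (real, 'd) vec. 0 < x $ first}"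
    by (simp only: O_plus_def set_eq_iff mem_Times_iff UNIV_I mem_Collect_eq simp_thms)
  have "axis (first :: 'd) (1::real) \<noteq> 0"
    by (simp add: axis_eq_0_iff)
  then have cl: "closure {x :: (real, 'd) vec. 0 < x $ first} = {x. 0 \<le> x $ first}"
    using closure_halfspace_gt[of "axis (first :: 'd) (1::real)" 0]
    by (simp add: inner_axis')
  have eq: "O_bar = (UNIV :: real set) \<times> {x :: (real, 'd) vec. 0 \<le> x $ first}"
    unfolding O closure_Times cl closure_UNIV by (rule refl)
  show ?thesis
    by (simp only: eq set_eq_iff mem_Times_iff UNIV_I mem_Collect_eq simp_thms)
qed


section \<open>Derivatives and smoothness up to the boundary\<close>

text \<open>
  All derivatives are taken relative to the closed half-space: they are ordinary partial
  derivatives in the interior, and at a boundary point the derivative in $x_1$ is one-sided.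
  Values of a function outside the closed half-space do not influence its derivatives on it.
\<close>

definition along :: "'d pt \<Rightarrow> ('d::{finite,linorder}) pt \<Rightarrow> real set" where
  "along v z = {s. z + s *\<^sub>R v \<in> O_bar}"

definition partial :: "'d pt \<Rightarrow> (('d::{finite,linorder}) pt \<Rightarrow> 'b::real_normed_vector) \<Rightarrow> 'd pt \<Rightarrow> 'b" where
  "partial v u z = vector_derivative (\<lambda>s. u (z + s *\<^sub>R v)) (at 0 within along v z)"

definition D_t :: "(('d::{finite,linorder}) pt \<Rightarrow> 'b::real_normed_vector) \<Rightarrow> 'd pt \<Rightarrow> 'b" where
  "D_t = partial (1, 0)"

definition D_x :: "'d \<Rightarrow> (('d::{finite,linorder}) pt \<Rightarrow> 'b::real_normed_vector) \<Rightarrow> 'd pt \<Rightarrow> 'b" where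
  "D_x j = partial (0, axis j 1)"

text \<open>
  \<open>C_k k u\<close>: all iterated partial derivatives in $(t,x)$ of order at most $k$, taken in any order,
  exist and are continuous on the closed half-space. \<^const>\<open>Basis\<close> consists of the time direction
  and the coordinate directions of space.
\<close>

primrec C_k :: "nat \<Rightarrow> (('d::{finite,linorder}) pt \<Rightarrow> 'b::real_normed_vector) \<Rightarrow> bool" where
  "C_k 0 u \<longleftrightarrow> continuous_on O_bar u"
| "C_k (Suc k) u \<longleftrightarrow> continuous_on O_bar u \<and>
     (\<forall>v\<in>Basis. (\<forall>z\<in>O_bar. (\<lambda>s. u (z + s *\<^sub>R v)) differentiable (at 0 within along v z)) \<and>
                C_k k (partial v u))"

definition C_inf_loc :: "(('d::{finite,linorder}) pt \<Rightarrow> 'b::real_normed_vector) \<Rightarrow> bool" where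
  "C_inf_loc u \<longleftrightarrow> (\<forall>k. C_k k u)"

definition multi_idx :: "nat \<Rightarrow> ('d::finite \<Rightarrow> nat) set" where
  "multi_idx k = {\<gamma>. (\<Sum>i\<in>UNIV. \<gamma> i) = k}"

lemma finite_multi_idx: "finite (multi_idx k :: ('d::finite \<Rightarrow> nat) set)"
proof (rule finite_subset)
  show "multi_idx k \<subseteq> {\<gamma> :: 'd \<Rightarrow> nat. \<forall>i. \<gamma> i \<in> {..k}}"
  proof
    fix \<gamma> :: "'d \<Rightarrow> nat" assume "\<gamma> \<in> multi_idx k"
    then have "\<gamma> i \<le> k" for i
      using member_le_sum[of i UNIV \<gamma>] by (simp add: multi_idx_def)
    then show "\<gamma> \<in> {\<gamma>. \<forall>i. \<gamma> i \<in> {..k}}" by simp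
  qed
  show "finite {\<gamma> :: 'd \<Rightarrow> nat. \<forall>i. \<gamma> i \<in> {..k}}"
    using finite_PiE[of "UNIV :: 'd set" "\<lambda>_. {..k}"] by (simp add: PiE_UNIV_domain Pi_def)
qed

text \<open>$D^\gamma u = D_1^{\gamma_1} \cdots D_d^{\gamma_d} u$.\<close>

definition D_mult :: "('d \<Rightarrow> nat) \<Rightarrow> (('d::{finite,linorder}) pt \<Rightarrow> 'b::real_normed_vector) \<Rightarrow> 'd pt \<Rightarrow> 'b" where
  "D_mult \<gamma> u = foldr (\<lambda>i. D_x i ^^ \<gamma> i) (sorted_list_of_set UNIV) u"


section \<open>Coefficients and the operator\<close>

type_synonym ('d, 'n) coeffs = "('d \<Rightarrow> nat) \<Rightarrow> ('d \<Rightarrow> nat) \<Rightarrow> real \<Rightarrow> complex ^ 'n ^ 'n"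

definition monomial :: "real ^ 'd \<Rightarrow> ('d::finite \<Rightarrow> nat) \<Rightarrow> real" where
  "monomial \<xi> \<alpha> = (\<Prod>i\<in>UNIV. (\<xi> $ i) ^ \<alpha> i)"

text \<open>$\theta^{\mathrm{tr}} M \bar\theta$.\<close>

definition sesq :: "complex ^ 'n ^ 'n \<Rightarrow> complex ^ 'n \<Rightarrow> complex" where
  "sesq M \<theta> = (\<Sum>i\<in>UNIV. \<Sum>j\<in>UNIV. \<theta> $ i * M $ i $ j * cnj (\<theta> $ j))"

definition legendre_hadamard :: "nat \<Rightarrow> real \<Rightarrow> ('d::finite, 'n::finite) coeffs \<Rightarrow> bool" where
  "legendre_hadamard m \<delta> A \<longleftrightarrow> (\<forall>t (\<xi> :: real ^ 'd) (\<theta> :: complex ^ 'n).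
     Re (\<Sum>\<alpha>\<in>multi_idx m. \<Sum>\<beta>\<in>multi_idx m.
           of_real (monomial \<xi> \<alpha> * monomial \<xi> \<beta>) * sesq (A \<alpha> \<beta> t) \<theta>)
       \<ge> \<delta> * norm \<xi> ^ (2 * m) * (norm \<theta>)\<^sup>2)"

text \<open>The norm on matrices is the Euclidean (Frobenius) norm of \<^typ>\<open>complex ^ 'n ^ 'n\<close>.\<close>

definition admissible :: "nat \<Rightarrow> real \<Rightarrow> ('d::finite, 'n::finite) coeffs \<Rightarrow> bool" where
  "admissible m \<delta> A \<longleftrightarrow>
     (\<forall>\<alpha>\<in>multi_idx m. \<forall>\<beta>\<in>multi_idx m.
        A \<alpha> \<beta> \<in> borel_measurable lebesgue \<and> (\<forall>t. norm (A \<alpha> \<beta> t) \<le> inverse \<delta>)) \<and>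
     legendre_hadamard m \<delta> A"

definition alpha_hat :: "nat \<Rightarrow> 'd::{finite,linorder} \<Rightarrow> nat" where
  "alpha_hat m = (\<lambda>i. if i = first then m else 0)"

definition L0 :: "nat \<Rightarrow> ('d::{finite,linorder}, 'n::finite) coeffs \<Rightarrow>
    ('d pt \<Rightarrow> complex ^ 'n) \<Rightarrow> 'd pt \<Rightarrow> complex ^ 'n" where
  "L0 m A u z = A (alpha_hat m) (alpha_hat m) (fst z) *v (D_x first ^^ (2 * m)) u z
     + (\<Sum>j\<in>UNIV - {first}. (D_x j ^^ (2 * m)) u z)"


section \<open>Cylinders, averages, even extension\<close>

definition Q_cyl :: "nat \<Rightarrow> real \<Rightarrow> 'd pt \<Rightarrow> ('d::{finite,linorder}) pt set" where
  "Q_cyl m r X = {fst X - r ^ (2 * m) <..< fst X} \<times> ball (snd X) r"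

definition Q_cyl_plus :: "nat \<Rightarrow> real \<Rightarrow> 'd pt \<Rightarrow> ('d::{finite,linorder}) pt set" where
  "Q_cyl_plus m r X = Q_cyl m r X \<inter> O_plus"

definition avg :: "('a::euclidean_space) set \<Rightarrow> ('a \<Rightarrow> 'b::{banach,second_countable_topology}) \<Rightarrow> 'b" where
  "avg D g = (LINT z:D|lebesgue. g z) /\<^sub>R measure lebesgue D"

definition even_ext :: "('d pt \<Rightarrow> 'b) \<Rightarrow> ('d::{finite,linorder}) pt \<Rightarrow> 'b" where
  "even_ext g z = g (fst z, \<chi> i. if i = first then \<bar>snd z $ i\<bar> else snd z $ i)"

definition mean_osc :: "('a::euclidean_space) set \<Rightarrow> ('a \<Rightarrow> 'b::{banach,second_countable_topology}) \<Rightarrow> real" where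
  "mean_osc D g = avg D (\<lambda>z. norm (g z - avg D g))"

text \<open>$|\mathcal E(D^k u)|$, the Euclidean norm of the collection of all $\mathcal E(D^\gamma u)$, $|\gamma| = k$.\<close>

definition norm_E_Dk :: "nat \<Rightarrow> (('d::{finite,linorder}) pt \<Rightarrow> 'b::real_normed_vector) \<Rightarrow> 'd pt \<Rightarrow> real" where
  "norm_E_Dk k u z = L2_set (\<lambda>\<gamma>. norm (even_ext (D_mult \<gamma> u) z)) (multi_idx k)"

text \<open>$a^s$ with $a^0 = 1$ also for $a = 0$, whereas \<^term>\<open>0 powr 0 = (0::real)\<close>.\<close>

definition pow0 :: "real \<Rightarrow> real \<Rightarrow> real" where
  "pow0 a s = (if s = 0 then 1 else a powr s)"

end

theory Submission
  imports Defs "HOL-Computational_Algebra.Polynomial"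
begin

text \<open>
  The single term \<open>k = m\<close> (respectively \<open>k = 2 * m\<close>) of the right-hand side suffices. For bounded
  \<open>\<kappa>\<close> the mean oscillation is trivially bounded by the average over the larger cylinder, so let
  \<open>\<kappa>\<close> be large and work on boxes of size $\rho \sim \kappa r$ that are cut off at $x_1 = 0$.

  The equation, with coefficients depending on $t$ only, is preserved by every spatial derivative, and the
  Dirichlet condition by tangential derivatives and, using the equation on the boundary, by $D_1^{2m}$.
  Testing with powers of a polynomial weight gives a Caccioppoli inequality; iterating it bounds
  $\|D_1^{2mk} D'^\beta u\|_{L^2}$ on smaller boxes by $\|u\|_{L^2}$. A Sobolev inequality applied one variable
  at a time turns this into pointwise bounds for all derivatives, and integrating these along segments bounds the
  oscillation of $D^\gamma u$ on a box of size $r$ by $(r/\rho) \rho^{-m}$ times the normalised $L^2$ norm of $u$.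
  Near the boundary the Poincare inequality replaces $u$ by $\rho^m D_1^m u$; away from it $D^\gamma u$ is itself a solution,
  and so is $D_1^{2m} u$ in all cases.
\<close>

section \<open>One-dimensional weighted inequalities\<close>

text \<open>The coefficient is merely measurable in t, so the equation cannot be differentiated in
  time, and a normal derivative of u in general loses the Dirichlet condition. Hence only tangential
  derivatives and D_1^(2m) can be iterated; normal derivatives of other orders come from
  interpolation, and u_t comes only from the equation. That brings in \<lambda> u, while the
  constants must not depend on \<lambda>: the energy inequality keeps the term \<lambda> |u|^2,
  whose sign is favourable, and applying it twice bounds \<lambda> \<rho>^(2m) u on a smaller box.
  Boxes replace balls because box and weight are then products. The energy inequalities are proved
  on segments parallel to an axis (spatial ones have fixed t, hence a fixed coefficient), always in
  the form that a single integral is nonnegative, and Fubini adds them up. A polynomial weight has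
  explicit derivatives, bounded by lower powers of itself. Boxes are closed while the equation holds
  in an open half-cylinder, so the top time \<tau> of a box stays strictly below t_0; all constants
  are uniform in \<tau>.\<close>

lemma interpolate_seq_step:
  fixes K :: "real \<Rightarrow> real"
  assumes "\<epsilon> > 0"
  shows "\<exists>C\<ge>0. \<forall>b::nat\<Rightarrow>real. (\<forall>j. 0 \<le> b j) \<longrightarrow>
     (\<forall>j \<eta>. 1 \<le> j \<longrightarrow> j < m \<longrightarrow> \<eta> > 0 \<longrightarrow> b j \<le> \<eta> * b (Suc j) + K \<eta> * b (j-1)) \<longrightarrow>
     j < m \<longrightarrow> b j \<le> \<epsilon> * b (Suc j) + C * b 0"
  using assms
proof (induction j arbitrary: \<epsilon>)
  case 0
  then show ?case by (intro exI[of _ 1]) (auto)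
next
  case (Suc j)
  \<comment> \<open>The induction hypothesis is used with 1/(2 K0), so that K0 times it contributes
    only half of \<open>b (Suc j)\<close>, which is absorbed on the left. The summand 1 makes K0
    positive whatever K is.\<close>
  define K0 where "K0 = \<bar>K (\<epsilon>/2)\<bar> + 1"
  have K0: "K0 > 0" "K (\<epsilon>/2) \<le> K0" by (auto simp: K0_def)
  from Suc.IH[of "1/(2*K0)"] K0 obtain C where C: "C \<ge> 0"
    "\<And>b::nat\<Rightarrow>real. (\<forall>j. 0 \<le> b j) \<Longrightarrow>
     (\<forall>j \<eta>. 1 \<le> j \<longrightarrow> j < m \<longrightarrow> \<eta> > 0 \<longrightarrow> b j \<le> \<eta> * b (Suc j) + K \<eta> * b (j-1)) \<Longrightarrow>
     j < m \<Longrightarrow> b j \<le> 1/(2*K0) * b (Suc j) + C * b 0" by auto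
  show ?case
  proof (rule exI[of _ "2*K0*C"], intro conjI allI impI)
    show "0 \<le> 2*K0*C" using K0 C by auto
    fix b :: "nat \<Rightarrow> real"
    assume b: "\<forall>j. 0 \<le> b j" and *: "\<forall>j \<eta>. 1 \<le> j \<longrightarrow> j < m \<longrightarrow> \<eta> > 0 \<longrightarrow> b j \<le> \<eta> * b (Suc j) + K \<eta> * b (j-1)"
      and j: "Suc j < m"
    have 1: "b (Suc j) \<le> \<epsilon>/2 * b (Suc (Suc j)) + K (\<epsilon>/2) * b j"
      using * j Suc.prems by (metis One_nat_def diff_Suc_1 half_gt_zero le_add1 plus_1_eq_Suc)
    have 2: "K (\<epsilon>/2) * b j \<le> K0 * b j" using K0 b by (intro mult_right_mono) auto
    have 3: "K0 * b j \<le> K0 * (1/(2*K0) * b (Suc j) + C * b 0)"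
      using K0 C(2)[OF b *] j by (intro mult_left_mono) auto
    have 4: "K0 * (1/(2*K0) * b (Suc j) + C * b 0) = b (Suc j)/2 + K0 * C * b 0"
      using K0 by (simp add: field_simps)
    from 1 2 3 4 show "b (Suc j) \<le> \<epsilon> * b (Suc (Suc j)) + 2*K0*C * b 0" by (simp add: field_simps)
  qed
qed

text \<open>The neighbour estimates are chained upwards with coefficient 1, and only the last link
  uses \<epsilon>; every link adds its own multiple of \<open>b 0\<close>.\<close>

lemma interpolate_seq_far:
  fixes K :: "real \<Rightarrow> real"
  assumes "\<epsilon> > 0"
  shows "\<exists>C\<ge>0. \<forall>b::nat\<Rightarrow>real. (\<forall>j. 0 \<le> b j) \<longrightarrow>
     (\<forall>j \<eta>. 1 \<le> j \<longrightarrow> j < m \<longrightarrow> \<eta> > 0 \<longrightarrow> b j \<le> \<eta> * b (Suc j) + K \<eta> * b (j-1)) \<longrightarrow>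
     j + i < m \<longrightarrow> b j \<le> \<epsilon> * b (Suc (j + i)) + C * b 0"
  using assms
proof (induction i arbitrary: \<epsilon>)
  case 0
  then show ?case using interpolate_seq_step[of \<epsilon> m K j] by simp
next
  case (Suc i)
  from Suc.IH[of 1] obtain C1 where C1: "C1 \<ge> 0"
    "\<And>b::nat\<Rightarrow>real. (\<forall>j. 0 \<le> b j) \<Longrightarrow>
     (\<forall>j \<eta>. 1 \<le> j \<longrightarrow> j < m \<longrightarrow> \<eta> > 0 \<longrightarrow> b j \<le> \<eta> * b (Suc j) + K \<eta> * b (j-1)) \<Longrightarrow>
     j + i < m \<Longrightarrow> b j \<le> 1 * b (Suc (j + i)) + C1 * b 0" by auto
  from interpolate_seq_step[OF Suc.prems, of m K "Suc (j+i)"] obtain C2 where C2: "C2 \<ge> 0"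
    "\<And>b::nat\<Rightarrow>real. (\<forall>j. 0 \<le> b j) \<Longrightarrow>
     (\<forall>j \<eta>. 1 \<le> j \<longrightarrow> j < m \<longrightarrow> \<eta> > 0 \<longrightarrow> b j \<le> \<eta> * b (Suc j) + K \<eta> * b (j-1)) \<Longrightarrow>
     Suc (j + i) < m \<Longrightarrow> b (Suc (j+i)) \<le> \<epsilon> * b (Suc (Suc (j + i))) + C2 * b 0" by auto
  show ?case
  proof (rule exI[of _ "C1+C2"], intro conjI allI impI)
    show "0 \<le> C1 + C2" using C1 C2 by auto
    fix b :: "nat \<Rightarrow> real"
    assume b: "\<forall>j. 0 \<le> b j" and *: "\<forall>j \<eta>. 1 \<le> j \<longrightarrow> j < m \<longrightarrow> \<eta> > 0 \<longrightarrow> b j \<le> \<eta> * b (Suc j) + K \<eta> * b (j-1)"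
      and j: "j + Suc i < m"
    show "b j \<le> \<epsilon> * b (Suc (j + Suc i)) + (C1+C2) * b 0"
      using C1(2)[OF b *] C2(2)[OF b *] j by (simp add: algebra_simps)
  qed
qed

text \<open>Interpolation in the abstract: \<open>b j\<close> will be the scaled size of a j-th
  derivative, either a weighted L^2 integral or a maximum over an interval. The constant is chosen
  before b because it has to serve all functions and all boxes at once.\<close>

lemma interpolate_seq:
  fixes K :: "real \<Rightarrow> real"
  assumes "\<epsilon> > 0"
  shows "\<exists>C\<ge>0. \<forall>b::nat\<Rightarrow>real. (\<forall>j. 0 \<le> b j) \<longrightarrow>
     (\<forall>j \<eta>. 1 \<le> j \<longrightarrow> j < m \<longrightarrow> \<eta> > 0 \<longrightarrow> b j \<le> \<eta> * b (Suc j) + K \<eta> * b (j-1)) \<longrightarrow>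
     (\<forall>j<m. b j \<le> \<epsilon> * b m + C * b 0)"
proof -
  have "\<exists>C. \<forall>j. C j \<ge> 0 \<and> (\<forall>b::nat\<Rightarrow>real. (\<forall>j. 0 \<le> b j) \<longrightarrow>
     (\<forall>j \<eta>. 1 \<le> j \<longrightarrow> j < m \<longrightarrow> \<eta> > 0 \<longrightarrow> b j \<le> \<eta> * b (Suc j) + K \<eta> * b (j-1)) \<longrightarrow>
     j + (m-1-j) < m \<longrightarrow> b j \<le> \<epsilon> * b (Suc (j + (m-1-j))) + C j * b 0)"
    using interpolate_seq_far[OF assms] by (intro choice) metis
  then obtain C where C: "\<And>j. C j \<ge> 0" "\<And>j b. (\<forall>j. 0 \<le> b j) \<Longrightarrow>
     (\<forall>j \<eta>. 1 \<le> j \<longrightarrow> j < m \<longrightarrow> \<eta> > 0 \<longrightarrow> b j \<le> \<eta> * b (Suc j) + K \<eta> * b (j-1)) \<Longrightarrow>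
     j + (m-1-j) < m \<Longrightarrow> b j \<le> \<epsilon> * b (Suc (j + (m-1-j))) + C j * b 0" by blast
  show ?thesis
  proof (rule exI[of _ "\<Sum>j<m. C j"], intro conjI allI impI)
    show "0 \<le> (\<Sum>j<m. C j)" using C by (simp add: sum_nonneg)
    fix b :: "nat \<Rightarrow> real" and j
    assume b: "\<forall>j. 0 \<le> b j" and *: "\<forall>j \<eta>. 1 \<le> j \<longrightarrow> j < m \<longrightarrow> \<eta> > 0 \<longrightarrow> b j \<le> \<eta> * b (Suc j) + K \<eta> * b (j-1)"
      and j: "j < m"
    have "C j * b 0 \<le> (\<Sum>j<m. C j) * b 0"
      using b j C by (intro mult_right_mono member_le_sum) auto
    with C(2)[OF b *, of j] j show "b j \<le> \<epsilon> * b m + (\<Sum>j<m. C j) * b 0" by simp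
  qed
qed

section \<open>The polynomial weight and its derivatives\<close>

definition wt :: "real \<Rightarrow> real \<Rightarrow> real \<Rightarrow> real" where
  "wt c \<rho> s = 1 - ((s - c) / \<rho>)\<^sup>2"

text \<open>The k-th derivative of \<open>wt c \<rho> s ^ N\<close> in s, computed on polynomials:
  \<open>[:1, 0, -1:]\<close> is 1 - y^2 with y = (s - c)/\<rho>, and the chain rule produces the
  factor 1/\<rho>^k.\<close>

definition wt_deriv :: "nat \<Rightarrow> real \<Rightarrow> real \<Rightarrow> nat \<Rightarrow> real \<Rightarrow> real" where
  "wt_deriv N c \<rho> k s = poly ((pderiv ^^ k) ([:1, 0, -1:] ^ N)) ((s - c) / \<rho>) / \<rho> ^ k"

lemma wt_deriv_0: "wt_deriv N c \<rho> 0 s = wt c \<rho> s ^ N"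
  by (simp add: wt_deriv_def wt_def poly_power power2_eq_square)

lemma wt_deriv_has_derivative:
  assumes "\<rho> \<noteq> 0"
  shows "(wt_deriv N c \<rho> k has_vector_derivative wt_deriv N c \<rho> (Suc k) s) (at s within S)"
proof -
  have "(wt_deriv N c \<rho> k has_real_derivative wt_deriv N c \<rho> (Suc k) s) (at s)"
    unfolding wt_deriv_def using assms
    by (auto intro!: derivative_eq_intros DERIV_chain'[OF _ poly_DERIV] simp: field_simps)
  then show ?thesis
    by (metis has_real_derivative_iff_has_vector_derivative has_vector_derivative_at_within)
qed

text \<open>Each differentiation removes at most one factor P. The cofactor may stay anonymous,
  since only its boundedness on a compact interval will be used.\<close>

lemma pderiv_power_factor:
  fixes P :: "real poly"
  assumes "k \<le> N"
  shows "\<exists>q. (pderiv ^^ k) (P ^ N) = P ^ (N - k) * q"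
  using assms
proof (induction k)
  case 0 then show ?case by (intro exI[of _ 1]) simp
next
  case (Suc k)
  then obtain q where q: "(pderiv ^^ k) (P ^ N) = P ^ (N - k) * q" by auto
  obtain n where n: "N - k = Suc n" "N - Suc k = n" using Suc.prems by (metis Suc_diff_le diff_Suc_Suc)
  have "(pderiv ^^ Suc k) (P ^ N) = P ^ n * (P * pderiv q + smult (of_nat (Suc n)) (pderiv P) * q)"
  proof -
    have "(pderiv ^^ Suc k) (P ^ N) = P ^ Suc n * pderiv q + q * pderiv (P ^ Suc n)"
      by (simp only: funpow.simps o_apply q n pderiv_mult)
    also have "... = P ^ Suc n * pderiv q + q * (smult (of_nat (Suc n)) (P ^ n) * pderiv P)"
      by (simp only: pderiv_power_Suc)
    also have "... = P ^ n * (P * pderiv q + smult (of_nat (Suc n)) (pderiv P) * q)"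
      by (simp add: distrib_left ac_simps del: of_nat_Suc)
    finally show ?thesis .
  qed
  then show ?case using n by auto
qed

lemma wt_range:
  assumes "\<bar>s - c\<bar> \<le> \<rho>" "\<rho> > 0"
  shows "0 \<le> wt c \<rho> s" "wt c \<rho> s \<le> 1"
proof -
  have "\<bar>(s - c)/\<rho>\<bar> \<le> 1" using assms by simp
  then have "((s - c)/\<rho>)\<^sup>2 \<le> 1" by (simp add: abs_square_le_1)
  then show "0 \<le> wt c \<rho> s" "wt c \<rho> s \<le> 1" by (auto simp: wt_def)
qed

text \<open>In the variable y = (s - c)/\<rho> the cofactor of the remaining power of the weight is
  a fixed polynomial on [-1, 1], bounded by compactness. This makes the constant independent of c
  and \<rho>; the sum over k serves all orders simultaneously.\<close>

lemma wt_deriv_bound: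
  "\<exists>C\<ge>0. \<forall>k\<le>N. \<forall>c \<rho> s. \<rho> > 0 \<longrightarrow> \<bar>s - c\<bar> \<le> \<rho> \<longrightarrow> \<bar>wt_deriv N c \<rho> k s\<bar> \<le> C / \<rho>^k * wt c \<rho> s ^ (N - k)"
proof -
  have 1: "\<exists>C\<ge>0. \<forall>c \<rho> s. \<rho> > 0 \<longrightarrow> \<bar>s - c\<bar> \<le> \<rho> \<longrightarrow> \<bar>wt_deriv N c \<rho> k s\<bar> \<le> C / \<rho>^k * wt c \<rho> s ^ (N - k)"
    if k: "k \<le> N" for k
  proof -
    obtain q where q: "(pderiv ^^ k) ([:1,0,-1::real:] ^ N) = [:1,0,-1:] ^ (N - k) * q"
      using pderiv_power_factor[OF k] by blast
    have "compact (poly q ` {-1..1})"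
      by (intro compact_continuous_image continuous_intros compact_Icc)
    then obtain C where C: "\<And>y. y \<in> {-1..1} \<Longrightarrow> \<bar>poly q y\<bar> \<le> C"
      using compact_imp_bounded[of "poly q ` {-1..1}"] unfolding bounded_iff real_norm_def by blast
    have C0: "C \<ge> 0" using C[of 0] by auto
    show ?thesis
    proof (intro exI[of _ C] conjI allI impI C0)
      fix c \<rho> s :: real assume r: "\<rho> > 0" and s: "\<bar>s - c\<bar> \<le> \<rho>"
      have "(s - c)/\<rho> \<in> {-1..1}" using r s by (auto simp: field_simps abs_le_iff)
      then have "\<bar>poly q ((s-c)/\<rho>)\<bar> \<le> C" by (rule C)
      moreover have "wt_deriv N c \<rho> k s = wt c \<rho> s ^ (N-k) * poly q ((s-c)/\<rho>) / \<rho>^k"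
        by (simp add: wt_deriv_def q wt_def poly_power power2_eq_square)
      ultimately show "\<bar>wt_deriv N c \<rho> k s\<bar> \<le> C / \<rho>^k * wt c \<rho> s ^ (N - k)"
        using wt_range[OF s r] r by (auto simp: abs_mult mult.commute intro!: divide_right_mono mult_right_mono)
    qed
  qed
  then have "\<exists>C. \<forall>k\<in>{..N}. C k \<ge> 0 \<and> (\<forall>c \<rho> s. \<rho> > 0 \<longrightarrow> \<bar>s - c\<bar> \<le> \<rho> \<longrightarrow> \<bar>wt_deriv N c \<rho> k s\<bar> \<le> C k / \<rho>^k * wt c \<rho> s ^ (N - k))"
    by (intro bchoice) auto
  then obtain C where C: "\<And>k. k \<le> N \<Longrightarrow> C k \<ge> 0" "\<And>k c \<rho> s. k \<le> N \<Longrightarrow> \<rho> > 0 \<Longrightarrow> \<bar>s - c\<bar> \<le> \<rho> \<Longrightarrow> \<bar>wt_deriv N c \<rho> k s\<bar> \<le> C k / \<rho>^k * wt c \<rho> s ^ (N - k)"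
    by (meson atMost_iff)
  show ?thesis
  proof (intro exI[of _ "\<Sum>k\<le>N. C k"] conjI allI impI)
    show "0 \<le> (\<Sum>k\<le>N. C k)" using C(1) by (intro sum_nonneg) auto
    fix k c \<rho> s assume k: "k \<le> N" and r: "\<rho> > (0::real)" and s: "\<bar>s - c\<bar> \<le> \<rho>"
    have "C k \<le> (\<Sum>k\<le>N. C k)" using k C by (intro member_le_sum) auto
    then have "C k / \<rho>^k * wt c \<rho> s ^ (N - k) \<le> (\<Sum>k\<le>N. C k) / \<rho>^k * wt c \<rho> s ^ (N - k)"
      using r wt_range[OF s r] by (intro mult_right_mono divide_right_mono) auto
    with C(2)[OF k r s] show "\<bar>wt_deriv N c \<rho> k s\<bar> \<le> (\<Sum>k\<le>N. C k) / \<rho>^k * wt c \<rho> s ^ (N - k)" by linarith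
  qed
qed

text \<open>A function is carried together with its derivatives as a sequence. A shift of the
  sequence or its image under a linear map is then again a chain, and the restrictions of
  \<open>(D_x j ^^ k) u\<close> to a segment fit without any iterated derivative operator on
  intervals. Derivatives at the end points are one-sided.\<close>

definition deriv_chain :: "nat \<Rightarrow> real \<Rightarrow> real \<Rightarrow> (nat \<Rightarrow> real \<Rightarrow> 'b::real_normed_vector) \<Rightarrow> bool" where
  "deriv_chain n \<alpha> \<beta> f \<longleftrightarrow> (\<forall>k<n. \<forall>s\<in>{\<alpha>..\<beta>}. (f k has_vector_derivative f (Suc k) s) (at s within {\<alpha>..\<beta>}))
     \<and> (\<forall>k\<le>n. continuous_on {\<alpha>..\<beta>} (f k))"

lemma deriv_chainD:
  assumes "deriv_chain n \<alpha> \<beta> f"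
  shows "k < n \<Longrightarrow> s \<in> {\<alpha>..\<beta>} \<Longrightarrow> (f k has_vector_derivative f (Suc k) s) (at s within {\<alpha>..\<beta>})"
    and "k \<le> n \<Longrightarrow> continuous_on {\<alpha>..\<beta>} (f k)"
  using assms by (auto simp: deriv_chain_def)

lemma deriv_chain_mono: "deriv_chain n \<alpha> \<beta> f \<Longrightarrow> k \<le> n \<Longrightarrow> deriv_chain k \<alpha> \<beta> f"
  by (auto simp: deriv_chain_def)

lemma deriv_chain_shift: "deriv_chain n \<alpha> \<beta> f \<Longrightarrow> k + i \<le> n \<Longrightarrow> deriv_chain k \<alpha> \<beta> (\<lambda>j. f (i + j))"
  by (auto simp: deriv_chain_def)

lemma integral_le_combination:
  fixes A G X Y :: "real \<Rightarrow> real"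
  assumes "A integrable_on S" "(G has_integral 0) S" "X integrable_on S" "Y integrable_on S"
    and "\<And>s. s \<in> S \<Longrightarrow> A s \<le> G s + (x * X s + y * Y s)"
  shows "integral S A \<le> x * integral S X + y * integral S Y"
proof -
  have "((\<lambda>s. G s + (x * X s + y * Y s)) has_integral (0 + (x * integral S X + y * integral S Y))) S"
    using assms by (intro has_integral_add has_integral_mult_right integrable_integral)
  from has_integral_le[OF integrable_integral[OF assms(1)] this assms(5)] show ?thesis by simp
qed

lemma young_weighted:
  fixes a b c \<theta> :: real
  assumes "\<theta> > 0"
  shows "a * b \<le> \<theta> / 2 * a\<^sup>2 + 1 / (2 * \<theta>) * b\<^sup>2"
proof -
  have "0 \<le> (\<theta> * a - b)\<^sup>2 / (2 * \<theta>)" using assms by simp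
  also have "... = \<theta> / 2 * a\<^sup>2 + 1 / (2 * \<theta>) * b\<^sup>2 - a * b"
    using assms by (simp add: power2_eq_square field_simps)
  finally show ?thesis by simp
qed

section \<open>Weighted interpolation on a slice\<close>

lemma continuous_on_wt [continuous_intros]: "\<rho> \<noteq> 0 \<Longrightarrow> continuous_on S (wt c \<rho>)"
  unfolding wt_def by (intro continuous_intros) auto

lemma wt_ends: "\<rho> \<noteq> 0 \<Longrightarrow> wt c \<rho> (c - \<rho>) = 0" "\<rho> \<noteq> 0 \<Longrightarrow> wt c \<rho> (c + \<rho>) = 0"
  by (auto simp: wt_def)

text \<open>The slice of a cylinder in the direction $x_1$ is either the full interval
  $[c - \rho, c + \rho]$ or is cut off at the boundary, where the Dirichlet condition replaces
  the vanishing of the weight.\<close>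

definition slice_dirichlet :: "nat \<Rightarrow> real \<Rightarrow> real \<Rightarrow> real \<Rightarrow> (nat \<Rightarrow> real \<Rightarrow> 'b::real_normed_vector) \<Rightarrow> bool" where
  "slice_dirichlet m c \<rho> \<alpha> f \<longleftrightarrow> \<rho> > 0 \<and> c - \<rho> \<le> \<alpha> \<and> \<alpha> \<le> c \<and> (\<alpha> = c - \<rho> \<or> (\<forall>k<m. f k \<alpha> = 0))"

text \<open>Integrate the derivative of w^(N+2k) (f_(k-1), f_k). At the right end w vanishes; at the
  left end either w vanishes or f_(k-1) does, because k-1 < m. What remains expresses the integral
  of w^(N+2k) |f_k|^2 through the products of f_(k-1) with f_(k+1) and with w' f_k, and Young's
  inequality splits both. The exponents N+2k rise by two per derivative so that the middle one is
  the mean of its neighbours, and the powers of \<rho> make all terms scale alike.\<close>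

lemma weighted_interpolation_step:
  fixes f :: "nat \<Rightarrow> real \<Rightarrow> 'b::euclidean_space"
  assumes ch: "deriv_chain (Suc k) \<alpha> (c+\<rho>) f" and bd: "slice_dirichlet m c \<rho> \<alpha> f"
    and k: "1 \<le> k" "k \<le> m" and \<theta>: "\<theta> > 0"
  shows "\<rho>^(2*k) * integral {\<alpha>..c+\<rho>} (\<lambda>s. wt c \<rho> s ^ (N + 2*k) * (norm (f k s))\<^sup>2)
    \<le> \<theta> * (\<rho>^(2*Suc k) * integral {\<alpha>..c+\<rho>} (\<lambda>s. wt c \<rho> s ^ (N + 2*Suc k) * (norm (f (Suc k) s))\<^sup>2))
      + (1/\<theta> + 4 * real (N+2*k)^2) * (\<rho>^(2*(k-1)) * integral {\<alpha>..c+\<rho>} (\<lambda>s. wt c \<rho> s ^ (N + 2*(k-1)) * (norm (f (k-1) s))\<^sup>2))"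
proof -
  obtain j where kj: "k = Suc j" using k by (metis Suc_le_D One_nat_def)
  let ?S = "{\<alpha>..c+\<rho>}"
  have \<rho>: "\<rho> > 0" and \<alpha>: "c - \<rho> \<le> \<alpha>" "\<alpha> \<le> c" using bd by (auto simp: slice_dirichlet_def)
  define n where "n = N + 2*j + 1"
  define w where "w = wt c \<rho>"
  define w' where "w' s = - 2 * ((s - c)/\<rho>) / \<rho>" for s
  have w': "(w has_real_derivative w' s) (at s within ?S)" for s
  proof -
    have 1: "((\<lambda>s. (s - c)/\<rho>) has_real_derivative 1/\<rho>) (at s within ?S)"
      using \<rho> by (auto intro!: derivative_eq_intros)
    have "((\<lambda>s. 1 - ((s - c)/\<rho>)^2) has_real_derivative 0 - real 2 * (1/\<rho> * ((s - c)/\<rho>)^(2 - 1))) (at s within ?S)"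
      using DERIV_diff[OF DERIV_const DERIV_power[OF 1, of 2], of 1] by simp
    moreover have "0 - real 2 * (1/\<rho> * ((s - c)/\<rho>)^(2 - 1)) = w' s" unfolding w'_def by (simp add: minus_divide_left)
    moreover have "w = (\<lambda>s. 1 - ((s - c)/\<rho>)^2)" by (simp add: w_def wt_def[abs_def])
    ultimately show ?thesis by (simp only:)
  qed
  define G where "G s = w s ^ Suc n * (f j s \<bullet> f (Suc (Suc j)) s + f k s \<bullet> f k s) + (real (Suc n) * (w' s * w s ^ n)) * (f j s \<bullet> f k s)" for s
  have dG: "((\<lambda>s. w s ^ Suc n * (f j s \<bullet> f k s)) has_real_derivative G s) (at s within ?S)" if s: "s \<in> ?S" for s
  proof -
    have 1: "(f j has_vector_derivative f k s) (at s within ?S)" "(f k has_vector_derivative f (Suc (Suc j)) s) (at s within ?S)"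
      using deriv_chainD(1)[OF ch] s kj by auto
    have 2: "((\<lambda>s. f j s \<bullet> f k s) has_real_derivative (f j s \<bullet> f (Suc (Suc j)) s + f k s \<bullet> f k s)) (at s within ?S)"
      using bounded_bilinear.has_vector_derivative[OF bounded_bilinear_inner 1]
      by (simp add: has_real_derivative_iff_has_vector_derivative)
    show ?thesis unfolding G_def
      by (rule DERIV_cong[OF DERIV_mult[OF DERIV_power[OF w'] 2]]) (simp del: of_nat_Suc power_Suc)
  qed
  have "w (c+\<rho>) = 0" using \<rho> by (simp add: w_def wt_ends)
  moreover have "w \<alpha> = 0 \<or> f j \<alpha> = 0"
    using bd k \<rho> kj by (auto simp: slice_dirichlet_def w_def wt_ends)
  ultimately have G0: "(G has_integral 0) ?S"
    using fundamental_theorem_of_calculus[of \<alpha> "c+\<rho>" "\<lambda>s. w s ^ Suc n * (f j s \<bullet> f k s)" G] dG \<alpha> \<rho>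
    by (auto simp: has_real_derivative_iff_has_vector_derivative)
  have cont: "continuous_on ?S w" "continuous_on ?S (f j)" "continuous_on ?S (f k)" "continuous_on ?S (f (Suc k))"
    using deriv_chainD(2)[OF ch] kj \<rho> by (auto simp: w_def intro: continuous_intros)
  have key: "integral ?S (\<lambda>s. 1/2 * (w s ^ Suc n * (norm (f k s))\<^sup>2))
     \<le> (\<theta>*\<rho>\<^sup>2/2) * integral ?S (\<lambda>s. w s ^ (n+3) * (norm (f (Suc k) s))\<^sup>2)
       + ((1/\<theta> + 4 * (real (Suc n))\<^sup>2) / (2*\<rho>\<^sup>2)) * integral ?S (\<lambda>s. w s ^ (n-1) * (norm (f j s))\<^sup>2)"
  proof (rule integral_le_combination[OF _ G0])
    show "(\<lambda>s. 1/2 * (w s ^ Suc n * (norm (f k s))\<^sup>2)) integrable_on ?S"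
      "(\<lambda>s. w s ^ (n+3) * (norm (f (Suc k) s))\<^sup>2) integrable_on ?S"
      "(\<lambda>s. w s ^ (n-1) * (norm (f j s))\<^sup>2) integrable_on ?S"
      by (intro integrable_continuous_real continuous_intros cont)+
    fix s assume s: "s \<in> ?S"
    have sc: "\<bar>s - c\<bar> \<le> \<rho>" using s \<alpha> by (auto simp: abs_le_iff)
    have w01: "0 \<le> w s" using wt_range[OF sc \<rho>] by (simp add: w_def)
    have w'b: "\<bar>w' s\<bar> \<le> 2/\<rho>" using sc \<rho> by (simp add: w'_def abs_mult divide_simps)
    define P where "P = w s ^ (N+2*j)"
    have P0: "P \<ge> 0" using w01 by (simp add: P_def)
    define x y z where "x = norm (f (Suc k) s)" and "y = norm (f k s)" and "z = norm (f j s)"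
    have pw: "w s ^ Suc n = P * (w s)^2" "w s ^ n = P * w s" "w s ^ (n+3) = P * (w s)^4" "w s ^ (n-1) = P"
      by (auto simp: n_def P_def power_add[symmetric] power_Suc[symmetric] simp del: power_Suc) (simp_all add: power_add eval_nat_numeral)
    have t1: "- (f j s \<bullet> f (Suc k) s) * (w s)^2 \<le> (\<theta>*\<rho>\<^sup>2/2) * ((w s)^4 * x\<^sup>2) + (1/(2*\<theta>*\<rho>\<^sup>2)) * z\<^sup>2"
    proof -
      have "- (f j s \<bullet> f (Suc k) s) \<le> x * z"
        using Cauchy_Schwarz_ineq2[of "f j s" "f (Suc k) s"] by (simp add: x_def z_def mult.commute)
      then have "- (f j s \<bullet> f (Suc k) s) * (w s)^2 \<le> (x * z) * (w s)^2" by (intro mult_right_mono) auto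
      also have "... = ((w s)^2 * x) * z" by simp
      also have "... \<le> (\<theta>*\<rho>\<^sup>2)/2 * ((w s)^2 * x)\<^sup>2 + 1/(2*(\<theta>*\<rho>\<^sup>2)) * z\<^sup>2"
        using \<theta> \<rho> by (intro young_weighted) simp
      finally show ?thesis by (simp add: power_mult_distrib power_mult[symmetric] mult.assoc)
    qed
    have t2: "- (real (Suc n) * (w' s * w s)) * (f j s \<bullet> f k s) \<le> 1/2 * ((w s)^2 * y\<^sup>2) + (2 * (real (Suc n))\<^sup>2/\<rho>\<^sup>2) * z\<^sup>2"
    proof -
      have "- (real (Suc n) * (w' s * w s)) * (f j s \<bullet> f k s) \<le> \<bar>(real (Suc n) * (w' s * w s)) * (f j s \<bullet> f k s)\<bar>"
        by (metis abs_ge_minus_self mult_minus_left)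
      also have "... = (real (Suc n) * w s) * (\<bar>w' s\<bar> * \<bar>f j s \<bullet> f k s\<bar>)" using w01 by (simp add: abs_mult)
      also have "... \<le> (real (Suc n) * w s) * ((2/\<rho>) * (z * y))"
        using w01 w'b \<rho> Cauchy_Schwarz_ineq2[of "f j s" "f k s"] by (intro mult_left_mono mult_mono) (auto simp: z_def y_def)
      also have "... = (w s * y) * ((2 * real (Suc n) / \<rho>) * z)" by simp
      also have "... \<le> 1/2 * (w s * y)\<^sup>2 + 1/(2*1) * ((2 * real (Suc n) / \<rho>) * z)\<^sup>2"
        by (intro young_weighted) simp
      finally show ?thesis by (simp add: power_mult_distrib power_divide mult_ac del: of_nat_Suc)
    qed
    have "1/2 * ((w s)^2 * y\<^sup>2) \<le> ((w s)^2 * ((f j s \<bullet> f (Suc k) s) + y\<^sup>2) + (real (Suc n) * (w' s * w s)) * (f j s \<bullet> f k s))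
       + ((\<theta>*\<rho>\<^sup>2/2) * ((w s)^4 * x\<^sup>2) + ((1/\<theta> + 4 * (real (Suc n))\<^sup>2) / (2*\<rho>\<^sup>2)) * z\<^sup>2)"
    proof -
      have "((1/\<theta> + 4 * (real (Suc n))\<^sup>2) / (2*\<rho>\<^sup>2)) * z\<^sup>2 = (1/(2*\<theta>*\<rho>\<^sup>2)) * z\<^sup>2 + (2 * (real (Suc n))\<^sup>2/\<rho>\<^sup>2) * z\<^sup>2"
        using \<theta> \<rho> by (simp add: field_simps eval_nat_numeral del: of_nat_Suc)
      with t1 t2 show ?thesis by (simp add: distrib_left algebra_simps del: of_nat_Suc)
    qed
    from mult_left_mono[OF this P0]
    show "1/2 * (w s ^ Suc n * (norm (f k s))\<^sup>2) \<le> G s + ((\<theta>*\<rho>\<^sup>2/2) * (w s ^ (n+3) * (norm (f (Suc k) s))\<^sup>2)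
       + ((1/\<theta> + 4 * (real (Suc n))\<^sup>2) / (2*\<rho>\<^sup>2)) * (w s ^ (n-1) * (norm (f j s))\<^sup>2))"
      unfolding G_def pw x_def[symmetric] y_def[symmetric] z_def[symmetric]
      by (simp add: kj dot_square_norm y_def algebra_simps del: of_nat_Suc)
  qed
  have e: "Suc n = N + 2*k" "n + 3 = N + 2*Suc k" "n - 1 = N + 2*(k-1)" "j = k-1" by (auto simp: n_def kj)
  have r: "\<rho>^(2*k) = \<rho>^(2*j) * \<rho>\<^sup>2" "\<rho>^(2*Suc k) = \<rho>^(2*j) * \<rho>^4"
    by (simp_all add: kj power_add eval_nat_numeral)
  define I1 I2 I3 where "I1 = integral ?S (\<lambda>s. w s ^ Suc n * (norm (f k s))\<^sup>2)"
    and "I2 = integral ?S (\<lambda>s. w s ^ (n+3) * (norm (f (Suc k) s))\<^sup>2)"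
    and "I3 = integral ?S (\<lambda>s. w s ^ (n-1) * (norm (f j s))\<^sup>2)"
  have "I1/2 \<le> (\<theta>*\<rho>\<^sup>2/2) * I2 + ((1/\<theta> + 4 * (real (Suc n))\<^sup>2) / (2*\<rho>\<^sup>2)) * I3"
    using key unfolding I1_def I2_def I3_def by simp
  then have "I1 * \<rho>\<^sup>2 \<le> \<theta> * \<rho>^4 * I2 + (1/\<theta> + 4 * (real (Suc n))\<^sup>2) * I3"
  proof -
    define X where "X = 1/\<theta> + 4 * (real (Suc n))\<^sup>2"
    assume "I1/2 \<le> (\<theta>*\<rho>\<^sup>2/2) * I2 + ((1/\<theta> + 4 * (real (Suc n))\<^sup>2) / (2*\<rho>\<^sup>2)) * I3"
    then have "2*\<rho>\<^sup>2 * (I1/2) \<le> 2*\<rho>\<^sup>2 * ((\<theta>*\<rho>\<^sup>2/2) * I2 + (X / (2*\<rho>\<^sup>2)) * I3)"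
      unfolding X_def by (intro mult_left_mono) auto
    also have "... = \<theta> * \<rho>^4 * I2 + X * I3" using \<rho> by (simp add: distrib_left eval_nat_numeral)
    finally show ?thesis by (simp add: X_def mult.commute)
  qed
  from mult_left_mono[OF this, of "\<rho>^(2*j)"] \<rho>
  have "\<rho>^(2*k) * I1 \<le> \<theta> * (\<rho>^(2*Suc k) * I2) + (1/\<theta> + 4 * (real (Suc n))\<^sup>2) * (\<rho>^(2*j) * I3)"
    unfolding r by (simp add: algebra_simps del: of_nat_Suc)
  then show ?thesis unfolding I1_def I2_def I3_def w_def e by simp
qed

text \<open>The preceding step holds with one function K of \<eta> for all orders below m, so the
  abstract interpolation applies to the sequence of scaled weighted integrals.\<close>

lemma weighted_interpolation:
  assumes "\<epsilon> > 0"
  shows "\<exists>C\<ge>0. \<forall>(f :: nat \<Rightarrow> real \<Rightarrow> 'b::euclidean_space) \<alpha> c \<rho>. deriv_chain m \<alpha> (c+\<rho>) f \<longrightarrow> slice_dirichlet m c \<rho> \<alpha> f \<longrightarrow>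
    (\<forall>j<m. \<rho>^(2*j) * integral {\<alpha>..c+\<rho>} (\<lambda>s. wt c \<rho> s ^ (N + 2*j) * (norm (f j s))\<^sup>2)
      \<le> \<epsilon> * (\<rho>^(2*m) * integral {\<alpha>..c+\<rho>} (\<lambda>s. wt c \<rho> s ^ (N + 2*m) * (norm (f m s))\<^sup>2))
        + C * integral {\<alpha>..c+\<rho>} (\<lambda>s. wt c \<rho> s ^ N * (norm (f 0 s))\<^sup>2))"
proof -
  obtain C where C: "C \<ge> 0" "\<And>b::nat\<Rightarrow>real. (\<forall>j. 0 \<le> b j) \<Longrightarrow>
     (\<forall>j \<eta>. 1 \<le> j \<longrightarrow> j < m \<longrightarrow> \<eta> > 0 \<longrightarrow> b j \<le> \<eta> * b (Suc j) + (1/\<eta> + 4 * real (N + 2*m)^2) * b (j-1)) \<Longrightarrow>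
     (\<forall>j<m. b j \<le> \<epsilon> * b m + C * b 0)"
    using interpolate_seq[OF assms, of m "\<lambda>\<eta>. 1/\<eta> + 4 * real (N + 2*m)^2"] by blast
  show ?thesis
  proof (rule exI[of _ C], intro conjI C(1), intro allI impI)
    fix f :: "nat \<Rightarrow> real \<Rightarrow> 'b" and \<alpha> c \<rho> :: real and j
    assume ch: "deriv_chain m \<alpha> (c+\<rho>) f" and bd: "slice_dirichlet m c \<rho> \<alpha> f" and j: "j < m"
    have \<rho>: "\<rho> > 0" and \<alpha>: "c - \<rho> \<le> \<alpha>" "\<alpha> \<le> c" using bd by (auto simp: slice_dirichlet_def)
    define b where "b j = \<rho>^(2*j) * integral {\<alpha>..c+\<rho>} (\<lambda>s. wt c \<rho> s ^ (N + 2*j) * (norm (f j s))\<^sup>2)" for j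
    have b0: "0 \<le> b j" for j
    proof -
      have "0 \<le> wt c \<rho> s" if "s \<in> {\<alpha>..c+\<rho>}" for s
        using that \<alpha> \<rho> by (intro wt_range) (auto simp: abs_le_iff)
      \<comment> \<open>The abstract interpolation asks for nonnegativity at every index, also
        beyond m where integrability is unknown; there the integral has the default value 0.\<close>
      then have "0 \<le> integral {\<alpha>..c+\<rho>} (\<lambda>s. wt c \<rho> s ^ (N + 2*j) * (norm (f j s))\<^sup>2)"
        by (cases "(\<lambda>s. wt c \<rho> s ^ (N + 2*j) * (norm (f j s))\<^sup>2) integrable_on {\<alpha>..c+\<rho>}")
           (auto intro!: Henstock_Kurzweil_Integration.integral_nonneg simp: not_integrable_integral)
      then show ?thesis using \<rho> by (simp add: b_def)
    qed
    have st: "b j \<le> \<eta> * b (Suc j) + (1/\<eta> + 4 * real (N + 2*m)^2) * b (j-1)" if "1 \<le> j" "j < m" "\<eta> > 0" for j \<eta>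
    proof -
      have "b j \<le> \<eta> * b (Suc j) + (1/\<eta> + 4 * real (N + 2*j)^2) * b (j-1)"
        unfolding b_def using that
        by (intro weighted_interpolation_step[OF deriv_chain_mono[OF ch] bd]) auto
      moreover have "(1/\<eta> + 4 * real (N + 2*j)^2) * b (j-1) \<le> (1/\<eta> + 4 * real (N + 2*m)^2) * b (j-1)"
        using that b0 by (intro mult_right_mono add_left_mono mult_left_mono power_mono) auto
      ultimately show ?thesis by linarith
    qed
    from C(2)[of b] b0 st j have "b j \<le> \<epsilon> * b m + C * b 0" by blast
    then show "\<rho>^(2*j) * integral {\<alpha>..c+\<rho>} (\<lambda>s. wt c \<rho> s ^ (N + 2*j) * (norm (f j s))\<^sup>2)
      \<le> \<epsilon> * (\<rho>^(2*m) * integral {\<alpha>..c+\<rho>} (\<lambda>s. wt c \<rho> s ^ (N + 2*m) * (norm (f m s))\<^sup>2))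
        + C * integral {\<alpha>..c+\<rho>} (\<lambda>s. wt c \<rho> s ^ N * (norm (f 0 s))\<^sup>2)"
      by (simp add: b_def)
  qed
qed

section \<open>Leibniz rule and repeated integration by parts\<close>

definition leibniz :: "(nat \<Rightarrow> real \<Rightarrow> real) \<Rightarrow> (nat \<Rightarrow> real \<Rightarrow> 'b::real_vector) \<Rightarrow> nat \<Rightarrow> real \<Rightarrow> 'b" where
  "leibniz W h k s = (\<Sum>i\<le>k. (real (k choose i) * W (k - i) s) *\<^sub>R h i s)"

lemma leibniz_has_derivative:
  fixes h :: "nat \<Rightarrow> real \<Rightarrow> 'b::real_normed_vector"
  assumes W: "\<And>j. j \<le> k \<Longrightarrow> (W j has_real_derivative W (Suc j) s) (at s within S)"
    and h: "\<And>j. j \<le> k \<Longrightarrow> (h j has_vector_derivative h (Suc j) s) (at s within S)"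
  shows "(leibniz W h k has_vector_derivative leibniz W h (Suc k) s) (at s within S)"
proof -
  let ?X = "\<lambda>i. W (Suc k - i) s *\<^sub>R h i s"
  have "(leibniz W h k has_vector_derivative
     (\<Sum>i\<le>k. (real (k choose i) * W (k - i) s) *\<^sub>R h (Suc i) s + (real (k choose i) * W (Suc (k - i)) s) *\<^sub>R h i s)) (at s within S)"
    unfolding leibniz_def
    by (intro has_vector_derivative_sum has_vector_derivative_scaleR DERIV_cmult W h) auto
  also have "(\<Sum>i\<le>k. (real (k choose i) * W (k - i) s) *\<^sub>R h (Suc i) s + (real (k choose i) * W (Suc (k - i)) s) *\<^sub>R h i s)
    = (\<Sum>i\<le>k. real (k choose i) *\<^sub>R ?X (Suc i)) + (\<Sum>i\<le>k. real (k choose i) *\<^sub>R ?X i)"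
    by (simp add: sum.distrib Suc_diff_le)
  also have "(\<Sum>i\<le>k. real (k choose i) *\<^sub>R ?X i) = (\<Sum>i\<le>Suc k. real (k choose i) *\<^sub>R ?X i)"
    by simp
  also have "... = ?X 0 + (\<Sum>i\<le>k. real (k choose Suc i) *\<^sub>R ?X (Suc i))"
    by (subst sum.atMost_Suc_shift) simp
  also have "(\<Sum>i\<le>k. real (k choose i) *\<^sub>R ?X (Suc i)) + (?X 0 + (\<Sum>i\<le>k. real (k choose Suc i) *\<^sub>R ?X (Suc i)))
     = (\<Sum>i\<le>Suc k. real (Suc k choose i) *\<^sub>R ?X i)"
    by (subst sum.atMost_Suc_shift) (simp add: sum.distrib[symmetric] scaleR_left_distrib distrib_right)
  also have "... = leibniz W h (Suc k) s" by (simp add: leibniz_def)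
  finally show ?thesis .
qed

text \<open>All boundary values are put on H. This matters because g will be a chain starting at the
  m-th derivative of a solution, about whose values on the flat boundary nothing is known.\<close>

lemma integration_by_parts_iterated:
  fixes g H :: "nat \<Rightarrow> real \<Rightarrow> 'b::euclidean_space"
  assumes "\<alpha> \<le> \<beta>" and g: "deriv_chain m \<alpha> \<beta> g" and H: "deriv_chain m \<alpha> \<beta> H"
    and 0: "\<And>k. k < m \<Longrightarrow> H k \<alpha> = 0" "\<And>k. k < m \<Longrightarrow> H k \<beta> = 0"
    and i: "i \<le> m"
  shows "integral {\<alpha>..\<beta>} (\<lambda>s. g 0 s \<bullet> H m s) = (-1)^i * integral {\<alpha>..\<beta>} (\<lambda>s. g i s \<bullet> H (m - i) s)"
  using i
proof (induction i)
  case 0 then show ?case by simp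
next
  case (Suc i)
  obtain j where j: "m - i = Suc j" "m - Suc i = j" using Suc.prems by (metis Suc_diff_Suc Suc_le_lessD)
  have "j < m" using j Suc.prems by linarith
  have int: "(\<lambda>s. g (Suc i) s \<bullet> H j s) integrable_on {\<alpha>..\<beta>}" "(\<lambda>s. g i s \<bullet> H (Suc j) s) integrable_on {\<alpha>..\<beta>}"
    using deriv_chainD(2)[OF g] deriv_chainD(2)[OF H] Suc.prems \<open>j < m\<close>
    by (auto intro!: integrable_continuous_real continuous_intros)
  have "((\<lambda>s. g i s \<bullet> H j s) has_vector_derivative (g i s \<bullet> H (Suc j) s + g (Suc i) s \<bullet> H j s)) (at s within {\<alpha>..\<beta>})"
    if "s \<in> {\<alpha>..\<beta>}" for s
    using deriv_chainD(1)[OF g _ that] deriv_chainD(1)[OF H _ that] Suc.prems \<open>j < m\<close>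
    by (intro bounded_bilinear.has_vector_derivative[OF bounded_bilinear_inner]) auto
  then have "((\<lambda>s. g i s \<bullet> H (Suc j) s + g (Suc i) s \<bullet> H j s) has_integral (g i \<beta> \<bullet> H j \<beta> - g i \<alpha> \<bullet> H j \<alpha>)) {\<alpha>..\<beta>}"
    using assms(1) by (intro fundamental_theorem_of_calculus) auto
  then have "integral {\<alpha>..\<beta>} (\<lambda>s. g i s \<bullet> H (Suc j) s + g (Suc i) s \<bullet> H j s) = 0"
    using 0[OF \<open>j < m\<close>] by (simp add: integral_unique)
  then have "integral {\<alpha>..\<beta>} (\<lambda>s. g i s \<bullet> H (Suc j) s) = - integral {\<alpha>..\<beta>} (\<lambda>s. g (Suc i) s \<bullet> H j s)"
    by (simp add: Henstock_Kurzweil_Integration.integral_add[OF int(2,1)])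
  with Suc j show ?case by simp
qed

text \<open>The Leibniz rule applied to \<open>wt ^ N * h\<close>: every derivative that hits the weight costs
  one power of the weight and one factor \<open>1 / \<rho>\<close>.\<close>

lemma weighted_integration_by_parts:
  assumes "m \<le> N"
  shows "\<exists>B\<ge>0. \<forall>(h :: nat \<Rightarrow> real \<Rightarrow> 'b::euclidean_space) \<alpha> c \<rho>. deriv_chain m \<alpha> (c+\<rho>) h \<longrightarrow> slice_dirichlet m c \<rho> \<alpha> h \<longrightarrow>
    (\<exists>H. continuous_on {\<alpha>..c+\<rho>} H \<and>
      (\<forall>g. deriv_chain m \<alpha> (c+\<rho>) g \<longrightarrow>
        integral {\<alpha>..c+\<rho>} (\<lambda>s. g 0 s \<bullet> H s) = (-1)^m * integral {\<alpha>..c+\<rho>} (\<lambda>s. g m s \<bullet> (wt c \<rho> s ^ N *\<^sub>R h 0 s))) \<and>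
      (\<forall>s\<in>{\<alpha>..c+\<rho>}. norm (H s - wt c \<rho> s ^ N *\<^sub>R h m s)
         \<le> B * (\<Sum>k<m. wt c \<rho> s ^ (N - (m - k)) / \<rho>^(m - k) * norm (h k s))))"
proof -
  obtain C where C: "C \<ge> 0" "\<And>k c \<rho> s. k \<le> N \<Longrightarrow> \<rho> > 0 \<Longrightarrow> \<bar>s - c\<bar> \<le> \<rho> \<Longrightarrow> \<bar>wt_deriv N c \<rho> k s\<bar> \<le> C / \<rho>^k * wt c \<rho> s ^ (N - k)"
    using wt_deriv_bound[of N] by blast
  show ?thesis
  proof (intro exI[of _ "2^m * C"] conjI allI impI)
    show "0 \<le> 2^m * C" using C by simp
    fix h :: "nat \<Rightarrow> real \<Rightarrow> 'b" and \<alpha> c \<rho> :: real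
    assume ch: "deriv_chain m \<alpha> (c+\<rho>) h" and bd: "slice_dirichlet m c \<rho> \<alpha> h"
    have \<rho>: "\<rho> > 0" and \<alpha>: "c - \<rho> \<le> \<alpha>" "\<alpha> \<le> c" using bd by (auto simp: slice_dirichlet_def)
    let ?S = "{\<alpha>..c+\<rho>}"
    define W where "W = wt_deriv N c \<rho>"
    have Wc: "continuous_on ?S (W k)" for k
      using wt_deriv_has_derivative[of \<rho> N c k] \<rho> unfolding W_def
      by (intro continuous_on_vector_derivative) auto
    have dc: "deriv_chain m \<alpha> (c+\<rho>) (leibniz W h)"
      unfolding deriv_chain_def
    proof (intro conjI allI impI ballI)
      fix k s assume "k < m" "s \<in> ?S"
      then show "(leibniz W h k has_vector_derivative leibniz W h (Suc k) s) (at s within ?S)"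
        using wt_deriv_has_derivative \<rho> deriv_chainD(1)[OF ch]
        by (intro leibniz_has_derivative) (auto simp: W_def has_real_derivative_iff_has_vector_derivative)
    next
      fix k assume "k \<le> m"
      then show "continuous_on ?S (leibniz W h k)"
        unfolding leibniz_def using deriv_chainD(2)[OF ch]
        by (intro continuous_intros Wc) auto
    qed
    have Wb: "\<bar>W k s\<bar> \<le> C / \<rho>^k * wt c \<rho> s ^ (N - k)" if "k \<le> N" "s \<in> ?S" for k s
      unfolding W_def using that \<alpha> by (intro C \<rho>) (auto simp: abs_le_iff)
    \<comment> \<open>Since k < m \<le> N, at least one factor of the weight survives k
      differentiations.\<close>
    have W0: "W k s = 0" if "k < m" "s \<in> ?S" "wt c \<rho> s = 0" for k s
      using Wb[of k s] that assms by (simp add: power_0_left)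
    have Lz: "leibniz W h k \<alpha> = 0" "leibniz W h k (c+\<rho>) = 0" if "k < m" for k
    proof -
      show "leibniz W h k (c+\<rho>) = 0"
        unfolding leibniz_def using that \<rho> \<alpha>
        by (intro sum.neutral ballI) (simp add: W0 wt_ends)
      have "W (k - i) \<alpha> *\<^sub>R h i \<alpha> = 0" if "i \<le> k" for i
      proof (cases "\<alpha> = c - \<rho>")
        case True then show ?thesis using W0[of "k-i" \<alpha>] \<open>k < m\<close> \<rho> by (simp add: wt_ends)
      next
        case False then show ?thesis using bd \<open>k < m\<close> that by (simp add: slice_dirichlet_def)
      qed
      then show "leibniz W h k \<alpha> = 0"
        unfolding leibniz_def by (intro sum.neutral ballI) (metis atMost_iff scaleR_scaleR scaleR_zero_right)
    qed
    show "\<exists>H. continuous_on ?S H \<and>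
      (\<forall>g. deriv_chain m \<alpha> (c+\<rho>) g \<longrightarrow>
        integral ?S (\<lambda>s. g 0 s \<bullet> H s) = (-1)^m * integral ?S (\<lambda>s. g m s \<bullet> (wt c \<rho> s ^ N *\<^sub>R h 0 s))) \<and>
      (\<forall>s\<in>?S. norm (H s - wt c \<rho> s ^ N *\<^sub>R h m s)
         \<le> 2^m * C * (\<Sum>k<m. wt c \<rho> s ^ (N - (m - k)) / \<rho>^(m - k) * norm (h k s)))"
    proof (intro exI[of _ "leibniz W h m"] conjI allI impI ballI)
      show "continuous_on ?S (leibniz W h m)" using deriv_chainD(2)[OF dc] by simp
      fix g :: "nat \<Rightarrow> real \<Rightarrow> 'b" assume g: "deriv_chain m \<alpha> (c+\<rho>) g"
      have "leibniz W h 0 s = wt c \<rho> s ^ N *\<^sub>R h 0 s" for s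
        by (simp add: leibniz_def W_def wt_deriv_0)
      then show "integral ?S (\<lambda>s. g 0 s \<bullet> leibniz W h m s) = (-1)^m * integral ?S (\<lambda>s. g m s \<bullet> (wt c \<rho> s ^ N *\<^sub>R h 0 s))"
        using integration_by_parts_iterated[OF _ g dc Lz, of m] \<alpha> \<rho> by simp
    next
      fix s assume s: "s \<in> ?S"
      have sc: "\<bar>s - c\<bar> \<le> \<rho>" using s \<alpha> by (auto simp: abs_le_iff)
      have w0: "0 \<le> wt c \<rho> s" using wt_range[OF sc \<rho>] by simp
      have "leibniz W h m s = (\<Sum>i<m. (real (m choose i) * W (m - i) s) *\<^sub>R h i s) + wt c \<rho> s ^ N *\<^sub>R h m s"
        unfolding leibniz_def lessThan_Suc_atMost[symmetric] by (simp add: W_def wt_deriv_0)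
      then have "leibniz W h m s - wt c \<rho> s ^ N *\<^sub>R h m s = (\<Sum>i<m. (real (m choose i) * W (m - i) s) *\<^sub>R h i s)"
        by simp
      then have "norm (leibniz W h m s - wt c \<rho> s ^ N *\<^sub>R h m s) \<le> (\<Sum>i<m. norm ((real (m choose i) * W (m - i) s) *\<^sub>R h i s))"
        by (simp only: norm_sum)
      also have "... \<le> (\<Sum>i<m. 2^m * C * (wt c \<rho> s ^ (N - (m - i)) / \<rho>^(m - i) * norm (h i s)))"
      proof (rule sum_mono)
        fix i assume "i \<in> {..<m}"
        have b: "real (m choose i) \<le> 2^m"
          using binomial_le_pow2[of m i] by (metis of_nat_le_iff of_nat_numeral of_nat_power)
        have "norm ((real (m choose i) * W (m - i) s) *\<^sub>R h i s) = real (m choose i) * \<bar>W (m-i) s\<bar> * norm (h i s)"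
          by (simp add: abs_mult)
        also have "... \<le> 2^m * (C / \<rho>^(m-i) * wt c \<rho> s ^ (N - (m-i))) * norm (h i s)"
          using b s assms by (intro mult_right_mono mult_mono Wb) auto
        finally show "norm ((real (m choose i) * W (m - i) s) *\<^sub>R h i s)
          \<le> 2^m * C * (wt c \<rho> s ^ (N - (m - i)) / \<rho>^(m - i) * norm (h i s))"
          by (simp add: mult_ac)
      qed
      finally show "norm (leibniz W h m s - wt c \<rho> s ^ N *\<^sub>R h m s)
         \<le> 2^m * C * (\<Sum>k<m. wt c \<rho> s ^ (N - (m - k)) / \<rho>^(m - k) * norm (h k s))"
        by (simp add: sum_distrib_left)
    qed
  qed
qed

text \<open>Integrating by parts m times leaves L f_m paired with the m-th derivative of w^(N+2m) f.
  The term without derivatives of the weight is coercive; in the others Young's inequality splits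
  off a small part of it, and the orders strictly between are interpolated. The result is stated as
  nonnegativity of one integral, which is the form that can be summed over parallel slices.\<close>

lemma slice_caccioppoli:
  assumes "\<delta> > 0" "M \<ge> 0" "m \<ge> 1"
  shows "\<exists>C\<ge>0. \<forall>(L :: 'b::euclidean_space \<Rightarrow> 'b) f \<alpha> c \<rho>. bounded_linear L \<longrightarrow> (\<forall>v. L v \<bullet> v \<ge> \<delta> * (norm v)\<^sup>2) \<longrightarrow> (\<forall>v. norm (L v) \<le> M * norm v) \<longrightarrow>
    deriv_chain (2*m) \<alpha> (c+\<rho>) f \<longrightarrow> slice_dirichlet m c \<rho> \<alpha> f \<longrightarrow>
    0 \<le> integral {\<alpha>..c+\<rho>} (\<lambda>s. (-1)^m * (L (f (2*m) s) \<bullet> (wt c \<rho> s ^ (N + 2*m) *\<^sub>R f 0 s))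
          - \<delta>/2 * (wt c \<rho> s ^ (N + 2*m) * (norm (f m s))\<^sup>2) + C / \<rho>^(2*m) * (wt c \<rho> s ^ N * (norm (f 0 s))\<^sup>2))"
proof -
  obtain B where B: "B \<ge> 0" "\<And>(h :: nat \<Rightarrow> real \<Rightarrow> 'b) \<alpha> c \<rho>. deriv_chain m \<alpha> (c+\<rho>) h \<Longrightarrow> slice_dirichlet m c \<rho> \<alpha> h \<Longrightarrow>
    (\<exists>H. continuous_on {\<alpha>..c+\<rho>} H \<and>
      (\<forall>g. deriv_chain m \<alpha> (c+\<rho>) g \<longrightarrow>
        integral {\<alpha>..c+\<rho>} (\<lambda>s. g 0 s \<bullet> H s) = (-1)^m * integral {\<alpha>..c+\<rho>} (\<lambda>s. g m s \<bullet> (wt c \<rho> s ^ (N+2*m) *\<^sub>R h 0 s))) \<and>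
      (\<forall>s\<in>{\<alpha>..c+\<rho>}. norm (H s - wt c \<rho> s ^ (N+2*m) *\<^sub>R h m s)
         \<le> B * (\<Sum>k<m. wt c \<rho> s ^ ((N+2*m) - (m - k)) / \<rho>^(m - k) * norm (h k s))))"
    using weighted_integration_by_parts[of m "N+2*m"] by (auto simp del: power_Suc)
  \<comment> \<open>Each of the m commutator terms may use the fraction \<delta>/(4m) of the
    coercive term; Young's inequality then costs m (M B)^2/\<delta>. The summand 1 makes K
    positive.\<close>
  define K where "K = real m * (M * B)\<^sup>2 / \<delta> + 1"
  have K: "K > 0" using assms by (simp add: K_def add_nonneg_pos)
  \<comment> \<open>With this choice the m interpolated terms, multiplied by K, use up another
    \<delta>/4. Of the coercive term 3\<delta>/4 - \<delta>/4 = \<delta>/2 is left.\<close>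
  define \<epsilon> where "\<epsilon> = \<delta> / (4 * real m * K)"
  have \<epsilon>: "\<epsilon> > 0" using assms K by (simp add: \<epsilon>_def)
  obtain C where C: "C \<ge> 0" "\<And>(f :: nat \<Rightarrow> real \<Rightarrow> 'b) \<alpha> c \<rho> j. deriv_chain m \<alpha> (c+\<rho>) f \<Longrightarrow> slice_dirichlet m c \<rho> \<alpha> f \<Longrightarrow> j < m \<Longrightarrow>
     \<rho>^(2*j) * integral {\<alpha>..c+\<rho>} (\<lambda>s. wt c \<rho> s ^ (N + 2*j) * (norm (f j s))\<^sup>2)
      \<le> \<epsilon> * (\<rho>^(2*m) * integral {\<alpha>..c+\<rho>} (\<lambda>s. wt c \<rho> s ^ (N + 2*m) * (norm (f m s))\<^sup>2))
        + C * integral {\<alpha>..c+\<rho>} (\<lambda>s. wt c \<rho> s ^ N * (norm (f 0 s))\<^sup>2)"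
    using weighted_interpolation[OF \<epsilon>, of m N] by blast
  show ?thesis
  proof (rule exI[of _ "real m * K * C"], intro conjI, use K C in simp, intro allI impI)
    fix L :: "'b \<Rightarrow> 'b" and f :: "nat \<Rightarrow> real \<Rightarrow> 'b" and \<alpha> c \<rho> :: real
    assume L: "bounded_linear L" "\<forall>v. L v \<bullet> v \<ge> \<delta> * (norm v)\<^sup>2" "\<forall>v. norm (L v) \<le> M * norm v"
      and ch: "deriv_chain (2*m) \<alpha> (c+\<rho>) f" and bd: "slice_dirichlet m c \<rho> \<alpha> f"
    have \<rho>: "\<rho> > 0" and \<alpha>: "c - \<rho> \<le> \<alpha>" "\<alpha> \<le> c" using bd by (auto simp: slice_dirichlet_def)
    let ?S = "{\<alpha>..c+\<rho>}"
    define w where "w = wt c \<rho>"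
    have chm: "deriv_chain m \<alpha> (c+\<rho>) f" using deriv_chain_mono[OF ch] by simp
    have gch: "deriv_chain m \<alpha> (c+\<rho>) (\<lambda>j s. L (f (m + j) s))"
      using deriv_chain_shift[OF ch, of m m] L(1)
      by (auto simp: deriv_chain_def intro: bounded_linear.has_vector_derivative bounded_linear.continuous_on)
    obtain H where H: "continuous_on ?S H"
       "integral ?S (\<lambda>s. L (f m s) \<bullet> H s) = (-1)^m * integral ?S (\<lambda>s. L (f (2*m) s) \<bullet> (w s ^ (N+2*m) *\<^sub>R f 0 s))"
       "\<And>s. s \<in> ?S \<Longrightarrow> norm (H s - w s ^ (N+2*m) *\<^sub>R f m s) \<le> B * (\<Sum>k<m. w s ^ ((N+2*m) - (m - k)) / \<rho>^(m - k) * norm (f k s))"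
      using B(2)[OF chm bd] gch unfolding w_def by (force simp: mult_2)
    have contf: "continuous_on ?S (f k)" if "k \<le> 2*m" for k using deriv_chainD(2)[OF ch that] .
    have contL: "continuous_on ?S (\<lambda>s. L (f k s))" if "k \<le> 2*m" for k
      using bounded_linear.continuous_on[OF L(1) contf[OF that]] .
    have contw: "continuous_on ?S w" using \<rho> by (auto simp: w_def intro: continuous_intros)
    have pt: "L (f m s) \<bullet> H s \<ge> 3*\<delta>/4 * (w s ^ (N+2*m) * (norm (f m s))\<^sup>2)
        - K / \<rho>^(2*m) * (\<Sum>k<m. \<rho>^(2*k) * (w s ^ (N+2*k) * (norm (f k s))\<^sup>2))" if s: "s \<in> ?S" for s
    proof -
      have sc: "\<bar>s - c\<bar> \<le> \<rho>" using s \<alpha> by (auto simp: abs_le_iff)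
      have w01: "0 \<le> w s" using wt_range[OF sc \<rho>] by (simp add: w_def)
      have 1: "L (f m s) \<bullet> (w s ^ (N+2*m) *\<^sub>R f m s) \<ge> \<delta> * (w s ^ (N+2*m) * (norm (f m s))\<^sup>2)"
        using mult_left_mono[OF L(2)[rule_format, of "f m s"], of "w s ^ (N+2*m)"] w01 by (simp add: mult_ac)
      have "\<bar>L (f m s) \<bullet> (H s - w s ^ (N+2*m) *\<^sub>R f m s)\<bar> \<le> norm (L (f m s)) * norm (H s - w s ^ (N+2*m) *\<^sub>R f m s)"
        by (rule Cauchy_Schwarz_ineq2)
      also have "... \<le> (M * norm (f m s)) * (B * (\<Sum>k<m. w s ^ ((N+2*m) - (m - k)) / \<rho>^(m - k) * norm (f k s)))"
        using L(3) H(3)[OF s] assms by (intro mult_mono) auto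
      also have "... = (\<Sum>k<m. (M * norm (f m s)) * (B * (w s ^ ((N+2*m) - (m - k)) / \<rho>^(m - k) * norm (f k s))))"
        by (simp add: sum_distrib_left)
      also have "... \<le> (\<Sum>k<m. \<delta>/(4*real m) * (w s ^ (N+2*m) * (norm (f m s))\<^sup>2)
           + K / \<rho>^(2*m) * (\<rho>^(2*k) * (w s ^ (N+2*k) * (norm (f k s))\<^sup>2)))"
      proof (rule sum_mono)
        fix k assume "k \<in> {..<m}" then have k: "k < m" by simp
        have e: "w s ^ ((N+2*m) - (m - k)) = w s ^ N * (w s ^ m * w s ^ k)"
          using k by (simp add: power_add[symmetric] add_ac)
        have e2: "\<rho>^(2*m) = \<rho>^(2*k) * (\<rho>^(m-k))\<^sup>2" using k by (simp add: power_add[symmetric] power_mult[symmetric] algebra_simps)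
        define x y where "x = w s ^ m * norm (f m s)" and "y = M * B / \<rho>^(m-k) * (w s ^ k * norm (f k s))"
        have "x * y \<le> (\<delta>/(2*real m))/2 * x\<^sup>2 + 1/(2*(\<delta>/(2*real m))) * y\<^sup>2"
          using assms by (intro young_weighted) simp
        also have "1/(2*(\<delta>/(2*real m))) * y\<^sup>2 = (real m * (M*B)\<^sup>2 / \<delta>) * ((w s ^ k * norm (f k s))\<^sup>2 / (\<rho>^(m-k))\<^sup>2)"
          using assms by (simp add: y_def power_mult_distrib power_divide)
        also have "... \<le> K * ((w s ^ k * norm (f k s))\<^sup>2 / (\<rho>^(m-k))\<^sup>2)"
          by (intro mult_right_mono) (auto simp: K_def)
        finally have xy: "x * y \<le> (\<delta>/(4*real m)) * x\<^sup>2 + K * ((w s ^ k * norm (f k s))\<^sup>2 / (\<rho>^(m-k))\<^sup>2)" by simp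
        have "(M * norm (f m s)) * (B * (w s ^ ((N+2*m) - (m - k)) / \<rho>^(m - k) * norm (f k s))) = w s ^ N * (x * y)"
          unfolding e x_def y_def by simp
        also have "... \<le> w s ^ N * ((\<delta>/(4*real m)) * x\<^sup>2 + K * ((w s ^ k * norm (f k s))\<^sup>2 / (\<rho>^(m-k))\<^sup>2))"
          using w01 by (intro mult_left_mono xy) simp
        also have "... = \<delta>/(4*real m) * (w s ^ (N+2*m) * (norm (f m s))\<^sup>2)
           + K / \<rho>^(2*m) * (\<rho>^(2*k) * (w s ^ (N+2*k) * (norm (f k s))\<^sup>2))"
          unfolding e2 x_def using \<rho> by (simp add: power_mult_distrib power_add power_mult distrib_left power_even_eq mult_ac)
        finally show "(M * norm (f m s)) * (B * (w s ^ ((N+2*m) - (m - k)) / \<rho>^(m - k) * norm (f k s)))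
           \<le> \<delta>/(4*real m) * (w s ^ (N+2*m) * (norm (f m s))\<^sup>2)
           + K / \<rho>^(2*m) * (\<rho>^(2*k) * (w s ^ (N+2*k) * (norm (f k s))\<^sup>2))" .
      qed
      also have "... = \<delta>/4 * (w s ^ (N+2*m) * (norm (f m s))\<^sup>2)
        + K / \<rho>^(2*m) * (\<Sum>k<m. \<rho>^(2*k) * (w s ^ (N+2*k) * (norm (f k s))\<^sup>2))"
        using assms by (simp add: sum.distrib sum_distrib_left)
      finally have 2: "\<bar>L (f m s) \<bullet> (H s - w s ^ (N+2*m) *\<^sub>R f m s)\<bar> \<le> \<delta>/4 * (w s ^ (N+2*m) * (norm (f m s))\<^sup>2)
        + K / \<rho>^(2*m) * (\<Sum>k<m. \<rho>^(2*k) * (w s ^ (N+2*k) * (norm (f k s))\<^sup>2))" .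
      have "L (f m s) \<bullet> H s = L (f m s) \<bullet> (w s ^ (N+2*m) *\<^sub>R f m s) + L (f m s) \<bullet> (H s - w s ^ (N+2*m) *\<^sub>R f m s)"
        by (simp add: inner_diff_right)
      with 1 2 show ?thesis by linarith
    qed
    define a where "a k = integral ?S (\<lambda>s. w s ^ (N+2*k) * (norm (f k s))\<^sup>2)" for k
    have ia: "((\<lambda>s. w s ^ (N+2*k) * (norm (f k s))\<^sup>2) has_integral a k) ?S" if "k \<le> m" for k
      unfolding a_def using that
      by (intro integrable_integral integrable_continuous_real continuous_intros contw contf) auto
    define I where "I = integral ?S (\<lambda>s. L (f m s) \<bullet> H s)"
    have iI: "((\<lambda>s. L (f m s) \<bullet> H s) has_integral I) ?S"
      unfolding I_def by (intro integrable_integral integrable_continuous_real continuous_intros contL H) auto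
    have "((\<lambda>s. 3*\<delta>/4 * (w s ^ (N+2*m) * (norm (f m s))\<^sup>2)
        - K / \<rho>^(2*m) * (\<Sum>k<m. \<rho>^(2*k) * (w s ^ (N+2*k) * (norm (f k s))\<^sup>2))) has_integral
       (3*\<delta>/4 * a m - K / \<rho>^(2*m) * (\<Sum>k<m. \<rho>^(2*k) * a k))) ?S"
      by (intro has_integral_diff has_integral_mult_right has_integral_sum ia) auto
    from has_integral_le[OF this iI pt] have "3*\<delta>/4 * a m - K / \<rho>^(2*m) * (\<Sum>k<m. \<rho>^(2*k) * a k) \<le> I" .
    moreover have "K / \<rho>^(2*m) * (\<Sum>k<m. \<rho>^(2*k) * a k) \<le> \<delta>/4 * a m + real m * K * C / \<rho>^(2*m) * a 0"
    proof -
      have "(\<Sum>k<m. \<rho>^(2*k) * a k) \<le> (\<Sum>k<m. \<epsilon> * (\<rho>^(2*m) * a m) + C * a 0)"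
        using C(2)[OF chm bd] by (intro sum_mono) (auto simp: a_def w_def)
      also have "... = real m * \<epsilon> * \<rho>^(2*m) * a m + real m * C * a 0" by (simp add: distrib_left)
      finally have "K / \<rho>^(2*m) * (\<Sum>k<m. \<rho>^(2*k) * a k) \<le> K / \<rho>^(2*m) * (real m * \<epsilon> * \<rho>^(2*m) * a m + real m * C * a 0)"
        using K \<rho> by (intro mult_left_mono) auto
      also have "... = \<delta>/4 * a m + real m * K * C / \<rho>^(2*m) * a 0"
        using K \<rho> assms by (simp add: \<epsilon>_def field_simps)
      finally show ?thesis .
    qed
    ultimately have fin: "0 \<le> I - \<delta>/2 * a m + real m * K * C / \<rho>^(2*m) * a 0" by simp
    have i2: "((\<lambda>s. (-1)^m * (L (f (2*m) s) \<bullet> (w s ^ (N+2*m) *\<^sub>R f 0 s))) has_integral I) ?S"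
      unfolding I_def H(2)
      by (intro has_integral_mult_right integrable_integral integrable_continuous_real continuous_intros contw contf contL) auto
    have "((\<lambda>s. (-1)^m * (L (f (2*m) s) \<bullet> (w s ^ (N+2*m) *\<^sub>R f 0 s)) - \<delta>/2 * (w s ^ (N+2*m) * (norm (f m s))\<^sup>2)
       + real m * K * C / \<rho>^(2*m) * (w s ^ N * (norm (f 0 s))\<^sup>2)) has_integral (I - \<delta>/2 * a m + real m * K * C / \<rho>^(2*m) * a 0)) ?S"
      using ia[of 0] by (intro has_integral_add has_integral_diff has_integral_mult_right i2 ia) auto
    then show "0 \<le> integral {\<alpha>..c+\<rho>} (\<lambda>s. (-1)^m * (L (f (2*m) s) \<bullet> (wt c \<rho> s ^ (N + 2*m) *\<^sub>R f 0 s))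
          - \<delta>/2 * (wt c \<rho> s ^ (N + 2*m) * (norm (f m s))\<^sup>2) + real m * K * C / \<rho>^(2*m) * (wt c \<rho> s ^ N * (norm (f 0 s))\<^sup>2))"
      using fin by (simp add: integral_unique w_def)
  qed
qed

text \<open>One factor of w^N |f_(2m)|^2 is integrated down to f_m while m derivatives fall on the
  weight and the other factor. The dependence on \<epsilon> is explicit and C is chosen before it,
  because on a slice of a box \<epsilon> will be multiplied by a power of the constant factors of
  the weight.\<close>

lemma slice_higher_derivative:
  assumes "2*m \<le> N"
  shows "\<exists>C\<ge>0. \<forall>(f :: nat \<Rightarrow> real \<Rightarrow> 'b::euclidean_space) \<alpha> c \<rho> \<epsilon>.
    deriv_chain (3*m) \<alpha> (c+\<rho>) f \<longrightarrow> slice_dirichlet m c \<rho> \<alpha> (\<lambda>k. f (2*m+k)) \<longrightarrow> \<epsilon> > 0 \<longrightarrow>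
    0 \<le> integral {\<alpha>..c+\<rho>} (\<lambda>s. C / (\<epsilon> * \<rho>^(2*m)) * (wt c \<rho> s ^ (N-2*m) * (norm (f m s))\<^sup>2)
       + \<epsilon> * (\<rho>^(2*m) * (wt c \<rho> s ^ (N+2*m) * (norm (f (3*m) s))\<^sup>2) + wt c \<rho> s ^ N * (norm (f (2*m) s))\<^sup>2)
       - wt c \<rho> s ^ N * (norm (f (2*m) s))\<^sup>2)"
proof -
  obtain B where B: "B \<ge> 0" "\<And>(h :: nat \<Rightarrow> real \<Rightarrow> 'b) \<alpha> c \<rho>. deriv_chain m \<alpha> (c+\<rho>) h \<Longrightarrow> slice_dirichlet m c \<rho> \<alpha> h \<Longrightarrow>
    (\<exists>H. continuous_on {\<alpha>..c+\<rho>} H \<and>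
      (\<forall>g. deriv_chain m \<alpha> (c+\<rho>) g \<longrightarrow>
        integral {\<alpha>..c+\<rho>} (\<lambda>s. g 0 s \<bullet> H s) = (-1)^m * integral {\<alpha>..c+\<rho>} (\<lambda>s. g m s \<bullet> (wt c \<rho> s ^ N *\<^sub>R h 0 s))) \<and>
      (\<forall>s\<in>{\<alpha>..c+\<rho>}. norm (H s - wt c \<rho> s ^ N *\<^sub>R h m s)
         \<le> B * (\<Sum>k<m. wt c \<rho> s ^ (N - (m - k)) / \<rho>^(m - k) * norm (h k s))))"
    using weighted_integration_by_parts[of m N] assms by (auto simp del: power_Suc)
  obtain C where C: "C \<ge> 0" "\<And>(f :: nat \<Rightarrow> real \<Rightarrow> 'b) \<alpha> c \<rho> j. deriv_chain m \<alpha> (c+\<rho>) f \<Longrightarrow> slice_dirichlet m c \<rho> \<alpha> f \<Longrightarrow> j < m \<Longrightarrow>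
     \<rho>^(2*j) * integral {\<alpha>..c+\<rho>} (\<lambda>s. wt c \<rho> s ^ (N + 2*j) * (norm (f j s))\<^sup>2)
      \<le> 1 * (\<rho>^(2*m) * integral {\<alpha>..c+\<rho>} (\<lambda>s. wt c \<rho> s ^ (N + 2*m) * (norm (f m s))\<^sup>2))
        + C * integral {\<alpha>..c+\<rho>} (\<lambda>s. wt c \<rho> s ^ N * (norm (f 0 s))\<^sup>2)"
    using weighted_interpolation[OF zero_less_one, of m N] by blast
  define D where "D = (real m + 1) * (C + 1)"
  have D: "D > 0" using C by (simp add: D_def)
  define E where "E = (real m + 1) * (B+1)\<^sup>2 * D / 2"
  have E: "E \<ge> 0" using D by (simp add: E_def)
  show ?thesis
  proof (rule exI[of _ E], intro conjI E allI impI)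
    fix f :: "nat \<Rightarrow> real \<Rightarrow> 'b" and \<alpha> c \<rho> \<epsilon> :: real
    assume ch: "deriv_chain (3*m) \<alpha> (c+\<rho>) f" and bd: "slice_dirichlet m c \<rho> \<alpha> (\<lambda>k. f (2*m+k))" and \<epsilon>: "\<epsilon> > 0"
    have \<rho>: "\<rho> > 0" and \<alpha>: "c - \<rho> \<le> \<alpha>" "\<alpha> \<le> c" using bd by (auto simp: slice_dirichlet_def)
    let ?S = "{\<alpha>..c+\<rho>}"
    define w where "w = wt c \<rho>"
    define h where "h k = f (2*m+k)" for k
    have chh: "deriv_chain m \<alpha> (c+\<rho>) h" unfolding h_def by (rule deriv_chain_shift[OF ch]) simp
    have chg: "deriv_chain m \<alpha> (c+\<rho>) (\<lambda>j. f (m+j))" by (rule deriv_chain_shift[OF ch]) simp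
    have bdh: "slice_dirichlet m c \<rho> \<alpha> h" using bd by (simp add: h_def[abs_def])
    obtain H where H: "continuous_on ?S H"
       "integral ?S (\<lambda>s. f m s \<bullet> H s) = (-1)^m * integral ?S (\<lambda>s. h 0 s \<bullet> (w s ^ N *\<^sub>R h 0 s))"
       "\<And>s. s \<in> ?S \<Longrightarrow> norm (H s - w s ^ N *\<^sub>R h m s) \<le> B * (\<Sum>k<m. w s ^ (N - (m - k)) / \<rho>^(m - k) * norm (h k s))"
    proof -
      obtain H where 1: "continuous_on ?S H"
        and 2: "\<forall>g. deriv_chain m \<alpha> (c+\<rho>) g \<longrightarrow>
          integral ?S (\<lambda>s. g 0 s \<bullet> H s) = (-1)^m * integral ?S (\<lambda>s. g m s \<bullet> (wt c \<rho> s ^ N *\<^sub>R h 0 s))"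
        and 3: "\<forall>s\<in>?S. norm (H s - wt c \<rho> s ^ N *\<^sub>R h m s)
         \<le> B * (\<Sum>k<m. wt c \<rho> s ^ (N - (m - k)) / \<rho>^(m - k) * norm (h k s))"
        using B(2)[OF chh bdh] by blast
      have e: "f (m+m) = h 0" by (simp add: h_def mult_2)
      from 1 2[rule_format, OF chg] 3 show ?thesis unfolding e w_def[symmetric] by (intro that) auto
    qed
    have contf: "continuous_on ?S (f k)" if "k \<le> 3*m" for k using deriv_chainD(2)[OF ch that] .
    have conth: "continuous_on ?S (h k)" if "k \<le> m" for k using deriv_chainD(2)[OF chh that] .
    have contw: "continuous_on ?S w" using \<rho> by (auto simp: w_def intro: continuous_intros)
    \<comment> \<open>D counts the m + 1 orders of derivatives of f_(2m), each interpolated with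
      constant C + 1 between the two orders that appear in the claim.\<close>
    define \<eta> where "\<eta> = \<epsilon> / D"
    have \<eta>: "\<eta> > 0" using \<epsilon> D by (simp add: \<eta>_def)
    have pt: "(-1)^m * (f m s \<bullet> H s) \<le> (real m + 1) * (B+1)\<^sup>2 / (2*\<eta>*\<rho>^(2*m)) * (w s ^ (N-2*m) * (norm (f m s))\<^sup>2)
        + \<eta>/2 * (\<Sum>k\<le>m. \<rho>^(2*k) * (w s ^ (N+2*k) * (norm (h k s))\<^sup>2))" if s: "s \<in> ?S" for s
    proof -
      have sc: "\<bar>s - c\<bar> \<le> \<rho>" using s \<alpha> by (auto simp: abs_le_iff)
      have w01: "0 \<le> w s" using wt_range[OF sc \<rho>] by (simp add: w_def)
      have "norm (H s) \<le> norm (w s ^ N *\<^sub>R h m s) + norm (H s - w s ^ N *\<^sub>R h m s)"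
        by (metis norm_triangle_sub)
      also have "... \<le> w s ^ N * norm (h m s) + B * (\<Sum>k<m. w s ^ (N - (m - k)) / \<rho>^(m - k) * norm (h k s))"
        using H(3)[OF s] w01 by simp
      also have "... \<le> (B+1) * (w s ^ N * norm (h m s)) + (B+1) * (\<Sum>k<m. w s ^ (N - (m - k)) / \<rho>^(m - k) * norm (h k s))"
      proof (intro add_mono mult_right_mono)
        have "0 \<le> B * (w s ^ N * norm (h m s))" using B(1) w01 by simp
        then show "w s ^ N * norm (h m s) \<le> (B+1) * (w s ^ N * norm (h m s))" by (simp add: distrib_right)
        show "0 \<le> (\<Sum>k<m. w s ^ (N - (m - k)) / \<rho>^(m - k) * norm (h k s))"
          using w01 \<rho> by (intro sum_nonneg mult_nonneg_nonneg divide_nonneg_nonneg) auto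
      qed simp
      also have "... = (\<Sum>k\<le>m. (B+1) * (w s ^ (N - (m - k)) / \<rho>^(m - k) * norm (h k s)))"
        by (simp add: lessThan_Suc_atMost[symmetric] distrib_left sum_distrib_left)
      finally have nH: "norm (H s) \<le> (\<Sum>k\<le>m. (B+1) * (w s ^ (N - (m - k)) / \<rho>^(m - k) * norm (h k s)))" .
      have "(-1)^m * (f m s \<bullet> H s) \<le> \<bar>(-1)^m * (f m s \<bullet> H s)\<bar>" by simp
      also have "... = \<bar>f m s \<bullet> H s\<bar>" by (simp add: abs_mult power_abs)
      also have "... \<le> norm (f m s) * norm (H s)" by (rule Cauchy_Schwarz_ineq2)
      also have "... \<le> (\<Sum>k\<le>m. norm (f m s) * ((B+1) * (w s ^ (N - (m - k)) / \<rho>^(m - k) * norm (h k s))))"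
        using mult_left_mono[OF nH norm_ge_zero[of "f m s"]] by (simp only: sum_distrib_left)
      also have "... \<le> (\<Sum>k\<le>m. (B+1)\<^sup>2 / (2*\<eta>*\<rho>^(2*m)) * (w s ^ (N-2*m) * (norm (f m s))\<^sup>2)
          + \<eta>/2 * (\<rho>^(2*k) * (w s ^ (N+2*k) * (norm (h k s))\<^sup>2)))"
      proof (rule sum_mono)
        fix k assume "k \<in> {..m}" then have k: "k \<le> m" by simp
        have "N - (m - k) = (N - 2*m) + (m + k)" "N + 2*k = (N - 2*m) + 2*(m+k)" using k assms by (simp_all add: algebra_simps) presburger?
        then have e: "w s ^ (N - (m - k)) = w s ^ (N-2*m) * w s ^ (m + k)" "w s ^ (N + 2*k) = w s ^ (N-2*m) * (w s ^ (m + k))\<^sup>2"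
          by (simp_all only: power_add power_even_eq)
        have e2: "1 / \<rho>^(m-k) = \<rho>^k / \<rho>^m" "\<rho>^(2*m) = (\<rho>^m)\<^sup>2" "\<rho>^(2*k) = (\<rho>^k)\<^sup>2" using k \<rho> by (auto simp: power_diff power_mult[symmetric] mult.commute)
        define x y where "x = w s ^ (m+k) * \<rho>^k * norm (h k s)" and "y = (B+1) / \<rho>^m * norm (f m s)"
        have xy: "x * y \<le> \<eta>/2 * x\<^sup>2 + 1/(2*\<eta>) * y\<^sup>2" by (rule young_weighted[OF \<eta>])
        have "norm (f m s) * ((B+1) * (w s ^ (N - (m - k)) / \<rho>^(m - k) * norm (h k s))) = norm (f m s) * ((B+1) * (w s ^ (N - (m - k)) * (1 / \<rho>^(m - k)) * norm (h k s)))" by simp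
        also have "... = w s ^ (N-2*m) * (x * y)" unfolding e e2 x_def y_def by simp
        also have "... \<le> w s ^ (N-2*m) * (\<eta>/2 * x\<^sup>2 + 1/(2*\<eta>) * y\<^sup>2)" using w01 xy by (intro mult_left_mono) auto
        also have "... = (B+1)\<^sup>2 / (2*\<eta>*\<rho>^(2*m)) * (w s ^ (N-2*m) * (norm (f m s))\<^sup>2)
          + \<eta>/2 * (\<rho>^(2*k) * (w s ^ (N+2*k) * (norm (h k s))\<^sup>2))"
          unfolding e e2 x_def y_def by (simp add: power_mult_distrib power_divide distrib_left mult_ac)
        finally show "norm (f m s) * ((B+1) * (w s ^ (N - (m - k)) / \<rho>^(m - k) * norm (h k s))) \<le> (B+1)\<^sup>2 / (2*\<eta>*\<rho>^(2*m)) * (w s ^ (N-2*m) * (norm (f m s))\<^sup>2)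
          + \<eta>/2 * (\<rho>^(2*k) * (w s ^ (N+2*k) * (norm (h k s))\<^sup>2))" .
      qed
      also have "... = (real m + 1) * (B+1)\<^sup>2 / (2*\<eta>*\<rho>^(2*m)) * (w s ^ (N-2*m) * (norm (f m s))\<^sup>2)
        + \<eta>/2 * (\<Sum>k\<le>m. \<rho>^(2*k) * (w s ^ (N+2*k) * (norm (h k s))\<^sup>2))"
        by (simp add: sum.distrib sum_distrib_left add.commute)
      finally show ?thesis .
    qed
    define a where "a k = integral ?S (\<lambda>s. w s ^ (N+2*k) * (norm (h k s))\<^sup>2)" for k
    have ia: "((\<lambda>s. w s ^ (N+2*k) * (norm (h k s))\<^sup>2) has_integral a k) ?S" if "k \<le> m" for k
      unfolding a_def using that
      by (intro integrable_integral integrable_continuous_real continuous_intros contw conth) auto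
    have a0: "a k \<ge> 0" if "k \<le> m" for k
    proof (rule has_integral_nonneg[OF ia[OF that]])
      fix s assume s: "s \<in> ?S"
      then have "0 \<le> w s" unfolding w_def using \<alpha> \<rho> by (intro wt_range) (auto simp: abs_le_iff)
      then show "0 \<le> w s ^ (N + 2 * k) * (norm (h k s))\<^sup>2" by simp
    qed
    define J where "J = integral ?S (\<lambda>s. w s ^ (N-2*m) * (norm (f m s))\<^sup>2)"
    have iJ: "((\<lambda>s. w s ^ (N-2*m) * (norm (f m s))\<^sup>2) has_integral J) ?S"
      unfolding J_def by (intro integrable_integral integrable_continuous_real continuous_intros contw contf) auto
    have iH: "((\<lambda>s. (-1)^m * (f m s \<bullet> H s)) has_integral a 0) ?S"
    proof -
      have "((\<lambda>s. (-1)^m * (f m s \<bullet> H s)) has_integral (-1)^m * integral ?S (\<lambda>s. f m s \<bullet> H s)) ?S"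
        by (intro has_integral_mult_right integrable_integral integrable_continuous_real continuous_intros contf H) auto
      moreover have "integral ?S (\<lambda>s. h 0 s \<bullet> (w s ^ N *\<^sub>R h 0 s)) = a 0"
        by (simp add: a_def dot_square_norm)
      ultimately show ?thesis using H(2) by (simp add: power_mult_distrib[symmetric] mult.assoc[symmetric])
    qed
    have "((\<lambda>s. (real m + 1) * (B+1)\<^sup>2 / (2*\<eta>*\<rho>^(2*m)) * (w s ^ (N-2*m) * (norm (f m s))\<^sup>2)
        + \<eta>/2 * (\<Sum>k\<le>m. \<rho>^(2*k) * (w s ^ (N+2*k) * (norm (h k s))\<^sup>2))) has_integral
       ((real m + 1) * (B+1)\<^sup>2 / (2*\<eta>*\<rho>^(2*m)) * J + \<eta>/2 * (\<Sum>k\<le>m. \<rho>^(2*k) * a k))) ?S"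
      by (intro has_integral_add has_integral_mult_right has_integral_sum ia iJ) auto
    from has_integral_le[OF iH this pt]
    have "a 0 \<le> (real m + 1) * (B+1)\<^sup>2 / (2*\<eta>*\<rho>^(2*m)) * J + \<eta>/2 * (\<Sum>k\<le>m. \<rho>^(2*k) * a k)" .
    moreover have "\<eta>/2 * (\<Sum>k\<le>m. \<rho>^(2*k) * a k) \<le> \<epsilon> * (\<rho>^(2*m) * a m + a 0)"
    proof -
      have am: "0 \<le> \<rho>^(2*m) * a m" using a0[of m] \<rho> by simp
      have le: "\<rho>^(2*k) * a k \<le> (C+1) * (\<rho>^(2*m) * a m + a 0)" if "k \<le> m" for k
      proof (cases "k = m")
        case True
        have "0 \<le> C * (\<rho>^(2*m) * a m + a 0) + a 0" using am a0[of 0] C by simp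
        then show ?thesis using True by (simp add: distrib_right)
      next
        case False
        then have "\<rho>^(2*k) * a k \<le> 1 * (\<rho>^(2*m) * a m) + C * a 0"
          using C(2)[OF chh bdh, of k] that by (simp add: a_def w_def)
        moreover have "0 \<le> C * (\<rho>^(2*m) * a m) + a 0" using am a0[of 0] C by simp
        ultimately show ?thesis by (simp add: distrib_right distrib_left)
      qed
      have "(\<Sum>k\<le>m. \<rho>^(2*k) * a k) \<le> (\<Sum>k\<le>m. (C+1) * (\<rho>^(2*m) * a m + a 0))" by (intro sum_mono le) auto
      also have "... = D * (\<rho>^(2*m) * a m + a 0)" by (simp add: D_def)
      finally have "\<eta>/2 * (\<Sum>k\<le>m. \<rho>^(2*k) * a k) \<le> \<eta>/2 * (D * (\<rho>^(2*m) * a m + a 0))"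
        using \<eta> by (intro mult_left_mono) auto
      also have "... = \<epsilon>/2 * (\<rho>^(2*m) * a m + a 0)" using D by (simp add: \<eta>_def)
      also have "... \<le> \<epsilon> * (\<rho>^(2*m) * a m + a 0)" using \<epsilon> am a0[of 0] by (intro mult_right_mono) auto
      finally show ?thesis .
    qed
    moreover have "(real m + 1) * (B+1)\<^sup>2 / (2*\<eta>*\<rho>^(2*m)) = E / (\<epsilon> * \<rho>^(2*m))"
      using D \<epsilon> by (simp add: E_def \<eta>_def field_simps)
    ultimately have fin: "0 \<le> E / (\<epsilon> * \<rho>^(2*m)) * J + \<epsilon> * (\<rho>^(2*m) * a m + a 0) - a 0" by simp
    have "((\<lambda>s. E / (\<epsilon> * \<rho>^(2*m)) * (w s ^ (N-2*m) * (norm (f m s))\<^sup>2)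
       + \<epsilon> * (\<rho>^(2*m) * (w s ^ (N+2*m) * (norm (h m s))\<^sup>2) + w s ^ (N+2*0) * (norm (h 0 s))\<^sup>2)
       - w s ^ (N+2*0) * (norm (h 0 s))\<^sup>2) has_integral (E / (\<epsilon> * \<rho>^(2*m)) * J + \<epsilon> * (\<rho>^(2*m) * a m + a 0) - a 0)) ?S"
      by (intro has_integral_add has_integral_diff has_integral_mult_right ia iJ) auto
    with fin show "0 \<le> integral ?S (\<lambda>s. E / (\<epsilon> * \<rho>^(2*m)) * (wt c \<rho> s ^ (N-2*m) * (norm (f m s))\<^sup>2)
       + \<epsilon> * (\<rho>^(2*m) * (wt c \<rho> s ^ (N+2*m) * (norm (f (3*m) s))\<^sup>2) + wt c \<rho> s ^ N * (norm (f (2*m) s))\<^sup>2)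
       - wt c \<rho> s ^ N * (norm (f (2*m) s))\<^sup>2)"
      by (simp add: integral_unique w_def h_def)
  qed
qed

text \<open>Energy inequalities control derivatives of order exactly m; this recovers order one.
  Interpolation covers orders strictly below m, so m = 1, where the first derivative is the top one,
  is a separate trivial case.\<close>

lemma slice_first_derivative:
  assumes "m \<ge> 1"
  shows "\<exists>C\<ge>0. \<forall>(f :: nat \<Rightarrow> real \<Rightarrow> 'b::euclidean_space) \<alpha> c \<rho>. deriv_chain m \<alpha> (c+\<rho>) f \<longrightarrow> slice_dirichlet m c \<rho> \<alpha> f \<longrightarrow>
    0 \<le> integral {\<alpha>..c+\<rho>} (\<lambda>s. \<rho>^(2*m) * (wt c \<rho> s ^ (2*m) * (norm (f m s))\<^sup>2) + C * (norm (f 0 s))\<^sup>2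
       - \<rho>\<^sup>2 * ((wt c \<rho> s)\<^sup>2 * (norm (f 1 s))\<^sup>2))"
proof -
  obtain C where C: "C \<ge> 0" "\<And>(f :: nat \<Rightarrow> real \<Rightarrow> 'b) \<alpha> c \<rho> j. deriv_chain m \<alpha> (c+\<rho>) f \<Longrightarrow> slice_dirichlet m c \<rho> \<alpha> f \<Longrightarrow> j < m \<Longrightarrow>
     \<rho>^(2*j) * integral {\<alpha>..c+\<rho>} (\<lambda>s. wt c \<rho> s ^ (0 + 2*j) * (norm (f j s))\<^sup>2)
      \<le> 1 * (\<rho>^(2*m) * integral {\<alpha>..c+\<rho>} (\<lambda>s. wt c \<rho> s ^ (0 + 2*m) * (norm (f m s))\<^sup>2))
        + C * integral {\<alpha>..c+\<rho>} (\<lambda>s. wt c \<rho> s ^ 0 * (norm (f 0 s))\<^sup>2)"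
    using weighted_interpolation[OF zero_less_one, of m 0] by blast
  show ?thesis
  proof (rule exI[of _ C], intro conjI C(1) allI impI)
    fix f :: "nat \<Rightarrow> real \<Rightarrow> 'b" and \<alpha> c \<rho> :: real
    assume ch: "deriv_chain m \<alpha> (c+\<rho>) f" and bd: "slice_dirichlet m c \<rho> \<alpha> f"
    have \<rho>: "\<rho> > 0" using bd by (auto simp: slice_dirichlet_def)
    let ?S = "{\<alpha>..c+\<rho>}"
    define w where "w = wt c \<rho>"
    have contw: "continuous_on ?S w" using \<rho> by (auto simp: w_def intro: continuous_intros)
    define a where "a k = integral ?S (\<lambda>s. w s ^ (2*k) * (norm (f k s))\<^sup>2)" for k
    have ia: "((\<lambda>s. w s ^ (2*k) * (norm (f k s))\<^sup>2) has_integral a k) ?S" if "k \<le> m" for k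
      unfolding a_def using deriv_chainD(2)[OF ch that]
      by (intro integrable_integral integrable_continuous_real continuous_intros contw) auto
    have a0: "a 0 \<ge> 0" using ia[of 0] by (rule has_integral_nonneg) auto
    have "\<rho>^(2*1) * a 1 \<le> \<rho>^(2*m) * a m + C * a 0"
    proof (cases "m = 1")
      case True then show ?thesis using a0 C by simp
    next
      case False then show ?thesis using C(2)[OF ch bd, of 1] assms by (simp add: a_def w_def power2_eq_square)
    qed
    moreover have "((\<lambda>s. \<rho>^(2*m) * (w s ^ (2*m) * (norm (f m s))\<^sup>2) + C * (w s ^ (2*0) * (norm (f 0 s))\<^sup>2)
       - \<rho>^(2*1) * (w s ^ (2*1) * (norm (f 1 s))\<^sup>2)) has_integral (\<rho>^(2*m) * a m + C * a 0 - \<rho>^(2*1) * a 1)) ?S"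
      using assms by (intro has_integral_add has_integral_diff has_integral_mult_right ia) auto
    ultimately show "0 \<le> integral ?S (\<lambda>s. \<rho>^(2*m) * (wt c \<rho> s ^ (2*m) * (norm (f m s))\<^sup>2) + C * (norm (f 0 s))\<^sup>2
       - \<rho>\<^sup>2 * ((wt c \<rho> s)\<^sup>2 * (norm (f 1 s))\<^sup>2))"
      by (simp add: integral_unique w_def)
  qed
qed

section \<open>Poincare and Sobolev inequalities on an interval\<close>

lemma slice_poincare:
  fixes f f' :: "real \<Rightarrow> 'b::euclidean_space"
  assumes d: "\<And>s. s \<in> {\<alpha>..\<beta>} \<Longrightarrow> (f has_vector_derivative f' s) (at s within {\<alpha>..\<beta>})"
    and c: "continuous_on {\<alpha>..\<beta>} f'" and 0: "f \<alpha> = 0" and "\<alpha> \<le> \<beta>"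
  shows "0 \<le> integral {\<alpha>..\<beta>} (\<lambda>s. 4 * (\<beta> - \<alpha>)\<^sup>2 * (norm (f' s))\<^sup>2 - (norm (f s))\<^sup>2)"
proof -
  let ?S = "{\<alpha>..\<beta>}"
  have cf: "continuous_on ?S f" using continuous_on_vector_derivative[OF d] .
  \<comment> \<open>The multiplier s - \<beta> vanishes at the end where f is free, and f vanishes
    at the other end, so no boundary term survives.\<close>
  have dG: "((\<lambda>s. (s - \<beta>) * (f s \<bullet> f s)) has_vector_derivative ((s - \<beta>) * (2 * (f s \<bullet> f' s)) + f s \<bullet> f s)) (at s within ?S)"
    if "s \<in> ?S" for s
  proof -
    have "((\<lambda>s. f s \<bullet> f s) has_real_derivative (f s \<bullet> f' s + f' s \<bullet> f s)) (at s within ?S)"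
      using bounded_bilinear.has_vector_derivative[OF bounded_bilinear_inner d[OF that] d[OF that]]
      by (simp add: has_real_derivative_iff_has_vector_derivative)
    then have "((\<lambda>s. (s - \<beta>) * (f s \<bullet> f s)) has_real_derivative ((s - \<beta>) * (2 * (f s \<bullet> f' s)) + f s \<bullet> f s)) (at s within ?S)"
      by (auto intro!: derivative_eq_intros simp: inner_commute)
    then show ?thesis by (simp add: has_real_derivative_iff_has_vector_derivative)
  qed
  have iG: "((\<lambda>s. (s - \<beta>) * (2 * (f s \<bullet> f' s)) + f s \<bullet> f s) has_integral 0) ?S"
    using fundamental_theorem_of_calculus[OF assms(4) dG] 0 by simp
  have pt: "(\<lambda>s. (s - \<beta>) * (2 * (f s \<bullet> f' s)) + f s \<bullet> f s) s \<ge> 1/2 * (norm (f s))\<^sup>2 - 2 * (\<beta> - \<alpha>)\<^sup>2 * (norm (f' s))\<^sup>2" if "s \<in> ?S" for s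
  proof -
    have "- ((s - \<beta>) * (2 * (f s \<bullet> f' s))) \<le> \<bar>(s - \<beta>) * (2 * (f s \<bullet> f' s))\<bar>" by linarith
    also have "... = 2 * (\<bar>s - \<beta>\<bar> * \<bar>f s \<bullet> f' s\<bar>)" by (simp add: abs_mult)
    also have "... \<le> 2 * ((\<beta> - \<alpha>) * (norm (f s) * norm (f' s)))"
      using that Cauchy_Schwarz_ineq2[of "f s" "f' s"] by (intro mult_left_mono mult_mono) auto
    also have "... = norm (f s) * (2 * (\<beta> - \<alpha>) * norm (f' s))" by simp
    also have "... \<le> 1/2 * (norm (f s))\<^sup>2 + 1/(2*1) * (2 * (\<beta> - \<alpha>) * norm (f' s))\<^sup>2" by (rule young_weighted) simp
    finally have 1: "- ((s - \<beta>) * (2 * (f s \<bullet> f' s))) \<le> 1/2 * (norm (f s))\<^sup>2 + 1/(2*1) * (2 * (\<beta> - \<alpha>) * norm (f' s))\<^sup>2" .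
    have 2: "(2 * (\<beta> - \<alpha>) * norm (f' s))\<^sup>2 = 4 * ((\<beta> - \<alpha>)\<^sup>2 * (norm (f' s))\<^sup>2)" by (simp only: power_mult_distrib) simp
    show ?thesis using 1 unfolding 2 by (simp add: dot_square_norm)
  qed
  have i: "(\<lambda>s. (norm (f s))\<^sup>2) integrable_on ?S" "(\<lambda>s. (norm (f' s))\<^sup>2) integrable_on ?S"
    by (intro integrable_continuous_real continuous_intros cf c)+
  have "((\<lambda>s. 1/2 * (norm (f s))\<^sup>2 - 2 * (\<beta> - \<alpha>)\<^sup>2 * (norm (f' s))\<^sup>2) has_integral
     (1/2 * integral ?S (\<lambda>s. (norm (f s))\<^sup>2) - 2 * (\<beta> - \<alpha>)\<^sup>2 * integral ?S (\<lambda>s. (norm (f' s))\<^sup>2))) ?S"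
    by (intro has_integral_diff has_integral_mult_right integrable_integral i)
  from has_integral_le[OF this iG pt]
  have "0 \<le> 4 * (\<beta> - \<alpha>)\<^sup>2 * integral ?S (\<lambda>s. (norm (f' s))\<^sup>2) - integral ?S (\<lambda>s. (norm (f s))\<^sup>2)" by simp
  also have "... = integral ?S (\<lambda>s. 4 * (\<beta> - \<alpha>)\<^sup>2 * (norm (f' s))\<^sup>2 - (norm (f s))\<^sup>2)"
    by (intro integral_unique[symmetric] has_integral_diff has_integral_mult_right integrable_integral i)
  finally show ?thesis .
qed

text \<open>Two values of |f|^2 differ by at most the integral of |2 f f'|, hence by the mean of
  |f|^2 + (\<beta> - \<alpha>)^2 |f'|^2 over the interval. Averaging over the second point replaces
  its value by another such mean. The powers of the length make the right-hand side a mean value,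
  which is the form iterated later over all directions.\<close>

lemma slice_sobolev:
  fixes f f' :: "real \<Rightarrow> 'b::euclidean_space"
  assumes d: "\<And>s. s \<in> {\<alpha>..\<beta>} \<Longrightarrow> (f has_vector_derivative f' s) (at s within {\<alpha>..\<beta>})"
    and c: "continuous_on {\<alpha>..\<beta>} f'" and "\<alpha> < \<beta>" and x: "x \<in> {\<alpha>..\<beta>}"
  shows "(norm (f x))\<^sup>2 \<le> 2 / (\<beta> - \<alpha>) * integral {\<alpha>..\<beta>} (\<lambda>s. (norm (f s))\<^sup>2 + (\<beta> - \<alpha>)\<^sup>2 * (norm (f' s))\<^sup>2)"
proof -
  let ?S = "{\<alpha>..\<beta>}" and ?L = "\<beta> - \<alpha>"
  have L: "?L > 0" using assms by simp
  have cf: "continuous_on ?S f" using continuous_on_vector_derivative[OF d] .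
  define P where "P s = (norm (f s))\<^sup>2 + ?L\<^sup>2 * (norm (f' s))\<^sup>2" for s
  have cP: "continuous_on ?S P" unfolding P_def by (intro continuous_intros cf c)
  have P0: "P s \<ge> 0" for s by (simp add: P_def)
  have df: "((\<lambda>s. (norm (f s))\<^sup>2) has_vector_derivative (2 * (f s \<bullet> f' s))) (at s within T)" if "s \<in> ?S" "T \<subseteq> ?S" for s T
    using has_vector_derivative_within_subset[OF bounded_bilinear.has_vector_derivative[OF bounded_bilinear_inner d[OF that(1)] d[OF that(1)]] that(2)]
    by (simp add: inner_commute dot_square_norm)
  have b: "\<bar>2 * (f s \<bullet> f' s)\<bar> \<le> P s / ?L" for s
  proof -
    have "\<bar>2 * (f s \<bullet> f' s)\<bar> \<le> 2 * (norm (f s) * norm (f' s))"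
      using Cauchy_Schwarz_ineq2[of "f s" "f' s"] by (simp add: abs_mult)
    also have "... = 2 * (norm (f s) * (?L * norm (f' s))) / ?L" using L by simp
    also have "... \<le> 2 * (1/2 * (norm (f s))\<^sup>2 + 1/(2*1) * (?L * norm (f' s))\<^sup>2) / ?L"
      using L by (intro divide_right_mono mult_left_mono young_weighted) auto
    also have "... = P s / ?L" by (simp add: P_def power_mult_distrib)
    finally show ?thesis .
  qed
  have sub: "\<bar>(norm (f v))\<^sup>2 - (norm (f u))\<^sup>2\<bar> \<le> integral ?S P / ?L" if uv: "u \<in> ?S" "v \<in> ?S" "u \<le> v" for u v
  proof -
    have T: "{u..v} \<subseteq> ?S" using uv by auto
    have i1: "((\<lambda>s. 2 * (f s \<bullet> f' s)) has_integral ((norm (f v))\<^sup>2 - (norm (f u))\<^sup>2)) {u..v}"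
      using T uv by (intro fundamental_theorem_of_calculus df) auto
    have i2: "(\<lambda>s. P s / ?L) integrable_on {u..v}" "(\<lambda>s. P s / ?L) integrable_on ?S"
      using continuous_on_subset[OF cP T] cP L by (auto intro!: integrable_continuous_real continuous_intros)
    have "norm (integral {u..v} (\<lambda>s. 2 * (f s \<bullet> f' s))) \<le> integral {u..v} (\<lambda>s. P s / ?L)"
      using b i1 i2 by (intro integral_norm_bound_integral) (auto simp: integrable_on_def)
    also have "... \<le> integral ?S (\<lambda>s. P s / ?L)" using T i2 P0 L by (intro integral_subset_le) auto
    also have "... = integral ?S P / ?L" by simp
    finally show ?thesis by (simp only: integral_unique[OF i1] real_norm_def)
  qed
  have sub1: "(norm (f x))\<^sup>2 - integral ?S P / ?L \<le> (norm (f y))\<^sup>2" if "y \<in> ?S" for y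
    using sub[of x y] sub[of y x] x that by (cases "x \<le> y") auto
  have "integral ?S (\<lambda>y. (norm (f x))\<^sup>2 - integral ?S P / ?L) \<le> integral ?S P"
  proof (intro integral_le integrable_continuous_real cP continuous_on_const)
    fix y assume "y \<in> ?S"
    from sub1[OF this] have "(norm (f x))\<^sup>2 - integral ?S P / ?L \<le> (norm (f y))\<^sup>2" .
    also have "... \<le> P y" by (simp add: P_def)
    finally show "(norm (f x))\<^sup>2 - integral ?S P / ?L \<le> P y" .
  qed
  then have "?L * ((norm (f x))\<^sup>2 - integral ?S P / ?L) \<le> integral ?S P" using L by simp
  moreover have "?L * ((norm (f x))\<^sup>2 - integral ?S P / ?L) = (norm (f x))\<^sup>2 * ?L - integral ?S P"
    using L by (simp add: right_diff_distrib mult.commute)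
  ultimately have "(norm (f x))\<^sup>2 * ?L \<le> 2 * integral ?S P" by linarith
  then have "(norm (f x))\<^sup>2 \<le> 2 / ?L * integral ?S P" by (simp only: pos_le_divide_eq[OF L] times_divide_eq_left)
  then show ?thesis by (simp only: P_def[abs_def])
qed

section \<open>Slices of boxes\<close>

text \<open>Fubini for an arbitrary basis direction. Lebesgue measure is the image of a product of
  one-dimensional measures indexed by \<open>Basis\<close>, and one factor of such a product can be
  split off.\<close>

lemma lborel_integral_slice:
  fixes F :: "'a::euclidean_space \<Rightarrow> real"
  assumes F: "integrable lborel F" and i: "i \<in> Basis"
  shows "integral\<^sup>L lborel F =
    (\<integral>x. (\<integral>y. F ((\<Sum>b\<in>Basis - {i}. x b *\<^sub>R b) + y *\<^sub>R i) \<partial>lborel) \<partial>(\<Pi>\<^sub>M b\<in>Basis - {i}. lborel))"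
proof -
  interpret product_sigma_finite "\<lambda>b::'a. lborel :: real measure"
    by (simp add: product_sigma_finite_def sigma_finite_lborel)
  let ?T = "\<lambda>x. \<Sum>b\<in>Basis. x b *\<^sub>R (b::'a)" and ?P = "\<Pi>\<^sub>M b\<in>(Basis::'a set). (lborel :: real measure)"
  have T: "?T \<in> measurable ?P borel" by measurable
  have Fm: "F \<in> borel_measurable borel" using F by (simp add: borel_measurable_integrable)
  have ins: "insert i (Basis - {i}) = (Basis::'a set)" using i by auto
  have eq: "integral\<^sup>L lborel F = integral\<^sup>L ?P (\<lambda>x. F (?T x))"
    by (subst lborel_eq) (rule integral_distr[OF T Fm])
  have int: "integrable ?P (\<lambda>x. F (?T x))"
    using F by (subst (asm) lborel_eq) (rule integrable_distr[OF T])
  have "integral\<^sup>L ?P (\<lambda>x. F (?T x)) = (\<integral>x. (\<integral>y. F (?T (x(i := y))) \<partial>lborel) \<partial>(\<Pi>\<^sub>M b\<in>Basis - {i}. lborel))"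
    by (rule product_integral_insert[of "Basis - {i}" i "\<lambda>x. F (?T x)", unfolded ins, OF _ _ int]) auto
  moreover have "?T (x(i := y)) = (\<Sum>b\<in>Basis - {i}. x b *\<^sub>R b) + y *\<^sub>R i" for x y
    by (subst sum.remove[OF finite_Basis i]) (auto simp: add.commute intro!: sum.cong)
  ultimately show ?thesis by (simp add: eq)
qed

definition slice :: "'a::euclidean_space \<Rightarrow> 'a \<Rightarrow> real \<Rightarrow> 'a" where
  "slice i z s = z + (s - z \<bullet> i) *\<^sub>R i"

lemma slice_inner:
  assumes "i \<in> Basis" "j \<in> Basis"
  shows "slice i z s \<bullet> j = (if j = i then s else z \<bullet> j)"
  using assms by (auto simp: slice_def inner_add_left inner_Basis)

lemma slice_self: "slice i z (z \<bullet> i) = z"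
  by (simp add: slice_def)

lemma slice_in_cbox:
  assumes "i \<in> Basis" "z \<in> cbox a b" "s \<in> {a \<bullet> i..b \<bullet> i}"
  shows "slice i z s \<in> cbox a b"
  using assms by (auto simp: mem_box slice_inner)

lemma continuous_on_slice [continuous_intros]:
  assumes "continuous_on S f" "continuous_on S g"
  shows "continuous_on S (\<lambda>x. slice i (f x) (g x))"
  unfolding slice_def using assms by (intro continuous_intros)

lemma continuous_on_slice_fun:
  assumes "continuous_on (cbox a b) g" "i \<in> Basis" "z \<in> cbox a b"
  shows "continuous_on {a \<bullet> i..b \<bullet> i} (\<lambda>s. g (slice i z s))"
  by (rule continuous_on_compose2[OF assms(1)]) (auto intro!: continuous_intros slice_in_cbox assms)

text \<open>The average over a segment is kept as a function on the whole box that is constant in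
  direction i. Averages over several directions can then be composed without changing the
  type.\<close>

definition slice_avg :: "'a::euclidean_space \<Rightarrow> 'a \<Rightarrow> 'a \<Rightarrow> ('a \<Rightarrow> real) \<Rightarrow> 'a \<Rightarrow> real" where
  "slice_avg a b i g z = integral {a \<bullet> i..b \<bullet> i} (\<lambda>s. g (slice i z s)) / (b \<bullet> i - a \<bullet> i)"

lemma continuous_on_slice_avg:
  assumes "continuous_on (cbox a b) g" "i \<in> Basis"
  shows "continuous_on (cbox a b) (slice_avg a b i g)"
proof -
  have "continuous_on (cbox a b \<times> cbox (a \<bullet> i) (b \<bullet> i)) (\<lambda>(z, s). g (slice i z s))"
    unfolding split_beta
    by (rule continuous_on_compose2[OF assms(1)]) (auto intro!: continuous_intros slice_in_cbox assms(2))
  from integral_continuous_on_param[OF this] show ?thesis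
    unfolding slice_avg_def divide_inverse by (intro continuous_intros) simp
qed

lemma lborel_integral_cbox:
  fixes g :: "'a::euclidean_space \<Rightarrow> real"
  assumes "continuous_on (cbox a b) g"
  shows "integrable lborel (\<lambda>x. indicator (cbox a b) x *\<^sub>R g x)"
    and "(\<integral>x. indicator (cbox a b) x *\<^sub>R g x \<partial>lborel) = integral (cbox a b) g"
proof -
  show 1: "integrable lborel (\<lambda>x. indicator (cbox a b) x *\<^sub>R g x)"
    by (rule borel_integrable_compact[OF compact_cbox assms])
  show "(\<integral>x. indicator (cbox a b) x *\<^sub>R g x \<partial>lborel) = integral (cbox a b) g"
    using set_borel_integral_eq_integral(2)[of "cbox a b" g] 1
    by (simp add: set_integrable_def set_lebesgue_integral_def)
qed

text \<open>By Fubini both integrals reduce to their inner integrals along i, and these agree: on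
  each segment the averaged function is a constant whose integral is that of g.\<close>

lemma integral_slice_avg:
  fixes g :: "'a::euclidean_space \<Rightarrow> real"
  assumes g: "continuous_on (cbox a b) g" and i: "i \<in> Basis" and ab: "a \<bullet> i < b \<bullet> i"
  shows "integral (cbox a b) (slice_avg a b i g) = integral (cbox a b) g"
proof -
  define q where "q x = (\<Sum>b\<in>Basis - {i}. x b *\<^sub>R b)" for x :: "'a \<Rightarrow> real"
  have qj: "q x \<bullet> j = (if j = i then 0 else x j)" if j: "j \<in> Basis" for x j
  proof -
    have "q x \<bullet> j = (\<Sum>b\<in>Basis - {i}. if b = j then x b else 0)"
      unfolding q_def inner_sum_left inner_scaleR_left by (rule sum.cong) (use j in \<open>auto simp: inner_Basis\<close>)
    also have "... = (if j = i then 0 else x j)" using j by simp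
    finally show ?thesis .
  qed
  have pj: "(q x + s *\<^sub>R i) \<bullet> j = (if j = i then s else x j)" if j: "j \<in> Basis" for x s j
    using qj[OF j] j i by (auto simp: inner_add_left inner_Basis)
  have mem: "q x + s *\<^sub>R i \<in> cbox a b \<longleftrightarrow> (\<forall>j\<in>Basis - {i}. a \<bullet> j \<le> x j \<and> x j \<le> b \<bullet> j) \<and> s \<in> {a \<bullet> i..b \<bullet> i}" for x s
  proof -
    have "q x + s *\<^sub>R i \<in> cbox a b \<longleftrightarrow> (\<forall>j\<in>Basis. a \<bullet> j \<le> (if j = i then s else x j) \<and> (if j = i then s else x j) \<le> b \<bullet> j)"
      unfolding mem_box by (intro ball_cong refl) (simp only: pj)
    then show ?thesis using i by auto
  qed
  have inner: "(\<integral>y. indicator (cbox a b) (q x + y *\<^sub>R i) *\<^sub>R h (q x + y *\<^sub>R i) \<partial>lborel)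
     = (if \<forall>j\<in>Basis - {i}. a \<bullet> j \<le> x j \<and> x j \<le> b \<bullet> j
        then integral {a \<bullet> i..b \<bullet> i} (\<lambda>s. h (q x + s *\<^sub>R i)) else 0)"
    if h: "continuous_on (cbox a b) h" for x and h :: "'a \<Rightarrow> real"
  proof (cases "\<forall>j\<in>Basis - {i}. a \<bullet> j \<le> x j \<and> x j \<le> b \<bullet> j")
    case True
    have sub: "(\<lambda>s. q x + s *\<^sub>R i) ` cbox (a \<bullet> i) (b \<bullet> i) \<subseteq> cbox a b" using mem True by auto
    have c: "continuous_on (cbox (a \<bullet> i) (b \<bullet> i)) (\<lambda>s. h (q x + s *\<^sub>R i))"
      by (rule continuous_on_compose2[OF h _ sub]) (intro continuous_intros)
    have "(\<integral>y. indicator (cbox a b) (q x + y *\<^sub>R i) *\<^sub>R h (q x + y *\<^sub>R i) \<partial>lborel)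
       = (\<integral>y. indicator (cbox (a \<bullet> i) (b \<bullet> i)) y *\<^sub>R h (q x + y *\<^sub>R i) \<partial>lborel)"
    proof (rule Bochner_Integration.integral_cong[OF refl])
      fix y
      have "indicator (cbox a b) (q x + y *\<^sub>R i) = (indicator (cbox (a \<bullet> i) (b \<bullet> i)) y :: real)"
        using True by (simp add: indicator_def mem)
      then show "indicator (cbox a b) (q x + y *\<^sub>R i) *\<^sub>R h (q x + y *\<^sub>R i) = indicator (cbox (a \<bullet> i) (b \<bullet> i)) y *\<^sub>R h (q x + y *\<^sub>R i)"
        by simp
    qed
    also have "... = integral (cbox (a \<bullet> i) (b \<bullet> i)) (\<lambda>s. h (q x + s *\<^sub>R i))"
      by (rule lborel_integral_cbox(2)[OF c])
    finally show ?thesis unfolding if_P[OF True] by (simp only: box_real)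
  next
    case False
    then have "indicator (cbox a b) (q x + y *\<^sub>R i) = (0::real)" for y using mem by (simp add: indicator_def)
    then show ?thesis using False by (simp only: scale_zero_left Bochner_Integration.integral_zero if_False)
  qed
  have cM: "continuous_on (cbox a b) (slice_avg a b i g)" by (rule continuous_on_slice_avg[OF g i])
  have sl: "slice i (q x + y *\<^sub>R i) s = q x + s *\<^sub>R i" for x y s
    using i qj[OF i, of x] by (simp add: slice_def inner_add_left inner_Basis scaleR_left_diff_distrib)
  have eq: "(if \<forall>j\<in>Basis - {i}. a \<bullet> j \<le> x j \<and> x j \<le> b \<bullet> j
        then integral {a \<bullet> i..b \<bullet> i} (\<lambda>s. slice_avg a b i g (q x + s *\<^sub>R i)) else 0)
     = (if \<forall>j\<in>Basis - {i}. a \<bullet> j \<le> x j \<and> x j \<le> b \<bullet> j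
        then integral {a \<bullet> i..b \<bullet> i} (\<lambda>s. g (q x + s *\<^sub>R i)) else 0)" for x
    using ab by (simp add: slice_avg_def sl)
  show ?thesis
    using lborel_integral_slice[OF lborel_integral_cbox(1)[OF g] i]
      lborel_integral_slice[OF lborel_integral_cbox(1)[OF cM] i]
    unfolding lborel_integral_cbox(2)[OF g] lborel_integral_cbox(2)[OF cM] q_def[symmetric] inner[OF g] inner[OF cM] eq
    by (simp only:)
qed

text \<open>The device that carries the one-dimensional inequalities to boxes. It asks for a
  continuous integrand, which has consequences for the coefficient term below.\<close>

lemma integral_nonneg_by_slices:
  fixes g :: "'a::euclidean_space \<Rightarrow> real"
  assumes g: "continuous_on (cbox a b) g" and i: "i \<in> Basis" and ab: "a \<bullet> i < b \<bullet> i"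
    and nn: "\<And>z. z \<in> cbox a b \<Longrightarrow> 0 \<le> integral {a \<bullet> i..b \<bullet> i} (\<lambda>s. g (slice i z s))"
  shows "0 \<le> integral (cbox a b) g"
proof -
  have "0 \<le> integral (cbox a b) (slice_avg a b i g)"
    using continuous_on_slice_avg[OF g i] ab nn
    by (intro Henstock_Kurzweil_Integration.integral_nonneg integrable_continuous) (auto simp: slice_avg_def)
  then show ?thesis by (simp add: integral_slice_avg[OF g i ab])
qed

section \<open>Averages over several directions\<close>

definition iter_avg :: "'a::euclidean_space \<Rightarrow> 'a \<Rightarrow> 'a list \<Rightarrow> ('a \<Rightarrow> real) \<Rightarrow> 'a \<Rightarrow> real" where
  "iter_avg a b l = foldr (slice_avg a b) l"

lemma iter_avg_simps [simp]:
  "iter_avg a b [] g = g" "iter_avg a b (i # l) g = slice_avg a b i (iter_avg a b l g)"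
  "iter_avg a b (l @ [i]) g = iter_avg a b l (slice_avg a b i g)"
  by (simp_all add: iter_avg_def)

lemma continuous_on_iter_avg:
  assumes "continuous_on (cbox a b) g" "set l \<subseteq> Basis"
  shows "continuous_on (cbox a b) (iter_avg a b l g)"
  using assms by (induction l) (auto intro: continuous_on_slice_avg)

lemma slice_avg_mono:
  assumes "continuous_on (cbox a b) f" "continuous_on (cbox a b) g" "i \<in> Basis" "a \<bullet> i < b \<bullet> i"
    and "\<And>z. z \<in> cbox a b \<Longrightarrow> f z \<le> g z" "z \<in> cbox a b"
  shows "slice_avg a b i f z \<le> slice_avg a b i g z"
  unfolding slice_avg_def using assms
  by (intro divide_right_mono integral_le integrable_continuous_real continuous_on_slice_fun)
     (auto simp: slice_in_cbox)

lemma slice_avg_add: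
  assumes "continuous_on (cbox a b) f" "continuous_on (cbox a b) g" "i \<in> Basis" "z \<in> cbox a b"
  shows "slice_avg a b i (\<lambda>z. f z + g z) z = slice_avg a b i f z + slice_avg a b i g z"
  unfolding slice_avg_def add_divide_distrib[symmetric] using assms
  by (intro arg_cong2[where f="(/)"] refl Henstock_Kurzweil_Integration.integral_add integrable_continuous_real continuous_on_slice_fun)

lemma slice_avg_cmult: "slice_avg a b i (\<lambda>z. c * f z) z = c * slice_avg a b i f z"
  unfolding slice_avg_def by simp

lemma slice_avg_cong:
  assumes "i \<in> Basis" "z \<in> cbox a b" "\<And>z. z \<in> cbox a b \<Longrightarrow> f z = g z"
  shows "slice_avg a b i f z = slice_avg a b i g z"
  unfolding slice_avg_def using assms
  by (intro arg_cong2[where f="(/)"] refl Henstock_Kurzweil_Integration.integral_cong) (auto simp: slice_in_cbox)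

lemma iter_avg_mono:
  assumes "continuous_on (cbox a b) f" "continuous_on (cbox a b) g" "set l \<subseteq> Basis" "\<And>i. i \<in> set l \<Longrightarrow> a \<bullet> i < b \<bullet> i"
    and "\<And>z. z \<in> cbox a b \<Longrightarrow> f z \<le> g z" "z \<in> cbox a b"
  shows "iter_avg a b l f z \<le> iter_avg a b l g z"
  using assms by (induction l arbitrary: z) (auto intro!: slice_avg_mono continuous_on_iter_avg)

lemma iter_avg_add:
  assumes "continuous_on (cbox a b) f" "continuous_on (cbox a b) g" "set l \<subseteq> Basis" "z \<in> cbox a b"
  shows "iter_avg a b l (\<lambda>z. f z + g z) z = iter_avg a b l f z + iter_avg a b l g z"
  using assms(3,4)
proof (induction l arbitrary: z)
  case (Cons i l)
  have "slice_avg a b i (iter_avg a b l (\<lambda>z. f z + g z)) z = slice_avg a b i (\<lambda>z. iter_avg a b l f z + iter_avg a b l g z) z"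
    using Cons by (intro slice_avg_cong) auto
  also have "... = slice_avg a b i (iter_avg a b l f) z + slice_avg a b i (iter_avg a b l g) z"
    using Cons assms by (intro slice_avg_add continuous_on_iter_avg) auto
  finally show ?case by simp
qed simp

lemma iter_avg_cmult: "iter_avg a b l (\<lambda>z. c * f z) z = c * iter_avg a b l f z"
proof (induction l arbitrary: z)
  case (Cons i l)
  then have "iter_avg a b l (\<lambda>z. c * f z) = (\<lambda>z. c * iter_avg a b l f z)" by (intro ext)
  then show ?case by (simp add: slice_avg_cmult)
qed simp

lemma iter_avg_sum:
  assumes "finite S" "\<And>k. k \<in> S \<Longrightarrow> continuous_on (cbox a b) (f k)" "set l \<subseteq> Basis" "z \<in> cbox a b"
  shows "iter_avg a b l (\<lambda>z. \<Sum>k\<in>S. f k z) z = (\<Sum>k\<in>S. iter_avg a b l (f k) z)"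
  using assms(1,2)
proof (induction S)
  case empty
  then show ?case using iter_avg_cmult[of a b l 0 "\<lambda>_. 0" z] by simp
next
  case (insert k S)
  then show ?case using assms(3,4) by (simp add: iter_avg_add continuous_on_sum)
qed

text \<open>An iterated average no longer depends on the coordinates already averaged, so over all
  directions it is a constant on the box; since averaging preserves the integral, this constant is
  the mean value.\<close>

lemma iter_avg_full:
  fixes g :: "'a::euclidean_space \<Rightarrow> real"
  assumes g: "continuous_on (cbox a b) g" and l: "set l = Basis" and ab: "\<And>i. i \<in> Basis \<Longrightarrow> a \<bullet> i < b \<bullet> i"
    and z: "z \<in> cbox a b"
  shows "iter_avg a b l g z = integral (cbox a b) g / measure lborel (cbox a b)"
proof -
  have indep: "set l' \<subseteq> Basis \<Longrightarrow> z \<in> cbox a b \<Longrightarrow> z' \<in> cbox a b \<Longrightarrow> (\<And>j. j \<in> Basis - set l' \<Longrightarrow> z \<bullet> j = z' \<bullet> j) \<Longrightarrow>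
      iter_avg a b l' g z = iter_avg a b l' g z'" for z z' l'
  proof (induction l' arbitrary: z z')
    case Nil
    then have "z = z'" by - (rule euclidean_eqI, auto)
    then show ?case by simp
  next
    case (Cons i l')
    have "iter_avg a b l' g (slice i z s) = iter_avg a b l' g (slice i z' s)" if "s \<in> {a \<bullet> i..b \<bullet> i}" for s
      using Cons.prems that by (intro Cons.IH slice_in_cbox) (auto simp: slice_inner)
    then have "integral {a \<bullet> i..b \<bullet> i} (\<lambda>s. iter_avg a b l' g (slice i z s)) = integral {a \<bullet> i..b \<bullet> i} (\<lambda>s. iter_avg a b l' g (slice i z' s))"
      by (rule Henstock_Kurzweil_Integration.integral_cong)
    then show ?case by (simp add: slice_avg_def)
  qed
  have int: "set l' \<subseteq> Basis \<Longrightarrow> integral (cbox a b) (iter_avg a b l' g) = integral (cbox a b) g" for l'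
    by (induction l') (auto simp: integral_slice_avg continuous_on_iter_avg g ab)
  have "integral (cbox a b) g = integral (cbox a b) (iter_avg a b l g)" using int[of l] l by simp
  also have "... = integral (cbox a b) (\<lambda>_. iter_avg a b l g z)"
    by (rule Henstock_Kurzweil_Integration.integral_cong, rule indep) (use l z in auto)
  also have "... = measure lborel (cbox a b) * iter_avg a b l g z" by simp
  finally have "integral (cbox a b) g = measure lborel (cbox a b) * iter_avg a b l g z" .
  moreover have "measure lborel (cbox a b) > 0" using ab by (simp add: content_pos_lt)
  ultimately show ?thesis by simp
qed

section \<open>Partial derivatives up to the boundary\<close>

abbreviation e_x :: "'d \<Rightarrow> ('d::{finite,linorder}) pt" where
  "e_x j \<equiv> (0, axis j 1)"

abbreviation e_t :: "('d::{finite,linorder}) pt" where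
  "e_t \<equiv> (1, 0)"

abbreviation D1 :: "(('d::{finite,linorder}) pt \<Rightarrow> 'b::real_normed_vector) \<Rightarrow> 'd pt \<Rightarrow> 'b" where
  "D1 \<equiv> D_x first"

lemma Basis_pt: "(Basis :: ('d::{finite,linorder}) pt set) = insert e_t (range e_x)"
  by (auto simp: Basis_prod_def Basis_vec_def)

lemma Basis_pt_simps [simp]: "e_t \<in> Basis" "e_x j \<in> Basis"
  by (auto simp: Basis_pt)

lemma e_x_inject [simp]: "e_x i = e_x j \<longleftrightarrow> i = j"
  by (simp add: axis_eq_axis)

lemma e_t_neq_e_x [simp]: "e_t \<noteq> e_x j" "e_x j \<noteq> e_t"
  by simp_all

lemma inner_e_x [simp]: "z \<bullet> e_x j = snd z $ j"
  by (cases z) (simp add: inner_axis)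

lemma inner_e_t [simp]: "z \<bullet> e_t = fst z"
  by (cases z) simp

lemma slice_e_x: "fst (slice (e_x j) z s) = fst z" "snd (slice (e_x j) z s) $ i = (if i = j then s else snd z $ i)"
  using slice_inner[of "e_x j" "e_x i" z s] by (auto simp: slice_def axis_eq_axis)

lemma slice_e_t: "fst (slice e_t z s) = s" "snd (slice e_t z s) = snd z"
  by (auto simp: slice_def)

lemma C_inf_locD:
  assumes "C_inf_loc u"
  shows "continuous_on O_bar u"
    and "v \<in> Basis \<Longrightarrow> C_inf_loc (partial v u)"
    and "v \<in> Basis \<Longrightarrow> z \<in> O_bar \<Longrightarrow> ((\<lambda>s. u (z + s *\<^sub>R v)) has_vector_derivative partial v u z) (at 0 within along v z)"
proof -
  have 1: "C_k k u" for k using assms by (simp add: C_inf_loc_def)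
  show "continuous_on O_bar u" using 1[of 0] by simp
  show "v \<in> Basis \<Longrightarrow> C_inf_loc (partial v u)" unfolding C_inf_loc_def using 1[of "Suc _"] by auto
  show "v \<in> Basis \<Longrightarrow> z \<in> O_bar \<Longrightarrow> ((\<lambda>s. u (z + s *\<^sub>R v)) has_vector_derivative partial v u z) (at 0 within along v z)"
    using 1[of "Suc 0"] unfolding partial_def by (simp add: vector_derivative_works)
qed

lemma C_inf_loc_funpow: "C_inf_loc u \<Longrightarrow> v \<in> Basis \<Longrightarrow> C_inf_loc ((partial v ^^ k) u)"
  by (induction k) (auto intro: C_inf_locD(2))

text \<open>Identities between derivatives, such as their commutation, hold only on the closed
  half-space. This allows them to be differentiated again, also at boundary points.\<close>

lemma partial_cong:
  assumes "\<And>z. z \<in> O_bar \<Longrightarrow> f z = g z" and z: "z \<in> O_bar"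
  shows "partial v f z = partial v g z"
proof -
  have 0: "0 \<in> along v z" using z by (simp add: along_def)
  have *: "((\<lambda>s. f (z + s *\<^sub>R v)) has_vector_derivative D) (at 0 within along v z) \<longleftrightarrow>
        ((\<lambda>s. g (z + s *\<^sub>R v)) has_vector_derivative D) (at 0 within along v z)" for D
    using has_vector_derivative_transform[OF 0, of "\<lambda>s. g (z + s *\<^sub>R v)" "\<lambda>s. f (z + s *\<^sub>R v)" D]
      has_vector_derivative_transform[OF 0, of "\<lambda>s. f (z + s *\<^sub>R v)" "\<lambda>s. g (z + s *\<^sub>R v)" D] assms(1)
    by (auto simp: along_def)
  show ?thesis unfolding partial_def vector_derivative_def * ..
qed

text \<open>\<open>partial\<close> is defined by a derivative at parameter 0 along the maximal
  admissible set. A translation of the parameter and a restriction of the set give the derivative at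
  any parameter within any set that stays in the half-space.\<close>

lemma partial_on_line:
  assumes u: "C_inf_loc u" and v: "v \<in> Basis" and S: "\<And>s. s \<in> S \<Longrightarrow> z + s *\<^sub>R v \<in> O_bar" and s: "s \<in> S"
  shows "((\<lambda>s. u (z + s *\<^sub>R v)) has_vector_derivative partial v u (z + s *\<^sub>R v)) (at s within S)"
proof -
  let ?z = "z + s *\<^sub>R v"
  have "((\<lambda>h. u (?z + h *\<^sub>R v)) has_vector_derivative partial v u ?z) (at 0 within along v ?z)"
    using C_inf_locD(3)[OF u v S[OF s]] .
  moreover have "(\<lambda>h. h - s) ` S \<subseteq> along v ?z"
    using S by (auto simp: along_def scaleR_left_diff_distrib)
  ultimately have 1: "((\<lambda>h. u (?z + h *\<^sub>R v)) has_vector_derivative partial v u ?z) (at (s - s) within (\<lambda>h. h - s) ` S)"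
    by (auto intro: has_vector_derivative_within_subset)
  have 2: "((\<lambda>h. h - s) has_vector_derivative 1) (at s within S)"
    by (auto intro!: derivative_eq_intros simp: has_vector_derivative_def)
  from vector_diff_chain_within[OF 2 1] show ?thesis
    by (simp add: o_def scaleR_left_diff_distrib)
qed

lemma partial_on_slice:
  assumes u: "C_inf_loc u" and i: "i \<in> Basis" and K: "cbox a b \<subseteq> O_bar" and z: "z \<in> cbox a b"
    and s: "s \<in> {a \<bullet> i..b \<bullet> i}"
  shows "((\<lambda>s. u (slice i z s)) has_vector_derivative partial i u (slice i z s)) (at s within {a \<bullet> i..b \<bullet> i})"
proof -
  define z0 where "z0 = slice i z 0"
  have e: "slice i z s = z0 + s *\<^sub>R i" for s by (simp add: z0_def slice_def scaleR_left_diff_distrib)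
  have "z0 + s *\<^sub>R i \<in> O_bar" if "s \<in> {a \<bullet> i..b \<bullet> i}" for s
    using slice_in_cbox[OF i z that] K by (auto simp: e)
  then show ?thesis unfolding e by (intro partial_on_line[OF u i _ s])
qed

lemma O_bar_add_Basis:
  assumes "z \<in> O_bar" "i \<in> Basis" "s \<ge> 0"
  shows "z + s *\<^sub>R i \<in> (O_bar :: ('d::{finite,linorder}) pt set)"
  using assms by (auto simp: O_bar_eq Basis_pt axis_def)

text \<open>Equality of mixed derivatives, up to the boundary: differentiate
  $u(z + s i + y j) = u(z + y j) + \int_0^s \partial_i u(z + \sigma i + y j)\,d\sigma$ in $y$ and then in $s$;
  the rectangle with $s, y \in [0,1]$ never leaves the half-space.\<close>

lemma partial_commute:
  fixes u :: "('d::{finite,linorder}) pt \<Rightarrow> 'b::euclidean_space"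
  assumes u: "C_inf_loc u" and i: "i \<in> Basis" and j: "j \<in> Basis" and z: "z \<in> O_bar"
  shows "partial i (partial j u) z = partial j (partial i u) z"
proof -
  let ?P = "partial i u" and ?Q = "partial j u" and ?R = "partial j (partial i u)"
  have P: "C_inf_loc ?P" and Q: "C_inf_loc ?Q" using C_inf_locD(2)[OF u] i j by auto
  have R: "C_inf_loc ?R" using C_inf_locD(2)[OF P j] .
  have in1: "z + s *\<^sub>R i + y *\<^sub>R j \<in> O_bar" if "s \<ge> 0" "y \<ge> 0" for s y
    using that z i j by (intro O_bar_add_Basis)
  have in2: "z + s *\<^sub>R i \<in> O_bar" if "s \<ge> 0" for s
    using that z i by (intro O_bar_add_Basis)
  have swap: "z + y *\<^sub>R j + s *\<^sub>R i = z + s *\<^sub>R i + y *\<^sub>R j" for s y by simp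
  have cont: "continuous_on A (\<lambda>x. f (z + g x *\<^sub>R i + h x *\<^sub>R j))"
    if "C_inf_loc f" "continuous_on A g" "continuous_on A h" "\<And>x. x \<in> A \<Longrightarrow> g x \<ge> 0" "\<And>x. x \<in> A \<Longrightarrow> h x \<ge> 0"
    for A :: "'c::topological_space set" and f :: "'d pt \<Rightarrow> 'b" and g h
    by (rule continuous_on_compose2[OF C_inf_locD(1)[OF that(1)]]) (use that in \<open>auto intro!: continuous_intros simp: in1\<close>)
  have FTC: "integral (cbox 0 s) (\<lambda>\<sigma>. ?P (z + \<sigma> *\<^sub>R i + y *\<^sub>R j)) = u (z + s *\<^sub>R i + y *\<^sub>R j) - u (z + y *\<^sub>R j)"
    if s: "s \<in> {0..1}" and y: "y \<in> {0..1}" for s y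
  proof -
    have "((\<lambda>\<sigma>. ?P (z + y *\<^sub>R j + \<sigma> *\<^sub>R i)) has_integral (u (z + y *\<^sub>R j + s *\<^sub>R i) - u (z + y *\<^sub>R j + 0 *\<^sub>R i))) {0..s}"
    proof (intro fundamental_theorem_of_calculus partial_on_line[OF u i])
      fix \<sigma> assume "\<sigma> \<in> {0..s}"
      then show "z + y *\<^sub>R j + \<sigma> *\<^sub>R i \<in> O_bar" using y unfolding swap by (intro in1) auto
    qed (use s in auto)
    from integral_unique[OF this[unfolded swap]] show ?thesis by (simp only: scaleR_zero_left add_0_right box_real)
  qed
  have dQ: "?Q (z + s *\<^sub>R i) = ?Q z + integral (cbox 0 s) (\<lambda>\<sigma>. ?R (z + \<sigma> *\<^sub>R i))" if s: "s \<in> {0..1}" for s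
  proof -
    have "((\<lambda>y. integral (cbox 0 s) (\<lambda>\<sigma>. ?P (z + \<sigma> *\<^sub>R i + y *\<^sub>R j))) has_vector_derivative
       integral (cbox 0 s) (\<lambda>\<sigma>. ?R (z + \<sigma> *\<^sub>R i + 0 *\<^sub>R j))) (at 0 within {0..1})"
    proof (rule leibniz_rule_vector_derivative[where U="{0..1}"
        and f="\<lambda>y \<sigma>. ?P (z + \<sigma> *\<^sub>R i + y *\<^sub>R j)" and fx="\<lambda>y \<sigma>. ?R (z + \<sigma> *\<^sub>R i + y *\<^sub>R j)"])
      fix y \<sigma> :: real assume "y \<in> {0..1}" "\<sigma> \<in> cbox 0 s"
      then show "((\<lambda>y. ?P (z + \<sigma> *\<^sub>R i + y *\<^sub>R j)) has_vector_derivative ?R (z + \<sigma> *\<^sub>R i + y *\<^sub>R j)) (at y within {0..1})"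
        by (intro partial_on_line[OF P j]) (simp_all add: in1)
    next
      fix y :: real assume y: "y \<in> {0..1}"
      show "(\<lambda>\<sigma>. ?P (z + \<sigma> *\<^sub>R i + y *\<^sub>R j)) integrable_on cbox 0 s"
        using y by (intro integrable_continuous cont[OF P]) (auto intro!: continuous_intros)
    next
      show "continuous_on ({0..1} \<times> cbox 0 s) (\<lambda>(y, \<sigma>). ?R (z + \<sigma> *\<^sub>R i + y *\<^sub>R j))"
        unfolding split_beta by (intro cont[OF R]) (auto intro!: continuous_intros)
    qed auto
    then have 1: "((\<lambda>y. u (z + s *\<^sub>R i + y *\<^sub>R j) - u (z + y *\<^sub>R j)) has_vector_derivative
       integral (cbox 0 s) (\<lambda>\<sigma>. ?R (z + \<sigma> *\<^sub>R i))) (at 0 within {0..1})"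
      unfolding scaleR_zero_left add_0_right by (rule has_vector_derivative_transform[rotated 2]) (simp_all add: FTC[OF s, unfolded box_real] s)
    have 2: "((\<lambda>y. u (z + s *\<^sub>R i + y *\<^sub>R j) - u (z + y *\<^sub>R j)) has_vector_derivative
       (?Q (z + s *\<^sub>R i + 0 *\<^sub>R j) - ?Q (z + 0 *\<^sub>R j))) (at 0 within {0..1})"
      using s by (intro has_vector_derivative_diff partial_on_line[OF u j]) (simp_all add: in1 O_bar_add_Basis[OF z j])
    have "integral (cbox 0 s) (\<lambda>\<sigma>. ?R (z + \<sigma> *\<^sub>R i)) = ?Q (z + s *\<^sub>R i + 0 *\<^sub>R j) - ?Q (z + 0 *\<^sub>R j)"
      using vector_derivative_unique_within_closed_interval[OF zero_less_one _ 1[folded box_real] 2[folded box_real]] by simp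
    then show ?thesis by simp
  qed
  have 3: "((\<lambda>s. ?Q (z + s *\<^sub>R i)) has_vector_derivative partial i ?Q (z + 0 *\<^sub>R i)) (at 0 within {0..1})"
    by (rule partial_on_line[OF Q i]) (simp_all add: in2)
  have cR: "continuous_on {0..1} (\<lambda>s. ?R (z + s *\<^sub>R i))"
    using cont[OF R, of "{0..1}" "\<lambda>s. s" "\<lambda>s. 0"] by simp
  have "((\<lambda>s. ?Q z + integral {0..s} (\<lambda>\<sigma>. ?R (z + \<sigma> *\<^sub>R i))) has_vector_derivative 0 + ?R (z + 0 *\<^sub>R i)) (at 0 within {0..1})"
    by (intro has_vector_derivative_add has_vector_derivative_const integral_has_vector_derivative[OF cR]) auto
  then have 4: "((\<lambda>s. ?Q (z + s *\<^sub>R i)) has_vector_derivative 0 + ?R (z + 0 *\<^sub>R i)) (at 0 within {0..1})"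
    by (rule has_vector_derivative_transform[rotated 2]) (simp_all add: dQ[unfolded box_real])
  show ?thesis
    using vector_derivative_unique_within_closed_interval[OF zero_less_one _ 3[folded box_real] 4[folded box_real]] by simp
qed

lemma partial_funpow_commute:
  fixes u :: "('d::{finite,linorder}) pt \<Rightarrow> 'b::euclidean_space"
  assumes u: "C_inf_loc u" and v: "v \<in> Basis" and w: "w \<in> Basis" and z: "z \<in> O_bar"
  shows "(partial v ^^ k) (partial w u) z = partial w ((partial v ^^ k) u) z"
  using z
proof (induction k arbitrary: z)
  case (Suc k)
  have "(partial v ^^ Suc k) (partial w u) z = partial v (partial w ((partial v ^^ k) u)) z"
    using partial_cong[OF Suc.IH Suc.prems] by simp
  also have "... = partial w (partial v ((partial v ^^ k) u)) z"
    using C_inf_loc_funpow[OF u v] v w Suc.prems by (intro partial_commute)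
  finally show ?case by simp
qed simp

lemma partial_funpow_funpow_commute:
  fixes u :: "('d::{finite,linorder}) pt \<Rightarrow> 'b::euclidean_space"
  assumes u: "C_inf_loc u" and v: "v \<in> Basis" and w: "w \<in> Basis" and z: "z \<in> O_bar"
  shows "(partial v ^^ k) ((partial w ^^ n) u) z = (partial w ^^ n) ((partial v ^^ k) u) z"
  using z
proof (induction n arbitrary: z)
  case (Suc n)
  have "(partial v ^^ k) ((partial w ^^ Suc n) u) z = partial w ((partial v ^^ k) ((partial w ^^ n) u)) z"
    using partial_funpow_commute[OF C_inf_loc_funpow[OF u w] v w Suc.prems] by simp
  also have "... = partial w ((partial w ^^ n) ((partial v ^^ k) u)) z"
    by (rule partial_cong[OF Suc.IH Suc.prems])
  finally show ?case by simp
qed simp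

section \<open>The equation on a closed box\<close>

text \<open>Complex vectors are treated as a real Euclidean space, so coercivity refers to the real
  inner product, that is, to the real part of the Hermitian form. No regularity in t is
  imposed.\<close>

definition coef :: "real \<Rightarrow> real \<Rightarrow> (real \<Rightarrow> 'b::euclidean_space \<Rightarrow> 'b) \<Rightarrow> bool" where
  "coef \<delta> M L \<longleftrightarrow> (\<forall>t. bounded_linear (L t) \<and> (\<forall>v. \<delta> * (norm v)\<^sup>2 \<le> L t v \<bullet> v) \<and> (\<forall>v. norm (L t v) \<le> M * norm v))"

definition pde :: "nat \<Rightarrow> (real \<Rightarrow> 'b::euclidean_space \<Rightarrow> 'b) \<Rightarrow> real \<Rightarrow> (('d::{finite,linorder}) pt \<Rightarrow> 'b) \<Rightarrow> 'd pt \<Rightarrow> 'b" where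
  "pde m L lam u z = D_t u z + (-1)^m *\<^sub>R (L (fst z) ((D1 ^^ (2*m)) u z) + (\<Sum>j\<in>UNIV - {first}. (D_x j ^^ (2*m)) u z)) + lam *\<^sub>R u z"

definition solves :: "nat \<Rightarrow> (real \<Rightarrow> 'b::euclidean_space \<Rightarrow> 'b) \<Rightarrow> real \<Rightarrow> ('d::{finite,linorder}) pt \<Rightarrow> 'd pt \<Rightarrow> ('d pt \<Rightarrow> 'b) \<Rightarrow> bool" where
  "solves m L lam a b u \<longleftrightarrow> C_inf_loc u \<and> (\<forall>z\<in>cbox a b. pde m L lam u z = 0)"

definition dirichlet :: "nat \<Rightarrow> ('d::{finite,linorder}) pt \<Rightarrow> 'd pt \<Rightarrow> ('d pt \<Rightarrow> 'b::real_normed_vector) \<Rightarrow> bool" where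
  "dirichlet m a b u \<longleftrightarrow> (\<forall>z\<in>cbox a b. snd z $ first = 0 \<longrightarrow> (\<forall>k<m. (D1 ^^ k) u z = 0))"

definition half_box :: "('d::{finite,linorder}) pt \<Rightarrow> 'd pt \<Rightarrow> bool" where
  "half_box a b \<longleftrightarrow> cbox a b \<subseteq> O_bar \<and> (\<forall>i\<in>Basis. a \<bullet> i < b \<bullet> i)"

lemma C_inf_loc_D_x: "C_inf_loc u \<Longrightarrow> C_inf_loc ((D_x j ^^ k) u)"
  unfolding D_x_def by (rule C_inf_loc_funpow) auto

lemma C_inf_loc_D_x1: "C_inf_loc u \<Longrightarrow> C_inf_loc (D_x j u)"
  using C_inf_loc_D_x[where k=1] by simp

lemma C_inf_loc_D_t: "C_inf_loc u \<Longrightarrow> C_inf_loc (D_t u)"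
  unfolding D_t_def by (rule C_inf_locD(2)) auto

text \<open>On a nondegenerate interval the one-sided derivative at an end point is unique. An
  identity on the closed box can therefore be differentiated at all of its points, including those
  on faces.\<close>

lemma vanishing_slice_derivative:
  assumes K: "half_box a b" and i: "i \<in> Basis" and z: "z \<in> cbox a b"
    and d: "((\<lambda>s. f (slice i z s)) has_vector_derivative D) (at (z \<bullet> i) within {a \<bullet> i..b \<bullet> i})"
    and 0: "\<And>s. s \<in> {a \<bullet> i..b \<bullet> i} \<Longrightarrow> f (slice i z s) = 0"
  shows "D = 0"
proof -
  have zi: "z \<bullet> i \<in> cbox (a \<bullet> i) (b \<bullet> i)" and ab: "a \<bullet> i < b \<bullet> i" using z i K by (auto simp: mem_box half_box_def)
  have "((\<lambda>s. 0) has_vector_derivative D) (at (z \<bullet> i) within {a \<bullet> i..b \<bullet> i})"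
    by (rule has_vector_derivative_transform[OF _ _ d]) (use zi 0 in auto)
  then show ?thesis
    using vector_derivative_unique_within_closed_interval[OF ab zi, of "\<lambda>s. 0" D 0] by (auto simp: has_vector_derivative_const)
qed

text \<open>Along a spatial segment t is fixed, so the coefficient is one bounded linear map and
  passes through the derivative; the remaining derivatives commute by smoothness up to the
  boundary.\<close>

lemma solves_D_x:
  fixes u :: "('d::{finite,linorder}) pt \<Rightarrow> 'b::euclidean_space"
  assumes K: "half_box a b" and L: "coef \<delta> M L" and u: "solves m L lam a b u"
  shows "solves m L lam a b (D_x j u)"
  unfolding solves_def
proof (intro conjI ballI)
  have C: "C_inf_loc u" using u by (simp add: solves_def)
  then show "C_inf_loc (D_x j u)" by (rule C_inf_loc_D_x1)
  fix z assume z: "z \<in> cbox a b"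
  let ?e = "e_x j" let ?I = "{a \<bullet> ?e..b \<bullet> ?e}"
  have Kb: "cbox a b \<subseteq> O_bar" using K by (simp add: half_box_def)
  have zO: "z \<in> O_bar" using z Kb by auto
  have zi: "z \<bullet> ?e \<in> ?I" using z Basis_pt_simps(2)[of j] by (auto simp: mem_box simp del: inner_e_x)
  have d: "((\<lambda>s. f (slice ?e z s)) has_vector_derivative D_x j f z) (at (z \<bullet> ?e) within ?I)" if "C_inf_loc f" for f :: "'d pt \<Rightarrow> 'b"
    using partial_on_slice[OF that Basis_pt_simps(2) Kb z zi] by (simp add: slice_self D_x_def del: inner_e_x)
  have BL: "bounded_linear (L t)" for t using L by (simp add: coef_def)
  have "((\<lambda>s. pde m L lam u (slice ?e z s)) has_vector_derivative
      D_x j (D_t u) z + (-1)^m *\<^sub>R (L (fst z) (D_x j ((D1 ^^ (2*m)) u) z) + (\<Sum>k\<in>UNIV - {first}. D_x j ((D_x k ^^ (2*m)) u) z)) + lam *\<^sub>R D_x j u z)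
      (at (z \<bullet> ?e) within ?I)"
    unfolding pde_def slice_e_x
    apply (intro has_vector_derivative_add has_vector_derivative_sum
      bounded_linear.has_vector_derivative[OF bounded_linear_scaleR_right]
      bounded_linear.has_vector_derivative[OF BL])
    by (rule d, intro C C_inf_loc_D_x C_inf_loc_D_t)+
  moreover have "D_x j (D_t u) z = D_t (D_x j u) z"
    unfolding D_x_def D_t_def by (rule partial_commute[OF C _ _ zO]) auto
  moreover have "D_x j ((D_x k ^^ n) u) z = (D_x k ^^ n) (D_x j u) z" for k n
    unfolding D_x_def by (rule partial_funpow_commute[OF C _ _ zO, symmetric]) auto
  ultimately have "((\<lambda>s. pde m L lam u (slice ?e z s)) has_vector_derivative pde m L lam (D_x j u) z) (at (z \<bullet> ?e) within ?I)"
    by (simp add: pde_def[of m L lam "D_x j u" z] del: inner_e_x)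
  then show "pde m L lam (D_x j u) z = 0"
  proof (rule vanishing_slice_derivative[OF K Basis_pt_simps(2) z])
    fix s assume "s \<in> ?I"
    then show "pde m L lam u (slice ?e z s) = 0"
      using u slice_in_cbox[OF Basis_pt_simps(2) z] by (auto simp: solves_def)
  qed
qed

text \<open>A segment in any direction other than that of x_1, time included, stays in the
  hyperplane x_1 = 0 once it starts there. The time direction is covered because the boundary
  argument for D_1^(2m) u needs u_t to vanish as well.\<close>

lemma dirichlet_partial:
  fixes u :: "('d::{finite,linorder}) pt \<Rightarrow> 'b::euclidean_space"
  assumes K: "half_box a b" and C: "C_inf_loc u" and u: "dirichlet m a b u" and i: "i \<in> Basis" and ne: "i \<noteq> e_x first"
  shows "dirichlet m a b (partial i u)"
  unfolding dirichlet_def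
proof (intro ballI impI allI)
  fix z k assume z: "z \<in> cbox a b" and z0: "snd z $ first = 0" and k: "k < m"
  have Kb: "cbox a b \<subseteq> O_bar" using K by (simp add: half_box_def)
  have zO: "z \<in> O_bar" using z Kb by auto
  have zi: "z \<bullet> i \<in> {a \<bullet> i..b \<bullet> i}" using z i by (auto simp: mem_box)
  have "((\<lambda>s. (D1 ^^ k) u (slice i z s)) has_vector_derivative partial i ((D1 ^^ k) u) z) (at (z \<bullet> i) within {a \<bullet> i..b \<bullet> i})"
    using partial_on_slice[OF C_inf_loc_D_x[OF C] i Kb z zi] by (simp add: slice_self)
  then have "partial i ((D1 ^^ k) u) z = 0"
  proof (rule vanishing_slice_derivative[OF K i z])
    fix s assume "s \<in> {a \<bullet> i..b \<bullet> i}"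
    then have "slice i z s \<in> cbox a b" using slice_in_cbox[OF i z] by auto
    moreover have "slice i z s \<bullet> e_x first = z \<bullet> e_x first"
      using slice_inner[OF i Basis_pt_simps(2), of z s first] not_sym[OF ne] by (simp only: if_False)
    ultimately show "(D1 ^^ k) u (slice i z s) = 0" using u z0 k by (auto simp: dirichlet_def)
  qed
  then show "(D1 ^^ k) (partial i u) z = 0"
    unfolding D_x_def using partial_funpow_commute[OF C _ i zO, where v="e_x first" and k=k] by auto
qed

lemma dirichlet_tangential:
  fixes u :: "('d::{finite,linorder}) pt \<Rightarrow> 'b::euclidean_space"
  assumes "half_box a b" "C_inf_loc u" "dirichlet m a b u" "j \<noteq> first"
  shows "dirichlet m a b ((D_x j ^^ n) u)"
proof (induction n)
  case (Suc n)
  have "e_x j \<noteq> e_x first" using assms(4) by (simp add: axis_eq_axis)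
  from dirichlet_partial[OF assms(1) C_inf_loc_D_x[OF assms(2)] Suc Basis_pt_simps(2) this] show ?case
    by (simp add: D_x_def)
qed (simp add: assms)

lemma solves_funpow_D_x:
  fixes u :: "('d::{finite,linorder}) pt \<Rightarrow> 'b::euclidean_space"
  assumes "half_box a b" "coef \<delta> M L" "solves m L lam a b u"
  shows "solves m L lam a b ((D_x j ^^ n) u)"
  by (induction n) (auto intro: solves_D_x[OF assms(1,2)] assms(3))

text \<open>On the flat boundary the equation, differentiated $k < m$ times in $x_1$, reduces to
  $A(t) D_1^{2m+k} u = 0$; since $A(t)$ is injective, $D_1^{2m} u$ inherits the Dirichlet condition.\<close>

lemma dirichlet_D1_2m:
  fixes u :: "('d::{finite,linorder}) pt \<Rightarrow> 'b::euclidean_space"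
  assumes K: "half_box a b" and L: "coef \<delta> M L" and \<delta>: "\<delta> > 0" and u: "solves m L lam a b u" and d: "dirichlet m a b u"
  shows "dirichlet m a b ((D1 ^^ (2*m)) u)"
  unfolding dirichlet_def
proof (intro ballI impI allI)
  fix z k assume z: "z \<in> cbox a b" and z0: "snd z $ first = 0" and k: "k < m"
  have C: "C_inf_loc u" using u by (simp add: solves_def)
  have zO: "z \<in> O_bar" using z K by (auto simp: half_box_def)
  have van: "(D1 ^^ k) w z = 0" if "dirichlet m a b w" for w :: "'d pt \<Rightarrow> 'b"
    using that z z0 k by (simp add: dirichlet_def)
  have t: "D_t ((D1 ^^ k) u) z = 0"
    using van[OF dirichlet_partial[OF K C d, of e_t]] partial_funpow_commute[OF C _ _ zO, where v="e_x first" and w=e_t and k=k]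
    by (simp add: D_t_def D_x_def)
  have x: "(D_x j ^^ (2*m)) ((D1 ^^ k) u) z = 0" if "j \<noteq> first" for j
    using van[OF dirichlet_tangential[OF K C d that, where n="2*m"]] partial_funpow_funpow_commute[OF C _ _ zO, where v="e_x first" and w="e_x j" and k=k and n="2*m"]
    by (simp add: D_x_def)
  have "pde m L lam ((D1 ^^ k) u) z = 0"
    using solves_funpow_D_x[OF K L u, where j=first and n=k] z by (simp add: solves_def)
  then have "(-1)^m *\<^sub>R L (fst z) ((D1 ^^ (2*m)) ((D1 ^^ k) u) z) = 0"
    using t x van[OF d] by (simp add: pde_def)
  then have "L (fst z) ((D1 ^^ (2*m)) ((D1 ^^ k) u) z) = 0" by simp
  moreover have "\<delta> * (norm v)\<^sup>2 \<le> L (fst z) v \<bullet> v" for v using L by (simp add: coef_def)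
  ultimately have "\<delta> * (norm ((D1 ^^ (2*m)) ((D1 ^^ k) u) z))\<^sup>2 \<le> 0" by (metis inner_zero_left)
  then have "(D1 ^^ (2*m)) ((D1 ^^ k) u) z = 0" using \<delta> by (simp add: mult_le_0_iff)
  moreover have "(D1 ^^ k) ((D1 ^^ (2*m)) u) = (D1 ^^ (2*m)) ((D1 ^^ k) u)"
    by (simp only: funpow_add[symmetric, THEN fun_cong, unfolded comp_apply] add.commute)
  ultimately show "(D1 ^^ k) ((D1 ^^ (2*m)) u) z = 0" by simp
qed

section \<open>Energy estimates\<close>

text \<open>The lower corner of a cube of half-side \<rho> around x, cut off at x_1 = 0, over a time
  interval of parabolic length \<rho>^(2m) ending at the top time \<tau>.\<close>

definition lo :: "nat \<Rightarrow> real \<Rightarrow> real ^ ('d::{finite,linorder}) \<Rightarrow> real \<Rightarrow> 'd pt" where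
  "lo m \<tau> x \<rho> = (\<tau> - \<rho>^(2*m), \<chi> j. if j = first then max 0 (x $ j - \<rho>) else x $ j - \<rho>)"

definition hi :: "real \<Rightarrow> real ^ ('d::{finite,linorder}) \<Rightarrow> real \<Rightarrow> 'd pt" where
  "hi \<tau> x \<rho> = (\<tau>, \<chi> j. x $ j + \<rho>)"

abbreviation kbox :: "nat \<Rightarrow> real \<Rightarrow> real ^ ('d::{finite,linorder}) \<Rightarrow> real \<Rightarrow> 'd pt set" where
  "kbox m \<tau> x \<rho> \<equiv> cbox (lo m \<tau> x \<rho>) (hi \<tau> x \<rho>)"

lemma lo_hi_inner:
  "lo m \<tau> x \<rho> \<bullet> e_t = \<tau> - \<rho>^(2*m)" "hi \<tau> x \<rho> \<bullet> e_t = \<tau>"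
  "lo m \<tau> x \<rho> \<bullet> e_x j = (if j = first then max 0 (x $ j - \<rho>) else x $ j - \<rho>)" "hi \<tau> x \<rho> \<bullet> e_x j = x $ j + \<rho>"
  by (simp_all add: lo_def hi_def del: inner_e_t inner_e_x) (simp_all add: inner_axis)

lemma mem_kbox:
  "z \<in> kbox m \<tau> x \<rho> \<longleftrightarrow> \<tau> - \<rho>^(2*m) \<le> fst z \<and> fst z \<le> \<tau> \<and>
    (\<forall>j. (if j = first then max 0 (x $ j - \<rho>) else x $ j - \<rho>) \<le> snd z $ j \<and> snd z $ j \<le> x $ j + \<rho>)"
  unfolding mem_box Basis_pt by (simp only: ball_simps image_iff inner_e_t inner_e_x) (simp add: lo_def hi_def)

lemma kbox_abs:
  assumes "z \<in> kbox m \<tau> x \<rho>"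
  shows "\<bar>snd z $ j - x $ j\<bar> \<le> \<rho>"
  using assms unfolding mem_kbox by (auto simp: abs_le_iff split: if_splits dest: spec[of _ j])

lemma half_box_kbox:
  assumes "\<rho> > 0" "x $ first \<ge> 0"
  shows "half_box (lo m \<tau> x \<rho>) (hi \<tau> x \<rho>)"
  unfolding half_box_def
proof (intro conjI ballI)
  show "kbox m \<tau> x \<rho> \<subseteq> O_bar"
  proof
    fix z assume "z \<in> kbox m \<tau> x \<rho>"
    then have "max 0 (x $ first - \<rho>) \<le> snd z $ first" unfolding mem_kbox by presburger
    then show "z \<in> O_bar" by (simp add: O_bar_eq)
  qed
  fix i :: "'a pt" assume "i \<in> Basis"
  then show "lo m \<tau> x \<rho> \<bullet> i < hi \<tau> x \<rho> \<bullet> i"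
    using assms by (auto simp only: Basis_pt lo_hi_inner insert_iff image_iff) (auto simp: max_def)
qed

lemma kbox_mono:
  assumes "\<rho> \<le> \<rho>'" "0 \<le> \<rho>"
  shows "kbox m \<tau> x \<rho> \<subseteq> kbox m \<tau> x \<rho>'"
proof
  fix z assume z: "z \<in> kbox m \<tau> x \<rho>"
  have "\<rho>^(2*m) \<le> \<rho>'^(2*m)" using assms by (intro power_mono) auto
  moreover have "(if j = first then max 0 (x $ j - \<rho>') else x $ j - \<rho>') \<le> snd z $ j \<and> snd z $ j \<le> x $ j + \<rho>'" for j
    using z assms unfolding mem_kbox by (auto split: if_splits dest!: spec[of _ j])
  ultimately show "z \<in> kbox m \<tau> x \<rho>'"
    using z unfolding mem_kbox by auto
qed

text \<open>Linear in time and zero only at the initial time: at the final time the energy argument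
  leaves a boundary term of the favourable sign, so nothing has to vanish there.\<close>

definition wt_t :: "nat \<Rightarrow> real \<Rightarrow> real \<Rightarrow> real \<Rightarrow> real" where
  "wt_t m \<tau> \<rho> t = (t - (\<tau> - \<rho>^(2*m))) / \<rho>^(2*m)"

text \<open>In a box that is cut off, this weight need not vanish on the flat boundary x_1 = 0. It
  vanishes on the other lateral faces, and the Dirichlet condition takes over on the flat
  one.\<close>

definition weight :: "nat \<Rightarrow> real \<Rightarrow> real ^ ('d::{finite,linorder}) \<Rightarrow> real \<Rightarrow> 'd pt \<Rightarrow> real" where
  "weight m \<tau> x \<rho> z = wt_t m \<tau> \<rho> (fst z) * (\<Prod>j\<in>UNIV. wt (x $ j) \<rho> (snd z $ j))"

lemma wt_t_range:
  assumes "\<tau> - \<rho>^(2*m) \<le> t" "t \<le> \<tau>" "\<rho> > 0"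
  shows "0 \<le> wt_t m \<tau> \<rho> t" "wt_t m \<tau> \<rho> t \<le> 1"
  using assms by (auto simp: wt_t_def)

lemma weight_factors_range:
  assumes "z \<in> kbox m \<tau> x \<rho>" "\<rho> > 0"
  shows "0 \<le> wt (x $ j) \<rho> (snd z $ j)" "wt (x $ j) \<rho> (snd z $ j) \<le> 1"
    "0 \<le> wt_t m \<tau> \<rho> (fst z)" "wt_t m \<tau> \<rho> (fst z) \<le> 1"
  using wt_range[OF kbox_abs[OF assms(1)] assms(2)] wt_t_range[of \<tau> \<rho> m "fst z"] assms
  by (auto simp: mem_kbox)

lemma weight_range:
  assumes "z \<in> kbox m \<tau> x \<rho>" "\<rho> > 0"
  shows "0 \<le> weight m \<tau> x \<rho> z" "weight m \<tau> x \<rho> z \<le> 1"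
proof -
  have 1: "0 \<le> (\<Prod>j\<in>UNIV. wt (x $ j) \<rho> (snd z $ j))" "(\<Prod>j\<in>UNIV. wt (x $ j) \<rho> (snd z $ j)) \<le> 1"
    using weight_factors_range(1,2)[OF assms] by (auto intro: prod_nonneg prod_le_1)
  show "0 \<le> weight m \<tau> x \<rho> z" "weight m \<tau> x \<rho> z \<le> 1"
    using 1 weight_factors_range(3,4)[OF assms] by (auto simp: weight_def intro: mult_le_one)
qed

lemma continuous_on_weight [continuous_intros]: "\<rho> > 0 \<Longrightarrow> continuous_on S (weight m \<tau> x \<rho>)"
  unfolding weight_def wt_def wt_t_def by (intro continuous_intros) auto

text \<open>On a slice in direction \<open>i\<close> all factors of the weight but one are constant.\<close>

lemma weight_slice_x:
  assumes z: "z \<in> kbox m \<tau> x \<rho>" and \<rho>: "\<rho> > 0"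
  obtains p where "0 \<le> p" "p \<le> 1" "\<And>s. weight m \<tau> x \<rho> (slice (e_x j) z s) = p * wt (x $ j) \<rho> s"
proof
  let ?p = "wt_t m \<tau> \<rho> (fst z) * (\<Prod>k\<in>UNIV - {j}. wt (x $ k) \<rho> (snd z $ k))"
  have 1: "0 \<le> (\<Prod>k\<in>UNIV - {j}. wt (x $ k) \<rho> (snd z $ k))" "(\<Prod>k\<in>UNIV - {j}. wt (x $ k) \<rho> (snd z $ k)) \<le> 1"
    using weight_factors_range(1,2)[OF assms] by (auto intro: prod_nonneg prod_le_1)
  show "0 \<le> ?p" "?p \<le> 1"
    using 1 weight_factors_range(3,4)[OF assms] by (auto intro: mult_le_one)
  fix s
  have "(\<Prod>k\<in>UNIV. wt (x $ k) \<rho> (snd (slice (e_x j) z s) $ k)) = wt (x $ j) \<rho> s * (\<Prod>k\<in>UNIV - {j}. wt (x $ k) \<rho> (snd z $ k))"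
    by (subst prod.remove[of _ j]) (auto simp: slice_e_x intro!: prod.cong)
  then show "weight m \<tau> x \<rho> (slice (e_x j) z s) = ?p * wt (x $ j) \<rho> s"
    by (simp add: weight_def slice_e_x)
qed

lemma weight_slice_t:
  assumes z: "z \<in> kbox m \<tau> x \<rho>" and \<rho>: "\<rho> > 0"
  obtains p where "0 \<le> p" "p \<le> 1" "\<And>s. weight m \<tau> x \<rho> (slice e_t z s) = p * wt_t m \<tau> \<rho> s"
proof
  let ?p = "\<Prod>k\<in>UNIV. wt (x $ k) \<rho> (snd z $ k)"
  show "0 \<le> ?p" "?p \<le> 1"
    using weight_factors_range(1,2)[OF assms] by (auto intro: prod_nonneg prod_le_1)
  show "weight m \<tau> x \<rho> (slice e_t z s) = ?p * wt_t m \<tau> \<rho> s" for s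
    by (simp add: weight_def slice_e_t)
qed

lemma deriv_chain_slice:
  fixes u :: "('d::{finite,linorder}) pt \<Rightarrow> 'b::euclidean_space"
  assumes u: "C_inf_loc u" and K: "half_box a b" and z: "z \<in> cbox a b"
  shows "deriv_chain n (a \<bullet> e_x j) (b \<bullet> e_x j) (\<lambda>k s. (D_x j ^^ k) u (slice (e_x j) z s))"
proof -
  have Kb: "cbox a b \<subseteq> O_bar" using K by (simp add: half_box_def)
  have d: "((\<lambda>s. (D_x j ^^ k) u (slice (e_x j) z s)) has_vector_derivative (D_x j ^^ Suc k) u (slice (e_x j) z s)) (at s within {a \<bullet> e_x j..b \<bullet> e_x j})"
    if "s \<in> {a \<bullet> e_x j..b \<bullet> e_x j}" for k s
    using partial_on_slice[OF C_inf_loc_D_x[OF u, of k j] Basis_pt_simps(2) Kb z that] by (simp add: D_x_def del: inner_e_x)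
  then show ?thesis unfolding deriv_chain_def using continuous_on_vector_derivative[OF d] by blast
qed

text \<open>Only a segment in direction x_1 can be shortened by the cut-off, and its lower end then
  lies on the flat boundary. In all other cases the segment has its full length and the weight
  vanishes at both ends.\<close>

lemma slice_dirichlet_slice:
  fixes u :: "('d::{finite,linorder}) pt \<Rightarrow> 'b::euclidean_space"
  assumes u: "dirichlet m (lo m \<tau> x \<rho>) (hi \<tau> x \<rho>) u" and \<rho>: "\<rho> > 0" and x: "x $ first \<ge> 0" and z: "z \<in> kbox m \<tau> x \<rho>"
  shows "slice_dirichlet m (x $ j) \<rho> (lo m \<tau> x \<rho> \<bullet> e_x j) (\<lambda>k s. (D_x j ^^ k) u (slice (e_x j) z s))"
proof (cases "j = first \<and> x $ j - \<rho> < 0")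
  case True
  then have lo0: "lo m \<tau> x \<rho> \<bullet> e_x j = 0" unfolding lo_hi_inner by auto
  have "slice (e_x j) z 0 \<in> kbox m \<tau> x \<rho>"
    by (rule slice_in_cbox[OF Basis_pt_simps(2) z]) (use lo0 True x \<rho> in \<open>simp add: lo_hi_inner del: inner_e_x\<close>)
  then have "\<forall>k<m. (D1 ^^ k) u (slice (e_x j) z 0) = 0"
    using u True by (auto simp: dirichlet_def slice_e_x)
  then show ?thesis using True x \<rho> unfolding slice_dirichlet_def lo0 by auto
next
  case False
  then have "lo m \<tau> x \<rho> \<bullet> e_x j = x $ j - \<rho>" unfolding lo_hi_inner by auto
  then show ?thesis using \<rho> unfolding slice_dirichlet_def by auto
qed

text \<open>With a measurable coefficient the continuity of this product is not automatic. The
  equation expresses it through derivatives of u, which are continuous; this is what makes the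
  integration over slices applicable to it.\<close>

lemma pde_continuous:
  fixes u :: "('d::{finite,linorder}) pt \<Rightarrow> 'b::euclidean_space"
  assumes K: "half_box a b" and u: "solves m L lam a b u"
  shows "continuous_on (cbox a b) (\<lambda>z. L (fst z) ((D1 ^^ (2*m)) u z))"
proof -
  have C: "C_inf_loc u" using u by (simp add: solves_def)
  have c: "continuous_on (cbox a b) f" if "C_inf_loc f" for f :: "'d pt \<Rightarrow> 'b"
    using continuous_on_subset[OF C_inf_locD(1)[OF that]] K by (simp add: half_box_def)
  have eq: "L (fst z) ((D1 ^^ (2*m)) u z) = - ((-1)^m *\<^sub>R (D_t u z + lam *\<^sub>R u z)) - (\<Sum>j\<in>UNIV - {first}. (D_x j ^^ (2*m)) u z)"
    if "z \<in> cbox a b" for z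
  proof -
    have "(-1)^m *\<^sub>R pde m L lam u z = 0" using u that by (simp add: solves_def)
    then have "(-1)^m *\<^sub>R (D_t u z + lam *\<^sub>R u z) + ((-1)^m * (-1)^m) *\<^sub>R (L (fst z) ((D1 ^^ (2*m)) u z) + (\<Sum>j\<in>UNIV - {first}. (D_x j ^^ (2*m)) u z)) = 0"
      by (simp only: pde_def scaleR_add_right scaleR_scaleR add_ac)
    moreover have "(-1)^m * (-1)^m = (1::real)" by (simp add: power_mult_distrib[symmetric])
    ultimately show ?thesis by (simp add: algebra_simps eq_neg_iff_add_eq_0)
  qed
  have "continuous_on (cbox a b) (\<lambda>z. - ((-1)^m *\<^sub>R (D_t u z + lam *\<^sub>R u z)) - (\<Sum>j\<in>UNIV - {first}. (D_x j ^^ (2*m)) u z))"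
    by (intro continuous_intros c C C_inf_loc_D_x C_inf_loc_D_t)
  then show ?thesis by (simp cong: continuous_on_cong add: eq)
qed

text \<open>The fundamental theorem of calculus for w^n |f|^2: the weight kills the initial value,
  and the integral equals half of |f|^2 at the final time.\<close>

lemma slice_time_energy:
  fixes f f' :: "real \<Rightarrow> 'b::euclidean_space"
  assumes d: "\<And>s. s \<in> {\<tau> - \<rho>^(2*m)..\<tau>} \<Longrightarrow> (f has_vector_derivative f' s) (at s within {\<tau> - \<rho>^(2*m)..\<tau>})"
    and c: "continuous_on {\<tau> - \<rho>^(2*m)..\<tau>} f'" and \<rho>: "\<rho> > 0" and n: "n \<ge> 1"
  shows "0 \<le> integral {\<tau> - \<rho>^(2*m)..\<tau>} (\<lambda>s. wt_t m \<tau> \<rho> s ^ n * (f' s \<bullet> f s) + real n / 2 / \<rho>^(2*m) * (wt_t m \<tau> \<rho> s ^ (n - 1) * (norm (f s))\<^sup>2))"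
proof -
  let ?S = "{\<tau> - \<rho>^(2*m)..\<tau>}" and ?w = "wt_t m \<tau> \<rho>"
  have le: "\<tau> - \<rho>^(2*m) \<le> \<tau>" using \<rho> by simp
  have dw: "(?w has_real_derivative 1 / \<rho>^(2*m)) (at s within ?S)" for s
    unfolding wt_t_def using \<rho> by (auto intro!: derivative_eq_intros)
  have "((\<lambda>s. ?w s ^ n * (f s \<bullet> f s)) has_vector_derivative
      2 * (?w s ^ n * (f' s \<bullet> f s) + real n / 2 / \<rho>^(2*m) * (?w s ^ (n - 1) * (norm (f s))\<^sup>2))) (at s within ?S)" if s: "s \<in> ?S" for s
  proof -
    have "((\<lambda>s. f s \<bullet> f s) has_real_derivative (f s \<bullet> f' s + f' s \<bullet> f s)) (at s within ?S)"
      using bounded_bilinear.has_vector_derivative[OF bounded_bilinear_inner d[OF s] d[OF s]]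
      by (simp add: has_real_derivative_iff_has_vector_derivative)
    from DERIV_cong[OF DERIV_mult[OF DERIV_power[OF dw, of n] this], of "2 * (?w s ^ n * (f' s \<bullet> f s) + real n / 2 / \<rho>^(2*m) * (?w s ^ (n - 1) * (norm (f s))\<^sup>2))"]
    show ?thesis by (simp add: has_real_derivative_iff_has_vector_derivative inner_commute dot_square_norm algebra_simps)
  qed
  from fundamental_theorem_of_calculus[OF le this]
  have "((\<lambda>s. 2 * (?w s ^ n * (f' s \<bullet> f s) + real n / 2 / \<rho>^(2*m) * (?w s ^ (n - 1) * (norm (f s))\<^sup>2))) has_integral
     (?w \<tau> ^ n * (f \<tau> \<bullet> f \<tau>) - ?w (\<tau> - \<rho>^(2*m)) ^ n * (f (\<tau> - \<rho>^(2*m)) \<bullet> f (\<tau> - \<rho>^(2*m))))) ?S" .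
  moreover have "?w (\<tau> - \<rho>^(2*m)) = 0" "?w \<tau> = 1" using \<rho> by (auto simp: wt_t_def)
  ultimately have I: "((\<lambda>s. 2 * (?w s ^ n * (f' s \<bullet> f s) + real n / 2 / \<rho>^(2*m) * (?w s ^ (n - 1) * (norm (f s))\<^sup>2))) has_integral (f \<tau> \<bullet> f \<tau>)) ?S"
    using n by (simp add: power_0_left)
  have half: "1/2 * (2 * y) = y" for y :: real by simp
  from has_integral_mult_right[OF I, of "1/2", unfolded half]
  have "((\<lambda>s. ?w s ^ n * (f' s \<bullet> f s) + real n / 2 / \<rho>^(2*m) * (?w s ^ (n - 1) * (norm (f s))\<^sup>2)) has_integral (1/2 * (f \<tau> \<bullet> f \<tau>))) ?S"
    unfolding half .
  then show ?thesis by (simp add: integral_unique)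
qed

lemma coef_weaken:
  assumes "coef \<delta> M L" "0 < \<delta>'" "\<delta>' \<le> \<delta>" "M \<le> M'"
  shows "coef \<delta>' M' L"
  unfolding coef_def
proof (intro allI conjI)
  fix t and v :: 'a
  show "bounded_linear (L t)" using assms by (simp add: coef_def)
  have "\<delta>' * (norm v)\<^sup>2 \<le> \<delta> * (norm v)\<^sup>2" using assms by (intro mult_right_mono) auto
  also have "... \<le> L t v \<bullet> v" using assms by (simp add: coef_def)
  finally show "\<delta>' * (norm v)\<^sup>2 \<le> L t v \<bullet> v" .
  have "norm (L t v) \<le> M * norm v" using assms by (simp add: coef_def)
  also have "... \<le> M' * norm v" using assms by (intro mult_right_mono) auto
  finally show "norm (L t v) \<le> M' * norm v" .
qed

lemma coef_id: "\<delta> \<le> 1 \<Longrightarrow> 1 \<le> M \<Longrightarrow> coef \<delta> M (\<lambda>t v. v)"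
  unfolding coef_def by (auto simp: dot_square_norm mult_left_le_one_le intro: mult_right_mono)
    (metis mult.left_neutral mult_right_mono norm_ge_zero zero_le_power2)+

text \<open>The coefficient must be constant along the slices, which is why it may depend on $t$ only.\<close>

lemma caccioppoli_direction:
  assumes "\<delta> > 0" "M \<ge> 0" "m \<ge> 1"
  shows "\<exists>C\<ge>0. \<forall>(L :: real \<Rightarrow> 'b::euclidean_space \<Rightarrow> 'b) \<tau> (x :: real ^ ('d::{finite,linorder})) \<rho> u j.
    coef \<delta> M L \<longrightarrow> \<rho> > 0 \<longrightarrow> x $ first \<ge> 0 \<longrightarrow> C_inf_loc u \<longrightarrow> dirichlet m (lo m \<tau> x \<rho>) (hi \<tau> x \<rho>) u \<longrightarrow>
    continuous_on (kbox m \<tau> x \<rho>) (\<lambda>z. L (fst z) ((D_x j ^^ (2*m)) u z)) \<longrightarrow>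
    0 \<le> integral (kbox m \<tau> x \<rho>) (\<lambda>z. (-1)^m * (weight m \<tau> x \<rho> z ^ (N+2*m) * (L (fst z) ((D_x j ^^ (2*m)) u z) \<bullet> u z))
      - \<delta>/2 * (weight m \<tau> x \<rho> z ^ (N+2*m) * (norm ((D_x j ^^ m) u z))\<^sup>2)
      + C / \<rho>^(2*m) * (weight m \<tau> x \<rho> z ^ N * (norm (u z))\<^sup>2))"
proof -
  obtain C where C: "C \<ge> 0" "\<And>(L :: 'b \<Rightarrow> 'b) f \<alpha> c \<rho>. bounded_linear L \<Longrightarrow> (\<forall>v. L v \<bullet> v \<ge> \<delta> * (norm v)\<^sup>2) \<Longrightarrow> (\<forall>v. norm (L v) \<le> M * norm v) \<Longrightarrow>
    deriv_chain (2*m) \<alpha> (c+\<rho>) f \<Longrightarrow> slice_dirichlet m c \<rho> \<alpha> f \<Longrightarrow>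
    0 \<le> integral {\<alpha>..c+\<rho>} (\<lambda>s. (-1)^m * (L (f (2*m) s) \<bullet> (wt c \<rho> s ^ (N + 2*m) *\<^sub>R f 0 s))
          - \<delta>/2 * (wt c \<rho> s ^ (N + 2*m) * (norm (f m s))\<^sup>2) + C / \<rho>^(2*m) * (wt c \<rho> s ^ N * (norm (f 0 s))\<^sup>2))"
    using slice_caccioppoli[OF assms, of N] by blast
  show ?thesis
  proof (rule exI[of _ C], intro conjI C(1) allI impI)
    fix L :: "real \<Rightarrow> 'b \<Rightarrow> 'b" and \<tau> \<rho> :: real and x :: "real ^ ('d::{finite,linorder})" and u :: "'d pt \<Rightarrow> 'b" and j
    assume L: "coef \<delta> M L" and \<rho>: "\<rho> > 0" and x: "x $ first \<ge> 0" and u: "C_inf_loc u"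
      and d: "dirichlet m (lo m \<tau> x \<rho>) (hi \<tau> x \<rho>) u"
      and cL: "continuous_on (kbox m \<tau> x \<rho>) (\<lambda>z. L (fst z) ((D_x j ^^ (2*m)) u z))"
    let ?K = "kbox m \<tau> x \<rho>" and ?\<phi> = "weight m \<tau> x \<rho>"
    have K: "half_box (lo m \<tau> x \<rho>) (hi \<tau> x \<rho>)" by (rule half_box_kbox[OF \<rho> x])
    have c: "continuous_on ?K f" if "C_inf_loc f" for f :: "'d pt \<Rightarrow> 'b"
      using continuous_on_subset[OF C_inf_locD(1)[OF that]] K by (simp add: half_box_def)
    let ?h = "\<lambda>z. (-1)^m * (?\<phi> z ^ (N+2*m) * (L (fst z) ((D_x j ^^ (2*m)) u z) \<bullet> u z))
      - \<delta>/2 * (?\<phi> z ^ (N+2*m) * (norm ((D_x j ^^ m) u z))\<^sup>2) + C / \<rho>^(2*m) * (?\<phi> z ^ N * (norm (u z))\<^sup>2)"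
    have ch: "continuous_on ?K ?h"
      using \<rho> by (intro continuous_intros c[OF u] c[OF C_inf_loc_D_x[OF u]] cL) auto
    show "0 \<le> integral ?K ?h"
    proof (rule integral_nonneg_by_slices[OF ch Basis_pt_simps(2)])
      show "lo m \<tau> x \<rho> \<bullet> e_x j < hi \<tau> x \<rho> \<bullet> e_x j" using K by (simp add: half_box_def del: inner_e_x)
      fix z assume z: "z \<in> ?K"
      obtain p where p: "0 \<le> p" "p \<le> 1" "\<And>s. ?\<phi> (slice (e_x j) z s) = p * wt (x $ j) \<rho> s"
        using weight_slice_x[OF z \<rho>] by blast
      define f where "f k s = (D_x j ^^ k) u (slice (e_x j) z s)" for k s
      let ?\<alpha> = "lo m \<tau> x \<rho> \<bullet> e_x j" and ?\<beta> = "hi \<tau> x \<rho> \<bullet> e_x j"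
      let ?w = "wt (x $ j) \<rho>" and ?L = "L (fst z)"
      have \<beta>: "?\<beta> = x $ j + \<rho>" by (rule lo_hi_inner)
      have dc: "deriv_chain (2*m) ?\<alpha> ?\<beta> f" unfolding f_def by (rule deriv_chain_slice[OF u K z])
      have sd: "slice_dirichlet m (x $ j) \<rho> ?\<alpha> f" unfolding f_def by (rule slice_dirichlet_slice[OF d \<rho> x z])
      let ?g = "\<lambda>s. (-1)^m * (?L (f (2*m) s) \<bullet> (?w s ^ (N + 2*m) *\<^sub>R f 0 s))
          - \<delta>/2 * (?w s ^ (N + 2*m) * (norm (f m s))\<^sup>2) + C / \<rho>^(2*m) * (?w s ^ N * (norm (f 0 s))\<^sup>2)"
      have BL: "bounded_linear ?L" using L by (simp add: coef_def)
      have cf: "continuous_on {?\<alpha>..?\<beta>} (f k)" if "k \<le> 2*m" for k using deriv_chainD(2)[OF dc that] .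
      have cg: "continuous_on {?\<alpha>..?\<beta>} ?g"
        using \<rho> by (intro continuous_intros cf bounded_linear.continuous_on[OF BL]) auto
      have "0 \<le> integral {?\<alpha>..?\<beta>} ?g"
        using C(2)[OF BL _ _ dc[unfolded \<beta>] sd] L unfolding \<beta> by (simp add: coef_def)
      then have "0 \<le> p ^ (N+2*m) * integral {?\<alpha>..?\<beta>} ?g" using p by simp
      also have "... = integral {?\<alpha>..?\<beta>} (\<lambda>s. p ^ (N+2*m) * ?g s)" by (rule integral_mult_right[symmetric])
      also have "... \<le> integral {?\<alpha>..?\<beta>} (\<lambda>s. ?h (slice (e_x j) z s))"
      proof (rule integral_le)
        show "(\<lambda>s. p ^ (N+2*m) * ?g s) integrable_on {?\<alpha>..?\<beta>}"
          by (intro integrable_continuous_real continuous_on_mult continuous_on_const cg)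
        show "(\<lambda>s. ?h (slice (e_x j) z s)) integrable_on {?\<alpha>..?\<beta>}"
          by (rule integrable_continuous_real[OF continuous_on_slice_fun[OF ch Basis_pt_simps(2) z]])
        fix s assume s: "s \<in> {?\<alpha>..?\<beta>}"
        have "slice (e_x j) z s \<in> ?K" by (rule slice_in_cbox[OF Basis_pt_simps(2) z s])
        from kbox_abs[OF this, of j] have "\<bar>s - x $ j\<bar> \<le> \<rho>" by (simp add: slice_e_x)
        then have w0: "0 \<le> ?w s" by (rule wt_range(1)[OF _ \<rho>])
        \<comment> \<open>The lower order term carries the power N only, so its factor p^(N+2m) has
          to be raised to p^N; since p \<le> 1 and the term is nonnegative, this goes in the right
          direction.\<close>
        have "p ^ (N+2*m) \<le> p ^ N" using p by (intro power_decreasing) auto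
        then have "p ^ (N+2*m) * (C / \<rho>^(2*m) * (?w s ^ N * (norm (f 0 s))\<^sup>2)) \<le> p ^ N * (C / \<rho>^(2*m) * (?w s ^ N * (norm (f 0 s))\<^sup>2))"
          using C(1) \<rho> w0 by (intro mult_right_mono) auto
        then show "p ^ (N+2*m) * ?g s \<le> ?h (slice (e_x j) z s)"
          by (simp add: p(3) slice_e_x f_def power_mult_distrib algebra_simps)
      qed
      finally show "0 \<le> integral {?\<alpha>..?\<beta>} (\<lambda>s. ?h (slice (e_x j) z s))" .
    qed
  qed
qed

lemma caccioppoli_time:
  fixes u :: "('d::{finite,linorder}) pt \<Rightarrow> 'b::euclidean_space"
  assumes \<rho>: "\<rho> > 0" and x: "x $ first \<ge> 0" and u: "C_inf_loc u" and m: "m \<ge> 1"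
  shows "0 \<le> integral (kbox m \<tau> x \<rho>) (\<lambda>z. weight m \<tau> x \<rho> z ^ (N+2*m) * (D_t u z \<bullet> u z)
      + real (N+2*m) / 2 / \<rho>^(2*m) * (weight m \<tau> x \<rho> z ^ N * (norm (u z))\<^sup>2))"
proof -
  let ?K = "kbox m \<tau> x \<rho>" and ?\<phi> = "weight m \<tau> x \<rho>" and ?n = "N + 2*m"
  have K: "half_box (lo m \<tau> x \<rho>) (hi \<tau> x \<rho>)" by (rule half_box_kbox[OF \<rho> x])
  then have Kb: "?K \<subseteq> O_bar" by (simp add: half_box_def)
  have c: "continuous_on ?K f" if "C_inf_loc f" for f :: "'d pt \<Rightarrow> 'b"
    using continuous_on_subset[OF C_inf_locD(1)[OF that] Kb] .
  let ?h = "\<lambda>z. ?\<phi> z ^ ?n * (D_t u z \<bullet> u z) + real ?n / 2 / \<rho>^(2*m) * (?\<phi> z ^ N * (norm (u z))\<^sup>2)"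
  have ch: "continuous_on ?K ?h"
    using \<rho> by (intro continuous_intros c[OF u] c[OF C_inf_loc_D_t[OF u]]) auto
  show ?thesis
  proof (rule integral_nonneg_by_slices[OF ch Basis_pt_simps(1)])
    show "lo m \<tau> x \<rho> \<bullet> e_t < hi \<tau> x \<rho> \<bullet> e_t" using K by (simp add: half_box_def del: inner_e_t)
    fix z assume z: "z \<in> ?K"
    obtain p where p: "0 \<le> p" "p \<le> 1" "\<And>s. ?\<phi> (slice e_t z s) = p * wt_t m \<tau> \<rho> s"
      using weight_slice_t[OF z \<rho>] by blast
    let ?S = "{lo m \<tau> x \<rho> \<bullet> e_t..hi \<tau> x \<rho> \<bullet> e_t}" and ?w = "wt_t m \<tau> \<rho>"
    have S: "?S = {\<tau> - \<rho>^(2*m)..\<tau>}" unfolding lo_hi_inner ..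
    let ?f = "\<lambda>s. u (slice e_t z s)" and ?f' = "\<lambda>s. D_t u (slice e_t z s)"
    have d: "(?f has_vector_derivative ?f' s) (at s within ?S)" if "s \<in> ?S" for s
      using partial_on_slice[OF u Basis_pt_simps(1) Kb z that] by (simp add: D_t_def del: inner_e_t)
    have cf': "continuous_on ?S ?f'" by (rule continuous_on_slice_fun[OF c[OF C_inf_loc_D_t[OF u]] Basis_pt_simps(1) z])
    have cf: "continuous_on ?S ?f" by (rule continuous_on_slice_fun[OF c[OF u] Basis_pt_simps(1) z])
    let ?g = "\<lambda>s. ?w s ^ ?n * (?f' s \<bullet> ?f s) + real ?n / 2 / \<rho>^(2*m) * (?w s ^ (?n - 1) * (norm (?f s))\<^sup>2)"
    have cw: "continuous_on ?S ?w" unfolding wt_t_def using \<rho> by (intro continuous_intros) auto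
    have cg: "continuous_on ?S ?g"
      using \<rho> by (intro continuous_intros cf cf' cw) auto
    have "0 \<le> integral ?S ?g"
      unfolding S by (rule slice_time_energy[OF d[unfolded S] cf'[unfolded S] \<rho>]) (use m in auto)
    then have "0 \<le> p ^ ?n * integral ?S ?g" using p by simp
    also have "... = integral ?S (\<lambda>s. p ^ ?n * ?g s)" by (rule integral_mult_right[symmetric])
    also have "... \<le> integral ?S (\<lambda>s. ?h (slice e_t z s))"
    proof (rule integral_le)
      show "(\<lambda>s. p ^ ?n * ?g s) integrable_on ?S"
        by (intro integrable_continuous_real continuous_on_mult continuous_on_const cg)
      show "(\<lambda>s. ?h (slice e_t z s)) integrable_on ?S"
        by (rule integrable_continuous_real[OF continuous_on_slice_fun[OF ch Basis_pt_simps(1) z]])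
      fix s assume s: "s \<in> ?S"
      have w: "0 \<le> ?w s" "?w s \<le> 1" using wt_t_range[of \<tau> \<rho> m s] s \<rho> unfolding S by auto
      have "p ^ ?n \<le> p ^ N" using p by (intro power_decreasing) auto
      moreover have "?w s ^ (?n - 1) \<le> ?w s ^ N" using w m by (intro power_decreasing) auto
      ultimately have "p ^ ?n * (real ?n / 2 / \<rho>^(2*m) * (?w s ^ (?n - 1) * (norm (?f s))\<^sup>2)) \<le> p ^ N * (real ?n / 2 / \<rho>^(2*m) * (?w s ^ N * (norm (?f s))\<^sup>2))"
        using p w \<rho> by (intro mult_mono mult_left_mono mult_right_mono) auto
      then show "p ^ ?n * ?g s \<le> ?h (slice e_t z s)"
        by (simp only: p(3) power_mult_distrib) (simp add: algebra_simps)
    qed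
    finally show "0 \<le> integral ?S (\<lambda>s. ?h (slice e_t z s))" .
  qed
qed

lemma continuous_on_kbox:
  assumes "\<rho> > 0" "x $ first \<ge> 0" "C_inf_loc f"
  shows "continuous_on (kbox m \<tau> x \<rho>) f"
  using continuous_on_subset[OF C_inf_locD(1)[OF assms(3)]] half_box_kbox[OF assms(1,2)] by (simp add: half_box_def)

text \<open>The equation is paired with the weight to the power N+2m times u. Each direction and the
  time derivative contribute an inequality that already holds for functions satisfying only the
  Dirichlet condition; the equation is used just to see that the paired terms add up to zero. The
  \<lambda> term is kept rather than dropped, since it is what later makes the constants uniform in
  \<lambda>.\<close>

lemma caccioppoli:
  assumes "\<delta> > 0" "M \<ge> 0" "m \<ge> 1"
  shows "\<exists>C\<ge>0. \<forall>(L :: real \<Rightarrow> 'b::euclidean_space \<Rightarrow> 'b) lam \<tau> (x :: real ^ ('d::{finite,linorder})) \<rho> u.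
    coef \<delta> M L \<longrightarrow> lam \<ge> 0 \<longrightarrow> \<rho> > 0 \<longrightarrow> x $ first \<ge> 0 \<longrightarrow> solves m L lam (lo m \<tau> x \<rho>) (hi \<tau> x \<rho>) u \<longrightarrow> dirichlet m (lo m \<tau> x \<rho>) (hi \<tau> x \<rho>) u \<longrightarrow>
    (\<Sum>j\<in>UNIV. integral (kbox m \<tau> x \<rho>) (\<lambda>z. weight m \<tau> x \<rho> z ^ (N+2*m) * (norm ((D_x j ^^ m) u z))\<^sup>2))
      + lam * integral (kbox m \<tau> x \<rho>) (\<lambda>z. weight m \<tau> x \<rho> z ^ (N+2*m) * (norm (u z))\<^sup>2)
    \<le> C / \<rho>^(2*m) * integral (kbox m \<tau> x \<rho>) (\<lambda>z. weight m \<tau> x \<rho> z ^ N * (norm (u z))\<^sup>2)"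
proof -
  \<comment> \<open>The ellipticity class is widened to contain the identity, which is the
    coefficient in the tangential directions.\<close>
  define \<delta>0 where "\<delta>0 = min \<delta> 1"
  define M0 where "M0 = max M 1"
  have \<delta>0: "\<delta>0 > 0" "\<delta>0 \<le> 1" "\<delta>0 \<le> \<delta>" and M0: "M0 \<ge> 0" "M \<le> M0" "1 \<le> M0" using assms by (auto simp: \<delta>0_def M0_def)
  obtain C where C: "C \<ge> 0" "\<And>(L :: real \<Rightarrow> 'b \<Rightarrow> 'b) \<tau> (x :: real ^ ('d::{finite,linorder})) \<rho> u j.
    coef \<delta>0 M0 L \<Longrightarrow> \<rho> > 0 \<Longrightarrow> x $ first \<ge> 0 \<Longrightarrow> C_inf_loc u \<Longrightarrow> dirichlet m (lo m \<tau> x \<rho>) (hi \<tau> x \<rho>) u \<Longrightarrow>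
    continuous_on (kbox m \<tau> x \<rho>) (\<lambda>z. L (fst z) ((D_x j ^^ (2*m)) u z)) \<Longrightarrow>
    0 \<le> integral (kbox m \<tau> x \<rho>) (\<lambda>z. (-1)^m * (weight m \<tau> x \<rho> z ^ (N+2*m) * (L (fst z) ((D_x j ^^ (2*m)) u z) \<bullet> u z))
      - \<delta>0/2 * (weight m \<tau> x \<rho> z ^ (N+2*m) * (norm ((D_x j ^^ m) u z))\<^sup>2)
      + C / \<rho>^(2*m) * (weight m \<tau> x \<rho> z ^ N * (norm (u z))\<^sup>2))"
    using caccioppoli_direction[OF \<delta>0(1) M0(1) assms(3), of N] by blast
  define n where "n = N + 2*m"
  define B where "B = real CARD('d) * C + real n / 2"
  have B: "B \<ge> 0" using C by (simp add: B_def)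
  show ?thesis
  proof (rule exI[of _ "2 / \<delta>0 * B"], intro conjI, use B \<delta>0 in simp, intro allI impI)
    fix L :: "real \<Rightarrow> 'b \<Rightarrow> 'b" and lam \<tau> \<rho> :: real and x :: "real ^ ('d::{finite,linorder})" and u :: "'d pt \<Rightarrow> 'b"
    assume L: "coef \<delta> M L" and lam: "lam \<ge> 0" and \<rho>: "\<rho> > 0" and x: "x $ first \<ge> 0"
      and s: "solves m L lam (lo m \<tau> x \<rho>) (hi \<tau> x \<rho>) u" and d: "dirichlet m (lo m \<tau> x \<rho>) (hi \<tau> x \<rho>) u"
    let ?K = "kbox m \<tau> x \<rho>" and ?\<phi> = "weight m \<tau> x \<rho>"
    have u: "C_inf_loc u" using s by (simp add: solves_def)
    note c = continuous_on_kbox[OF \<rho> x]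
    define Lj where "Lj j = (if j = first then L else (\<lambda>t v. v))" for j :: 'd
    have cL: "continuous_on ?K (\<lambda>z. Lj j (fst z) ((D_x j ^^ (2*m)) u z))" for j
      using pde_continuous[OF half_box_kbox[OF \<rho> x] s] c[OF C_inf_loc_D_x[OF u, where j=j and k="2*m"]] by (auto simp: Lj_def)
    have Lc: "coef \<delta>0 M0 (Lj j)" for j
      unfolding Lj_def by (cases "j = first") (simp_all add: coef_weaken[OF L \<delta>0(1,3) M0(2)] coef_id[OF \<delta>0(2) M0(3)])
    define U where "U = integral ?K (\<lambda>z. ?\<phi> z ^ N * (norm (u z))\<^sup>2)"
    define Uw where "Uw = integral ?K (\<lambda>z. ?\<phi> z ^ n * (norm (u z))\<^sup>2)"
    define I where "I j = integral ?K (\<lambda>z. ?\<phi> z ^ n * (norm ((D_x j ^^ m) u z))\<^sup>2)" for j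
    define T where "T j = integral ?K (\<lambda>z. (-1)^m * (?\<phi> z ^ n * (Lj j (fst z) ((D_x j ^^ (2*m)) u z) \<bullet> u z)))" for j
    define T0 where "T0 = integral ?K (\<lambda>z. ?\<phi> z ^ n * (D_t u z \<bullet> u z))"
    have hU: "((\<lambda>z. ?\<phi> z ^ N * (norm (u z))\<^sup>2) has_integral U) ?K"
      unfolding U_def using \<rho> by (intro integrable_integral integrable_continuous continuous_intros c u)
    have hUw: "((\<lambda>z. ?\<phi> z ^ n * (norm (u z))\<^sup>2) has_integral Uw) ?K"
      unfolding Uw_def using \<rho> by (intro integrable_integral integrable_continuous continuous_intros c u)
    have hI: "((\<lambda>z. ?\<phi> z ^ n * (norm ((D_x j ^^ m) u z))\<^sup>2) has_integral I j) ?K" for j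
      unfolding I_def using \<rho> by (intro integrable_integral integrable_continuous continuous_intros c C_inf_loc_D_x u)
    have hT: "((\<lambda>z. (-1)^m * (?\<phi> z ^ n * (Lj j (fst z) ((D_x j ^^ (2*m)) u z) \<bullet> u z))) has_integral T j) ?K" for j
      unfolding T_def using \<rho> by (intro integrable_integral integrable_continuous continuous_intros c cL u)
    have hT0: "((\<lambda>z. ?\<phi> z ^ n * (D_t u z \<bullet> u z)) has_integral T0) ?K"
      unfolding T0_def using \<rho> by (intro integrable_integral integrable_continuous continuous_intros c C_inf_loc_D_t u)
    have 1: "0 \<le> T j - \<delta>0/2 * I j + C / \<rho>^(2*m) * U" for j
    proof -
      have "((\<lambda>z. (-1)^m * (?\<phi> z ^ n * (Lj j (fst z) ((D_x j ^^ (2*m)) u z) \<bullet> u z)) - \<delta>0/2 * (?\<phi> z ^ n * (norm ((D_x j ^^ m) u z))\<^sup>2)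
          + C / \<rho>^(2*m) * (?\<phi> z ^ N * (norm (u z))\<^sup>2)) has_integral (T j - \<delta>0/2 * I j + C / \<rho>^(2*m) * U)) ?K"
        by (intro has_integral_add has_integral_diff has_integral_mult_right hT hI hU)
      from integral_unique[OF this] C(2)[OF Lc \<rho> x u d cL, of j] show ?thesis unfolding n_def by simp
    qed
    have 2: "0 \<le> T0 + real n / 2 / \<rho>^(2*m) * U"
    proof -
      have "((\<lambda>z. ?\<phi> z ^ n * (D_t u z \<bullet> u z) + real n / 2 / \<rho>^(2*m) * (?\<phi> z ^ N * (norm (u z))\<^sup>2)) has_integral (T0 + real n / 2 / \<rho>^(2*m) * U)) ?K"
        by (intro has_integral_add has_integral_mult_right hT0 hU)
      from integral_unique[OF this] caccioppoli_time[OF \<rho> x u assms(3), of \<tau> N] show ?thesis unfolding n_def by simp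
    qed
    have 3: "T0 + (\<Sum>j\<in>UNIV. T j) + lam * Uw = 0"
    proof -
      have "((\<lambda>z. ?\<phi> z ^ n * (D_t u z \<bullet> u z) + (\<Sum>j\<in>UNIV. (-1)^m * (?\<phi> z ^ n * (Lj j (fst z) ((D_x j ^^ (2*m)) u z) \<bullet> u z)))
          + lam * (?\<phi> z ^ n * (norm (u z))\<^sup>2)) has_integral (T0 + (\<Sum>j\<in>UNIV. T j) + lam * Uw)) ?K"
        by (intro has_integral_add has_integral_sum has_integral_mult_right hT hT0 hUw) auto
      moreover have "?\<phi> z ^ n * (D_t u z \<bullet> u z) + (\<Sum>j\<in>UNIV. (-1)^m * (?\<phi> z ^ n * (Lj j (fst z) ((D_x j ^^ (2*m)) u z) \<bullet> u z)))
          + lam * (?\<phi> z ^ n * (norm (u z))\<^sup>2) = 0" if z: "z \<in> ?K" for z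
      proof -
        have "(\<Sum>j\<in>UNIV. Lj j (fst z) ((D_x j ^^ (2*m)) u z)) = L (fst z) ((D1 ^^ (2*m)) u z) + (\<Sum>j\<in>UNIV - {first}. (D_x j ^^ (2*m)) u z)"
          by (subst sum.remove[of _ first]) (auto simp: Lj_def intro!: sum.cong)
        then have "D_t u z + (-1)^m *\<^sub>R (\<Sum>j\<in>UNIV. Lj j (fst z) ((D_x j ^^ (2*m)) u z)) + lam *\<^sub>R u z = 0"
          using s z by (simp add: solves_def pde_def)
        then have "?\<phi> z ^ n * ((D_t u z + (-1)^m *\<^sub>R (\<Sum>j\<in>UNIV. Lj j (fst z) ((D_x j ^^ (2*m)) u z)) + lam *\<^sub>R u z) \<bullet> u z) = 0" by simp
        then show ?thesis
          by (simp add: inner_add_left inner_sum_left distrib_left sum_distrib_left dot_square_norm mult_ac)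
      qed
      ultimately have "((\<lambda>z. 0) has_integral (T0 + (\<Sum>j\<in>UNIV. T j) + lam * Uw)) ?K"
        by (rule has_integral_eq[rotated])
      then show ?thesis using has_integral_0_eq by blast
    qed
    have "0 \<le> (\<Sum>j\<in>(UNIV::'d set). T j - \<delta>0/2 * I j + C / \<rho>^(2*m) * U)" by (intro sum_nonneg 1)
    also have "... = (\<Sum>j\<in>UNIV. T j) - \<delta>0/2 * (\<Sum>j\<in>UNIV. I j) + real CARD('d) * (C / \<rho>^(2*m) * U)"
      by (simp add: sum.distrib sum_subtractf sum_distrib_left)
    finally have "\<delta>0/2 * (\<Sum>j\<in>UNIV. I j) + lam * Uw \<le> real CARD('d) * (C / \<rho>^(2*m) * U) + real n / 2 / \<rho>^(2*m) * U"
      using 2 3 by linarith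
    also have "... = B / \<rho>^(2*m) * U" by (simp add: B_def add_divide_distrib distrib_right)
    finally have 4: "\<delta>0/2 * (\<Sum>j\<in>UNIV. I j) + lam * Uw \<le> B / \<rho>^(2*m) * U" .
    have "Uw \<ge> 0" by (rule has_integral_nonneg[OF hUw]) (intro mult_nonneg_nonneg zero_le_power weight_range(1)[OF _ \<rho>]; simp)
    \<comment> \<open>Since \<delta>0/2 \<le> 1, the \<lambda> term may be reduced to share the
      factor \<delta>0/2 with the derivative terms.\<close>
    then have "\<delta>0/2 * (lam * Uw) \<le> lam * Uw" using lam \<delta>0 by (intro mult_left_le_one_le) auto
    with 4 have "\<delta>0/2 * ((\<Sum>j\<in>UNIV. I j) + lam * Uw) \<le> B / \<rho>^(2*m) * U" by (simp add: distrib_left)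
    then have "2/\<delta>0 * (\<delta>0/2 * ((\<Sum>j\<in>UNIV. I j) + lam * Uw)) \<le> 2/\<delta>0 * (B / \<rho>^(2*m) * U)"
      using \<delta>0 by (intro mult_left_mono) auto
    then have "(\<Sum>j\<in>UNIV. I j) + lam * Uw \<le> 2 / \<delta>0 * B / \<rho>^(2*m) * U" using \<delta>0 by simp
    then show "(\<Sum>j\<in>UNIV. integral ?K (\<lambda>z. ?\<phi> z ^ (N+2*m) * (norm ((D_x j ^^ m) u z))\<^sup>2))
      + lam * integral ?K (\<lambda>z. ?\<phi> z ^ (N+2*m) * (norm (u z))\<^sup>2)
      \<le> 2 / \<delta>0 * B / \<rho>^(2*m) * integral ?K (\<lambda>z. ?\<phi> z ^ N * (norm (u z))\<^sup>2)"
      by (simp add: I_def Uw_def U_def n_def)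
  qed
qed

section \<open>From weighted integrals to energies on half boxes\<close>

lemma weight_lower_bound:
  fixes x :: "real ^ ('d::{finite,linorder})"
  assumes z: "z \<in> kbox m \<tau> x (\<rho>/2)" and \<rho>: "\<rho> > 0" and m: "m \<ge> 1"
  shows "(3/4) ^ (CARD('d) + 1) \<le> weight m \<tau> x \<rho> z"
proof -
  \<comment> \<open>On half the box each spatial factor is at least 1 - (1/2)^2. The time factor
    obeys the same bound because (1/2)^(2m) \<le> 1/4 for m \<ge> 1.\<close>
  have 1: "3/4 \<le> wt (x $ j) \<rho> (snd z $ j)" for j
  proof -
    have "\<bar>(snd z $ j - x $ j) / \<rho>\<bar> \<le> 1/2" using kbox_abs[OF z, of j] \<rho> by (simp add: field_simps)
    then have "((snd z $ j - x $ j) / \<rho>)\<^sup>2 \<le> (1/2)\<^sup>2" by (intro power2_le_iff_abs_le[THEN iffD2]) auto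
    then show ?thesis by (simp add: wt_def power2_eq_square)
  qed
  have "(\<rho>/2)^(2*m) \<le> \<rho>^(2*m) / 4"
  proof -
    have "(1/2::real)^(2*m) \<le> (1/2)^2" using m by (intro power_decreasing) auto
    then have "\<rho>^(2*m) * (1/2)^(2*m) \<le> \<rho>^(2*m) * (1/4)" using \<rho> by (intro mult_left_mono) (auto simp: power2_eq_square)
    then show ?thesis by (simp add: power_divide power_one_over)
  qed
  then have "\<tau> - \<rho>^(2*m)/4 \<le> fst z" using z by (simp add: mem_kbox)
  then have 2: "3/4 \<le> wt_t m \<tau> \<rho> (fst z)" using \<rho> by (simp add: wt_t_def field_simps)
  have "(\<Prod>j\<in>(UNIV::'d set). 3/4) \<le> (\<Prod>j\<in>UNIV. wt (x $ j) \<rho> (snd z $ j))"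
    by (intro prod_mono) (use 1 in auto)
  then have "(3/4) * (3/4) ^ CARD('d) \<le> wt_t m \<tau> \<rho> (fst z) * (\<Prod>j\<in>UNIV. wt (x $ j) \<rho> (snd z $ j))"
    using 2 by (intro mult_mono) auto
  then show ?thesis by (simp add: weight_def)
qed

lemma integral_half_kbox_le:
  fixes x :: "real ^ ('d::{finite,linorder})"
  assumes \<rho>: "\<rho> > 0" and m: "m \<ge> 1" and g: "continuous_on (kbox m \<tau> x \<rho>) g" and g0: "\<And>z. z \<in> kbox m \<tau> x \<rho> \<Longrightarrow> 0 \<le> g z"
  shows "integral (kbox m \<tau> x (\<rho>/2)) g \<le> (4/3)^((CARD('d)+1)*n) * integral (kbox m \<tau> x \<rho>) (\<lambda>z. weight m \<tau> x \<rho> z ^ n * g z)"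
proof -
  let ?c = "(3/4::real)^((CARD('d)+1)*n)"
  have sub: "kbox m \<tau> x (\<rho>/2) \<subseteq> kbox m \<tau> x \<rho>" using \<rho> by (intro kbox_mono) auto
  have cg: "continuous_on (kbox m \<tau> x \<rho>) (\<lambda>z. weight m \<tau> x \<rho> z ^ n * g z)" using \<rho> by (intro continuous_intros g)
  have "?c * integral (kbox m \<tau> x (\<rho>/2)) g = integral (kbox m \<tau> x (\<rho>/2)) (\<lambda>z. ?c * g z)" by simp
  also have "... \<le> integral (kbox m \<tau> x (\<rho>/2)) (\<lambda>z. weight m \<tau> x \<rho> z ^ n * g z)"
  proof (intro integral_le integrable_continuous continuous_on_subset[OF cg sub] continuous_on_mult continuous_on_const continuous_on_subset[OF g sub])
    fix z assume z: "z \<in> kbox m \<tau> x (\<rho>/2)"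
    have "?c \<le> weight m \<tau> x \<rho> z ^ n"
      unfolding power_mult by (intro power_mono weight_lower_bound[OF z \<rho> m]) auto
    moreover have "0 \<le> g z" using g0 z sub by blast
    ultimately show "?c * g z \<le> weight m \<tau> x \<rho> z ^ n * g z" by (rule mult_right_mono)
  qed
  also have "... \<le> integral (kbox m \<tau> x \<rho>) (\<lambda>z. weight m \<tau> x \<rho> z ^ n * g z)"
    using g0 weight_range(1)[OF _ \<rho>] by (intro integral_subset_le sub integrable_continuous continuous_on_subset[OF cg] cg) (auto intro!: mult_nonneg_nonneg zero_le_power)
  finally have "?c * integral (kbox m \<tau> x (\<rho>/2)) g \<le> integral (kbox m \<tau> x \<rho>) (\<lambda>z. weight m \<tau> x \<rho> z ^ n * g z)" .
  then have "(4/3)^((CARD('d)+1)*n) * (?c * integral (kbox m \<tau> x (\<rho>/2)) g) \<le> (4/3)^((CARD('d)+1)*n) * integral (kbox m \<tau> x \<rho>) (\<lambda>z. weight m \<tau> x \<rho> z ^ n * g z)"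
    by (intro mult_left_mono) auto
  moreover have "(4/3::real)^((CARD('d)+1)*n) * ?c = 1" by (simp only: power_mult_distrib[symmetric]) simp
  ultimately show ?thesis by (simp only: mult.assoc[symmetric])
qed

text \<open>The hypotheses that survive a smaller box, a tangential derivative and the operator
  D_1^(2m). Every estimate below is stated for this class, so that it can be applied again to such
  derivatives of u.\<close>

definition admits :: "real \<Rightarrow> real \<Rightarrow> nat \<Rightarrow> (real \<Rightarrow> 'b::euclidean_space \<Rightarrow> 'b) \<Rightarrow> real \<Rightarrow> real \<Rightarrow> real ^ ('d::{finite,linorder}) \<Rightarrow> real \<Rightarrow> ('d pt \<Rightarrow> 'b) \<Rightarrow> bool" where
  "admits \<delta> M m L lam \<tau> x \<rho> u \<longleftrightarrow> coef \<delta> M L \<and> lam \<ge> 0 \<and> \<rho> > 0 \<and> x $ first \<ge> 0 \<and>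
     solves m L lam (lo m \<tau> x \<rho>) (hi \<tau> x \<rho>) u \<and> dirichlet m (lo m \<tau> x \<rho>) (hi \<tau> x \<rho>) u"

abbreviation energy :: "nat \<Rightarrow> real \<Rightarrow> real ^ ('d::{finite,linorder}) \<Rightarrow> real \<Rightarrow> ('d pt \<Rightarrow> 'b::euclidean_space) \<Rightarrow> real" where
  "energy m \<tau> x \<rho> u \<equiv> integral (kbox m \<tau> x \<rho>) (\<lambda>z. (norm (u z))\<^sup>2)"

text \<open>Holds for every function, because a non-integrable integrand has integral 0.\<close>

lemma energy_nonneg: "0 \<le> energy m \<tau> x \<rho> u"
  by (cases "(\<lambda>z. (norm (u z))\<^sup>2) integrable_on kbox m \<tau> x \<rho>")
     (auto intro: Henstock_Kurzweil_Integration.integral_nonneg simp: not_integrable_integral)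

lemma energy_mono:
  assumes "C_inf_loc u" "0 < \<rho>" "\<rho> \<le> \<rho>'" "x $ first \<ge> 0"
  shows "energy m \<tau> x \<rho> u \<le> energy m \<tau> x \<rho>' u"
  using assms
  by (intro integral_subset_le kbox_mono integrable_continuous continuous_intros continuous_on_kbox) auto

lemma admitsD:
  assumes "admits \<delta> M m L lam \<tau> x \<rho> u"
  shows "coef \<delta> M L" "lam \<ge> 0" "\<rho> > 0" "x $ first \<ge> 0" "solves m L lam (lo m \<tau> x \<rho>) (hi \<tau> x \<rho>) u"
    "dirichlet m (lo m \<tau> x \<rho>) (hi \<tau> x \<rho>) u" "C_inf_loc u" "half_box (lo m \<tau> x \<rho>) (hi \<tau> x \<rho>)"
  using assms half_box_kbox[of \<rho> x] by (auto simp: admits_def solves_def)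

lemma admits_smaller:
  assumes "admits \<delta> M m L lam \<tau> x \<rho> u" "0 < \<rho>'" "\<rho>' \<le> \<rho>"
  shows "admits \<delta> M m L lam \<tau> x \<rho>' u"
  using assms kbox_mono[of \<rho>' \<rho> m \<tau> x] unfolding admits_def solves_def dirichlet_def by auto

lemma admits_tangential:
  assumes "admits \<delta> M m L lam \<tau> x \<rho> u" "j \<noteq> first"
  shows "admits \<delta> M m L lam \<tau> x \<rho> (D_x j u)"
  using admitsD[OF assms(1)] assms(2) solves_D_x[of "lo m \<tau> x \<rho>" "hi \<tau> x \<rho>" \<delta> M L m lam u j]
    dirichlet_tangential[where a="lo m \<tau> x \<rho>" and b="hi \<tau> x \<rho>" and u=u and m=m and j=j and n=1]
  unfolding admits_def by simp

lemma admits_D1_2m: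
  assumes "admits \<delta> M m L lam \<tau> x \<rho> u" "\<delta> > 0"
  shows "admits \<delta> M m L lam \<tau> x \<rho> ((D1 ^^ (2*m)) u)"
  using admitsD[OF assms(1)] assms(2) solves_funpow_D_x[of "lo m \<tau> x \<rho>" "hi \<tau> x \<rho>" \<delta> M L m lam u "2*m" first]
    dirichlet_D1_2m[of "lo m \<tau> x \<rho>" "hi \<tau> x \<rho>" \<delta> M L m lam u]
  unfolding admits_def by simp

lemma caccioppoli_unweighted:
  assumes "\<delta> > 0" "M \<ge> 0" "m \<ge> 1"
  shows "\<exists>C\<ge>0. \<forall>(L :: real \<Rightarrow> 'b::euclidean_space \<Rightarrow> 'b) lam \<tau> (x :: real ^ ('d::{finite,linorder})) \<rho> u.
    admits \<delta> M m L lam \<tau> x \<rho> u \<longrightarrow>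
    (\<forall>j. \<rho>^(2*m) * integral (kbox m \<tau> x \<rho>) (\<lambda>z. weight m \<tau> x \<rho> z ^ (2*m) * (norm ((D_x j ^^ m) u z))\<^sup>2) \<le> C * energy m \<tau> x \<rho> u)
    \<and> lam * \<rho>^(2*m) * integral (kbox m \<tau> x \<rho>) (\<lambda>z. weight m \<tau> x \<rho> z ^ (2*m) * (norm (u z))\<^sup>2) \<le> C * energy m \<tau> x \<rho> u"
proof -
  obtain C where C: "C \<ge> 0" "\<And>(L :: real \<Rightarrow> 'b \<Rightarrow> 'b) lam \<tau> (x :: real ^ ('d::{finite,linorder})) \<rho> u.
    coef \<delta> M L \<Longrightarrow> lam \<ge> 0 \<Longrightarrow> \<rho> > 0 \<Longrightarrow> x $ first \<ge> 0 \<Longrightarrow> solves m L lam (lo m \<tau> x \<rho>) (hi \<tau> x \<rho>) u \<Longrightarrow> dirichlet m (lo m \<tau> x \<rho>) (hi \<tau> x \<rho>) u \<Longrightarrow>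
    (\<Sum>j\<in>UNIV. integral (kbox m \<tau> x \<rho>) (\<lambda>z. weight m \<tau> x \<rho> z ^ (0+2*m) * (norm ((D_x j ^^ m) u z))\<^sup>2))
      + lam * integral (kbox m \<tau> x \<rho>) (\<lambda>z. weight m \<tau> x \<rho> z ^ (0+2*m) * (norm (u z))\<^sup>2)
    \<le> C / \<rho>^(2*m) * integral (kbox m \<tau> x \<rho>) (\<lambda>z. weight m \<tau> x \<rho> z ^ 0 * (norm (u z))\<^sup>2)"
    using caccioppoli[OF assms, of 0] by blast
  show ?thesis
  proof (rule exI[of _ C], intro conjI C(1), intro allI impI)
    fix L :: "real \<Rightarrow> 'b \<Rightarrow> 'b" and lam \<tau> \<rho> :: real and x :: "real ^ ('d::{finite,linorder})" and u :: "'d pt \<Rightarrow> 'b"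
    assume a: "admits \<delta> M m L lam \<tau> x \<rho> u"
    note \<rho> = admitsD(3)[OF a] and x = admitsD(4)[OF a] and u = admitsD(7)[OF a]
    define I where "I j = integral (kbox m \<tau> x \<rho>) (\<lambda>z. weight m \<tau> x \<rho> z ^ (2*m) * (norm ((D_x j ^^ m) u z))\<^sup>2)" for j
    define U where "U = integral (kbox m \<tau> x \<rho>) (\<lambda>z. weight m \<tau> x \<rho> z ^ (2*m) * (norm (u z))\<^sup>2)"
    have I0: "0 \<le> I j" for j
      unfolding I_def using weight_range(1)[OF _ \<rho>] \<rho>
      by (intro Henstock_Kurzweil_Integration.integral_nonneg integrable_continuous continuous_intros continuous_on_kbox[OF \<rho> x C_inf_loc_D_x[OF u]]) auto
    have U0: "0 \<le> U"
      unfolding U_def using weight_range(1)[OF _ \<rho>] \<rho>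
      by (intro Henstock_Kurzweil_Integration.integral_nonneg integrable_continuous continuous_intros continuous_on_kbox[OF \<rho> x u]) auto
    have *: "(\<Sum>j\<in>UNIV. I j) + lam * U \<le> C / \<rho>^(2*m) * energy m \<tau> x \<rho> u"
      using C(2)[OF admitsD(1-6)[OF a]] by (simp add: I_def U_def)
    then have **: "\<rho>^(2*m) * ((\<Sum>j\<in>UNIV. I j) + lam * U) \<le> C * energy m \<tau> x \<rho> u"
      using mult_left_mono[OF *, of "\<rho>^(2*m)"] \<rho> by simp
    have s0: "0 \<le> lam * U" using admitsD(2)[OF a] U0 by simp
    have "I j \<le> (\<Sum>j\<in>UNIV. I j)" for j by (rule member_le_sum) (auto simp: I0)
    then have s1: "I j \<le> (\<Sum>j\<in>UNIV. I j) + lam * U" for j using s0 by (rule add_increasing2[rotated])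
    have s2: "lam * U \<le> (\<Sum>j\<in>UNIV. I j) + lam * U" using sum_nonneg[of UNIV I] I0 by simp
    have "\<rho>^(2*m) * I j \<le> C * energy m \<tau> x \<rho> u" for j
      by (rule order_trans[OF mult_left_mono[OF s1] **]) (use \<rho> in simp)
    moreover have "\<rho>^(2*m) * (lam * U) \<le> C * energy m \<tau> x \<rho> u"
      by (rule order_trans[OF mult_left_mono[OF s2] **]) (use \<rho> in simp)
    ultimately have "\<rho>^(2*m) * I j \<le> C * energy m \<tau> x \<rho> u" "\<rho>^(2*m) * (lam * U) \<le> C * energy m \<tau> x \<rho> u" for j
      by blast+
    then show "(\<forall>j. \<rho>^(2*m) * integral (kbox m \<tau> x \<rho>) (\<lambda>z. weight m \<tau> x \<rho> z ^ (2*m) * (norm ((D_x j ^^ m) u z))\<^sup>2) \<le> C * energy m \<tau> x \<rho> u)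
    \<and> lam * \<rho>^(2*m) * integral (kbox m \<tau> x \<rho>) (\<lambda>z. weight m \<tau> x \<rho> z ^ (2*m) * (norm (u z))\<^sup>2) \<le> C * energy m \<tau> x \<rho> u"
      by (auto simp: I_def U_def mult_ac)
  qed
qed

text \<open>The factor \<lambda> \<rho>^(2m) may be arbitrarily large; it is paid for by passing to
  half the box, with a constant independent of \<lambda>.\<close>

lemma energy_lam:
  assumes "\<delta> > 0" "M \<ge> 0" "m \<ge> 1"
  shows "\<exists>C\<ge>0. \<forall>(L :: real \<Rightarrow> 'b::euclidean_space \<Rightarrow> 'b) lam \<tau> (x :: real ^ ('d::{finite,linorder})) \<rho> u.
    admits \<delta> M m L lam \<tau> x \<rho> u \<longrightarrow> lam * \<rho>^(2*m) * energy m \<tau> x (\<rho>/2) u \<le> C * energy m \<tau> x \<rho> u"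
proof -
  obtain C where C: "C \<ge> 0" "\<And>(L :: real \<Rightarrow> 'b \<Rightarrow> 'b) lam \<tau> (x :: real ^ ('d::{finite,linorder})) \<rho> u.
    admits \<delta> M m L lam \<tau> x \<rho> u \<Longrightarrow>
    lam * \<rho>^(2*m) * integral (kbox m \<tau> x \<rho>) (\<lambda>z. weight m \<tau> x \<rho> z ^ (2*m) * (norm (u z))\<^sup>2) \<le> C * energy m \<tau> x \<rho> u"
    using caccioppoli_unweighted[OF assms] by blast
  let ?c = "(4/3)^((CARD('d)+1)*(2*m)) :: real"
  show ?thesis
  proof (rule exI[of _ "?c * C"], intro conjI, use C in simp, intro allI impI)
    fix L :: "real \<Rightarrow> 'b \<Rightarrow> 'b" and lam \<tau> \<rho> :: real and x :: "real ^ ('d::{finite,linorder})" and u :: "'d pt \<Rightarrow> 'b"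
    assume a: "admits \<delta> M m L lam \<tau> x \<rho> u"
    note \<rho> = admitsD(3)[OF a] and x = admitsD(4)[OF a] and u = admitsD(7)[OF a]
    have "energy m \<tau> x (\<rho>/2) u \<le> ?c * integral (kbox m \<tau> x \<rho>) (\<lambda>z. weight m \<tau> x \<rho> z ^ (2*m) * (norm (u z))\<^sup>2)"
      by (intro integral_half_kbox_le \<rho> assms continuous_intros continuous_on_kbox x u) auto
    from mult_left_mono[OF this, of "lam * \<rho>^(2*m)"]
    have "lam * \<rho>^(2*m) * energy m \<tau> x (\<rho>/2) u \<le> ?c * (lam * \<rho>^(2*m) * integral (kbox m \<tau> x \<rho>) (\<lambda>z. weight m \<tau> x \<rho> z ^ (2*m) * (norm (u z))\<^sup>2))"
      using admitsD(2)[OF a] \<rho> by (simp add: mult_ac)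
    also have "... \<le> ?c * (C * energy m \<tau> x \<rho> u)" by (intro mult_left_mono C(2)[OF a]) auto
    finally show "lam * \<rho>^(2*m) * energy m \<tau> x (\<rho>/2) u \<le> ?c * C * energy m \<tau> x \<rho> u" by (simp add: mult_ac)
  qed
qed

text \<open>The energy inequality bounds the derivatives of order m; on each slice the first
  derivative lies between these and u. The normal direction is included, although D_1 u need not
  satisfy the Dirichlet condition, since the slice inequality only concerns u itself.\<close>

lemma energy_D_x:
  assumes "\<delta> > 0" "M \<ge> 0" "m \<ge> 1"
  shows "\<exists>C\<ge>0. \<forall>(L :: real \<Rightarrow> 'b::euclidean_space \<Rightarrow> 'b) lam \<tau> (x :: real ^ ('d::{finite,linorder})) \<rho> u j.
    admits \<delta> M m L lam \<tau> x \<rho> u \<longrightarrow> \<rho>\<^sup>2 * energy m \<tau> x (\<rho>/2) (D_x j u) \<le> C * energy m \<tau> x \<rho> u"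
proof -
  obtain C where C: "C \<ge> 0" "\<And>(L :: real \<Rightarrow> 'b \<Rightarrow> 'b) lam \<tau> (x :: real ^ ('d::{finite,linorder})) \<rho> u j.
    admits \<delta> M m L lam \<tau> x \<rho> u \<Longrightarrow>
    \<rho>^(2*m) * integral (kbox m \<tau> x \<rho>) (\<lambda>z. weight m \<tau> x \<rho> z ^ (2*m) * (norm ((D_x j ^^ m) u z))\<^sup>2) \<le> C * energy m \<tau> x \<rho> u"
    using caccioppoli_unweighted[OF assms] by blast
  obtain B where B: "B \<ge> 0" "\<And>(f :: nat \<Rightarrow> real \<Rightarrow> 'b) \<alpha> c \<rho>. deriv_chain m \<alpha> (c+\<rho>) f \<Longrightarrow> slice_dirichlet m c \<rho> \<alpha> f \<Longrightarrow>
    0 \<le> integral {\<alpha>..c+\<rho>} (\<lambda>s. \<rho>^(2*m) * (wt c \<rho> s ^ (2*m) * (norm (f m s))\<^sup>2) + B * (norm (f 0 s))\<^sup>2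
       - \<rho>\<^sup>2 * ((wt c \<rho> s)\<^sup>2 * (norm (f 1 s))\<^sup>2))"
    using slice_first_derivative[OF assms(3)] by blast
  let ?c = "(4/3)^((CARD('d)+1)*(2*m)) :: real"
  show ?thesis
  proof (rule exI[of _ "?c * (C + B)"], intro conjI, use C B in simp, intro allI impI)
    fix L :: "real \<Rightarrow> 'b \<Rightarrow> 'b" and lam \<tau> \<rho> :: real and x :: "real ^ ('d::{finite,linorder})" and u :: "'d pt \<Rightarrow> 'b" and j
    assume a: "admits \<delta> M m L lam \<tau> x \<rho> u"
    note \<rho> = admitsD(3)[OF a] and x = admitsD(4)[OF a] and u = admitsD(7)[OF a] and d = admitsD(6)[OF a] and K = admitsD(8)[OF a]
    note c = continuous_on_kbox[OF \<rho> x]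
    let ?K = "kbox m \<tau> x \<rho>" and ?\<phi> = "weight m \<tau> x \<rho>"
    let ?h = "\<lambda>z. \<rho>^(2*m) * (?\<phi> z ^ (2*m) * (norm ((D_x j ^^ m) u z))\<^sup>2) + B * (norm (u z))\<^sup>2 - \<rho>\<^sup>2 * (?\<phi> z ^ (2*m) * (norm (D_x j u z))\<^sup>2)"
    have ch: "continuous_on ?K ?h"
      using \<rho> by (intro continuous_intros c u C_inf_loc_D_x C_inf_loc_D_x1)
    have "0 \<le> integral ?K ?h"
    proof (rule integral_nonneg_by_slices[OF ch Basis_pt_simps(2)])
      show "lo m \<tau> x \<rho> \<bullet> e_x j < hi \<tau> x \<rho> \<bullet> e_x j" using K by (simp add: half_box_def del: inner_e_x)
      fix z assume z: "z \<in> ?K"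
      obtain p where p: "0 \<le> p" "p \<le> 1" "\<And>s. ?\<phi> (slice (e_x j) z s) = p * wt (x $ j) \<rho> s"
        using weight_slice_x[OF z \<rho>] by blast
      define f where "f k s = (D_x j ^^ k) u (slice (e_x j) z s)" for k s
      let ?\<alpha> = "lo m \<tau> x \<rho> \<bullet> e_x j" and ?\<beta> = "hi \<tau> x \<rho> \<bullet> e_x j"
      let ?w = "wt (x $ j) \<rho>"
      have \<beta>: "?\<beta> = x $ j + \<rho>" by (rule lo_hi_inner)
      have dc: "deriv_chain m ?\<alpha> ?\<beta> f" unfolding f_def by (rule deriv_chain_slice[OF u K z])
      have sd: "slice_dirichlet m (x $ j) \<rho> ?\<alpha> f" unfolding f_def by (rule slice_dirichlet_slice[OF d \<rho> x z])
      let ?g = "\<lambda>s. \<rho>^(2*m) * (?w s ^ (2*m) * (norm (f m s))\<^sup>2) + B * (norm (f 0 s))\<^sup>2 - \<rho>\<^sup>2 * ((?w s)\<^sup>2 * (norm (f 1 s))\<^sup>2)"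
      have cf: "continuous_on {?\<alpha>..?\<beta>} (f k)" if "k \<le> m" for k using deriv_chainD(2)[OF dc that] .
      have cg: "continuous_on {?\<alpha>..?\<beta>} ?g"
        using \<rho> assms(3) by (intro continuous_intros cf) auto
      have "0 \<le> integral {?\<alpha>..?\<beta>} ?g"
        using B(2)[OF dc[unfolded \<beta>] sd] unfolding \<beta> by simp
      then have "0 \<le> p ^ (2*m) * integral {?\<alpha>..?\<beta>} ?g" using p by simp
      also have "... = integral {?\<alpha>..?\<beta>} (\<lambda>s. p ^ (2*m) * ?g s)" by (rule integral_mult_right[symmetric])
      also have "... \<le> integral {?\<alpha>..?\<beta>} (\<lambda>s. ?h (slice (e_x j) z s))"
      proof (rule integral_le)
        show "(\<lambda>s. p ^ (2*m) * ?g s) integrable_on {?\<alpha>..?\<beta>}"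
          by (intro integrable_continuous_real continuous_on_mult continuous_on_const cg)
        show "(\<lambda>s. ?h (slice (e_x j) z s)) integrable_on {?\<alpha>..?\<beta>}"
          by (rule integrable_continuous_real[OF continuous_on_slice_fun[OF ch Basis_pt_simps(2) z]])
        fix s assume s: "s \<in> {?\<alpha>..?\<beta>}"
        have "slice (e_x j) z s \<in> ?K" by (rule slice_in_cbox[OF Basis_pt_simps(2) z s])
        from kbox_abs[OF this, of j] have sc: "\<bar>s - x $ j\<bar> \<le> \<rho>" by (simp add: slice_e_x)
        note w = wt_range[OF sc \<rho>]
        have "p ^ (2*m) * (B * (norm (f 0 s))\<^sup>2) \<le> B * (norm (f 0 s))\<^sup>2"
          using p B(1) by (intro mult_left_le_one_le power_le_one) auto
        moreover have "?w s ^ (2*m) \<le> (?w s)\<^sup>2" using w assms(3) by (intro power_decreasing) auto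
        then have "p ^ (2*m) * (\<rho>\<^sup>2 * (?w s ^ (2*m) * (norm (f 1 s))\<^sup>2)) \<le> p ^ (2*m) * (\<rho>\<^sup>2 * ((?w s)\<^sup>2 * (norm (f 1 s))\<^sup>2))"
          using p by (intro mult_left_mono mult_right_mono) auto
        ultimately have "p ^ (2*m) * (\<rho>^(2*m) * (?w s ^ (2*m) * (norm (f m s))\<^sup>2)) + p ^ (2*m) * (B * (norm (f 0 s))\<^sup>2)
           - p ^ (2*m) * (\<rho>\<^sup>2 * ((?w s)\<^sup>2 * (norm (f 1 s))\<^sup>2))
          \<le> p ^ (2*m) * (\<rho>^(2*m) * (?w s ^ (2*m) * (norm (f m s))\<^sup>2)) + B * (norm (f 0 s))\<^sup>2
           - p ^ (2*m) * (\<rho>\<^sup>2 * (?w s ^ (2*m) * (norm (f 1 s))\<^sup>2))" by linarith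
        then show "p ^ (2*m) * ?g s \<le> ?h (slice (e_x j) z s)"
          by (simp add: p(3) f_def power_mult_distrib right_diff_distrib distrib_left mult_ac)
      qed
      finally show "0 \<le> integral {?\<alpha>..?\<beta>} (\<lambda>s. ?h (slice (e_x j) z s))" .
    qed
    moreover have "(?h has_integral (\<rho>^(2*m) * integral ?K (\<lambda>z. ?\<phi> z ^ (2*m) * (norm ((D_x j ^^ m) u z))\<^sup>2) + B * energy m \<tau> x \<rho> u
        - \<rho>\<^sup>2 * integral ?K (\<lambda>z. ?\<phi> z ^ (2*m) * (norm (D_x j u z))\<^sup>2))) ?K"
      using \<rho> by (intro has_integral_add has_integral_diff has_integral_mult_right integrable_integral integrable_continuous continuous_intros c u C_inf_loc_D_x C_inf_loc_D_x1)
    ultimately have 1: "\<rho>\<^sup>2 * integral ?K (\<lambda>z. ?\<phi> z ^ (2*m) * (norm (D_x j u z))\<^sup>2) \<le> (C + B) * energy m \<tau> x \<rho> u"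
      using C(2)[OF a, of j] by (simp add: integral_unique distrib_right)
    have "energy m \<tau> x (\<rho>/2) (D_x j u) \<le> ?c * integral ?K (\<lambda>z. ?\<phi> z ^ (2*m) * (norm (D_x j u z))\<^sup>2)"
      by (intro integral_half_kbox_le \<rho> assms continuous_intros c C_inf_loc_D_x1 u) auto
    from mult_left_mono[OF this, of "\<rho>\<^sup>2"]
    have "\<rho>\<^sup>2 * energy m \<tau> x (\<rho>/2) (D_x j u) \<le> ?c * (\<rho>\<^sup>2 * integral ?K (\<lambda>z. ?\<phi> z ^ (2*m) * (norm (D_x j u z))\<^sup>2))"
      by (simp add: mult_ac)
    also have "... \<le> ?c * ((C + B) * energy m \<tau> x \<rho> u)" by (intro mult_left_mono 1) auto
    finally show "\<rho>\<^sup>2 * energy m \<tau> x (\<rho>/2) (D_x j u) \<le> ?c * (C + B) * energy m \<tau> x \<rho> u" by (simp add: mult_ac)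
  qed
qed

text \<open>Pairing $v = D_1^{2m} u$ with itself and moving $m$ derivatives onto the weight and the second
  factor bounds $v$ by $D_1^m u$ and $D_1^m v$; no boundary terms appear since $v$ satisfies the Dirichlet
  condition as well, and $D_1^m v$ is absorbed by the energy inequality for $v$.\<close>

lemma energy_D1_2m:
  assumes "\<delta> > 0" "M \<ge> 0" "m \<ge> 1"
  shows "\<exists>C\<ge>0. \<forall>(L :: real \<Rightarrow> 'b::euclidean_space \<Rightarrow> 'b) lam \<tau> (x :: real ^ ('d::{finite,linorder})) \<rho> u.
    admits \<delta> M m L lam \<tau> x \<rho> u \<longrightarrow> \<rho>^(4*m) * energy m \<tau> x (\<rho>/2) ((D1 ^^ (2*m)) u) \<le> C * energy m \<tau> x \<rho> u"
proof -
  \<comment> \<open>Then N - 2m = 2m is the exponent with which D_1^m u is controlled by the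
    unweighted inequality, and all powers of the slice factor p can be matched.\<close>
  define N where "N = 4*m"
  obtain C where C: "C \<ge> 0" "\<And>(L :: real \<Rightarrow> 'b \<Rightarrow> 'b) lam \<tau> (x :: real ^ ('d::{finite,linorder})) \<rho> u.
    admits \<delta> M m L lam \<tau> x \<rho> u \<Longrightarrow>
    \<rho>^(2*m) * integral (kbox m \<tau> x \<rho>) (\<lambda>z. weight m \<tau> x \<rho> z ^ (2*m) * (norm ((D1 ^^ m) u z))\<^sup>2) \<le> C * energy m \<tau> x \<rho> u"
    using caccioppoli_unweighted[OF assms] by blast
  obtain C' where C': "C' \<ge> 0" "\<And>(L :: real \<Rightarrow> 'b \<Rightarrow> 'b) lam \<tau> (x :: real ^ ('d::{finite,linorder})) \<rho> u.
    coef \<delta> M L \<Longrightarrow> lam \<ge> 0 \<Longrightarrow> \<rho> > 0 \<Longrightarrow> x $ first \<ge> 0 \<Longrightarrow> solves m L lam (lo m \<tau> x \<rho>) (hi \<tau> x \<rho>) u \<Longrightarrow> dirichlet m (lo m \<tau> x \<rho>) (hi \<tau> x \<rho>) u \<Longrightarrow>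
    (\<Sum>j\<in>UNIV. integral (kbox m \<tau> x \<rho>) (\<lambda>z. weight m \<tau> x \<rho> z ^ (N+2*m) * (norm ((D_x j ^^ m) u z))\<^sup>2))
      + lam * integral (kbox m \<tau> x \<rho>) (\<lambda>z. weight m \<tau> x \<rho> z ^ (N+2*m) * (norm (u z))\<^sup>2)
    \<le> C' / \<rho>^(2*m) * integral (kbox m \<tau> x \<rho>) (\<lambda>z. weight m \<tau> x \<rho> z ^ N * (norm (u z))\<^sup>2)"
    using caccioppoli[OF assms, of N] by blast
  have "2*m \<le> N" by (simp add: N_def)
  then obtain B where B: "B \<ge> 0" "\<And>(f :: nat \<Rightarrow> real \<Rightarrow> 'b) \<alpha> c \<rho> \<epsilon>.
    deriv_chain (3*m) \<alpha> (c+\<rho>) f \<Longrightarrow> slice_dirichlet m c \<rho> \<alpha> (\<lambda>k. f (2*m+k)) \<Longrightarrow> \<epsilon> > 0 \<Longrightarrow>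
    0 \<le> integral {\<alpha>..c+\<rho>} (\<lambda>s. B / (\<epsilon> * \<rho>^(2*m)) * (wt c \<rho> s ^ (N-2*m) * (norm (f m s))\<^sup>2)
       + \<epsilon> * (\<rho>^(2*m) * (wt c \<rho> s ^ (N+2*m) * (norm (f (3*m) s))\<^sup>2) + wt c \<rho> s ^ N * (norm (f (2*m) s))\<^sup>2)
       - wt c \<rho> s ^ N * (norm (f (2*m) s))\<^sup>2)"
    using slice_higher_derivative[of m N] by blast
  have Nm: "N - 2*m = 2*m" by (simp add: N_def)
  \<comment> \<open>The terms to be absorbed are at most \<epsilon> (C' + 1) times the weighted
    energy of v, here exactly one half of it.\<close>
  define \<epsilon> where "\<epsilon> = 1 / (2 * (C' + 1))"
  have \<epsilon>: "\<epsilon> > 0" using C' by (simp add: \<epsilon>_def)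
  let ?c = "(4/3)^((CARD('d)+1)*N) :: real"
  show ?thesis
  proof (rule exI[of _ "?c * (2 * B / \<epsilon> * C)"], intro conjI, use B C \<epsilon> in simp, intro allI impI)
    fix L :: "real \<Rightarrow> 'b \<Rightarrow> 'b" and lam \<tau> \<rho> :: real and x :: "real ^ ('d::{finite,linorder})" and u :: "'d pt \<Rightarrow> 'b"
    assume a: "admits \<delta> M m L lam \<tau> x \<rho> u"
    note \<rho> = admitsD(3)[OF a] and x = admitsD(4)[OF a] and u = admitsD(7)[OF a] and K = admitsD(8)[OF a]
    note c = continuous_on_kbox[OF \<rho> x]
    define v where "v = (D1 ^^ (2*m)) u"
    have av: "admits \<delta> M m L lam \<tau> x \<rho> v" unfolding v_def by (rule admits_D1_2m[OF a assms(1)])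
    note v = admitsD(7)[OF av]
    let ?K = "kbox m \<tau> x \<rho>" and ?\<phi> = "weight m \<tau> x \<rho>"
    let ?h = "\<lambda>z. B / (\<epsilon> * \<rho>^(2*m)) * (?\<phi> z ^ (2*m) * (norm ((D1 ^^ m) u z))\<^sup>2)
       + \<epsilon> * (\<rho>^(2*m) * (?\<phi> z ^ (N+2*m) * (norm ((D1 ^^ m) v z))\<^sup>2) + ?\<phi> z ^ N * (norm (v z))\<^sup>2)
       - ?\<phi> z ^ N * (norm (v z))\<^sup>2"
    have ch: "continuous_on ?K ?h"
      using \<rho> \<epsilon> by (intro continuous_intros c u v C_inf_loc_D_x) auto
    have "0 \<le> integral ?K ?h"
    proof (rule integral_nonneg_by_slices[OF ch Basis_pt_simps(2)])
      show "lo m \<tau> x \<rho> \<bullet> e_x first < hi \<tau> x \<rho> \<bullet> e_x first" using K by (simp add: half_box_def del: inner_e_x)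
      fix z assume z: "z \<in> ?K"
      obtain p where p: "0 \<le> p" "p \<le> 1" "\<And>s. ?\<phi> (slice (e_x first) z s) = p * wt (x $ first) \<rho> s"
        using weight_slice_x[OF z \<rho>] by blast
      define f where "f k s = (D1 ^^ k) u (slice (e_x first) z s)" for k s
      let ?\<alpha> = "lo m \<tau> x \<rho> \<bullet> e_x first" and ?\<beta> = "hi \<tau> x \<rho> \<bullet> e_x first"
      let ?w = "wt (x $ first) \<rho>"
      have \<beta>: "?\<beta> = x $ first + \<rho>" by (rule lo_hi_inner)
      have dc: "deriv_chain (3*m) ?\<alpha> ?\<beta> f" unfolding f_def by (rule deriv_chain_slice[OF u K z])
      have fv: "(D1 ^^ k) v (slice (e_x first) z s) = f (2*m+k) s" for k s
        by (simp only: f_def v_def add.commute[of "2*m"] funpow_add o_apply)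
      have sd: "slice_dirichlet m (x $ first) \<rho> ?\<alpha> (\<lambda>k. f (2*m+k))"
        using slice_dirichlet_slice[OF admitsD(6)[OF av] \<rho> x z, where j=first] by (simp only: fv)
      have f3: "f (2*m + m) = f (3*m)" by (simp add: mult.commute)
      have cf: "continuous_on {?\<alpha>..?\<beta>} (f k)" if "k \<le> 3*m" for k using deriv_chainD(2)[OF dc that] .
      show "0 \<le> integral {?\<alpha>..?\<beta>} (\<lambda>s. ?h (slice (e_x first) z s))"
      \<comment> \<open>The three terms carry the weight to the powers 2m, N + 2m and N. Scaling
        \<epsilon> by p^(2m) and the whole slice inequality by p^N reproduces these powers of p; for
        p = 0, where this is impossible, the integrand vanishes on the slice.\<close>
      proof (cases "p = 0")
        case True
        then have "?h (slice (e_x first) z s) = 0" for s using assms(3) by (simp add: p(3) N_def power_0_left)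
        then show ?thesis by simp
      next
        case False
        then have p0: "p > 0" using p(1) by simp
        let ?e = "\<epsilon> * p^(2*m)"
        let ?g = "\<lambda>s. B / (?e * \<rho>^(2*m)) * (?w s ^ (N-2*m) * (norm (f m s))\<^sup>2)
         + ?e * (\<rho>^(2*m) * (?w s ^ (N+2*m) * (norm (f (3*m) s))\<^sup>2) + ?w s ^ N * (norm (f (2*m) s))\<^sup>2)
         - ?w s ^ N * (norm (f (2*m) s))\<^sup>2"
        have cg: "continuous_on {?\<alpha>..?\<beta>} ?g"
          using \<rho> \<epsilon> p0 by (intro continuous_intros cf) auto
        have "0 \<le> integral {?\<alpha>..?\<beta>} ?g"
          using B(2)[OF dc[unfolded \<beta>] sd, of ?e] \<epsilon> p0 unfolding \<beta> by simp
        then have "0 \<le> p ^ N * integral {?\<alpha>..?\<beta>} ?g" using p by simp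
        also have "... = integral {?\<alpha>..?\<beta>} (\<lambda>s. p ^ N * ?g s)" by (rule integral_mult_right[symmetric])
        also have "... \<le> integral {?\<alpha>..?\<beta>} (\<lambda>s. ?h (slice (e_x first) z s))"
        proof (rule integral_le)
          show "(\<lambda>s. p ^ N * ?g s) integrable_on {?\<alpha>..?\<beta>}"
            by (intro integrable_continuous_real continuous_on_mult continuous_on_const cg)
          show "(\<lambda>s. ?h (slice (e_x first) z s)) integrable_on {?\<alpha>..?\<beta>}"
            by (rule integrable_continuous_real[OF continuous_on_slice_fun[OF ch Basis_pt_simps(2) z]])
          fix s assume s: "s \<in> {?\<alpha>..?\<beta>}"
          have "slice (e_x first) z s \<in> ?K" by (rule slice_in_cbox[OF Basis_pt_simps(2) z s])
          from kbox_abs[OF this, of first] have sc: "\<bar>s - x $ first\<bar> \<le> \<rho>" by (simp add: slice_e_x)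
          note w = wt_range[OF sc \<rho>]
          define X Y Z where "X = ?w s ^ (2*m) * (norm (f m s))\<^sup>2" and "Y = \<rho>^(2*m) * (?w s ^ (N+2*m) * (norm (f (3*m) s))\<^sup>2)"
            and "Z = ?w s ^ N * (norm (f (2*m) s))\<^sup>2"
          have Z0: "0 \<le> Z" using w by (simp add: Z_def)
          have pN: "p ^ N = p^(2*m) * p^(2*m)" by (simp add: N_def power_add[symmetric])
          have pNm: "p ^ (N+2*m) = p^N * p^(2*m)" by (simp add: power_add)
          have "p^N * ?g s = B / (\<epsilon> * \<rho>^(2*m)) * (p^(2*m) * X) + \<epsilon> * (p^(N+2*m) * Y + p^(N+2*m) * Z) - p^N * Z"
          proof -
            have "p^N * ?g s = p^N * (B / (?e * \<rho>^(2*m)) * X) + p^N * (?e * (Y + Z)) - p^N * Z"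
              unfolding Nm X_def[symmetric] Y_def[symmetric] Z_def[symmetric] by (simp only: distrib_left right_diff_distrib)
            also have "p^N * (B / (?e * \<rho>^(2*m)) * X) = B / (\<epsilon> * \<rho>^(2*m)) * (p^(2*m) * X)"
              unfolding pN using p0 \<epsilon> \<rho> by simp
            also have "p^N * (?e * (Y + Z)) = \<epsilon> * (p^(N+2*m) * Y + p^(N+2*m) * Z)"
              unfolding pNm by (simp add: algebra_simps)
            finally show ?thesis .
          qed
          also have "... \<le> B / (\<epsilon> * \<rho>^(2*m)) * (p^(2*m) * X) + \<epsilon> * (p^(N+2*m) * Y + p^N * Z) - p^N * Z"
            using p Z0 \<epsilon> by (intro diff_right_mono add_left_mono mult_left_mono mult_right_mono power_decreasing) auto
          also have "... = ?h (slice (e_x first) z s)"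
          proof -
            have v0: "v (slice (e_x first) z s) = f (2*m) s" using fv[of 0 s] by simp
            have u0: "(D1 ^^ m) u (slice (e_x first) z s) = f m s" by (simp add: f_def)
            show ?thesis unfolding p(3) fv f3 v0 u0 X_def Y_def Z_def by (simp only: power_mult_distrib mult_ac)
          qed
          finally show "p ^ N * ?g s \<le> ?h (slice (e_x first) z s)" .
        qed
        finally show ?thesis .
      qed
    qed
    moreover have "(?h has_integral (B / (\<epsilon> * \<rho>^(2*m)) * integral ?K (\<lambda>z. ?\<phi> z ^ (2*m) * (norm ((D1 ^^ m) u z))\<^sup>2)
       + \<epsilon> * (\<rho>^(2*m) * integral ?K (\<lambda>z. ?\<phi> z ^ (N+2*m) * (norm ((D1 ^^ m) v z))\<^sup>2) + integral ?K (\<lambda>z. ?\<phi> z ^ N * (norm (v z))\<^sup>2))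
       - integral ?K (\<lambda>z. ?\<phi> z ^ N * (norm (v z))\<^sup>2))) ?K"
      using \<rho> by (intro has_integral_add has_integral_diff has_integral_mult_right integrable_integral integrable_continuous continuous_intros c u v C_inf_loc_D_x)
    moreover define P Q X where "P = integral ?K (\<lambda>z. ?\<phi> z ^ (2*m) * (norm ((D1 ^^ m) u z))\<^sup>2)"
      and "Q = integral ?K (\<lambda>z. ?\<phi> z ^ (N+2*m) * (norm ((D1 ^^ m) v z))\<^sup>2)"
      and "X = integral ?K (\<lambda>z. ?\<phi> z ^ N * (norm (v z))\<^sup>2)"
    ultimately have 1: "0 \<le> B / (\<epsilon> * \<rho>^(2*m)) * P + \<epsilon> * (\<rho>^(2*m) * Q + X) - X"
      by (simp add: integral_unique)
    have 2: "\<rho>^(2*m) * Q \<le> C' * X"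
    proof -
      have nn: "0 \<le> integral ?K (\<lambda>z. ?\<phi> z ^ (N+2*m) * (norm (g z))\<^sup>2)" if "C_inf_loc g" for g :: "'d pt \<Rightarrow> 'b"
        using \<rho>
        by (intro Henstock_Kurzweil_Integration.integral_nonneg integrable_continuous continuous_intros c that)
           (auto intro!: mult_nonneg_nonneg zero_le_power weight_range(1))
      have "Q \<le> (\<Sum>j\<in>UNIV. integral ?K (\<lambda>z. ?\<phi> z ^ (N+2*m) * (norm ((D_x j ^^ m) v z))\<^sup>2))"
        unfolding Q_def by (rule member_le_sum[of first]) (auto intro!: nn C_inf_loc_D_x v simp del: power_add)
      also have "... \<le> C' / \<rho>^(2*m) * X"
        using C'(2)[OF admitsD(1-6)[OF av]] mult_nonneg_nonneg[OF admitsD(2)[OF av] nn[OF v]] by (simp add: X_def)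
      finally have "\<rho>^(2*m) * Q \<le> \<rho>^(2*m) * (C' / \<rho>^(2*m) * X)" using \<rho> by (intro mult_left_mono) auto
      then show ?thesis using \<rho> by simp
    qed
    have "X \<le> B / (\<epsilon> * \<rho>^(2*m)) * P + \<epsilon> * (\<rho>^(2*m) * Q + X)" using 1 by simp
    also have "\<epsilon> * (\<rho>^(2*m) * Q + X) \<le> \<epsilon> * ((C' + 1) * X)"
      using 2 \<epsilon> by (intro mult_left_mono) (auto simp: distrib_right)
    also have "\<epsilon> * ((C' + 1) * X) = X / 2"
    proof -
      have "y \<noteq> 0 \<Longrightarrow> 1 / (2 * y) * (y * X) = X / 2" for y by simp
      from this[of "C' + 1"] C'(1) show ?thesis unfolding \<epsilon>_def by linarith
    qed
    finally have "X \<le> 2 * (B / (\<epsilon> * \<rho>^(2*m)) * P)" by simp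
    then have "\<rho>^(4*m) * X \<le> \<rho>^(4*m) * (2 * (B / (\<epsilon> * \<rho>^(2*m)) * P))" using \<rho> by (intro mult_left_mono) auto
    also have "... = 2 * B / \<epsilon> * (\<rho>^(2*m) * P)"
    proof -
      have "\<rho>^(4*m) = \<rho>^(2*m) * \<rho>^(2*m)" by (simp add: power_add[symmetric])
      then show ?thesis using \<rho> \<epsilon> by simp
    qed
    also have "... \<le> 2 * B / \<epsilon> * (C * energy m \<tau> x \<rho> u)"
      using C(2)[OF a] B \<epsilon> by (intro mult_left_mono) (auto simp: P_def)
    finally have 3: "\<rho>^(4*m) * X \<le> 2 * B / \<epsilon> * C * energy m \<tau> x \<rho> u" by simp
    have "energy m \<tau> x (\<rho>/2) v \<le> ?c * X"
      unfolding X_def by (intro integral_half_kbox_le \<rho> assms continuous_intros c v) auto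
    then have "\<rho>^(4*m) * energy m \<tau> x (\<rho>/2) v \<le> \<rho>^(4*m) * (?c * X)" using \<rho> by (intro mult_left_mono) auto
    also have "... = ?c * (\<rho>^(4*m) * X)" by simp
    also have "... \<le> ?c * (2 * B / \<epsilon> * C * energy m \<tau> x \<rho> u)" by (intro mult_left_mono 3) auto
    finally show "\<rho>^(4*m) * energy m \<tau> x (\<rho>/2) ((D1 ^^ (2*m)) u) \<le> ?c * (2 * B / \<epsilon> * C) * energy m \<tau> x \<rho> u"
      by (simp add: v_def mult_ac)
  qed
qed

text \<open>A tangential derivative is again in the class, so the first-order estimate can be
  repeated; each derivative halves the box, hence the radius \<rho>/2^n.\<close>

lemma energy_tangential:
  assumes "\<delta> > 0" "M \<ge> 0" "m \<ge> 1"
  shows "\<exists>C\<ge>0. \<forall>(L :: real \<Rightarrow> 'b::euclidean_space \<Rightarrow> 'b) lam \<tau> (x :: real ^ ('d::{finite,linorder})) \<rho> u js.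
    admits \<delta> M m L lam \<tau> x \<rho> u \<longrightarrow> length js = n \<longrightarrow> first \<notin> set js \<longrightarrow>
      admits \<delta> M m L lam \<tau> x \<rho> (foldr D_x js u) \<and> \<rho>^(2*n) * energy m \<tau> x (\<rho>/2^n) (foldr D_x js u) \<le> C * energy m \<tau> x \<rho> u"
proof (induction n)
  case 0
  show ?case by (intro exI[of _ 1]) simp
next
  case (Suc n)
  obtain C where C: "C \<ge> 0" "\<And>(L :: real \<Rightarrow> 'b \<Rightarrow> 'b) lam \<tau> (x :: real ^ ('d::{finite,linorder})) \<rho> u js.
    admits \<delta> M m L lam \<tau> x \<rho> u \<Longrightarrow> length js = n \<Longrightarrow> first \<notin> set js \<Longrightarrow>
      admits \<delta> M m L lam \<tau> x \<rho> (foldr D_x js u) \<and> \<rho>^(2*n) * energy m \<tau> x (\<rho>/2^n) (foldr D_x js u) \<le> C * energy m \<tau> x \<rho> u"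
    using Suc.IH by blast
  obtain B where B: "B \<ge> 0" "\<And>(L :: real \<Rightarrow> 'b \<Rightarrow> 'b) lam \<tau> (x :: real ^ ('d::{finite,linorder})) \<rho> u j.
    admits \<delta> M m L lam \<tau> x \<rho> u \<Longrightarrow> \<rho>\<^sup>2 * energy m \<tau> x (\<rho>/2) (D_x j u) \<le> B * energy m \<tau> x \<rho> u"
    using energy_D_x[OF assms] by blast
  show ?case
  proof (rule exI[of _ "(2^n)\<^sup>2 * B * C"], intro conjI, use B C in simp, intro allI impI)
    fix L :: "real \<Rightarrow> 'b \<Rightarrow> 'b" and lam \<tau> \<rho> :: real and x :: "real ^ ('d::{finite,linorder})" and u :: "'d pt \<Rightarrow> 'b" and js :: "'d list"
    assume a: "admits \<delta> M m L lam \<tau> x \<rho> u" and len: "length js = Suc n" and "first \<notin> set js"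
    then obtain j ks where js: "js = j # ks" and ks: "length ks = n" "first \<notin> set ks" and j: "j \<noteq> first"
      by (cases js) auto
    define v where "v = foldr D_x ks u"
    have av: "admits \<delta> M m L lam \<tau> x \<rho> v" and e: "\<rho>^(2*n) * energy m \<tau> x (\<rho>/2^n) v \<le> C * energy m \<tau> x \<rho> u"
      using C(2)[OF a ks] by (simp_all add: v_def)
    have \<rho>: "\<rho> > 0" using admitsD(3)[OF a] .
    have av': "admits \<delta> M m L lam \<tau> x (\<rho>/2^n) v" using \<rho> by (intro admits_smaller[OF av]) (auto simp: field_simps)
    have "(\<rho>/2^n)\<^sup>2 * energy m \<tau> x (\<rho>/2^Suc n) (D_x j v) \<le> B * energy m \<tau> x (\<rho>/2^n) v"
      using B(2)[OF av', of j] by (simp add: mult.commute)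
    then have "(2^n)\<^sup>2 * \<rho>^(2*n) * ((\<rho>/2^n)\<^sup>2 * energy m \<tau> x (\<rho>/2^Suc n) (D_x j v)) \<le> (2^n)\<^sup>2 * \<rho>^(2*n) * (B * energy m \<tau> x (\<rho>/2^n) v)"
      using \<rho> by (intro mult_left_mono) auto
    also have "... = (2^n)\<^sup>2 * B * (\<rho>^(2*n) * energy m \<tau> x (\<rho>/2^n) v)" by (simp add: mult_ac)
    also have "... \<le> (2^n)\<^sup>2 * B * (C * energy m \<tau> x \<rho> u)" using B by (intro mult_left_mono e) auto
    also have "(2^n)\<^sup>2 * \<rho>^(2*n) * ((\<rho>/2^n)\<^sup>2 * energy m \<tau> x (\<rho>/2^Suc n) (D_x j v)) = \<rho>^(2*Suc n) * energy m \<tau> x (\<rho>/2^Suc n) (D_x j v)"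
    proof -
      have "(2^n)\<^sup>2 * \<rho>^(2*n) * (\<rho>/2^n)\<^sup>2 = \<rho>^(2*Suc n)" by (simp add: power_divide power_add[symmetric])
      then show ?thesis by (simp only: mult.assoc[symmetric])
    qed
    finally show "admits \<delta> M m L lam \<tau> x \<rho> (foldr D_x js u) \<and> \<rho>^(2*Suc n) * energy m \<tau> x (\<rho>/2^Suc n) (foldr D_x js u) \<le> (2^n)\<^sup>2 * B * C * energy m \<tau> x \<rho> u"
      using admits_tangential[OF av j] by (simp add: v_def js mult.assoc)
  qed
qed

text \<open>These are the spatial derivatives that occur in the equation, put on a common radius in
  order to bound u_t. Membership in the class is part of the conclusion because the time average of
  each of them will be estimated in turn.\<close>

lemma energy_D_x_2m:
  assumes "\<delta> > 0" "M \<ge> 0" "m \<ge> 1"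
  shows "\<exists>C\<ge>0. \<forall>(L :: real \<Rightarrow> 'b::euclidean_space \<Rightarrow> 'b) lam \<tau> (x :: real ^ ('d::{finite,linorder})) \<rho> u j.
    admits \<delta> M m L lam \<tau> x \<rho> u \<longrightarrow>
      admits \<delta> M m L lam \<tau> x \<rho> ((D_x j ^^ (2*m)) u) \<and> \<rho>^(4*m) * energy m \<tau> x (\<rho>/2^(2*m)) ((D_x j ^^ (2*m)) u) \<le> C * energy m \<tau> x \<rho> u"
proof -
  obtain C where C: "C \<ge> 0" "\<And>(L :: real \<Rightarrow> 'b \<Rightarrow> 'b) lam \<tau> (x :: real ^ ('d::{finite,linorder})) \<rho> u j.
    admits \<delta> M m L lam \<tau> x \<rho> u \<Longrightarrow> j \<noteq> first \<Longrightarrow>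
      admits \<delta> M m L lam \<tau> x \<rho> ((D_x j ^^ (2*m)) u) \<and> \<rho>^(2*(2*m)) * energy m \<tau> x (\<rho>/2^(2*m)) ((D_x j ^^ (2*m)) u) \<le> C * energy m \<tau> x \<rho> u"
    proof -
    obtain C where C: "C \<ge> 0" "\<And>(L :: real \<Rightarrow> 'b \<Rightarrow> 'b) lam \<tau> (x :: real ^ ('d::{finite,linorder})) \<rho> u js.
    admits \<delta> M m L lam \<tau> x \<rho> u \<Longrightarrow> length js = 2*m \<Longrightarrow> first \<notin> set js \<Longrightarrow>
      admits \<delta> M m L lam \<tau> x \<rho> (foldr D_x js u) \<and> \<rho>^(2*(2*m)) * energy m \<tau> x (\<rho>/2^(2*m)) (foldr D_x js u) \<le> C * energy m \<tau> x \<rho> u"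
      using energy_tangential[OF assms, of "2*m"] by blast
    show ?thesis
    proof (rule that[OF C(1)])
      fix L :: "real \<Rightarrow> 'b \<Rightarrow> 'b" and lam \<tau> \<rho> :: real and x :: "real ^ ('d::{finite,linorder})" and u :: "'d pt \<Rightarrow> 'b" and j :: 'd
      assume "admits \<delta> M m L lam \<tau> x \<rho> u" "j \<noteq> first"
      from C(2)[OF this(1), of "replicate (2*m) j"] this(2)
      show "admits \<delta> M m L lam \<tau> x \<rho> ((D_x j ^^ (2*m)) u) \<and> \<rho>^(2*(2*m)) * energy m \<tau> x (\<rho>/2^(2*m)) ((D_x j ^^ (2*m)) u) \<le> C * energy m \<tau> x \<rho> u"
        by simp
    qed
  qed
  obtain B where B: "B \<ge> 0" "\<And>(L :: real \<Rightarrow> 'b \<Rightarrow> 'b) lam \<tau> (x :: real ^ ('d::{finite,linorder})) \<rho> u.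
    admits \<delta> M m L lam \<tau> x \<rho> u \<Longrightarrow> \<rho>^(4*m) * energy m \<tau> x (\<rho>/2) ((D1 ^^ (2*m)) u) \<le> B * energy m \<tau> x \<rho> u"
    using energy_D1_2m[OF assms] by blast
  show ?thesis
  proof (rule exI[of _ "C + B"], intro conjI, use B C in simp, intro allI impI)
    fix L :: "real \<Rightarrow> 'b \<Rightarrow> 'b" and lam \<tau> \<rho> :: real and x :: "real ^ ('d::{finite,linorder})" and u :: "'d pt \<Rightarrow> 'b" and j :: 'd
    assume a: "admits \<delta> M m L lam \<tau> x \<rho> u"
    have E: "0 \<le> C * energy m \<tau> x \<rho> u" "0 \<le> B * energy m \<tau> x \<rho> u" using C(1) B(1) by (intro mult_nonneg_nonneg energy_nonneg; simp)+
    have \<rho>: "\<rho> > 0" using admitsD(3)[OF a] .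
    show "admits \<delta> M m L lam \<tau> x \<rho> ((D_x j ^^ (2*m)) u) \<and> \<rho>^(4*m) * energy m \<tau> x (\<rho>/2^(2*m)) ((D_x j ^^ (2*m)) u) \<le> (C + B) * energy m \<tau> x \<rho> u"
    proof (cases "j = first")
      case True
      have "(2::real)^1 \<le> 2^(2*m)" using assms(3) by (intro power_increasing) auto
      then have "\<rho>/2^(2*m) \<le> \<rho>/2" using \<rho> by (intro divide_left_mono) auto
      then have "\<rho>^(4*m) * energy m \<tau> x (\<rho>/2^(2*m)) ((D1 ^^ (2*m)) u) \<le> \<rho>^(4*m) * energy m \<tau> x (\<rho>/2) ((D1 ^^ (2*m)) u)"
        using \<rho> admitsD(4,7)[OF a] by (intro mult_left_mono energy_mono C_inf_loc_D_x) auto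
      with B(2)[OF a] E admits_D1_2m[OF a assms(1)] True show ?thesis by (simp add: distrib_right)
    next
      case False
      have "2*(2*m) = 4*m" by simp
      with C(2)[OF a False] E show ?thesis by (simp add: distrib_right)
    qed
  qed
qed

section \<open>Pointwise bounds and oscillation\<close>

text \<open>The one-dimensional Sobolev inequality along i holds at every point and is then averaged
  over the directions in l. Appending i at the end of the list makes its average the innermost
  one.\<close>

lemma iter_avg_reduce:
  fixes u :: "('d::{finite,linorder}) pt \<Rightarrow> 'b::euclidean_space"
  assumes u: "C_inf_loc u" and K: "half_box a b" and i: "i \<in> Basis" and l: "set l \<subseteq> Basis" and z: "z \<in> cbox a b"
  shows "iter_avg a b l (\<lambda>z. (norm (u z))\<^sup>2) z \<le>
    2 * (iter_avg a b (l @ [i]) (\<lambda>z. (norm (u z))\<^sup>2) z + (b \<bullet> i - a \<bullet> i)\<^sup>2 * iter_avg a b (l @ [i]) (\<lambda>z. (norm (partial i u z))\<^sup>2) z)"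
proof -
  let ?L = "b \<bullet> i - a \<bullet> i"
  have Kb: "cbox a b \<subseteq> O_bar" and ab: "\<And>j. j \<in> Basis \<Longrightarrow> a \<bullet> j < b \<bullet> j" using K by (auto simp: half_box_def)
  have c: "continuous_on (cbox a b) f" if "C_inf_loc f" for f :: "'d pt \<Rightarrow> 'b"
    using continuous_on_subset[OF C_inf_locD(1)[OF that] Kb] .
  let ?g = "\<lambda>z. (norm (u z))\<^sup>2" and ?g' = "\<lambda>z. (norm (partial i u z))\<^sup>2"
  have cg: "continuous_on (cbox a b) ?g" "continuous_on (cbox a b) ?g'"
    by (intro continuous_intros c u C_inf_locD(2)[OF u i])+
  have cg2: "continuous_on (cbox a b) (\<lambda>z. ?L\<^sup>2 * ?g' z)" by (intro continuous_intros cg)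
  have pt: "?g y \<le> 2 * (slice_avg a b i ?g y + ?L\<^sup>2 * slice_avg a b i ?g' y)" if y: "y \<in> cbox a b" for y
  proof -
    have d: "((\<lambda>s. u (slice i y s)) has_vector_derivative partial i u (slice i y s)) (at s within {a \<bullet> i..b \<bullet> i})"
      if "s \<in> {a \<bullet> i..b \<bullet> i}" for s
      using partial_on_slice[OF u i Kb y that] .
    have cc: "continuous_on {a \<bullet> i..b \<bullet> i} (\<lambda>s. partial i u (slice i y s))"
      by (rule continuous_on_compose2[OF c[OF C_inf_locD(2)[OF u i]]]) (auto intro!: continuous_intros slice_in_cbox i y)
    have yi: "y \<bullet> i \<in> {a \<bullet> i..b \<bullet> i}" using y i by (auto simp: mem_box)
    have "?g y \<le> 2 / ?L * integral {a \<bullet> i..b \<bullet> i} (\<lambda>s. ?g (slice i y s) + ?L\<^sup>2 * ?g' (slice i y s))"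
      using slice_sobolev[OF d cc ab[OF i] yi] by (simp add: slice_self)
    also have "... = 2 * slice_avg a b i (\<lambda>z. ?g z + ?L\<^sup>2 * ?g' z) y" by (simp add: slice_avg_def)
    also have "... = 2 * (slice_avg a b i ?g y + ?L\<^sup>2 * slice_avg a b i ?g' y)"
      by (subst slice_avg_add[OF cg(1) cg2 i y]) (simp add: slice_avg_cmult)
    finally show ?thesis .
  qed
  have cs: "continuous_on (cbox a b) (slice_avg a b i ?g)" "continuous_on (cbox a b) (slice_avg a b i ?g')"
    using cg i by (auto intro: continuous_on_slice_avg)
  have cs2: "continuous_on (cbox a b) (\<lambda>y. ?L\<^sup>2 * slice_avg a b i ?g' y)" by (intro continuous_intros cs)
  have "iter_avg a b l ?g z \<le> iter_avg a b l (\<lambda>y. 2 * (slice_avg a b i ?g y + ?L\<^sup>2 * slice_avg a b i ?g' y)) z"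
    using l ab by (intro iter_avg_mono cg continuous_intros cs pt z) auto
  also have "... = 2 * (iter_avg a b l (slice_avg a b i ?g) z + ?L\<^sup>2 * iter_avg a b l (slice_avg a b i ?g') z)"
    by (simp only: iter_avg_cmult iter_avg_add[OF cs(1) cs2 l z])
  finally show ?thesis by simp
qed

lemma iter_avg_nonneg:
  assumes "continuous_on (cbox a b) g" "set l \<subseteq> Basis" "\<And>i. i \<in> Basis \<Longrightarrow> a \<bullet> i < b \<bullet> i"
    and "\<And>z. z \<in> cbox a b \<Longrightarrow> 0 \<le> g z" "z \<in> cbox a b"
  shows "0 \<le> iter_avg a b l g z"
  using iter_avg_mono[of a b "\<lambda>_. 0" g l z] iter_avg_cmult[of a b l 0 g z] assms by auto

text \<open>With \<open>l\<close> listing all directions the average of $|u|^2$ is over the whole box; removing a direction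
  costs one derivative in it by the one-dimensional Sobolev inequality, and with \<open>l = []\<close> the bound is pointwise. The time
  direction comes last, since $u_t$ is expressed by spatial derivatives through the equation.\<close>

definition avg_bound :: "'b::euclidean_space itself \<Rightarrow> real \<Rightarrow> real \<Rightarrow> nat \<Rightarrow> ('d::{finite,linorder}) pt list \<Rightarrow> bool" where
  "avg_bound T \<delta> M m l \<longleftrightarrow> (\<exists>C\<ge>0. \<exists>\<sigma>>0. \<sigma> \<le> 1 \<and> (\<forall>(L :: real \<Rightarrow> 'b \<Rightarrow> 'b) lam \<tau> (x :: real ^ ('d::{finite,linorder})) \<rho> u z.
     admits \<delta> M m L lam \<tau> x \<rho> u \<longrightarrow> z \<in> kbox m \<tau> x (\<sigma> * \<rho>) \<longrightarrow>
     \<rho>^(2*m + CARD('d)) * iter_avg (lo m \<tau> x (\<sigma> * \<rho>)) (hi \<tau> x (\<sigma> * \<rho>)) l (\<lambda>z. (norm (u z))\<^sup>2) z \<le> C * energy m \<tau> x \<rho> u))"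

lemma avg_boundE:
  assumes "avg_bound TYPE('b::euclidean_space) \<delta> M m (l :: ('d::{finite,linorder}) pt list)"
  obtains C \<sigma> where "C \<ge> 0" "\<sigma> > 0" "\<sigma> \<le> 1"
    "\<And>(L :: real \<Rightarrow> 'b \<Rightarrow> 'b) lam \<tau> (x :: real ^ ('d::{finite,linorder})) \<rho> u z.
     admits \<delta> M m L lam \<tau> x \<rho> u \<Longrightarrow> z \<in> kbox m \<tau> x (\<sigma> * \<rho>) \<Longrightarrow>
     \<rho>^(2*m + CARD('d)) * iter_avg (lo m \<tau> x (\<sigma> * \<rho>)) (hi \<tau> x (\<sigma> * \<rho>)) l (\<lambda>z. (norm (u z))\<^sup>2) z \<le> C * energy m \<tau> x \<rho> u"
  using assms unfolding avg_bound_def by blast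

text \<open>The centre lies in the closed half-space, so even a box that is cut off retains a side
  of length at least \<rho> in direction x_1.\<close>

lemma measure_kbox_ge:
  fixes x :: "real ^ ('d::{finite,linorder})"
  assumes "\<rho> > 0" "x $ first \<ge> 0"
  shows "\<rho>^(2*m + CARD('d)) \<le> measure lborel (kbox m \<tau> x \<rho>)"
proof -
  let ?a = "lo m \<tau> x \<rho>" and ?b = "hi \<tau> x \<rho>"
  have le: "\<forall>i\<in>Basis. ?a \<bullet> i \<le> ?b \<bullet> i" using half_box_kbox[OF assms, of m \<tau>] by (auto simp: half_box_def intro: less_imp_le)
  have et: "e_t \<notin> range (e_x :: 'd \<Rightarrow> 'd pt)" by auto
  have inj: "inj (e_x :: 'd \<Rightarrow> 'd pt)" by (rule injI) (auto simp: axis_eq_axis)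
  have "measure lborel (kbox m \<tau> x \<rho>) = (\<Prod>i\<in>insert e_t (range e_x). ?b \<bullet> i - ?a \<bullet> i)"
    using content_cbox[OF le] by (simp only: Basis_pt)
  also have "... = (?b \<bullet> e_t - ?a \<bullet> e_t) * (\<Prod>i\<in>range e_x. ?b \<bullet> i - ?a \<bullet> i)"
    by (rule prod.insert[OF _ et]) simp
  also have "(\<Prod>i\<in>range e_x. ?b \<bullet> i - ?a \<bullet> i) = (\<Prod>j\<in>UNIV. ?b \<bullet> e_x j - ?a \<bullet> e_x j)"
    by (subst prod.reindex[OF inj]) (simp add: o_def)
  finally have "measure lborel (kbox m \<tau> x \<rho>) = \<rho>^(2*m) * (\<Prod>j\<in>UNIV. ?b \<bullet> e_x j - ?a \<bullet> e_x j)"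
    by (simp only: lo_hi_inner) simp
  moreover have "(\<Prod>j\<in>(UNIV::'d set). \<rho>) \<le> (\<Prod>j\<in>UNIV. ?b \<bullet> e_x j - ?a \<bullet> e_x j)"
    unfolding lo_hi_inner using assms by (intro prod_mono) auto
  ultimately show ?thesis using assms by (simp add: power_add)
qed

text \<open>The normal direction has to be removed before all others. D_1 u is not in the class in
  general, so nothing but its energy over a box is available, and this suffices only while all the
  other directions are still averaged.\<close>

lemma avg_bound_full:
  assumes "\<delta> > 0" "M \<ge> 0" "m \<ge> 1" and l: "set l \<union> {e_x first} = (Basis :: ('d::{finite,linorder}) pt set)"
  shows "avg_bound TYPE('b::euclidean_space) \<delta> M m (l :: 'd pt list)"
proof -
  obtain B where B: "B \<ge> 0" "\<And>(L :: real \<Rightarrow> 'b \<Rightarrow> 'b) lam \<tau> (x :: real ^ ('d::{finite,linorder})) \<rho> u j.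
    admits \<delta> M m L lam \<tau> x \<rho> u \<Longrightarrow> \<rho>\<^sup>2 * energy m \<tau> x (\<rho>/2) (D_x j u) \<le> B * energy m \<tau> x \<rho> u"
    using energy_D_x[OF assms(1-3)] by blast
  let ?q = "2*m + CARD('d)"
  have full: "set (l @ [e_x first]) = (Basis :: 'd pt set)" using l by auto
  show ?thesis
    unfolding avg_bound_def
  proof (rule exI[of _ "2 * 2^?q * (1 + B)"], intro conjI, use B in simp, rule exI[of _ "1/2"], intro conjI allI impI)
    fix L :: "real \<Rightarrow> 'b \<Rightarrow> 'b" and lam \<tau> \<rho> :: real and x :: "real ^ ('d::{finite,linorder})" and u :: "'d pt \<Rightarrow> 'b" and z
    assume a: "admits \<delta> M m L lam \<tau> x \<rho> u" and z: "z \<in> kbox m \<tau> x (1/2 * \<rho>)"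
    define r where "r = 1/2 * \<rho>"
    have \<rho>: "\<rho> > 0" and x: "x $ first \<ge> 0" and u: "C_inf_loc u" using admitsD[OF a] by auto
    have r: "r > 0" "r = \<rho>/2" using \<rho> by (auto simp: r_def)
    let ?a = "lo m \<tau> x r" and ?b = "hi \<tau> x r" and ?i = "e_x first :: 'd pt"
    have K: "half_box ?a ?b" by (rule half_box_kbox[OF r(1) x])
    have avg: "\<rho>^?q * iter_avg ?a ?b (l @ [?i]) (\<lambda>z. (norm (g z))\<^sup>2) z \<le> 2^?q * energy m \<tau> x r g"
      if g: "C_inf_loc g" for g :: "'d pt \<Rightarrow> 'b"
    proof -
      have m0: "0 < r^?q" using r by simp
      have mm: "r^?q \<le> measure lborel (cbox ?a ?b)" by (rule measure_kbox_ge[OF r(1) x])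
      have "iter_avg ?a ?b (l @ [?i]) (\<lambda>z. (norm (g z))\<^sup>2) z = energy m \<tau> x r g / measure lborel (cbox ?a ?b)"
        using K z by (intro iter_avg_full[OF _ full] continuous_intros continuous_on_kbox[OF r(1) x g]) (auto simp: half_box_def r_def)
      also have "... \<le> energy m \<tau> x r g / r^?q"
        using mm m0 by (intro divide_left_mono energy_nonneg mult_pos_pos) auto
      finally have "\<rho>^?q * iter_avg ?a ?b (l @ [?i]) (\<lambda>z. (norm (g z))\<^sup>2) z \<le> \<rho>^?q * (energy m \<tau> x r g / r^?q)"
        using \<rho> by (intro mult_left_mono) auto
      also have "... = 2^?q * energy m \<tau> x r g" using \<rho> by (simp add: r(2) power_divide)
      finally show ?thesis .
    qed
    have L: "?b \<bullet> ?i - ?a \<bullet> ?i \<le> \<rho>" "0 \<le> ?b \<bullet> ?i - ?a \<bullet> ?i" unfolding lo_hi_inner using x r by auto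
    have "\<rho>^?q * iter_avg ?a ?b l (\<lambda>z. (norm (u z))\<^sup>2) z
       \<le> \<rho>^?q * (2 * (iter_avg ?a ?b (l @ [?i]) (\<lambda>z. (norm (u z))\<^sup>2) z + (?b \<bullet> ?i - ?a \<bullet> ?i)\<^sup>2 * iter_avg ?a ?b (l @ [?i]) (\<lambda>z. (norm (D1 u z))\<^sup>2) z))"
      unfolding D_x_def using \<rho> l z by (intro mult_left_mono iter_avg_reduce[OF u K]) (auto simp: r_def)
    also have "... = 2 * (\<rho>^?q * iter_avg ?a ?b (l @ [?i]) (\<lambda>z. (norm (u z))\<^sup>2) z)
       + 2 * (?b \<bullet> ?i - ?a \<bullet> ?i)\<^sup>2 * (\<rho>^?q * iter_avg ?a ?b (l @ [?i]) (\<lambda>z. (norm (D1 u z))\<^sup>2) z)"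
      by (simp only: distrib_left mult_ac)
    also have "... \<le> 2 * (2^?q * energy m \<tau> x r u) + 2 * \<rho>\<^sup>2 * (2^?q * energy m \<tau> x r (D1 u))"
      using L \<rho> full z K continuous_on_kbox[OF r(1) x C_inf_loc_D_x1[OF u]]
      by (intro add_mono mult_left_mono mult_mono avg u C_inf_loc_D_x1 power_mono mult_nonneg_nonneg iter_avg_nonneg) (auto intro!: continuous_intros simp: half_box_def r_def)
    also have "... = 2 * 2^?q * (energy m \<tau> x r u + \<rho>\<^sup>2 * energy m \<tau> x r (D1 u))" by (simp add: distrib_left mult_ac)
    also have "... \<le> 2 * 2^?q * (energy m \<tau> x \<rho> u + B * energy m \<tau> x \<rho> u)"
      using B(2)[OF a, of first] energy_mono[OF u r(1), of \<rho> x m \<tau>] \<rho> x r(2) by (intro mult_left_mono add_mono) auto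
    finally show "\<rho>^?q * iter_avg (lo m \<tau> x (1/2 * \<rho>)) (hi \<tau> x (1/2 * \<rho>)) l (\<lambda>z. (norm (u z))\<^sup>2) z \<le> 2 * 2^?q * (1 + B) * energy m \<tau> x \<rho> u"
      by (simp add: r_def algebra_simps)
  qed auto
qed

text \<open>Here the derivative that appears is in the class, so the hypothesis with the longer list
  applies to u and to D_j u alike, on half the box; the energy estimate for D_j u then returns to
  u.\<close>

lemma avg_bound_tangential:
  assumes "\<delta> > 0" "M \<ge> 0" "m \<ge> 1" and l: "set l \<subseteq> (Basis :: ('d::{finite,linorder}) pt set)" and j: "j \<noteq> first"
    and ab: "avg_bound TYPE('b::euclidean_space) \<delta> M m (l @ [e_x j])"
  shows "avg_bound TYPE('b) \<delta> M m l"
proof -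
  obtain B where B: "B \<ge> 0" "\<And>(L :: real \<Rightarrow> 'b \<Rightarrow> 'b) lam \<tau> (x :: real ^ ('d::{finite,linorder})) \<rho> u j.
    admits \<delta> M m L lam \<tau> x \<rho> u \<Longrightarrow> \<rho>\<^sup>2 * energy m \<tau> x (\<rho>/2) (D_x j u) \<le> B * energy m \<tau> x \<rho> u"
    using energy_D_x[OF assms(1-3)] by blast
  let ?q = "2*m + CARD('d)"
  obtain C \<sigma> where C: "C \<ge> 0" "\<sigma> > 0" "\<sigma> \<le> 1"
    "\<And>(L :: real \<Rightarrow> 'b \<Rightarrow> 'b) lam \<tau> (x :: real ^ ('d::{finite,linorder})) \<rho> u z.
     admits \<delta> M m L lam \<tau> x \<rho> u \<Longrightarrow> z \<in> kbox m \<tau> x (\<sigma> * \<rho>) \<Longrightarrow>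
     \<rho>^?q * iter_avg (lo m \<tau> x (\<sigma> * \<rho>)) (hi \<tau> x (\<sigma> * \<rho>)) (l @ [e_x j]) (\<lambda>z. (norm (u z))\<^sup>2) z \<le> C * energy m \<tau> x \<rho> u"
    by (rule avg_boundE[OF ab]) (rule that; assumption)
  show ?thesis
    unfolding avg_bound_def
  proof (rule exI[of _ "2 * 2^?q * C * (1 + B)"], intro conjI, use B C in simp, rule exI[of _ "\<sigma>/2"], intro conjI allI impI)
    fix L :: "real \<Rightarrow> 'b \<Rightarrow> 'b" and lam \<tau> \<rho> :: real and x :: "real ^ ('d::{finite,linorder})" and u :: "'d pt \<Rightarrow> 'b" and z
    assume a: "admits \<delta> M m L lam \<tau> x \<rho> u" and z: "z \<in> kbox m \<tau> x (\<sigma>/2 * \<rho>)"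
    define r where "r = \<sigma> * (\<rho>/2)"
    have \<rho>: "\<rho> > 0" and x: "x $ first \<ge> 0" and u: "C_inf_loc u" using admitsD[OF a] by auto
    have r: "r > 0" using \<rho> C by (simp add: r_def)
    have z: "z \<in> kbox m \<tau> x r" using z by (simp add: r_def)
    let ?a = "lo m \<tau> x r" and ?b = "hi \<tau> x r" and ?i = "e_x j :: 'd pt"
    have K: "half_box ?a ?b" by (rule half_box_kbox[OF r(1) x])
    have avg: "\<rho>^?q * iter_avg ?a ?b (l @ [?i]) (\<lambda>z. (norm (g z))\<^sup>2) z \<le> 2^?q * C * energy m \<tau> x (\<rho>/2) g"
      if g: "admits \<delta> M m L lam \<tau> x \<rho> g" for g :: "'d pt \<Rightarrow> 'b"
    proof -
      have g2: "admits \<delta> M m L lam \<tau> x (\<rho>/2) g" by (rule admits_smaller[OF g]) (use \<rho> in auto)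
      have "2^?q * ((\<rho>/2)^?q * iter_avg ?a ?b (l @ [?i]) (\<lambda>z. (norm (g z))\<^sup>2) z) \<le> 2^?q * (C * energy m \<tau> x (\<rho>/2) g)"
        using C(4)[OF g2, of z] z unfolding r_def by (intro mult_left_mono) auto
      moreover have "2^?q * (\<rho>/2)^?q = \<rho>^?q" by (simp only: power_mult_distrib[symmetric]) simp
      ultimately show ?thesis by (simp only: mult.assoc[symmetric])
    qed
    have "r \<le> 1 * (\<rho>/2)" unfolding r_def using C \<rho> by (intro mult_right_mono) auto
    then have L: "?b \<bullet> ?i - ?a \<bullet> ?i \<le> \<rho>" "0 \<le> ?b \<bullet> ?i - ?a \<bullet> ?i" unfolding lo_hi_inner using x r j by auto
    have aj: "admits \<delta> M m L lam \<tau> x \<rho> (D_x j u)" by (rule admits_tangential[OF a j])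
    have "\<rho>^?q * iter_avg ?a ?b l (\<lambda>z. (norm (u z))\<^sup>2) z
       \<le> \<rho>^?q * (2 * (iter_avg ?a ?b (l @ [?i]) (\<lambda>z. (norm (u z))\<^sup>2) z + (?b \<bullet> ?i - ?a \<bullet> ?i)\<^sup>2 * iter_avg ?a ?b (l @ [?i]) (\<lambda>z. (norm (D_x j u z))\<^sup>2) z))"
      unfolding D_x_def using \<rho> l z by (intro mult_left_mono iter_avg_reduce[OF u K]) (auto simp: r_def)
    also have "... = 2 * (\<rho>^?q * iter_avg ?a ?b (l @ [?i]) (\<lambda>z. (norm (u z))\<^sup>2) z)
       + 2 * (?b \<bullet> ?i - ?a \<bullet> ?i)\<^sup>2 * (\<rho>^?q * iter_avg ?a ?b (l @ [?i]) (\<lambda>z. (norm (D_x j u z))\<^sup>2) z)"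
      by (simp only: distrib_left mult_ac)
    also have "... \<le> 2 * (2^?q * C * energy m \<tau> x (\<rho>/2) u) + 2 * \<rho>\<^sup>2 * (2^?q * C * energy m \<tau> x (\<rho>/2) (D_x j u))"
      using L \<rho> l z C(1) K continuous_on_kbox[OF r x C_inf_loc_D_x1[OF u]]
      by (intro add_mono mult_left_mono mult_mono avg a aj power_mono mult_nonneg_nonneg iter_avg_nonneg) (auto intro!: continuous_intros simp: half_box_def)
    also have "... = 2 * 2^?q * C * (energy m \<tau> x (\<rho>/2) u + \<rho>\<^sup>2 * energy m \<tau> x (\<rho>/2) (D_x j u))" by (simp add: distrib_left mult_ac)
    also have "... \<le> 2 * 2^?q * C * (energy m \<tau> x \<rho> u + B * energy m \<tau> x \<rho> u)"
      using B(2)[OF a, of j] energy_mono[OF u, of "\<rho>/2" \<rho> x m \<tau>] \<rho> x C(1) by (intro mult_left_mono add_mono) auto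
    finally show "\<rho>^?q * iter_avg (lo m \<tau> x (\<sigma>/2 * \<rho>)) (hi \<tau> x (\<sigma>/2 * \<rho>)) l (\<lambda>z. (norm (u z))\<^sup>2) z \<le> 2 * 2^?q * C * (1 + B) * energy m \<tau> x \<rho> u"
      by (simp add: r_def algebra_simps)
  qed (use C in auto)
qed

lemma D_t_bound:
  fixes u :: "('d::{finite,linorder}) pt \<Rightarrow> 'b::euclidean_space"
  assumes L: "coef \<delta> M L" and s: "solves m L lam a b u" and z: "z \<in> cbox a b" and M0: "M \<le> M0" "1 \<le> M0" and lam: "lam \<ge> 0"
  shows "(norm (D_t u z))\<^sup>2 \<le> 2 * M0\<^sup>2 * real CARD('d) * (\<Sum>j\<in>UNIV. (norm ((D_x j ^^ (2*m)) u z))\<^sup>2) + 2 * lam\<^sup>2 * (norm (u z))\<^sup>2"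
proof -
  let ?n = "\<lambda>j. norm ((D_x j ^^ (2*m)) u z)"
  let ?A = "L (fst z) ((D1 ^^ (2*m)) u z)" and ?S = "\<Sum>j\<in>UNIV - {first}. (D_x j ^^ (2*m)) u z"
  have "D_t u z + (-1)^m *\<^sub>R (?A + ?S) + lam *\<^sub>R u z = 0" using s z by (simp add: solves_def pde_def)
  then have eq: "D_t u z = - ((-1)^m *\<^sub>R (?A + ?S) + lam *\<^sub>R u z)" by (simp only: add.assoc eq_neg_iff_add_eq_0)
  have "norm (D_t u z) \<le> norm ((-1)^m *\<^sub>R (?A + ?S)) + norm (lam *\<^sub>R u z)"
    unfolding eq norm_minus_cancel by (rule norm_triangle_ineq)
  also have "... = norm (?A + ?S) + lam * norm (u z)" using lam by (simp add: power_abs)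
  also have "norm (?A + ?S) \<le> norm ?A + (\<Sum>j\<in>UNIV - {first}. ?n j)"
    by (rule norm_triangle_le) (intro add_left_mono norm_sum)
  also have "norm ?A \<le> M0 * ?n first"
  proof (rule order_trans)
    show "norm ?A \<le> M * ?n first" using L by (simp add: coef_def)
    show "M * ?n first \<le> M0 * ?n first" using M0 by (intro mult_right_mono) auto
  qed
  also have "(\<Sum>j\<in>UNIV - {first}. ?n j) \<le> (\<Sum>j\<in>UNIV - {first}. M0 * ?n j)"
    using M0 by (intro sum_mono mult_le_cancel_right1[THEN iffD2]) auto
  also have "M0 * ?n first + (\<Sum>j\<in>UNIV - {first}. M0 * ?n j) = M0 * (\<Sum>j\<in>UNIV. ?n j)"
    unfolding sum_distrib_left by (rule sum.remove[symmetric]) auto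
  finally have 1: "norm (D_t u z) \<le> M0 * (\<Sum>j\<in>UNIV. ?n j) + lam * norm (u z)" by simp
  have "(norm (D_t u z))\<^sup>2 \<le> (M0 * (\<Sum>j\<in>UNIV. ?n j) + lam * norm (u z))\<^sup>2" by (intro power_mono 1) auto
  also have "... \<le> 2 * (M0 * (\<Sum>j\<in>UNIV. ?n j))\<^sup>2 + 2 * (lam * norm (u z))\<^sup>2"
    using sum_squares_bound[of "M0 * (\<Sum>j\<in>UNIV. ?n j)" "lam * norm (u z)"] by (simp add: power2_sum)
  also have "(M0 * (\<Sum>j\<in>UNIV. ?n j))\<^sup>2 \<le> M0\<^sup>2 * ((\<Sum>j\<in>UNIV. (?n j)\<^sup>2) * real CARD('d))"
    unfolding power_mult_distrib by (intro mult_left_mono sum_squared_le_sum_of_squares) auto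
  finally show ?thesis by (simp add: power_mult_distrib mult_ac)
qed

text \<open>Two applications of the \<lambda> estimate, on \<rho> and on \<rho>/2. The square is
  what the term \<lambda> u of the equation contributes to |u_t|^2.\<close>

lemma energy_lam2:
  assumes "\<delta> > 0" "M \<ge> 0" "m \<ge> 1"
  shows "\<exists>C\<ge>0. \<forall>(L :: real \<Rightarrow> 'b::euclidean_space \<Rightarrow> 'b) lam \<tau> (x :: real ^ ('d::{finite,linorder})) \<rho> u.
    admits \<delta> M m L lam \<tau> x \<rho> u \<longrightarrow> lam\<^sup>2 * \<rho>^(4*m) * energy m \<tau> x (\<rho>/4) u \<le> C * energy m \<tau> x \<rho> u"
proof -
  obtain B where B: "B \<ge> 0" "\<And>(L :: real \<Rightarrow> 'b \<Rightarrow> 'b) lam \<tau> (x :: real ^ ('d::{finite,linorder})) \<rho> u.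
    admits \<delta> M m L lam \<tau> x \<rho> u \<Longrightarrow> lam * \<rho>^(2*m) * energy m \<tau> x (\<rho>/2) u \<le> B * energy m \<tau> x \<rho> u"
    using energy_lam[OF assms] by blast
  show ?thesis
  proof (rule exI[of _ "2^(2*m) * B * B"], intro conjI, use B in simp, intro allI impI)
    fix L :: "real \<Rightarrow> 'b \<Rightarrow> 'b" and lam \<tau> \<rho> :: real and x :: "real ^ ('d::{finite,linorder})" and u :: "'d pt \<Rightarrow> 'b"
    assume a: "admits \<delta> M m L lam \<tau> x \<rho> u"
    have \<rho>: "\<rho> > 0" and lam: "lam \<ge> 0" using admitsD[OF a] by auto
    have a2: "admits \<delta> M m L lam \<tau> x (\<rho>/2) u" by (rule admits_smaller[OF a]) (use \<rho> in auto)
    have e: "\<rho>^(4*m) = \<rho>^(2*m) * \<rho>^(2*m)" "\<rho>^(2*m) = 2^(2*m) * (\<rho>/2)^(2*m)"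
      by (simp_all add: power_add[symmetric] power_divide)
    have "lam\<^sup>2 * \<rho>^(4*m) * energy m \<tau> x (\<rho>/4) u = (2^(2*m) * (lam * \<rho>^(2*m))) * (lam * (\<rho>/2)^(2*m) * energy m \<tau> x (\<rho>/2/2) u)"
      unfolding e(1) by (subst (2) e(2)) (simp add: power2_eq_square)
    also have "... \<le> (2^(2*m) * (lam * \<rho>^(2*m))) * (B * energy m \<tau> x (\<rho>/2) u)"
      using lam \<rho> by (intro mult_left_mono B(2)[OF a2]) auto
    also have "... = 2^(2*m) * B * (lam * \<rho>^(2*m) * energy m \<tau> x (\<rho>/2) u)" by simp
    also have "... \<le> 2^(2*m) * B * (B * energy m \<tau> x \<rho> u)" using B by (intro mult_left_mono B(2)[OF a]) auto
    finally show "lam\<^sup>2 * \<rho>^(4*m) * energy m \<tau> x (\<rho>/4) u \<le> 2^(2*m) * B * B * energy m \<tau> x \<rho> u" by (simp add: mult_ac)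
  qed
qed

text \<open>No equation for u_t is available. Instead |u_t|^2 is bounded pointwise by squares of
  D_j^(2m) u and \<lambda> u, that is, of multiples of functions in the class, and the hypothesis on
  time averages applies to each of these. The time length r^(2m) of the box, squared by the Sobolev
  inequality, compensates the scaling \<rho>^(-4m) of their energies.\<close>

lemma avg_bound_time:
  assumes "\<delta> > 0" "M \<ge> 0" "m \<ge> 1"
    and ab: "avg_bound TYPE('b::euclidean_space) \<delta> M m [e_t :: ('d::{finite,linorder}) pt]"
  shows "avg_bound TYPE('b) \<delta> M m ([] :: 'd pt list)"
proof -
  obtain B where B: "B \<ge> 0" "\<And>(L :: real \<Rightarrow> 'b \<Rightarrow> 'b) lam \<tau> (x :: real ^ ('d::{finite,linorder})) \<rho> u j.
    admits \<delta> M m L lam \<tau> x \<rho> u \<Longrightarrow>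
      admits \<delta> M m L lam \<tau> x \<rho> ((D_x j ^^ (2*m)) u) \<and> \<rho>^(4*m) * energy m \<tau> x (\<rho>/2^(2*m)) ((D_x j ^^ (2*m)) u) \<le> B * energy m \<tau> x \<rho> u"
    using energy_D_x_2m[OF assms(1-3)] by blast
  obtain B' where B': "B' \<ge> 0" "\<And>(L :: real \<Rightarrow> 'b \<Rightarrow> 'b) lam \<tau> (x :: real ^ ('d::{finite,linorder})) \<rho> u.
    admits \<delta> M m L lam \<tau> x \<rho> u \<Longrightarrow> lam\<^sup>2 * \<rho>^(4*m) * energy m \<tau> x (\<rho>/4) u \<le> B' * energy m \<tau> x \<rho> u"
    using energy_lam2[OF assms(1-3)] by blast
  let ?q = "2*m + CARD('d)"
  obtain C \<sigma> where C: "C \<ge> 0" "\<sigma> > 0" "\<sigma> \<le> 1"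
    "\<And>(L :: real \<Rightarrow> 'b \<Rightarrow> 'b) lam \<tau> (x :: real ^ ('d::{finite,linorder})) \<rho> u z.
     admits \<delta> M m L lam \<tau> x \<rho> u \<Longrightarrow> z \<in> kbox m \<tau> x (\<sigma> * \<rho>) \<Longrightarrow>
     \<rho>^?q * iter_avg (lo m \<tau> x (\<sigma> * \<rho>)) (hi \<tau> x (\<sigma> * \<rho>)) [e_t] (\<lambda>z. (norm (u z))\<^sup>2) z \<le> C * energy m \<tau> x \<rho> u"
    by (rule avg_boundE[OF ab]) (rule that; assumption)
  define M0 where "M0 = max M 1"
  have M0: "M \<le> M0" "1 \<le> M0" by (auto simp: M0_def)
  \<comment> \<open>The radius \<rho>/w is the one at which the energies of D_j^(2m) u are known; as
    w \<ge> 4, it also lies below the radius \<rho>/4 of the \<lambda> estimate.\<close>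
  define w where "w = (2::real)^(2*m)"
  have w: "w \<ge> 4"
  proof -
    have "(2::real)^2 \<le> 2^(2*m)" using assms(3) by (intro power_increasing) auto
    then show ?thesis by (simp add: w_def)
  qed
  define H where "H = w^?q * C"
  have H: "H \<ge> 0" using C w by (simp add: H_def)
  define A where "A = 2 * M0\<^sup>2 * real CARD('d)"
  have A: "A \<ge> 0" by (simp add: A_def)
  define C2 where "C2 = 2 * H * (1 + (A * (real CARD('d) * B) + 2 * B'))"
  show ?thesis
    unfolding avg_bound_def
  proof (rule exI[of _ C2], intro conjI, use H A B B' in \<open>simp add: C2_def\<close>, rule exI[of _ "\<sigma>/w"], intro conjI allI impI)
    fix L :: "real \<Rightarrow> 'b \<Rightarrow> 'b" and lam \<tau> \<rho> :: real and x :: "real ^ ('d::{finite,linorder})" and u :: "'d pt \<Rightarrow> 'b" and z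
    assume a: "admits \<delta> M m L lam \<tau> x \<rho> u" and z: "z \<in> kbox m \<tau> x (\<sigma>/w * \<rho>)"
    define r where "r = \<sigma> * (\<rho>/w)"
    have \<rho>: "\<rho> > 0" and x: "x $ first \<ge> 0" and u: "C_inf_loc u" and lam: "lam \<ge> 0" using admitsD[OF a] by auto
    have \<rho>w: "0 < \<rho>/w" "\<rho>/w \<le> \<rho>/4" "\<rho>/w \<le> \<rho>" using \<rho> w by (auto simp: field_simps)
    have r: "r > 0" unfolding r_def by (intro mult_pos_pos \<rho>w(1) C(2))
    have "r \<le> 1 * (\<rho>/w)" unfolding r_def using C \<rho>w by (intro mult_right_mono) auto
    then have r\<rho>: "r \<le> \<rho>" using \<rho>w by linarith
    have z: "z \<in> kbox m \<tau> x r" using z by (simp add: r_def)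
    let ?a = "lo m \<tau> x r" and ?b = "hi \<tau> x r"
    have K: "half_box ?a ?b" by (rule half_box_kbox[OF r(1) x])
    note c = continuous_on_kbox[OF r x]
    let ?M = "iter_avg ?a ?b [e_t]"
    have avg: "\<rho>^?q * ?M (\<lambda>z. (norm (g z))\<^sup>2) z \<le> H * energy m \<tau> x (\<rho>/w) g"
      if g: "admits \<delta> M m L lam \<tau> x \<rho> g" for g :: "'d pt \<Rightarrow> 'b"
    proof -
      have g2: "admits \<delta> M m L lam \<tau> x (\<rho>/w) g" by (rule admits_smaller[OF g]) (use \<rho>w in auto)
      have "w^?q * ((\<rho>/w)^?q * ?M (\<lambda>z. (norm (g z))\<^sup>2) z) \<le> w^?q * (C * energy m \<tau> x (\<rho>/w) g)"
        using C(4)[OF g2, of z] z w unfolding r_def by (intro mult_left_mono) auto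
      moreover have "w^?q * (\<rho>/w)^?q = \<rho>^?q" using w by (simp only: power_mult_distrib[symmetric]) simp
      ultimately show ?thesis by (simp only: mult.assoc[symmetric] H_def)
    qed
    have rm: "(r^(2*m))\<^sup>2 \<le> \<rho>^(4*m)"
    proof -
      have "(r^(2*m))\<^sup>2 = r^(4*m)" by (simp add: power_mult[symmetric] mult.commute)
      then show ?thesis using r\<rho> r by (simp add: power_mono)
    qed
    have aj: "admits \<delta> M m L lam \<tau> x \<rho> ((D_x j ^^ (2*m)) u)" for j using B(2)[OF a] by blast
    have sr: "solves m L lam ?a ?b u" using admitsD(5)[OF admits_smaller[OF a r r\<rho>]] .
    define G where "G = (\<Sum>j\<in>UNIV. ?M (\<lambda>z. (norm ((D_x j ^^ (2*m)) u z))\<^sup>2) z)"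
    define U where "U = ?M (\<lambda>z. (norm (u z))\<^sup>2) z"
    have Dt: "?M (\<lambda>z. (norm (D_t u z))\<^sup>2) z \<le> A * G + 2 * lam\<^sup>2 * U"
    proof -
      have c1: "continuous_on (kbox m \<tau> x r) (\<lambda>z. (norm (D_t u z))\<^sup>2)"
        by (intro continuous_intros c C_inf_loc_D_t u)
      have c2: "continuous_on (kbox m \<tau> x r) (\<lambda>z. (norm ((D_x j ^^ (2*m)) u z))\<^sup>2)" for j
        by (intro continuous_intros c C_inf_loc_D_x u)
      have c3: "continuous_on (kbox m \<tau> x r) (\<lambda>z. A * (\<Sum>j\<in>UNIV. (norm ((D_x j ^^ (2*m)) u z))\<^sup>2))"
        by (intro continuous_on_mult continuous_on_const continuous_on_sum c2)
      have c4: "continuous_on (kbox m \<tau> x r) (\<lambda>z. 2 * lam\<^sup>2 * (norm (u z))\<^sup>2)"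
        by (intro continuous_intros c u)
      have l: "set [e_t :: 'd pt] \<subseteq> Basis" by simp
      have "?M (\<lambda>z. (norm (D_t u z))\<^sup>2) z \<le> ?M (\<lambda>z. A * (\<Sum>j\<in>UNIV. (norm ((D_x j ^^ (2*m)) u z))\<^sup>2) + 2 * lam\<^sup>2 * (norm (u z))\<^sup>2) z"
      proof (rule iter_avg_mono[OF c1 continuous_on_add[OF c3 c4] l _ _ z])
        show "?a \<bullet> i < ?b \<bullet> i" if "i \<in> set [e_t]" for i using that K by (auto simp: half_box_def simp del: inner_e_t)
        show "(norm (D_t u y))\<^sup>2 \<le> A * (\<Sum>j\<in>UNIV. (norm ((D_x j ^^ (2*m)) u y))\<^sup>2) + 2 * lam\<^sup>2 * (norm (u y))\<^sup>2" if "y \<in> kbox m \<tau> x r" for y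
          unfolding A_def by (rule D_t_bound[OF admitsD(1)[OF a] sr that M0 lam])
      qed
      also have "... = ?M (\<lambda>z. A * (\<Sum>j\<in>UNIV. (norm ((D_x j ^^ (2*m)) u z))\<^sup>2)) z + ?M (\<lambda>z. 2 * lam\<^sup>2 * (norm (u z))\<^sup>2) z"
        by (rule iter_avg_add[OF c3 c4 l z])
      also have "... = A * G + 2 * lam\<^sup>2 * U"
        unfolding iter_avg_cmult G_def U_def by (subst iter_avg_sum[OF finite c2 l z]) (rule refl)
      finally show ?thesis .
    qed
    have bG: "\<rho>^(4*m) * (\<rho>^?q * G) \<le> H * (real CARD('d) * B * energy m \<tau> x \<rho> u)"
    proof -
      have "\<rho>^(4*m) * (\<rho>^?q * G) = (\<Sum>j\<in>UNIV. \<rho>^(4*m) * (\<rho>^?q * ?M (\<lambda>z. (norm ((D_x j ^^ (2*m)) u z))\<^sup>2) z))"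
        by (simp add: G_def sum_distrib_left)
      also have "... \<le> (\<Sum>j\<in>(UNIV::'d set). \<rho>^(4*m) * (H * energy m \<tau> x (\<rho>/w) ((D_x j ^^ (2*m)) u)))"
        using \<rho> by (intro sum_mono mult_left_mono avg aj) auto
      also have "... = (\<Sum>j\<in>(UNIV::'d set). H * (\<rho>^(4*m) * energy m \<tau> x (\<rho>/w) ((D_x j ^^ (2*m)) u)))"
        by (intro sum.cong refl) (simp only: mult_ac)
      also have "... \<le> (\<Sum>j\<in>(UNIV::'d set). H * (B * energy m \<tau> x \<rho> u))"
        using B(2)[OF a] H unfolding w_def by (intro sum_mono mult_left_mono) auto
      finally show ?thesis by (simp add: mult_ac)
    qed
    have eU: "energy m \<tau> x (\<rho>/w) u \<le> energy m \<tau> x (\<rho>/4) u" "energy m \<tau> x (\<rho>/w) u \<le> energy m \<tau> x \<rho> u"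
      using \<rho>w x u by (auto intro!: energy_mono)
    have bU: "\<rho>^(4*m) * (lam\<^sup>2 * (\<rho>^?q * U)) \<le> H * (B' * energy m \<tau> x \<rho> u)"
    proof -
      have "\<rho>^(4*m) * (lam\<^sup>2 * (\<rho>^?q * U)) \<le> \<rho>^(4*m) * (lam\<^sup>2 * (H * energy m \<tau> x (\<rho>/4) u))"
      proof (intro mult_left_mono)
        show "\<rho>^?q * U \<le> H * energy m \<tau> x (\<rho>/4) u"
          using avg[OF a] mult_left_mono[OF eU(1) H] unfolding U_def by linarith
      qed (use \<rho> in auto)
      also have "... = H * (lam\<^sup>2 * \<rho>^(4*m) * energy m \<tau> x (\<rho>/4) u)" by (simp only: mult_ac)
      also have "... \<le> H * (B' * energy m \<tau> x \<rho> u)" using H by (intro mult_left_mono B'(2)[OF a]) auto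
      finally show ?thesis .
    qed
    have bU0: "\<rho>^?q * U \<le> H * energy m \<tau> x \<rho> u"
      using avg[OF a] mult_left_mono[OF eU(2) H] unfolding U_def by linarith
    have Dt0: "0 \<le> ?M (\<lambda>z. (norm (D_t u z))\<^sup>2) z"
      using K by (intro iter_avg_nonneg continuous_intros c C_inf_loc_D_t u z) (auto simp: half_box_def)
    have "iter_avg ?a ?b [] (\<lambda>z. (norm (u z))\<^sup>2) z \<le> 2 * (U + (r^(2*m))\<^sup>2 * ?M (\<lambda>z. (norm (D_t u z))\<^sup>2) z)"
      using iter_avg_reduce[OF u K Basis_pt_simps(1), of "[]" z] z unfolding U_def D_t_def lo_hi_inner by simp
    also have "... \<le> 2 * (U + \<rho>^(4*m) * (A * G + 2 * lam\<^sup>2 * U))"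
      using rm Dt Dt0 \<rho> by (intro mult_left_mono add_left_mono mult_mono) auto
    finally have "\<rho>^?q * iter_avg ?a ?b [] (\<lambda>z. (norm (u z))\<^sup>2) z \<le> \<rho>^?q * (2 * (U + \<rho>^(4*m) * (A * G + 2 * lam\<^sup>2 * U)))"
      using \<rho> by (intro mult_left_mono) auto
    also have "... = 2 * (\<rho>^?q * U) + 2 * A * (\<rho>^(4*m) * (\<rho>^?q * G)) + 4 * (\<rho>^(4*m) * (lam\<^sup>2 * (\<rho>^?q * U)))"
      by (simp add: algebra_simps)
    also have "... \<le> 2 * (H * energy m \<tau> x \<rho> u) + 2 * A * (H * (real CARD('d) * B * energy m \<tau> x \<rho> u)) + 4 * (H * (B' * energy m \<tau> x \<rho> u))"
      using bU0 bU bG A by (intro add_mono mult_left_mono) auto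
    also have "... = C2 * energy m \<tau> x \<rho> u" by (simp add: C2_def algebra_simps)
    finally show "\<rho>^?q * iter_avg (lo m \<tau> x (\<sigma>/w * \<rho>)) (hi \<tau> x (\<sigma>/w * \<rho>)) [] (\<lambda>z. (norm (u z))\<^sup>2) z \<le> C2 * energy m \<tau> x \<rho> u"
      by (simp add: r_def)
  qed (use C w in \<open>auto simp: field_simps\<close>)
qed

lemma sup_bound:
  assumes "\<delta> > 0" "M \<ge> 0" "m \<ge> 1"
  shows "\<exists>C\<ge>0. \<exists>\<sigma>>0. \<sigma> \<le> 1 \<and> (\<forall>(L :: real \<Rightarrow> 'b::euclidean_space \<Rightarrow> 'b) lam \<tau> (x :: real ^ ('d::{finite,linorder})) \<rho> u z.
     admits \<delta> M m L lam \<tau> x \<rho> u \<longrightarrow> z \<in> kbox m \<tau> x (\<sigma> * \<rho>) \<longrightarrow>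
     \<rho>^(2*m + CARD('d)) * (norm (u z))\<^sup>2 \<le> C * energy m \<tau> x \<rho> u)"
proof -
  have red: "avg_bound TYPE('b) \<delta> M m (l @ map e_x T) \<Longrightarrow> set T \<subseteq> UNIV - {first} \<Longrightarrow> set l \<subseteq> Basis \<Longrightarrow> avg_bound TYPE('b) \<delta> M m l"
    for l :: "('d::{finite,linorder}) pt list" and T
  proof (induction T arbitrary: l)
    case (Cons j T)
    have "avg_bound TYPE('b) \<delta> M m (l @ [e_x j])"
      by (rule Cons.IH) (use Cons.prems in auto)
    then show ?case using Cons.prems by - (rule avg_bound_tangential[OF assms, of l j], auto)
  qed simp
  obtain T :: "'d list" where T: "set T = UNIV - {first}" using finite_list[of "UNIV - {first :: 'd}"] by auto
  have "set (e_t # map e_x T) \<union> {e_x first} = (Basis :: 'd pt set)"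
    unfolding Basis_pt using T by auto
  from avg_bound_full[OF assms this] have "avg_bound TYPE('b) \<delta> M m ([e_t] @ map e_x T)" by simp
  then have "avg_bound TYPE('b) \<delta> M m [e_t :: 'd pt]" by (rule red) (use T in auto)
  from avg_bound_time[OF assms this] show ?thesis by (simp add: avg_bound_def)
qed

section \<open>Pointwise bounds for derivatives of all orders\<close>

lemma slice_derivative_step:
  fixes f :: "nat \<Rightarrow> real \<Rightarrow> 'b::euclidean_space"
  assumes ch: "deriv_chain (Suc (Suc k)) \<alpha> \<beta> f" and h: "0 < h" "h \<le> (\<beta> - \<alpha>)/2"
    and P: "\<And>s. s \<in> {\<alpha>..\<beta>} \<Longrightarrow> norm (f k s) \<le> P" and B: "\<And>s. s \<in> {\<alpha>..\<beta>} \<Longrightarrow> norm (f (Suc (Suc k)) s) \<le> B"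
    and x: "x \<in> {\<alpha>..\<beta>}"
  shows "norm (f (Suc k) x) \<le> 2 * P / h + 3 * h * B"
proof -
  \<comment> \<open>As h is at most half the length, one of x - h and x + h stays in the interval.
    The derivative at x is recovered from the difference quotient between x and y, up to its
    variation there, which is at most 3 h B.\<close>
  obtain y where y: "y \<in> {\<alpha>..\<beta>}" "\<bar>y - x\<bar> = h"
    using x h by (cases "x + h \<le> \<beta>") (auto intro: that[of "x + h"] that[of "x - h"])
  have B0: "B \<ge> 0" using B[OF x] norm_ge_zero order_trans by blast
  have seg: "closed_segment x s \<subseteq> closed_segment x y" if "s \<in> closed_segment x y" for s
    using that by (simp add: closed_segment_subset)
  have segI: "closed_segment x y \<subseteq> {\<alpha>..\<beta>}" using x y(1) by (intro closed_segment_subset) auto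
  have le: "\<bar>s - x\<bar> \<le> h" if "s \<in> closed_segment x y" for s
    using segment_bound1[OF that] y(2) by (simp add: dist_norm abs_minus_commute)
  have 1: "norm (f (Suc k) s - f (Suc k) x) \<le> 3 * h * B" if s: "s \<in> closed_segment x y" for s
  proof -
    have "norm (f (Suc k) s - f (Suc k) x - (s - x) *\<^sub>R f (Suc (Suc k)) x) \<le> norm (s - x) * (2 * B)"
    proof (rule vector_differentiable_bound_linearization[where S="{\<alpha>..\<beta>}" and f'="f (Suc (Suc k))"])
      show "(f (Suc k) has_vector_derivative f (Suc (Suc k)) t) (at t within {\<alpha>..\<beta>})" if "t \<in> {\<alpha>..\<beta>}" for t
        using deriv_chainD(1)[OF ch _ that] by simp
      show "closed_segment x s \<subseteq> {\<alpha>..\<beta>}" using seg[OF s] segI by blast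
      show "norm (f (Suc (Suc k)) t - f (Suc (Suc k)) x) \<le> 2 * B" if "t \<in> {\<alpha>..\<beta>}" for t
        using norm_triangle_ineq4[of "f (Suc (Suc k)) t" "f (Suc (Suc k)) x"] B[OF that] B[OF x] by linarith
    qed (rule x)
    then have "norm (f (Suc k) s - f (Suc k) x) \<le> norm (s - x) * (2 * B) + norm ((s - x) *\<^sub>R f (Suc (Suc k)) x)"
      using norm_triangle_sub[of "f (Suc k) s - f (Suc k) x" "(s - x) *\<^sub>R f (Suc (Suc k)) x"] by linarith
    also have "... \<le> h * (2 * B) + h * B"
      unfolding norm_scaleR real_norm_def using le[OF s] B[OF x] B0 h by (intro add_mono mult_mono) auto
    finally show ?thesis by (simp add: algebra_simps)
  qed
  have "norm (f k y - f k x - (y - x) *\<^sub>R f (Suc k) x) \<le> norm (y - x) * (3 * h * B)"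
  proof (rule vector_differentiable_bound_linearization[where S="closed_segment x y" and f'="f (Suc k)"])
    show "(f k has_vector_derivative f (Suc k) t) (at t within closed_segment x y)" if "t \<in> closed_segment x y" for t
      using has_vector_derivative_within_subset[OF deriv_chainD(1)[OF ch] segI] that segI by auto
  qed (auto intro: 1)
  then have "norm ((y - x) *\<^sub>R f (Suc k) x) \<le> norm (y - x) * (3 * h * B) + norm (f k y - f k x)"
    using norm_triangle_sub[of "(y - x) *\<^sub>R f (Suc k) x" "f k y - f k x"]
    by (simp only: norm_minus_commute[of "(y - x) *\<^sub>R f (Suc k) x"])
  also have "norm (f k y - f k x) \<le> 2 * P" using norm_triangle_ineq4[of "f k y" "f k x"] P[OF x] P[OF y(1)] by linarith
  finally have "h * norm (f (Suc k) x) \<le> h * (3 * h * B) + 2 * P" using y(2) by simp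
  then have "h * norm (f (Suc k) x) \<le> h * (2 * P / h + 3 * h * B)" using h by (simp add: distrib_left)
  then show ?thesis using h by (simp only: mult_le_cancel_left_pos)
qed

text \<open>The abstract interpolation again, now for maxima scaled by powers of the length. The
  step works up to the end points and involves no boundary values, so it applies to slices ending on
  the flat boundary and to derivatives of any normal order.\<close>

lemma slice_derivative_interpolation:
  "\<exists>C\<ge>0. \<forall>(f :: nat \<Rightarrow> real \<Rightarrow> 'b::euclidean_space) \<alpha> \<beta> P. \<alpha> < \<beta> \<longrightarrow> deriv_chain K \<alpha> \<beta> f \<longrightarrow>
    (\<forall>s\<in>{\<alpha>..\<beta>}. norm (f 0 s) \<le> P) \<longrightarrow> (\<forall>s\<in>{\<alpha>..\<beta>}. (\<beta> - \<alpha>)^K * norm (f K s) \<le> P) \<longrightarrow>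
    (\<forall>a\<le>K. \<forall>s\<in>{\<alpha>..\<beta>}. (\<beta> - \<alpha>)^a * norm (f a s) \<le> C * P)"
proof -
  \<comment> \<open>The bound 3 \<theta> \<le> \<eta> produces the coefficient \<eta> of the higher
    derivative, and \<theta> \<le> 1/2 keeps the step h = \<theta> l within half of the
    interval.\<close>
  define \<theta> where "\<theta> \<eta> = min (\<eta>/3) (1/2)" for \<eta> :: real
  obtain C where C: "C \<ge> 0" "\<And>b::nat\<Rightarrow>real. (\<forall>j. 0 \<le> b j) \<Longrightarrow>
     (\<forall>j \<eta>. 1 \<le> j \<longrightarrow> j < K \<longrightarrow> \<eta> > 0 \<longrightarrow> b j \<le> \<eta> * b (Suc j) + 2 / \<theta> \<eta> * b (j-1)) \<Longrightarrow>
     (\<forall>j<K. b j \<le> 1 * b K + C * b 0)"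
    using interpolate_seq[OF zero_less_one, of K "\<lambda>\<eta>. 2 / \<theta> \<eta>"] by blast
  show ?thesis
  proof (rule exI[of _ "1 + C"], intro conjI, use C in simp, intro allI impI ballI)
    fix f :: "nat \<Rightarrow> real \<Rightarrow> 'b" and \<alpha> \<beta> P :: real and a s
    assume ab: "\<alpha> < \<beta>" and ch: "deriv_chain K \<alpha> \<beta> f" and f0: "\<forall>s\<in>{\<alpha>..\<beta>}. norm (f 0 s) \<le> P"
      and fK: "\<forall>s\<in>{\<alpha>..\<beta>}. (\<beta> - \<alpha>)^K * norm (f K s) \<le> P" and a: "a \<le> K" and s: "s \<in> {\<alpha>..\<beta>}"
    define l where "l = \<beta> - \<alpha>"
    have l: "l > 0" using ab by (simp add: l_def)
    have ex: "\<exists>y\<in>{\<alpha>..\<beta>}. \<forall>s\<in>{\<alpha>..\<beta>}. norm (f j s) \<le> norm (f j y)" if "j \<le> K" for j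
      using continuous_attains_sup[of "{\<alpha>..\<beta>}" "\<lambda>s. norm (f j s)"] ab deriv_chainD(2)[OF ch that] by (auto intro: continuous_intros)
    \<comment> \<open>A maximum point where one is known to exist, that is for j \<le> K; for larger
      j the value is arbitrary, and only the nonnegativity of \<open>b j\<close> is used.\<close>
    define y where "y j = (SOME y. y \<in> {\<alpha>..\<beta>} \<and> (\<forall>s\<in>{\<alpha>..\<beta>}. norm (f j s) \<le> norm (f j y)))" for j
    have y: "y j \<in> {\<alpha>..\<beta>}" "\<And>s. s \<in> {\<alpha>..\<beta>} \<Longrightarrow> norm (f j s) \<le> norm (f j (y j))" if "j \<le> K" for j
      using someI_ex[of "\<lambda>y. y \<in> {\<alpha>..\<beta>} \<and> (\<forall>s\<in>{\<alpha>..\<beta>}. norm (f j s) \<le> norm (f j y))"] ex[OF that] unfolding y_def by blast+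
    define b where "b j = l^j * norm (f j (y j))" for j
    have b0: "0 \<le> b j" for j using l by (simp add: b_def)
    have "b j \<le> \<eta> * b (Suc j) + 2 / \<theta> \<eta> * b (j-1)" if j: "1 \<le> j" "j < K" and \<eta>: "\<eta> > 0" for j \<eta>
    proof -
      obtain k where k: "j = Suc k" using j by (cases j) auto
      have \<theta>: "0 < \<theta> \<eta>" "3 * \<theta> \<eta> \<le> \<eta>" "\<theta> \<eta> \<le> 1/2" using \<eta> by (auto simp: \<theta>_def)
      have "norm (f (Suc k) (y j)) \<le> 2 * norm (f k (y k)) / (\<theta> \<eta> * l) + 3 * (\<theta> \<eta> * l) * norm (f (Suc (Suc k)) (y (Suc (Suc k))))"
      proof (rule slice_derivative_step[where \<alpha>=\<alpha> and \<beta>=\<beta>])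
        show "deriv_chain (Suc (Suc k)) \<alpha> \<beta> f" using deriv_chain_mono[OF ch] j k by auto
        show "\<theta> \<eta> * l \<le> (\<beta> - \<alpha>)/2" using mult_right_mono[OF \<theta>(3), of l] l by (simp add: l_def)
      qed (use y j k \<theta> l in auto)
      then have "l^j * norm (f j (y j)) \<le> l^j * (2 * norm (f k (y k)) / (\<theta> \<eta> * l) + 3 * (\<theta> \<eta> * l) * norm (f (Suc (Suc k)) (y (Suc (Suc k)))))"
        unfolding k using l by (intro mult_left_mono) auto
      also have "... = 2 / \<theta> \<eta> * b k + 3 * \<theta> \<eta> * b (Suc j)"
        using l \<theta>(1) by (simp add: b_def k distrib_left)
      also have "... \<le> 2 / \<theta> \<eta> * b k + \<eta> * b (Suc j)" using \<theta> b0 by (intro add_left_mono mult_right_mono) auto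
      finally show ?thesis by (simp add: b_def k)
    qed
    then have main: "\<forall>j<K. b j \<le> 1 * b K + C * b 0" using C(2) b0 by blast
    have bK: "b K \<le> P" "b 0 \<le> P" using fK f0 y(1)[of K] y(1)[of 0] by (auto simp: b_def l_def)
    have "b a \<le> (1 + C) * P"
    proof (cases "a = K")
      case True
      have "0 \<le> C * P" using C bK b0[of 0] by (intro mult_nonneg_nonneg) auto
      then show ?thesis using True bK by (simp add: distrib_right)
    next
      case False
      then have "b a \<le> b K + C * b 0" using main a by auto
      also have "... \<le> P + C * P" using bK C by (intro add_mono mult_left_mono) auto
      finally show ?thesis by (simp add: distrib_right)
    qed
    moreover have "l^a * norm (f a s) \<le> b a" unfolding b_def using y(2)[OF a s] l by (intro mult_left_mono) auto
    ultimately show "(\<beta> - \<alpha>)^a * norm (f a s) \<le> (1 + C) * P" unfolding l_def by linarith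
  qed
qed

text \<open>D_1^(2m) maps the class into itself, so its estimate can be iterated on halved boxes.
  Only normal orders divisible by 2m are reached in this way.\<close>

lemma energy_D1_iterated:
  assumes "\<delta> > 0" "M \<ge> 0" "m \<ge> 1"
  shows "\<exists>C\<ge>0. \<forall>(L :: real \<Rightarrow> 'b::euclidean_space \<Rightarrow> 'b) lam \<tau> (x :: real ^ ('d::{finite,linorder})) \<rho> u.
    admits \<delta> M m L lam \<tau> x \<rho> u \<longrightarrow> admits \<delta> M m L lam \<tau> x \<rho> ((D1 ^^ (2*m*k)) u) \<and>
    \<rho>^(4*m*k) * energy m \<tau> x (\<rho>/2^k) ((D1 ^^ (2*m*k)) u) \<le> C * energy m \<tau> x \<rho> u"
proof (induction k)
  case 0
  show ?case by (intro exI[of _ 1]) simp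
next
  case (Suc k)
  obtain C where C: "C \<ge> 0" "\<And>(L :: real \<Rightarrow> 'b \<Rightarrow> 'b) lam \<tau> (x :: real ^ ('d::{finite,linorder})) \<rho> u.
    admits \<delta> M m L lam \<tau> x \<rho> u \<Longrightarrow> admits \<delta> M m L lam \<tau> x \<rho> ((D1 ^^ (2*m*k)) u) \<and>
    \<rho>^(4*m*k) * energy m \<tau> x (\<rho>/2^k) ((D1 ^^ (2*m*k)) u) \<le> C * energy m \<tau> x \<rho> u"
    using Suc.IH by blast
  obtain B where B: "B \<ge> 0" "\<And>(L :: real \<Rightarrow> 'b \<Rightarrow> 'b) lam \<tau> (x :: real ^ ('d::{finite,linorder})) \<rho> u.
    admits \<delta> M m L lam \<tau> x \<rho> u \<Longrightarrow> \<rho>^(4*m) * energy m \<tau> x (\<rho>/2) ((D1 ^^ (2*m)) u) \<le> B * energy m \<tau> x \<rho> u"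
    using energy_D1_2m[OF assms] by blast
  show ?case
  proof (rule exI[of _ "(2^k)^(4*m) * B * C"], intro conjI, use B C in simp, intro allI impI)
    fix L :: "real \<Rightarrow> 'b \<Rightarrow> 'b" and lam \<tau> \<rho> :: real and x :: "real ^ ('d::{finite,linorder})" and u :: "'d pt \<Rightarrow> 'b"
    assume a: "admits \<delta> M m L lam \<tau> x \<rho> u"
    define v where "v = (D1 ^^ (2*m*k)) u"
    have av: "admits \<delta> M m L lam \<tau> x \<rho> v" and e: "\<rho>^(4*m*k) * energy m \<tau> x (\<rho>/2^k) v \<le> C * energy m \<tau> x \<rho> u"
      using C(2)[OF a] by (simp_all add: v_def)
    have v': "(D1 ^^ (2*m*Suc k)) u = (D1 ^^ (2*m)) v"
      by (simp only: v_def mult_Suc_right funpow_add o_apply)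
    have \<rho>: "\<rho> > 0" using admitsD(3)[OF a] .
    have av': "admits \<delta> M m L lam \<tau> x (\<rho>/2^k) v" using \<rho> by (intro admits_smaller[OF av]) (auto simp: field_simps)
    have "(\<rho>/2^k)^(4*m) * energy m \<tau> x (\<rho>/2^Suc k) ((D1 ^^ (2*m)) v) \<le> B * energy m \<tau> x (\<rho>/2^k) v"
      using B(2)[OF av'] by (simp add: mult.commute)
    then have "(2^k)^(4*m) * \<rho>^(4*m*k) * ((\<rho>/2^k)^(4*m) * energy m \<tau> x (\<rho>/2^Suc k) ((D1 ^^ (2*m)) v)) \<le> (2^k)^(4*m) * \<rho>^(4*m*k) * (B * energy m \<tau> x (\<rho>/2^k) v)"
      using \<rho> by (intro mult_left_mono) auto
    also have "... = (2^k)^(4*m) * B * (\<rho>^(4*m*k) * energy m \<tau> x (\<rho>/2^k) v)" by (simp add: mult_ac)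
    also have "... \<le> (2^k)^(4*m) * B * (C * energy m \<tau> x \<rho> u)" using B by (intro mult_left_mono e) auto
    also have "(2^k)^(4*m) * \<rho>^(4*m*k) * ((\<rho>/2^k)^(4*m) * energy m \<tau> x (\<rho>/2^Suc k) ((D1 ^^ (2*m)) v)) = \<rho>^(4*m*Suc k) * energy m \<tau> x (\<rho>/2^Suc k) ((D1 ^^ (2*m)) v)"
    proof -
      have "(2^k)^(4*m) * \<rho>^(4*m*k) * (\<rho>/2^k)^(4*m) = \<rho>^(4*m*Suc k)" by (simp add: power_divide power_add)
      then show ?thesis by (simp only: mult.assoc[symmetric])
    qed
    finally show "admits \<delta> M m L lam \<tau> x \<rho> ((D1 ^^ (2*m*Suc k)) u) \<and> \<rho>^(4*m*Suc k) * energy m \<tau> x (\<rho>/2^Suc k) ((D1 ^^ (2*m*Suc k)) u) \<le> (2^k)^(4*m) * B * C * energy m \<tau> x \<rho> u"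
      unfolding v' using admits_D1_2m[OF av assms(1)] by (simp only: mult.assoc)
  qed
qed

text \<open>A bounds the normalised L^2 size of u, so the claim is invariant under parabolic
  scaling. The list holds the tangential directions and a is the normal order. C and \<sigma> are
  parameters, so that several orders can later share the same pair.\<close>

definition derivative_bound :: "'b::euclidean_space itself \<Rightarrow> ('d::{finite,linorder}) itself \<Rightarrow> real \<Rightarrow> real \<Rightarrow> nat \<Rightarrow> nat \<Rightarrow> nat \<Rightarrow> real \<Rightarrow> real \<Rightarrow> bool" where
  "derivative_bound T T' \<delta> M m a n C \<sigma> \<longleftrightarrow> (\<forall>(L :: real \<Rightarrow> 'b \<Rightarrow> 'b) lam \<tau> (x :: real ^ ('d::{finite,linorder})) \<rho> u js A z.
     admits \<delta> M m L lam \<tau> x \<rho> u \<longrightarrow> length js = n \<longrightarrow> first \<notin> set js \<longrightarrow> A \<ge> 0 \<longrightarrow>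
     energy m \<tau> x \<rho> u \<le> A\<^sup>2 * \<rho>^(2*m + CARD('d)) \<longrightarrow> z \<in> kbox m \<tau> x (\<sigma> * \<rho>) \<longrightarrow>
     \<rho>^(a+n) * norm ((D1 ^^ a) (foldr D_x js u) z) \<le> C * A)"

lemma derivative_boundD:
  fixes L :: "real \<Rightarrow> 'b::euclidean_space \<Rightarrow> 'b" and x :: "real ^ ('d::{finite,linorder})"
  assumes "derivative_bound TYPE('b) TYPE('d) \<delta> M m a n C \<sigma>" "admits \<delta> M m L lam \<tau> x \<rho> u" "length js = n" "first \<notin> set js" "A \<ge> 0"
     "energy m \<tau> x \<rho> u \<le> A\<^sup>2 * \<rho>^(2*m + CARD('d))" "z \<in> kbox m \<tau> x (\<sigma> * \<rho>)"
  shows "\<rho>^(a+n) * norm ((D1 ^^ a) (foldr D_x js u) z) \<le> C * A"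
  using assms unfolding derivative_bound_def by blast

lemma derivative_bound_mono:
  assumes "derivative_bound TYPE('b::euclidean_space) TYPE('d::{finite,linorder}) \<delta> M m a n C \<sigma>" "C \<le> C'" "0 < \<sigma>'" "\<sigma>' \<le> \<sigma>"
  shows "derivative_bound TYPE('b) TYPE('d) \<delta> M m a n C' \<sigma>'"
  unfolding derivative_bound_def
proof (intro allI impI)
  fix L :: "real \<Rightarrow> 'b \<Rightarrow> 'b" and lam \<tau> \<rho> A :: real and x :: "real ^ ('d::{finite,linorder})" and u :: "'d pt \<Rightarrow> 'b" and js :: "'d list" and z
  assume a: "admits \<delta> M m L lam \<tau> x \<rho> u" and js: "length js = n" "first \<notin> set js" and A: "A \<ge> 0"
    and e: "energy m \<tau> x \<rho> u \<le> A\<^sup>2 * \<rho>^(2*m + CARD('d))" and z: "z \<in> kbox m \<tau> x (\<sigma>' * \<rho>)"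
  have "kbox m \<tau> x (\<sigma>' * \<rho>) \<subseteq> kbox m \<tau> x (\<sigma> * \<rho>)" using admitsD(3)[OF a] assms by (intro kbox_mono mult_right_mono) auto
  with derivative_boundD[OF assms(1) a js A e] z have "\<rho>^(a+n) * norm ((D1 ^^ a) (foldr D_x js u) z) \<le> C * A" by blast
  also have "... \<le> C' * A" using A assms(2) by (rule mult_right_mono[rotated])
  finally show "\<rho>^(a+n) * norm ((D1 ^^ a) (foldr D_x js u) z) \<le> C' * A" .
qed

text \<open>Tangential derivatives followed by powers of D_1^(2m) lead to a function in the class on
  a box smaller by the factor 2^(n+k), and the pointwise bound for the class finishes.\<close>

lemma derivative_bound_2m:
  assumes "\<delta> > 0" "M \<ge> 0" "m \<ge> 1"
  shows "\<exists>C\<ge>0. \<exists>\<sigma>>0. \<sigma> \<le> 1 \<and> derivative_bound TYPE('b::euclidean_space) TYPE('d::{finite,linorder}) \<delta> M m (2*m*k) n C \<sigma>"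
proof -
  obtain C1 where C1: "C1 \<ge> 0" "\<And>(L :: real \<Rightarrow> 'b \<Rightarrow> 'b) lam \<tau> (x :: real ^ ('d::{finite,linorder})) \<rho> u js.
    admits \<delta> M m L lam \<tau> x \<rho> u \<Longrightarrow> length js = n \<Longrightarrow> first \<notin> set js \<Longrightarrow>
      admits \<delta> M m L lam \<tau> x \<rho> (foldr D_x js u) \<and> \<rho>^(2*n) * energy m \<tau> x (\<rho>/2^n) (foldr D_x js u) \<le> C1 * energy m \<tau> x \<rho> u"
    using energy_tangential[OF assms, of n] by blast
  obtain C2 where C2: "C2 \<ge> 0" "\<And>(L :: real \<Rightarrow> 'b \<Rightarrow> 'b) lam \<tau> (x :: real ^ ('d::{finite,linorder})) \<rho> u.
    admits \<delta> M m L lam \<tau> x \<rho> u \<Longrightarrow> admits \<delta> M m L lam \<tau> x \<rho> ((D1 ^^ (2*m*k)) u) \<and>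
    \<rho>^(4*m*k) * energy m \<tau> x (\<rho>/2^k) ((D1 ^^ (2*m*k)) u) \<le> C2 * energy m \<tau> x \<rho> u"
    using energy_D1_iterated[OF assms, of k] by blast
  let ?q = "2*m + CARD('d)"
  obtain C3 \<sigma> where C3: "C3 \<ge> 0" "\<sigma> > 0" "\<sigma> \<le> 1" "\<And>(L :: real \<Rightarrow> 'b::euclidean_space \<Rightarrow> 'b) lam \<tau> (x :: real ^ ('d::{finite,linorder})) \<rho> u z.
     admits \<delta> M m L lam \<tau> x \<rho> u \<Longrightarrow> z \<in> kbox m \<tau> x (\<sigma> * \<rho>) \<Longrightarrow> \<rho>^?q * (norm (u z))\<^sup>2 \<le> C3 * energy m \<tau> x \<rho> u"
    using sup_bound[OF assms] by blast
  define w where "w = (2::real)^(n+k)"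
  have w: "w \<ge> 1" unfolding w_def by (rule one_le_power) simp
  define D where "D = w^?q * C3 * (2^n)^(4*m*k) * C2 * C1"
  have D: "D \<ge> 0" using C1 C2 C3 w by (simp add: D_def)
  show ?thesis
  proof (rule exI[of _ "sqrt D"], intro conjI, use D in simp, rule exI[of _ "\<sigma>/w"], intro conjI)
    show "0 < \<sigma>/w" using C3(2) w by simp
    show "\<sigma>/w \<le> 1" using C3(2,3) w by (simp add: field_simps)
    show "derivative_bound TYPE('b) TYPE('d) \<delta> M m (2*m*k) n (sqrt D) (\<sigma>/w)"
      unfolding derivative_bound_def
    proof (intro allI impI)
      fix L :: "real \<Rightarrow> 'b \<Rightarrow> 'b" and lam \<tau> \<rho> A :: real and x :: "real ^ ('d::{finite,linorder})" and u :: "'d pt \<Rightarrow> 'b" and js :: "'d list" and z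
      assume a: "admits \<delta> M m L lam \<tau> x \<rho> u" and js: "length js = n" "first \<notin> set js" and A: "A \<ge> 0"
        and e: "energy m \<tau> x \<rho> u \<le> A\<^sup>2 * \<rho>^?q" and z: "z \<in> kbox m \<tau> x (\<sigma>/w * \<rho>)"
      have \<rho>: "\<rho> > 0" using admitsD(3)[OF a] .
      define u1 where "u1 = foldr D_x js u"
      have a1: "admits \<delta> M m L lam \<tau> x \<rho> u1" and e1: "\<rho>^(2*n) * energy m \<tau> x (\<rho>/2^n) u1 \<le> C1 * energy m \<tau> x \<rho> u"
        using C1(2)[OF a js] by (simp_all add: u1_def)
      have a1': "admits \<delta> M m L lam \<tau> x (\<rho>/2^n) u1" using \<rho> by (intro admits_smaller[OF a1]) (auto simp: field_simps)
      define v where "v = (D1 ^^ (2*m*k)) u1"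
      have a2: "admits \<delta> M m L lam \<tau> x (\<rho>/2^n) v" and e2: "(\<rho>/2^n)^(4*m*k) * energy m \<tau> x (\<rho>/2^n/2^k) v \<le> C2 * energy m \<tau> x (\<rho>/2^n) u1"
        using C2(2)[OF a1'] by (simp_all add: v_def)
      have rw: "\<rho>/2^n/2^k = \<rho>/w" by (simp add: w_def power_add)
      have a3: "admits \<delta> M m L lam \<tau> x (\<rho>/w) v" unfolding rw[symmetric] using \<rho> by (intro admits_smaller[OF a2]) (auto simp: field_simps)
      have e3: "(\<rho>/w)^?q * (norm (v z))\<^sup>2 \<le> C3 * energy m \<tau> x (\<rho>/w) v" using C3(4)[OF a3] z by simp
      have p1: "\<rho>^?q = w^?q * (\<rho>/w)^?q" using w by (simp only: power_mult_distrib[symmetric]) simp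
      have p2: "\<rho>^(4*m*k) = (2^n)^(4*m*k) * (\<rho>/2^n)^(4*m*k)" by (simp only: power_mult_distrib[symmetric]) simp
      have p3: "(\<rho>^(2*m*k+n))\<^sup>2 = \<rho>^(4*m*k) * \<rho>^(2*n)" by (simp add: power_add[symmetric] power_mult[symmetric] algebra_simps)
      have "\<rho>^?q * (\<rho>^(2*m*k+n) * norm (v z))\<^sup>2 = w^?q * \<rho>^(4*m*k) * \<rho>^(2*n) * ((\<rho>/w)^?q * (norm (v z))\<^sup>2)"
        unfolding power_mult_distrib p3 by (subst p1) (simp only: mult_ac)
      also have "... \<le> w^?q * \<rho>^(4*m*k) * \<rho>^(2*n) * (C3 * energy m \<tau> x (\<rho>/w) v)"
        using w \<rho> by (intro mult_left_mono e3) auto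
      also have "... = w^?q * C3 * \<rho>^(2*n) * (2^n)^(4*m*k) * ((\<rho>/2^n)^(4*m*k) * energy m \<tau> x (\<rho>/2^n/2^k) v)"
        unfolding rw by (subst p2) (simp only: mult_ac)
      also have "... \<le> w^?q * C3 * \<rho>^(2*n) * (2^n)^(4*m*k) * (C2 * energy m \<tau> x (\<rho>/2^n) u1)"
        using w \<rho> C3(1) by (intro mult_left_mono e2) auto
      also have "... = w^?q * C3 * (2^n)^(4*m*k) * C2 * (\<rho>^(2*n) * energy m \<tau> x (\<rho>/2^n) u1)" by (simp only: mult_ac)
      also have "... \<le> w^?q * C3 * (2^n)^(4*m*k) * C2 * (C1 * energy m \<tau> x \<rho> u)"
        using w C3(1) C2(1) by (intro mult_left_mono e1) auto
      also have "... = D * energy m \<tau> x \<rho> u" by (simp only: D_def mult_ac)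
      also have "... \<le> D * (A\<^sup>2 * \<rho>^?q)" using D by (intro mult_left_mono e)
      finally have "\<rho>^?q * (\<rho>^(2*m*k+n) * norm (v z))\<^sup>2 \<le> \<rho>^?q * (D * A\<^sup>2)" by (simp only: mult_ac)
      then have "(\<rho>^(2*m*k+n) * norm (v z))\<^sup>2 \<le> D * A\<^sup>2" using \<rho> by (simp only: mult_le_cancel_left_pos zero_less_power)
      also have "... = (sqrt D * A)\<^sup>2" using D by (simp add: power_mult_distrib)
      finally show "\<rho>^(2*m*k+n) * norm ((D1 ^^ (2*m*k)) (foldr D_x js u) z) \<le> sqrt D * A"
        unfolding v_def u1_def by (rule power2_le_imp_le) (use D A in simp)
    qed
  qed
qed

text \<open>The normal order a need not be divisible by 2m; it is interpolated along x_1 between the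
  orders 0 and K = 2ma, both of which are covered by the preceding lemma.\<close>

lemma derivative_bound:
  assumes "\<delta> > 0" "M \<ge> 0" "m \<ge> 1"
  shows "\<exists>C\<ge>0. \<exists>\<sigma>>0. \<sigma> \<le> 1 \<and> derivative_bound TYPE('b::euclidean_space) TYPE('d::{finite,linorder}) \<delta> M m a n C \<sigma>"
proof -
  define K where "K = 2*m*a"
  have aK: "a \<le> K" using assms(3) by (simp add: K_def)
  obtain C1 \<sigma>1 where C1: "C1 \<ge> 0" "\<sigma>1 > 0" "\<sigma>1 \<le> 1" "derivative_bound TYPE('b) TYPE('d) \<delta> M m 0 n C1 \<sigma>1"
    using derivative_bound_2m[OF assms, of 0 n] by auto
  obtain C2 \<sigma>2 where C2: "C2 \<ge> 0" "\<sigma>2 > 0" "\<sigma>2 \<le> 1" "derivative_bound TYPE('b) TYPE('d) \<delta> M m K n C2 \<sigma>2"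
    using derivative_bound_2m[OF assms, of a n] unfolding K_def by auto
  obtain C3 where "C3 \<ge> 0 \<and> (\<forall>(f :: nat \<Rightarrow> real \<Rightarrow> 'b) \<alpha> \<beta> P. \<alpha> < \<beta> \<longrightarrow> deriv_chain K \<alpha> \<beta> f \<longrightarrow>
    (\<forall>s\<in>{\<alpha>..\<beta>}. norm (f 0 s) \<le> P) \<longrightarrow> (\<forall>s\<in>{\<alpha>..\<beta>}. (\<beta> - \<alpha>)^K * norm (f K s) \<le> P) \<longrightarrow>
    (\<forall>a\<le>K. \<forall>s\<in>{\<alpha>..\<beta>}. (\<beta> - \<alpha>)^a * norm (f a s) \<le> C3 * P))"
    by (rule exE[OF slice_derivative_interpolation])
  note C3 = conjunct1[OF this] conjunct2[OF this, rule_format]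
  define \<sigma> where "\<sigma> = min \<sigma>1 \<sigma>2"
  have \<sigma>: "\<sigma> > 0" "\<sigma> \<le> 1" "\<sigma> \<le> \<sigma>1" "\<sigma> \<le> \<sigma>2" using C1 C2 by (auto simp: \<sigma>_def)
  note b1 = derivative_bound_mono[OF C1(4) order_refl \<sigma>(1,3)]
  note b2 = derivative_bound_mono[OF C2(4) order_refl \<sigma>(1,4)]
  define C where "C = C3 * (C1 + 2^K * C2) / \<sigma>^a"
  have C: "C \<ge> 0" using C1 C2 C3 \<sigma> by (simp add: C_def)
  show ?thesis
  proof (rule exI[of _ C], intro conjI C, rule exI[of _ \<sigma>], intro conjI \<sigma>)
    show "derivative_bound TYPE('b) TYPE('d) \<delta> M m a n C \<sigma>"
      unfolding derivative_bound_def
    proof (intro allI impI)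
      fix L :: "real \<Rightarrow> 'b \<Rightarrow> 'b" and lam \<tau> \<rho> A :: real and x :: "real ^ ('d::{finite,linorder})" and u :: "'d pt \<Rightarrow> 'b" and js :: "'d list" and z
      assume a: "admits \<delta> M m L lam \<tau> x \<rho> u" and js: "length js = n" "first \<notin> set js" and A: "A \<ge> 0"
        and e: "energy m \<tau> x \<rho> u \<le> A\<^sup>2 * \<rho>^(2*m + CARD('d))" and z: "z \<in> kbox m \<tau> x (\<sigma> * \<rho>)"
      have \<rho>: "\<rho> > 0" and x: "x $ first \<ge> 0" and u: "C_inf_loc u" using admitsD[OF a] by auto
      define u1 where "u1 = foldr D_x js u"
      have u1: "C_inf_loc u1" unfolding u1_def using u by (induction js) (auto intro: C_inf_loc_D_x1)
      define r where "r = \<sigma> * \<rho>"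
      have r: "r > 0" "r \<le> \<rho>" using \<sigma> \<rho> by (auto simp: r_def mult_left_le_one_le)
      have K: "half_box (lo m \<tau> x r) (hi \<tau> x r)" by (rule half_box_kbox[OF r(1) x])
      have z: "z \<in> kbox m \<tau> x r" using z by (simp add: r_def)
      let ?i = "e_x first :: 'd pt"
      define \<alpha> \<beta> where "\<alpha> = lo m \<tau> x r \<bullet> ?i" and "\<beta> = hi \<tau> x r \<bullet> ?i"
      have len: "r \<le> \<beta> - \<alpha>" "\<beta> - \<alpha> \<le> 2 * \<rho>" unfolding \<alpha>_def \<beta>_def lo_hi_inner using r x by auto
      have in_box: "slice ?i z s \<in> kbox m \<tau> x (\<sigma> * \<rho>)" if "s \<in> {\<alpha>..\<beta>}" for s
        unfolding r_def[symmetric] by (rule slice_in_cbox[OF Basis_pt_simps(2) z]) (use that in \<open>simp add: \<alpha>_def \<beta>_def\<close>)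
      define f where "f j s = (D1 ^^ j) u1 (slice ?i z s)" for j s
      have dc: "deriv_chain K \<alpha> \<beta> f" unfolding f_def \<alpha>_def \<beta>_def by (rule deriv_chain_slice[OF u1 K z])
      define P where "P = (C1 + 2^K * C2) * A / \<rho>^n"
      have "norm (f 0 s) \<le> P" if s: "s \<in> {\<alpha>..\<beta>}" for s
      proof -
        have "\<rho>^n * norm (f 0 s) \<le> C1 * A"
          using derivative_boundD[OF b1 a js A e in_box[OF s]] by (simp add: f_def u1_def)
        also have "... \<le> (C1 + 2^K * C2) * A" using C2 A by (intro mult_right_mono) auto
        finally show ?thesis using \<rho> by (simp add: P_def pos_le_divide_eq mult.commute)
      qed
      moreover have "(\<beta> - \<alpha>)^K * norm (f K s) \<le> P" if s: "s \<in> {\<alpha>..\<beta>}" for s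
      proof -
        have "(\<beta> - \<alpha>)^K * norm (f K s) \<le> (2 * \<rho>)^K * norm (f K s)" using len r by (intro mult_right_mono power_mono) auto
        then have "\<rho>^n * ((\<beta> - \<alpha>)^K * norm (f K s)) \<le> \<rho>^n * ((2 * \<rho>)^K * norm (f K s))" using \<rho> by (intro mult_left_mono) auto
        also have "... = 2^K * (\<rho>^(K+n) * norm (f K s))" by (simp add: power_add power_mult_distrib)
        also have "... \<le> 2^K * (C2 * A)"
          using derivative_boundD[OF b2 a js A e in_box[OF s]] by (intro mult_left_mono) (auto simp: f_def u1_def)
        also have "... \<le> (C1 + 2^K * C2) * A" using C1 A by (simp add: distrib_right)
        finally show ?thesis using \<rho> by (simp add: P_def pos_le_divide_eq mult.commute)
      qed
      moreover have zs: "z \<bullet> ?i \<in> {\<alpha>..\<beta>}" using z Basis_pt_simps(2)[of first] unfolding \<alpha>_def \<beta>_def mem_box by (simp del: inner_e_x)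
      ultimately have "(\<beta> - \<alpha>)^a * norm (f a (z \<bullet> ?i)) \<le> C3 * P" using len r by (intro C3(2)[OF _ dc _ _ aK]) auto
      moreover have "f a (z \<bullet> ?i) = (D1 ^^ a) u1 z" unfolding f_def slice_self ..
      moreover have "(\<sigma> * \<rho>)^a * norm ((D1 ^^ a) u1 z) \<le> (\<beta> - \<alpha>)^a * norm ((D1 ^^ a) u1 z)"
        using len(1) r unfolding r_def by (intro mult_right_mono power_mono) auto
      ultimately have "(\<sigma> * \<rho>)^a * norm ((D1 ^^ a) u1 z) \<le> C3 * P" by simp
      then have "\<rho>^n / \<sigma>^a * ((\<sigma> * \<rho>)^a * norm ((D1 ^^ a) u1 z)) \<le> \<rho>^n / \<sigma>^a * (C3 * P)"
        using \<rho> \<sigma> by (intro mult_left_mono) auto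
      moreover have "\<rho>^n / \<sigma>^a * ((\<sigma> * \<rho>)^a * norm ((D1 ^^ a) u1 z)) = \<rho>^(a+n) * norm ((D1 ^^ a) u1 z)"
        using \<sigma>(1) by (simp add: power_mult_distrib power_add)
      moreover have "\<rho>^n / \<sigma>^a * (C3 * P) = C * A" using \<rho> by (simp add: C_def P_def)
      ultimately show "\<rho>^(a+n) * norm ((D1 ^^ a) (foldr D_x js u) z) \<le> C * A" by (simp add: u1_def)
    qed
  qed
qed

lemma derivative_bound_common:
  assumes "\<delta> > 0" "M \<ge> 0" "m \<ge> 1" "finite I"
  shows "\<exists>C\<ge>0. \<exists>\<sigma>>0. \<sigma> \<le> 1 \<and> (\<forall>(a, n)\<in>I. derivative_bound TYPE('b::euclidean_space) TYPE('d::{finite,linorder}) \<delta> M m a n C \<sigma>)"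
  using assms(4)
proof induction
  case empty
  show ?case by (intro exI[of _ 0] conjI exI[of _ 1]) auto
next
  case (insert p I)
  obtain a n where p: "p = (a, n)" by (cases p)
  from insert.IH obtain C \<sigma> where 1: "C \<ge> 0" "\<sigma> > 0" "\<sigma> \<le> 1" "\<forall>(a, n)\<in>I. derivative_bound TYPE('b) TYPE('d) \<delta> M m a n C \<sigma>"
    by auto
  obtain C' \<sigma>' where 2: "C' \<ge> 0" "\<sigma>' > 0" "\<sigma>' \<le> 1" "derivative_bound TYPE('b) TYPE('d) \<delta> M m a n C' \<sigma>'"
    using derivative_bound[OF assms(1-3), of a n] by auto
  have "derivative_bound TYPE('b) TYPE('d) \<delta> M m a' n' (max C C') (min \<sigma> \<sigma>')" if "(a', n') \<in> insert p I" for a' n'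
  proof (cases "(a', n') \<in> I")
    case True
    then have "derivative_bound TYPE('b) TYPE('d) \<delta> M m a' n' C \<sigma>" using 1(4) by blast
    from derivative_bound_mono[OF this, of "max C C'" "min \<sigma> \<sigma>'"] show ?thesis using 1(2) 2(2) by simp
  next
    case False
    then have "a' = a" "n' = n" using that p by auto
    then show ?thesis using derivative_bound_mono[OF 2(4), of "max C C'" "min \<sigma> \<sigma>'"] 1 2 by auto
  qed
  then show ?case using 1 2 by (intro exI[of _ "max C C'"] conjI exI[of _ "min \<sigma> \<sigma>'"]) auto
qed

text \<open>On a quarter of the box the energy of u is smaller by the factor (\<lambda>
  \<rho>^(2m))^(-2). The derivative bound is applied there with A divided by \<lambda> \<rho>^(2m),
  up to a constant, whence the separate case \<lambda> = 0.\<close>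

lemma derivative_bound_lam:
  assumes "\<delta> > 0" "M \<ge> 0" "m \<ge> 1"
  shows "\<exists>C\<ge>0. \<exists>\<sigma>>0. \<sigma> \<le> 1 \<and> (\<forall>(L :: real \<Rightarrow> 'b::euclidean_space \<Rightarrow> 'b) lam \<tau> (x :: real ^ ('d::{finite,linorder})) \<rho> u js A z.
     admits \<delta> M m L lam \<tau> x \<rho> u \<longrightarrow> length js = n \<longrightarrow> first \<notin> set js \<longrightarrow> A \<ge> 0 \<longrightarrow>
     energy m \<tau> x \<rho> u \<le> A\<^sup>2 * \<rho>^(2*m + CARD('d)) \<longrightarrow> z \<in> kbox m \<tau> x (\<sigma> * \<rho>) \<longrightarrow>
     lam * \<rho>^(2*m) * (\<rho>^(a+n) * norm ((D1 ^^ a) (foldr D_x js u) z)) \<le> C * A)"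
proof -
  obtain B where B: "B \<ge> 0" "\<And>(L :: real \<Rightarrow> 'b \<Rightarrow> 'b) lam \<tau> (x :: real ^ ('d::{finite,linorder})) \<rho> u.
    admits \<delta> M m L lam \<tau> x \<rho> u \<Longrightarrow> lam\<^sup>2 * \<rho>^(4*m) * energy m \<tau> x (\<rho>/4) u \<le> B * energy m \<tau> x \<rho> u"
    using energy_lam2[OF assms] by blast
  obtain C \<sigma> where C: "C \<ge> 0" "\<sigma> > 0" "\<sigma> \<le> 1" "derivative_bound TYPE('b) TYPE('d) \<delta> M m a n C \<sigma>"
    using derivative_bound[OF assms, of a n] by auto
  let ?q = "2*m + CARD('d)"
  define D where "D = 4^(a+n) * C * sqrt (B * 4^?q)"
  have D: "D \<ge> 0" using B C by (simp add: D_def)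
  show ?thesis
  proof (rule exI[of _ D], intro conjI D, rule exI[of _ "\<sigma>/4"], intro conjI allI impI)
    fix L :: "real \<Rightarrow> 'b \<Rightarrow> 'b" and lam \<tau> \<rho> A :: real and x :: "real ^ ('d::{finite,linorder})" and u :: "'d pt \<Rightarrow> 'b" and js :: "'d list" and z
    assume a: "admits \<delta> M m L lam \<tau> x \<rho> u" and js: "length js = n" "first \<notin> set js" and A: "A \<ge> 0"
      and e: "energy m \<tau> x \<rho> u \<le> A\<^sup>2 * \<rho>^?q" and z: "z \<in> kbox m \<tau> x (\<sigma>/4 * \<rho>)"
    have \<rho>: "\<rho> > 0" and lam0: "lam \<ge> 0" using admitsD[OF a] by auto
    show "lam * \<rho>^(2*m) * (\<rho>^(a+n) * norm ((D1 ^^ a) (foldr D_x js u) z)) \<le> D * A"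
    proof (cases "lam = 0")
      case True
      then show ?thesis using D A by simp
    next
      case False
      then have lam: "lam > 0" using lam0 by simp
      let ?l = "lam * \<rho>^(2*m)"
      have l: "?l > 0" using lam \<rho> by simp
      have l2: "?l\<^sup>2 = lam\<^sup>2 * \<rho>^(4*m)" by (simp add: power_mult_distrib power_mult[symmetric] mult.commute)
      have \<rho>4: "(\<rho>/4)^?q * 4^?q = \<rho>^?q" by (simp only: power_mult_distrib[symmetric]) simp
      define A' where "A' = sqrt (B * 4^?q) * A / ?l"
      have A': "A' \<ge> 0" using A B l by (simp add: A'_def)
      have a4: "admits \<delta> M m L lam \<tau> x (\<rho>/4) u" by (rule admits_smaller[OF a]) (use \<rho> in auto)
      have "?l\<^sup>2 * energy m \<tau> x (\<rho>/4) u \<le> B * (A\<^sup>2 * \<rho>^?q)"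
        unfolding l2 by (rule order_trans[OF B(2)[OF a] mult_left_mono[OF e B(1)]])
      also have "... = ?l\<^sup>2 * (A'\<^sup>2 * (\<rho>/4)^?q)"
      proof -
        have "?l * A' = sqrt (B * 4^?q) * A" unfolding A'_def using lam \<rho> by simp
        then have "?l\<^sup>2 * A'\<^sup>2 = (B * 4^?q) * A\<^sup>2" unfolding power_mult_distrib[symmetric] using B(1) by (simp add: power_mult_distrib)
        then show ?thesis unfolding \<rho>4[symmetric] by (simp only: mult.assoc[symmetric]) (simp only: mult_ac)
      qed
      finally have "energy m \<tau> x (\<rho>/4) u \<le> A'\<^sup>2 * (\<rho>/4)^?q" using l by (simp only: mult_le_cancel_left_pos zero_less_power)
      from derivative_boundD[OF C(4) a4 js A' this] z
      have "(\<rho>/4)^(a+n) * norm ((D1 ^^ a) (foldr D_x js u) z) \<le> C * A'" by simp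
      then have "?l * 4^(a+n) * ((\<rho>/4)^(a+n) * norm ((D1 ^^ a) (foldr D_x js u) z)) \<le> ?l * 4^(a+n) * (C * A')"
        using l by (intro mult_left_mono) auto
      also have "... = D * A" unfolding A'_def D_def using lam \<rho> by simp
      also have "?l * 4^(a+n) * ((\<rho>/4)^(a+n) * norm ((D1 ^^ a) (foldr D_x js u) z)) = ?l * ((4^(a+n) * (\<rho>/4)^(a+n)) * norm ((D1 ^^ a) (foldr D_x js u) z))"
        by (simp only: mult_ac)
      also have "4^(a+n) * (\<rho>/4)^(a+n) = \<rho>^(a+n)" by (simp only: power_mult_distrib[symmetric]) simp
      finally show ?thesis .
    qed
  qed (use C in auto)
qed

section \<open>Oscillation on small boxes\<close>

lemma box_increment:
  fixes w :: "('d::{finite,linorder}) pt \<Rightarrow> 'b::euclidean_space"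
  assumes w: "C_inf_loc w" and K: "half_box a b" and B: "\<And>i y. i \<in> Basis \<Longrightarrow> y \<in> cbox a b \<Longrightarrow> norm (partial i w y) \<le> B i"
    and z: "z \<in> cbox a b" "z' \<in> cbox a b"
  shows "norm (w z - w z') \<le> 3 * (\<Sum>i\<in>Basis. \<bar>z \<bullet> i - z' \<bullet> i\<bar> * B i)"
proof -
  have Kb: "cbox a b \<subseteq> O_bar" using K by (simp add: half_box_def)
  \<comment> \<open>The factor 3 is 2 + 1: the error of linearisation is controlled by the variation
    2 B of the derivative, and the linear term itself adds B.\<close>
  have step: "norm (w (slice i y s) - w y) \<le> 3 * (\<bar>s - y \<bullet> i\<bar> * B i)"
    if i: "i \<in> Basis" and y: "y \<in> cbox a b" and s: "s \<in> {a \<bullet> i..b \<bullet> i}" for i y s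
  proof -
    have yi: "y \<bullet> i \<in> {a \<bullet> i..b \<bullet> i}" using y i by (auto simp: mem_box)
    let ?f = "\<lambda>t. w (slice i y t)" and ?f' = "\<lambda>t. partial i w (slice i y t)"
    have bd: "norm (?f' t) \<le> B i" if "t \<in> {a \<bullet> i..b \<bullet> i}" for t
      by (rule B[OF i slice_in_cbox[OF i y that]])
    have "norm (?f s - ?f (y \<bullet> i) - (s - y \<bullet> i) *\<^sub>R ?f' (y \<bullet> i)) \<le> norm (s - y \<bullet> i) * (2 * B i)"
    proof (rule vector_differentiable_bound_linearization[where S="{a \<bullet> i..b \<bullet> i}" and f'="?f'"])
      show "(?f has_vector_derivative ?f' t) (at t within {a \<bullet> i..b \<bullet> i})" if "t \<in> {a \<bullet> i..b \<bullet> i}" for t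
        by (rule partial_on_slice[OF w i Kb y that])
      show "closed_segment (y \<bullet> i) s \<subseteq> {a \<bullet> i..b \<bullet> i}" using yi s by (intro closed_segment_subset) auto
      show "norm (?f' t - ?f' (y \<bullet> i)) \<le> 2 * B i" if "t \<in> {a \<bullet> i..b \<bullet> i}" for t
        using norm_triangle_ineq4[of "?f' t" "?f' (y \<bullet> i)"] bd[OF that] bd[OF yi] by linarith
    qed (rule yi)
    then have "norm (?f s - ?f (y \<bullet> i)) \<le> \<bar>s - y \<bullet> i\<bar> * (2 * B i) + \<bar>s - y \<bullet> i\<bar> * norm (?f' (y \<bullet> i))"
      using norm_triangle_sub[of "?f s - ?f (y \<bullet> i)" "(s - y \<bullet> i) *\<^sub>R ?f' (y \<bullet> i)"] by simp
    also have "... \<le> \<bar>s - y \<bullet> i\<bar> * (2 * B i) + \<bar>s - y \<bullet> i\<bar> * B i"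
      using bd[OF yi] by (intro add_left_mono mult_left_mono) auto
    finally show ?thesis by (simp add: slice_self mult_ac)
  qed
  \<comment> \<open>One coordinate at a time is changed to that of z'; all intermediate points stay
    in the box because it is a product.\<close>
  have "norm (w z - w z') \<le> 3 * (\<Sum>i\<in>S. \<bar>z \<bullet> i - z' \<bullet> i\<bar> * B i)"
    if "finite S" "S \<subseteq> Basis" "z \<in> cbox a b" "z' \<in> cbox a b" "\<And>i. i \<in> Basis - S \<Longrightarrow> z \<bullet> i = z' \<bullet> i" for S z z'
    using that
  proof (induction S arbitrary: z)
    case empty
    then have "z = z'" by - (rule euclidean_eqI, auto)
    then show ?case by simp
  next
    case (insert i S)
    have i: "i \<in> Basis" and zi: "z' \<bullet> i \<in> {a \<bullet> i..b \<bullet> i}" using insert.prems by (auto simp: mem_box)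
    let ?y = "slice i z (z' \<bullet> i)"
    have y: "?y \<in> cbox a b" by (rule slice_in_cbox[OF i insert.prems(2) zi])
    have yj: "?y \<bullet> j = (if j = i then z' \<bullet> i else z \<bullet> j)" if "j \<in> Basis" for j using slice_inner[OF i that] by simp
    have "norm (w ?y - w z') \<le> 3 * (\<Sum>j\<in>S. \<bar>?y \<bullet> j - z' \<bullet> j\<bar> * B j)"
      by (rule insert.IH[OF _ y insert.prems(3)]) (use insert.prems yj in auto)
    also have "(\<Sum>j\<in>S. \<bar>?y \<bullet> j - z' \<bullet> j\<bar> * B j) = (\<Sum>j\<in>S. \<bar>z \<bullet> j - z' \<bullet> j\<bar> * B j)"
    proof (rule sum.cong[OF refl])
      fix j assume "j \<in> S"
      then have "j \<in> Basis" "j \<noteq> i" using insert.hyps insert.prems(1) by auto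
      then show "\<bar>?y \<bullet> j - z' \<bullet> j\<bar> * B j = \<bar>z \<bullet> j - z' \<bullet> j\<bar> * B j" by (simp add: yj)
    qed
    finally have 1: "norm (w ?y - w z') \<le> 3 * (\<Sum>j\<in>S. \<bar>z \<bullet> j - z' \<bullet> j\<bar> * B j)" .
    have 2: "norm (w z - w ?y) \<le> 3 * (\<bar>z \<bullet> i - z' \<bullet> i\<bar> * B i)"
      using step[OF i insert.prems(2) zi] by (simp add: norm_minus_commute abs_minus_commute)
    have "norm (w z - w z') \<le> norm (w z - w ?y) + norm (w ?y - w z')"
      using norm_triangle_ineq[of "w z - w ?y" "w ?y - w z'"] by simp
    then show ?case using 1 2 insert.hyps by simp
  qed
  from this[OF finite_Basis order_refl z] show ?thesis by simp
qed

lemma C_inf_loc_foldr: "C_inf_loc u \<Longrightarrow> C_inf_loc (foldr D_x js u)"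
  by (induction js) (auto intro: C_inf_loc_D_x1)

lemma D_x_funpow_foldr:
  fixes u :: "('d::{finite,linorder}) pt \<Rightarrow> 'b::euclidean_space"
  assumes u: "C_inf_loc u" and y: "y \<in> O_bar"
  shows "(D_x j ^^ k) ((D1 ^^ a) (foldr D_x js u)) y = (D1 ^^ a) (foldr D_x (replicate k j @ js) u) y"
proof -
  have "(partial (e_x j) ^^ k) ((partial (e_x first) ^^ a) (foldr D_x js u)) y = (partial (e_x first) ^^ a) ((partial (e_x j) ^^ k) (foldr D_x js u)) y"
    by (rule partial_funpow_funpow_commute[OF C_inf_loc_foldr[OF u] _ _ y]) auto
  then show ?thesis by (simp add: D_x_def)
qed

text \<open>A spatial increment costs one further derivative and gains r/\<rho>. In time the
  increment is r^(2m) times w_t, which the equation for w bounds by derivatives of 2m higher order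
  and by \<lambda> w; the resulting (r/\<rho>)^(2m) is at most r/\<rho>.\<close>

lemma oscillation:
  assumes "\<delta> > 0" "M \<ge> 0" "m \<ge> 1"
  shows "\<exists>C\<ge>0. \<exists>\<sigma>>0. \<sigma> \<le> 1 \<and> (\<forall>(L :: real \<Rightarrow> 'b::euclidean_space \<Rightarrow> 'b) lam \<tau> (x :: real ^ ('d::{finite,linorder})) \<rho> u js A r z z'.
     admits \<delta> M m L lam \<tau> x \<rho> u \<longrightarrow> length js = n \<longrightarrow> first \<notin> set js \<longrightarrow> A \<ge> 0 \<longrightarrow>
     energy m \<tau> x \<rho> u \<le> A\<^sup>2 * \<rho>^(2*m + CARD('d)) \<longrightarrow> 0 < r \<longrightarrow> r \<le> \<sigma> * \<rho> \<longrightarrow> z \<in> kbox m \<tau> x r \<longrightarrow> z' \<in> kbox m \<tau> x r \<longrightarrow>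
     \<rho>^(a+n) * norm ((D1 ^^ a) (foldr D_x js u) z - (D1 ^^ a) (foldr D_x js u) z') \<le> C * A * (r / \<rho>))"
proof -
  \<comment> \<open>The orders reached from (a, n) by one more normal or tangential derivative, for
    increments in space, and by 2m more of either kind, for the spatial operator in the
    equation.\<close>
  let ?I = "{(Suc a, n), (a, Suc n), (2*m + a, n), (a, 2*m + n)}"
  obtain C0 \<sigma>0 where C0: "C0 \<ge> 0" "\<sigma>0 > 0" "\<sigma>0 \<le> 1" "\<forall>(a, n)\<in>?I. derivative_bound TYPE('b) TYPE('d) \<delta> M m a n C0 \<sigma>0"
    using derivative_bound_common[OF assms, of ?I] by auto
  obtain C1 \<sigma>1 where C1: "C1 \<ge> 0" "\<sigma>1 > 0" "\<sigma>1 \<le> 1" "\<And>(L :: real \<Rightarrow> 'b \<Rightarrow> 'b) lam \<tau> (x :: real ^ ('d::{finite,linorder})) \<rho> u js A z.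
     admits \<delta> M m L lam \<tau> x \<rho> u \<Longrightarrow> length js = n \<Longrightarrow> first \<notin> set js \<Longrightarrow> A \<ge> 0 \<Longrightarrow>
     energy m \<tau> x \<rho> u \<le> A\<^sup>2 * \<rho>^(2*m + CARD('d)) \<Longrightarrow> z \<in> kbox m \<tau> x (\<sigma>1 * \<rho>) \<Longrightarrow>
     lam * \<rho>^(2*m) * (\<rho>^(a+n) * norm ((D1 ^^ a) (foldr D_x js u) z)) \<le> C1 * A"
    using derivative_bound_lam[OF assms, of n a] by blast
  define \<sigma> where "\<sigma> = min \<sigma>0 \<sigma>1"
  have \<sigma>: "\<sigma> > 0" "\<sigma> \<le> 1" "\<sigma> \<le> \<sigma>0" "\<sigma> \<le> \<sigma>1" using C0 C1 by (auto simp: \<sigma>_def)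
  define M0 where "M0 = max M 1"
  have M0: "M \<le> M0" "1 \<le> M0" by (auto simp: M0_def)
  let ?d = "real CARD('d)"
  define E where "E = 2 * M0\<^sup>2 * ?d * ?d * C0\<^sup>2 + 2 * C1\<^sup>2"
  have E: "E \<ge> 0" by (simp add: E_def)
  define C where "C = 3 * (sqrt E + 2 * ?d * C0)"
  have C: "C \<ge> 0" using E C0 by (simp add: C_def)
  show ?thesis
  proof (rule exI[of _ C], intro conjI C, rule exI[of _ \<sigma>], intro conjI \<sigma> allI impI)
    fix L :: "real \<Rightarrow> 'b \<Rightarrow> 'b" and lam \<tau> \<rho> A r :: real and x :: "real ^ ('d::{finite,linorder})" and u :: "'d pt \<Rightarrow> 'b" and js :: "'d list" and z z'
    assume a: "admits \<delta> M m L lam \<tau> x \<rho> u" and js: "length js = n" "first \<notin> set js" and A: "A \<ge> 0"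
      and e: "energy m \<tau> x \<rho> u \<le> A\<^sup>2 * \<rho>^(2*m + CARD('d))" and r: "0 < r" "r \<le> \<sigma> * \<rho>"
      and z: "z \<in> kbox m \<tau> x r" and z': "z' \<in> kbox m \<tau> x r"
    have \<rho>: "\<rho> > 0" and x: "x $ first \<ge> 0" and u: "C_inf_loc u" and lam: "lam \<ge> 0" using admitsD[OF a] by auto
    have "\<sigma> * \<rho> \<le> 1 * \<rho>" using \<sigma>(2) \<rho> by (intro mult_right_mono) auto
    then have r\<rho>: "r \<le> \<rho>" using r by linarith
    define w where "w = (D1 ^^ a) (foldr D_x js u)"
    have wC: "C_inf_loc w" unfolding w_def by (intro C_inf_loc_D_x C_inf_loc_foldr u)
    have K: "half_box (lo m \<tau> x r) (hi \<tau> x r)" by (rule half_box_kbox[OF r(1) x])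
    have sub: "kbox m \<tau> x r \<subseteq> kbox m \<tau> x (\<sigma>0 * \<rho>)" "kbox m \<tau> x r \<subseteq> kbox m \<tau> x (\<sigma>1 * \<rho>)" "kbox m \<tau> x r \<subseteq> kbox m \<tau> x \<rho>"
    proof -
      have "\<sigma> * \<rho> \<le> \<sigma>0 * \<rho>" "\<sigma> * \<rho> \<le> \<sigma>1 * \<rho>" using \<sigma>(3,4) \<rho> by (auto intro: mult_right_mono)
      then have "r \<le> \<sigma>0 * \<rho>" "r \<le> \<sigma>1 * \<rho>" using r(2) by linarith+
      then show "kbox m \<tau> x r \<subseteq> kbox m \<tau> x (\<sigma>0 * \<rho>)" "kbox m \<tau> x r \<subseteq> kbox m \<tau> x (\<sigma>1 * \<rho>)" "kbox m \<tau> x r \<subseteq> kbox m \<tau> x \<rho>"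
        using r(1) r\<rho> by (intro kbox_mono; simp)+
    qed
    have inO: "y \<in> O_bar" if "y \<in> kbox m \<tau> x r" for y using that K by (auto simp: half_box_def)
    have bd: "norm ((D1 ^^ a') (foldr D_x js' u) y) \<le> C0 * A / \<rho>^(a'+n')"
      if "(a', n') \<in> ?I" "length js' = n'" "first \<notin> set js'" "y \<in> kbox m \<tau> x r" for a' n' js' y
    proof -
      have "derivative_bound TYPE('b) TYPE('d) \<delta> M m a' n' C0 \<sigma>0" using C0(4) that(1) by blast
      from derivative_boundD[OF this a that(2,3) A e subsetD[OF sub(1) that(4)]]
      show ?thesis using \<rho> by (simp add: pos_le_divide_eq mult.commute)
    qed
    have Dx: "norm (D_x j w y) \<le> C0 * A / \<rho>^(a+n+1)" if y: "y \<in> kbox m \<tau> x r" for j y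
    proof (cases "j = first")
      case True
      then show ?thesis using bd[of "Suc a" n js y] js y by (simp add: w_def)
    next
      case False
      have "D_x j w y = (D1 ^^ a) (foldr D_x (j # js) u) y"
        using D_x_funpow_foldr[OF u inO[OF y], where j=j and k=1 and a=a and js=js] by (simp add: w_def)
      then show ?thesis using bd[of a "Suc n" "j # js" y] js y False by simp
    qed
    let ?e = "a + n + 2*m"
    have Dx2m: "norm ((D_x j ^^ (2*m)) w y) \<le> C0 * A / \<rho>^?e" if y: "y \<in> kbox m \<tau> x r" for j y
    proof (cases "j = first")
      case True
      have "(D1 ^^ (2*m)) w = (D1 ^^ (2*m + a)) (foldr D_x js u)" by (simp only: w_def funpow_add o_apply)
      then show ?thesis using bd[of "2*m + a" n js y] js y True by (simp add: add_ac)
    next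
      case False
      have "(D_x j ^^ (2*m)) w y = (D1 ^^ a) (foldr D_x (replicate (2*m) j @ js) u) y"
        using D_x_funpow_foldr[OF u inO[OF y], where j=j and k="2*m" and a=a and js=js] by (simp add: w_def)
      then show ?thesis using bd[of a "2*m + n" "replicate (2*m) j @ js" y] js y False by (simp add: add_ac)
    qed
    have lw: "lam * norm (w y) \<le> C1 * A / \<rho>^?e" if y: "y \<in> kbox m \<tau> x r" for y
    proof -
      have "lam * \<rho>^(2*m) * (\<rho>^(a+n) * norm (w y)) \<le> C1 * A"
        unfolding w_def using C1(4)[OF a js A e, of y] y sub(2) by blast
      then have "(lam * norm (w y)) * \<rho>^?e \<le> C1 * A" by (simp add: power_add mult_ac)
      then show ?thesis using \<rho> by (simp add: pos_le_divide_eq)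
    qed
    have "solves m L lam (lo m \<tau> x \<rho>) (hi \<tau> x \<rho>) (foldr D_x js u)"
      by (induction js) (auto intro: solves_D_x[OF admitsD(8,1)[OF a]] admitsD(5)[OF a])
    then have "solves m L lam (lo m \<tau> x \<rho>) (hi \<tau> x \<rho>) w"
      unfolding w_def by (rule solves_funpow_D_x[OF admitsD(8,1)[OF a]])
    then have sw: "solves m L lam (lo m \<tau> x r) (hi \<tau> x r) w" using sub(3) by (auto simp: solves_def)
    have Dt: "norm (D_t w y) \<le> sqrt E * A / \<rho>^?e" if y: "y \<in> kbox m \<tau> x r" for y
    proof -
      have "(norm (D_t w y))\<^sup>2 \<le> 2 * M0\<^sup>2 * ?d * (\<Sum>j\<in>UNIV. (norm ((D_x j ^^ (2*m)) w y))\<^sup>2) + 2 * lam\<^sup>2 * (norm (w y))\<^sup>2"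
        by (rule D_t_bound[OF admitsD(1)[OF a] sw y M0 lam])
      also have "2 * lam\<^sup>2 * (norm (w y))\<^sup>2 = 2 * (lam * norm (w y))\<^sup>2" by (simp add: power_mult_distrib)
      also have "2 * M0\<^sup>2 * ?d * (\<Sum>j\<in>UNIV. (norm ((D_x j ^^ (2*m)) w y))\<^sup>2) + 2 * (lam * norm (w y))\<^sup>2
         \<le> 2 * M0\<^sup>2 * ?d * (\<Sum>j\<in>(UNIV::'d set). (C0 * A / \<rho>^?e)\<^sup>2) + 2 * (C1 * A / \<rho>^?e)\<^sup>2"
        using lam by (intro add_mono mult_left_mono sum_mono power_mono Dx2m[OF y] lw[OF y]) auto
      also have "... = E * (A / \<rho>^?e)\<^sup>2"
      proof -
        define Y where "Y = A / \<rho>^?e"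
        have "C0 * A / \<rho>^?e = C0 * Y" "C1 * A / \<rho>^?e = C1 * Y" by (simp_all add: Y_def)
        then show ?thesis unfolding Y_def[symmetric] by (simp add: E_def power_mult_distrib algebra_simps)
      qed
      also have "... = (sqrt E * A / \<rho>^?e)\<^sup>2" using E by (simp add: power_mult_distrib power_divide)
      finally show ?thesis by (rule power2_le_imp_le) (use E A \<rho> in simp)
    qed
    define B where "B i = (if i = e_t then sqrt E * A / \<rho>^?e else C0 * A / \<rho>^(a+n+1))" for i :: "'d pt"
    have bdB: "norm (partial i w y) \<le> B i" if i: "i \<in> Basis" and y: "y \<in> kbox m \<tau> x r" for i y
    proof -
      consider "i = e_t" | j where "i = e_x j" using i unfolding Basis_pt by blast
      then show ?thesis
      proof cases
        case 1
        show ?thesis using Dt[OF y] unfolding 1 B_def D_t_def by (simp only: if_True simp_thms)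
      next
        case 2
        have "B i = C0 * A / \<rho>^(a+n+1)" by (simp add: 2 B_def)
        with Dx[OF y, of j] show ?thesis unfolding 2 D_x_def by (simp only:)
      qed
    qed
    from box_increment[OF wC K bdB z z']
    have "norm (w z - w z') \<le> 3 * (\<Sum>i\<in>insert e_t (range e_x). \<bar>z \<bullet> i - z' \<bullet> i\<bar> * B i)" unfolding Basis_pt .
    also have "(\<Sum>i\<in>insert e_t (range e_x). \<bar>z \<bullet> i - z' \<bullet> i\<bar> * B i) = \<bar>z \<bullet> e_t - z' \<bullet> e_t\<bar> * B e_t + (\<Sum>i\<in>range e_x. \<bar>z \<bullet> i - z' \<bullet> i\<bar> * B i)"
      by (rule sum.insert) auto
    also have "(\<Sum>i\<in>range e_x. \<bar>z \<bullet> i - z' \<bullet> i\<bar> * B i) = (\<Sum>j\<in>UNIV. \<bar>z \<bullet> e_x j - z' \<bullet> e_x j\<bar> * B (e_x j))"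
      by (subst sum.reindex) (auto intro!: injI simp: axis_eq_axis o_def)
    also have "\<bar>z \<bullet> e_t - z' \<bullet> e_t\<bar> * B e_t + (\<Sum>j\<in>UNIV. \<bar>z \<bullet> e_x j - z' \<bullet> e_x j\<bar> * B (e_x j))
       \<le> r^(2*m) * (sqrt E * A / \<rho>^?e) + (\<Sum>j\<in>(UNIV::'d set). (2 * r) * (C0 * A / \<rho>^(a+n+1)))"
    proof (intro add_mono sum_mono)
      have "\<bar>z \<bullet> e_t - z' \<bullet> e_t\<bar> \<le> r^(2*m)" using z z' by (auto simp: mem_kbox abs_le_iff)
      then show "\<bar>z \<bullet> e_t - z' \<bullet> e_t\<bar> * B e_t \<le> r^(2*m) * (sqrt E * A / \<rho>^?e)"
        unfolding B_def if_P[OF refl] using E A \<rho> by (intro mult_right_mono) auto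
      fix j
      have "\<bar>z \<bullet> e_x j - z' \<bullet> e_x j\<bar> \<le> 2 * r" using kbox_abs[OF z, of j] kbox_abs[OF z', of j] unfolding inner_e_x by linarith
      moreover have "B (e_x j) = C0 * A / \<rho>^(a+n+1)" by (simp add: B_def)
      ultimately show "\<bar>z \<bullet> e_x j - z' \<bullet> e_x j\<bar> * B (e_x j) \<le> (2 * r) * (C0 * A / \<rho>^(a+n+1))"
        using C0(1) A \<rho> by (simp only:) (intro mult_right_mono, auto)
    qed
    finally have "norm (w z - w z') \<le> 3 * (r^(2*m) * (sqrt E * A / \<rho>^?e) + ?d * ((2 * r) * (C0 * A / \<rho>^(a+n+1))))" by simp
    then have "\<rho>^(a+n) * norm (w z - w z') \<le> \<rho>^(a+n) * (3 * (r^(2*m) * (sqrt E * A / \<rho>^?e) + ?d * ((2 * r) * (C0 * A / \<rho>^(a+n+1)))))"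
      using \<rho> by (intro mult_left_mono) auto
    also have "... = 3 * ((r/\<rho>)^(2*m) * (sqrt E * A) + 2 * ?d * C0 * A * (r/\<rho>))"
    proof -
      have 1: "\<rho>^(a+n) * (r^(2*m) * (sqrt E * A / \<rho>^?e)) = (r/\<rho>)^(2*m) * (sqrt E * A)"
        using \<rho> by (simp add: power_add power_divide)
      have 2: "\<rho>^(a+n) * (?d * ((2 * r) * (C0 * A / \<rho>^(a+n+1)))) = 2 * ?d * C0 * A * (r/\<rho>)"
        using \<rho> by (simp add: power_add)
      show ?thesis unfolding 1[symmetric] 2[symmetric] by (simp only: distrib_left mult.left_commute[of _ 3])
    qed
    also have "... \<le> 3 * ((r/\<rho>) * (sqrt E * A) + 2 * ?d * C0 * A * (r/\<rho>))"
    proof -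
      have "(r/\<rho>)^(2*m) \<le> (r/\<rho>)^1" using r r\<rho> \<rho> assms(3) by (intro power_decreasing) auto
      then show ?thesis using E A by (intro mult_left_mono add_right_mono mult_right_mono) auto
    qed
    also have "... = C * A * (r/\<rho>)" by (simp add: C_def algebra_simps)
    finally show "\<rho>^(a+n) * norm ((D1 ^^ a) (foldr D_x js u) z - (D1 ^^ a) (foldr D_x js u) z') \<le> C * A * (r/\<rho>)"
      by (simp add: w_def)
  qed
qed

text \<open>The assumption that the centre is within \<rho> of the flat boundary makes every slice
  in direction x_1 start there. Its length is at most 2\<rho>, and the one-dimensional constant 4
  (2\<rho>)^2 becomes 16 \<rho>^2; the Dirichlet condition permits m repetitions.\<close>

lemma energy_poincare:
  fixes u :: "('d::{finite,linorder}) pt \<Rightarrow> 'b::euclidean_space"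
  assumes u: "C_inf_loc u" and d: "dirichlet m (lo m \<tau> x \<rho>) (hi \<tau> x \<rho>) u" and \<rho>: "\<rho> > 0" and x: "0 \<le> x $ first" "x $ first \<le> \<rho>"
    and k: "k \<le> m"
  shows "energy m \<tau> x \<rho> u \<le> (16 * \<rho>\<^sup>2)^k * energy m \<tau> x \<rho> ((D1 ^^ k) u)"
  using k
proof (induction k)
  case (Suc k)
  let ?K = "kbox m \<tau> x \<rho>" and ?i = "e_x first :: 'd pt" and ?v = "(D1 ^^ k) u"
  have K: "half_box (lo m \<tau> x \<rho>) (hi \<tau> x \<rho>)" by (rule half_box_kbox[OF \<rho> x(1)])
  then have Kb: "?K \<subseteq> O_bar" by (simp add: half_box_def)
  have v: "C_inf_loc ?v" by (rule C_inf_loc_D_x[OF u])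
  note c = continuous_on_kbox[OF \<rho> x(1)]
  let ?h = "\<lambda>z. 16 * \<rho>\<^sup>2 * (norm ((D1 ^^ Suc k) u z))\<^sup>2 - (norm (?v z))\<^sup>2"
  have ch: "continuous_on ?K ?h" by (intro continuous_intros c C_inf_loc_D_x u)
  have lo0: "lo m \<tau> x \<rho> \<bullet> ?i = 0" unfolding lo_hi_inner using x by simp
  have "0 \<le> integral ?K ?h"
  proof (rule integral_nonneg_by_slices[OF ch Basis_pt_simps(2)])
    show "lo m \<tau> x \<rho> \<bullet> ?i < hi \<tau> x \<rho> \<bullet> ?i" using K by (simp add: half_box_def del: inner_e_x)
    fix z assume z: "z \<in> ?K"
    let ?\<alpha> = "lo m \<tau> x \<rho> \<bullet> ?i" and ?\<beta> = "hi \<tau> x \<rho> \<bullet> ?i"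
    let ?f = "\<lambda>s. ?v (slice ?i z s)" and ?f' = "\<lambda>s. (D1 ^^ Suc k) u (slice ?i z s)"
    have ab: "?\<alpha> \<le> ?\<beta>" "?\<beta> - ?\<alpha> \<le> 2 * \<rho>" unfolding lo_hi_inner using x \<rho> by auto
    have dv: "(?f has_vector_derivative ?f' s) (at s within {?\<alpha>..?\<beta>})" if "s \<in> {?\<alpha>..?\<beta>}" for s
      using partial_on_slice[OF v Basis_pt_simps(2) Kb z that] by (simp add: D_x_def del: inner_e_x)
    have cf': "continuous_on {?\<alpha>..?\<beta>} ?f'" by (rule continuous_on_slice_fun[OF c[OF C_inf_loc_D_x[OF u]] Basis_pt_simps(2) z])
    have cf: "continuous_on {?\<alpha>..?\<beta>} ?f" by (rule continuous_on_slice_fun[OF c[OF v] Basis_pt_simps(2) z])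
    have "slice ?i z ?\<alpha> \<in> ?K" by (rule slice_in_cbox[OF Basis_pt_simps(2) z]) (use ab in simp)
    then have f0: "?f ?\<alpha> = 0" using d Suc.prems unfolding lo0 by (auto simp: dirichlet_def slice_e_x)
    have "0 \<le> integral {?\<alpha>..?\<beta>} (\<lambda>s. 4 * (?\<beta> - ?\<alpha>)\<^sup>2 * (norm (?f' s))\<^sup>2 - (norm (?f s))\<^sup>2)"
      by (rule slice_poincare[OF dv cf' f0 ab(1)])
    also have "... \<le> integral {?\<alpha>..?\<beta>} (\<lambda>s. ?h (slice ?i z s))"
    proof (intro integral_le integrable_continuous_real continuous_intros cf cf')
      fix s
      have "(?\<beta> - ?\<alpha>)\<^sup>2 \<le> (2 * \<rho>)\<^sup>2" using ab by (intro power_mono) auto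
      then have "4 * (?\<beta> - ?\<alpha>)\<^sup>2 * (norm (?f' s))\<^sup>2 \<le> 4 * (2 * \<rho>)\<^sup>2 * (norm (?f' s))\<^sup>2"
        by (intro mult_right_mono mult_left_mono) auto
      then show "4 * (?\<beta> - ?\<alpha>)\<^sup>2 * (norm (?f' s))\<^sup>2 - (norm (?f s))\<^sup>2 \<le> ?h (slice ?i z s)" by (simp add: power_mult_distrib)
    qed
    finally show "0 \<le> integral {?\<alpha>..?\<beta>} (\<lambda>s. ?h (slice ?i z s))" .
  qed
  moreover have "(?h has_integral (16 * \<rho>\<^sup>2 * energy m \<tau> x \<rho> ((D1 ^^ Suc k) u) - energy m \<tau> x \<rho> ?v)) ?K"
    by (intro has_integral_diff has_integral_mult_right integrable_integral integrable_continuous continuous_intros c C_inf_loc_D_x u)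
  ultimately have "energy m \<tau> x \<rho> ?v \<le> 16 * \<rho>\<^sup>2 * energy m \<tau> x \<rho> ((D1 ^^ Suc k) u)" by (simp add: integral_unique)
  then have "(16 * \<rho>\<^sup>2)^k * energy m \<tau> x \<rho> ?v \<le> (16 * \<rho>\<^sup>2)^k * (16 * \<rho>\<^sup>2 * energy m \<tau> x \<rho> ((D1 ^^ Suc k) u))"
    by (intro mult_left_mono) auto
  with Suc show ?case by (simp add: mult_ac)
qed simp

section \<open>Averages over cylinders and even extension\<close>

lemma Q_cyl_basic:
  fixes X :: "('d::{finite,linorder}) pt"
  shows "open (Q_cyl m r X)" "bounded (Q_cyl m r X)"
  unfolding Q_cyl_def by (auto intro: open_Times bounded_Times)

lemma measure_Q_cyl:
  fixes X :: "('d::{finite,linorder}) pt"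
  assumes r: "r > 0"
  shows "measure lebesgue (Q_cyl m r X) = r^(2*m + CARD('d)) * unit_ball_vol (real CARD('d))"
proof -
  let ?A = "{fst X - r^(2*m) <..< fst X}" and ?B = "ball (snd X) r"
  have "measure lebesgue (Q_cyl m r X) = measure lborel (Q_cyl m r X)"
    using Q_cyl_basic(1)[of m r X] by (intro measure_completion) auto
  also have "... = measure (lborel \<Otimes>\<^sub>M lborel) (?A \<times> ?B)" by (simp add: lborel_prod Q_cyl_def)
  also have "... = measure lborel ?A * measure lborel ?B"
    unfolding measure_def by (subst lborel.emeasure_pair_measure_Times) (auto simp: enn2real_mult)
  also have "measure lborel ?A = r^(2*m)" using r by simp
  also have "measure lborel ?B = unit_ball_vol (real CARD('d)) * r^CARD('d)" using r by (simp add: content_ball)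
  finally show ?thesis by (simp add: power_add)
qed

lemma measure_Q_cyl_pos:
  fixes X :: "('d::{finite,linorder}) pt"
  assumes "r > 0"
  shows "measure lebesgue (Q_cyl m r X) > 0"
  using assms by (simp add: measure_Q_cyl)

lemma Q_cyl_integrable:
  fixes g :: "('d::{finite,linorder}) pt \<Rightarrow> 'b::euclidean_space"
  assumes "continuous_on UNIV g"
  shows "set_integrable lebesgue (Q_cyl m r X) g"
proof -
  obtain c where c: "Q_cyl m r X \<subseteq> cbox (- c) c" using bounded_subset_cbox_symmetric[OF Q_cyl_basic(2)] by blast
  have "g absolutely_integrable_on cbox (- c) c"
    using assms by (intro absolutely_integrable_continuous) (auto intro: continuous_on_subset)
  then show ?thesis by (rule set_integrable_subset) (use c Q_cyl_basic(1)[of m r X] in auto)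
qed

lemma Q_cyl_avg:
  fixes g :: "('d::{finite,linorder}) pt \<Rightarrow> 'b::euclidean_space"
  assumes "continuous_on UNIV g"
  shows "avg (Q_cyl m r X) g = integral (Q_cyl m r X) g /\<^sub>R measure lebesgue (Q_cyl m r X)" "g integrable_on Q_cyl m r X"
  using set_lebesgue_integral_eq_integral[OF Q_cyl_integrable[OF assms]] by (auto simp: avg_def)

lemma Q_cyl_avg_mono:
  fixes f g :: "('d::{finite,linorder}) pt \<Rightarrow> real"
  assumes "continuous_on UNIV f" "continuous_on UNIV g" "\<And>z. z \<in> Q_cyl m r X \<Longrightarrow> f z \<le> g z"
  shows "avg (Q_cyl m r X) f \<le> avg (Q_cyl m r X) g"
  unfolding Q_cyl_avg[OF assms(1)] Q_cyl_avg[OF assms(2)]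
  by (intro scaleR_left_mono integral_le Q_cyl_avg assms) auto

lemma Q_cyl_avg_const:
  fixes X :: "('d::{finite,linorder}) pt" and c :: real
  assumes "r > 0"
  shows "avg (Q_cyl m r X) (\<lambda>z. c) = c"
proof -
  have "Q_cyl m r X \<in> lmeasurable" using Q_cyl_basic[of m r X] by (auto intro: lmeasurable_open)
  then have "integral (Q_cyl m r X) (\<lambda>z. c) = c * measure lebesgue (Q_cyl m r X)"
    using integral_mult_right[of "Q_cyl m r X" c "\<lambda>_. 1"] by (simp add: lmeasure_integral)
  then show ?thesis using measure_Q_cyl_pos[OF assms, of m X] by (subst Q_cyl_avg(1)) auto
qed

lemma Q_cyl_avg_linear:
  fixes f :: "('d::{finite,linorder}) pt \<Rightarrow> real"
  assumes "continuous_on UNIV f" "r > 0"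
  shows "avg (Q_cyl m r X) (\<lambda>z. c * f z + k) = c * avg (Q_cyl m r X) f + k"
proof -
  have c: "continuous_on UNIV (\<lambda>z. c * f z + k)" "continuous_on UNIV (\<lambda>z::'d pt. k)" by (intro continuous_intros assms)+
  have "integral (Q_cyl m r X) (\<lambda>z. c * f z + k) = c * integral (Q_cyl m r X) f + integral (Q_cyl m r X) (\<lambda>z. k)"
    by (intro integral_unique has_integral_add has_integral_mult_right integrable_integral Q_cyl_avg assms c)
  then have "avg (Q_cyl m r X) (\<lambda>z. c * f z + k) = c * avg (Q_cyl m r X) f + avg (Q_cyl m r X) (\<lambda>z. k)"
    unfolding Q_cyl_avg(1)[OF c(1)] Q_cyl_avg(1)[OF c(2)] Q_cyl_avg(1)[OF assms(1)] by (simp add: distrib_left)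
  then show ?thesis using Q_cyl_avg_const[OF assms(2)] by simp
qed

lemma mean_osc_le_oscillation:
  fixes G :: "('d::{finite,linorder}) pt \<Rightarrow> 'b::euclidean_space"
  assumes G: "continuous_on UNIV G" and r: "r > 0" and K: "\<And>z z'. z \<in> Q_cyl m r X \<Longrightarrow> z' \<in> Q_cyl m r X \<Longrightarrow> norm (G z - G z') \<le> K"
  shows "mean_osc (Q_cyl m r X) G \<le> K"
proof -
  let ?Q = "Q_cyl m r X"
  define \<mu> where "\<mu> = measure lebesgue ?Q"
  have \<mu>: "\<mu> > 0" unfolding \<mu>_def by (rule measure_Q_cyl_pos[OF r])
  have int1: "integral ?Q (\<lambda>z. c) = \<mu> *\<^sub>R c" for c :: 'b
  proof -
    have "?Q \<in> lmeasurable" using Q_cyl_basic[of m r X] by (auto intro: lmeasurable_open)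
    then have "integral ?Q (\<lambda>z. 1::real) = \<mu>" unfolding \<mu>_def by (rule lmeasure_integral[symmetric])
    moreover have "(\<lambda>z. 1::real) integrable_on ?Q" by (intro Q_cyl_avg continuous_intros)
    ultimately have "((\<lambda>z. 1::real) has_integral \<mu>) ?Q" by (metis integrable_integral)
    from has_integral_scaleR_left[OF this, of c] show ?thesis by (simp add: integral_unique)
  qed
  have dev: "norm (G z - avg ?Q G) \<le> K" if z: "z \<in> ?Q" for z
  proof -
    have "norm (integral ?Q (\<lambda>y. G z - G y)) \<le> integral ?Q (\<lambda>y. K)"
      using K[OF z] G by (intro integral_norm_bound_integral Q_cyl_avg continuous_intros) auto
    also have "integral ?Q (\<lambda>y. G z - G y) = \<mu> *\<^sub>R G z - integral ?Q G"
      by (simp add: Henstock_Kurzweil_Integration.integral_diff Q_cyl_avg(2)[OF G] Q_cyl_avg(2) int1)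
    also have "... = \<mu> *\<^sub>R (G z - avg ?Q G)" unfolding Q_cyl_avg(1)[OF G] using \<mu> by (simp add: \<mu>_def scaleR_diff_right)
    also have "integral ?Q (\<lambda>y. K) = \<mu> * K"
      using Q_cyl_avg_const[OF r, of m X K] \<mu> by (simp add: Q_cyl_avg(1) \<mu>_def[symmetric] field_simps)
    finally show ?thesis using \<mu> by simp
  qed
  have "avg ?Q (\<lambda>z. norm (G z - avg ?Q G)) \<le> avg ?Q (\<lambda>z. K)"
    using dev G by (intro Q_cyl_avg_mono continuous_intros) auto
  then show ?thesis by (simp only: mean_osc_def Q_cyl_avg_const[OF r])
qed

lemma mean_osc_le_avg:
  fixes G :: "('d::{finite,linorder}) pt \<Rightarrow> 'b::euclidean_space"
  assumes G: "continuous_on UNIV G" and r: "r > 0"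
  shows "mean_osc (Q_cyl m r X) G \<le> 2 * sqrt (avg (Q_cyl m r X) (\<lambda>z. (norm (G z))\<^sup>2))"
proof -
  let ?Q = "Q_cyl m r X"
  define B where "B = avg ?Q (\<lambda>z. (norm (G z))\<^sup>2)"
  have cn: "continuous_on UNIV (\<lambda>z. norm (G z))" "continuous_on UNIV (\<lambda>z. (norm (G z))\<^sup>2)" by (intro continuous_intros G)+
  have "0 \<le> B" using Q_cyl_avg_mono[OF _ cn(2), of "\<lambda>_. 0" m r X] Q_cyl_avg_const[OF r, of m X 0] by (simp add: B_def)
  \<comment> \<open>The Cauchy-Schwarz inequality for averages via Young with a parameter a; letting
    a decrease to the root of B avoids dividing by zero when B = 0.\<close>
  have a1: "avg ?Q (\<lambda>z. norm (G z)) \<le> a" if a: "a > 0" "B \<le> a\<^sup>2" for a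
  proof -
    have "avg ?Q (\<lambda>z. norm (G z)) \<le> avg ?Q (\<lambda>z. 1/(2*a) * (norm (G z))\<^sup>2 + a/2)"
    proof (intro Q_cyl_avg_mono continuous_intros G)
      fix z
      have "1 * norm (G z) \<le> a/2 * 1\<^sup>2 + 1/(2*a) * (norm (G z))\<^sup>2" by (rule young_weighted[OF a(1)])
      then show "norm (G z) \<le> 1/(2*a) * (norm (G z))\<^sup>2 + a/2" by simp
    qed
    also have "... = 1/(2*a) * B + a/2" unfolding B_def by (rule Q_cyl_avg_linear[OF cn(2) r])
    also have "1/(2*a) * B \<le> 1/(2*a) * a\<^sup>2" using a by (intro mult_left_mono) auto
    also have "1/(2*a) * a\<^sup>2 + a/2 = a" using a by (simp add: power2_eq_square)
    finally show ?thesis by simp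
  qed
  have a2: "avg ?Q (\<lambda>z. norm (G z)) \<le> sqrt B"
  proof (rule field_le_epsilon)
    fix e :: real assume e: "e > 0"
    have "B \<le> (sqrt B + e)\<^sup>2" using \<open>0 \<le> B\<close> e by (simp add: power2_sum)
    then show "avg ?Q (\<lambda>z. norm (G z)) \<le> sqrt B + e" using \<open>0 \<le> B\<close> e by (intro a1) (auto intro: add_nonneg_pos)
  qed
  have an: "norm (avg ?Q G) \<le> avg ?Q (\<lambda>z. norm (G z))"
    unfolding Q_cyl_avg(1)[OF G] Q_cyl_avg(1)[OF cn(1)]
    using integral_norm_bound_integral[OF Q_cyl_avg(2)[OF G, of m r X] Q_cyl_avg(2)[OF cn(1)]]
    by (simp add: mult_left_mono)
  have "mean_osc ?Q G \<le> avg ?Q (\<lambda>z. 1 * norm (G z) + norm (avg ?Q G))"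
    unfolding mean_osc_def by (intro Q_cyl_avg_mono continuous_intros G) (auto intro: norm_triangle_ineq4)
  also have "... = 1 * avg ?Q (\<lambda>z. norm (G z)) + norm (avg ?Q G)" by (rule Q_cyl_avg_linear[OF cn(1) r])
  finally show ?thesis using a2 an by (simp add: B_def)
qed

text \<open>The even extension is composition with this reflection into the closed half-space. Its
  continuity and its differences of values over a full cylinder are thereby reduced to points where
  the estimates hold.\<close>

definition fold_pt :: "('d::{finite,linorder}) pt \<Rightarrow> 'd pt" where
  "fold_pt z = (fst z, \<chi> i. if i = first then \<bar>snd z $ i\<bar> else snd z $ i)"

lemma even_ext_fold: "even_ext g z = g (fold_pt z)"
  by (simp add: even_ext_def fold_pt_def)

lemma fold_pt_in_O_bar: "fold_pt z \<in> O_bar"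
  by (simp add: fold_pt_def O_bar_eq)

lemma fold_pt_id: "z \<in> O_bar \<Longrightarrow> fold_pt z = z"
  by (cases z) (auto simp: fold_pt_def O_bar_eq vec_eq_iff)

lemma continuous_on_even_ext:
  assumes "continuous_on O_bar g"
  shows "continuous_on UNIV (even_ext g)"
proof -
  have "continuous_on UNIV (\<lambda>z :: 'a pt. if i = first then \<bar>snd z $ i\<bar> else snd z $ i)" for i
  proof (cases "i = first")
    case True
    then show ?thesis by (simp only: if_True simp_thms) (intro continuous_intros)
  next
    case False
    then show ?thesis by (simp only: if_False simp_thms) (intro continuous_intros)
  qed
  then have "continuous_on UNIV (fold_pt :: 'a pt \<Rightarrow> 'a pt)"
    unfolding fold_pt_def by (intro continuous_on_Pair continuous_on_fst continuous_on_id continuous_on_vec_lambda)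
  then show ?thesis unfolding even_ext_fold[abs_def]
    by (rule continuous_on_compose2[OF assms]) (auto intro: fold_pt_in_O_bar)
qed

text \<open>For a centre with nonnegative first coordinate c, replacing the coordinate s by |s| does
  not increase the distance to c. The top time is left free between the time of the point and that
  of the cylinder.\<close>

lemma fold_pt_in_kbox:
  fixes X :: "('d::{finite,linorder}) pt"
  assumes z: "z \<in> Q_cyl m r X" and X: "X \<in> O_bar" and \<tau>: "fst z \<le> \<tau>" "\<tau> \<le> fst X"
  shows "fold_pt z \<in> kbox m \<tau> (snd X) r"
proof -
  have "dist (snd X) (snd z) < r" and t: "fst X - r^(2*m) < fst z" using z by (auto simp: Q_cyl_def)
  then have zj: "\<bar>snd z $ j - snd X $ j\<bar> < r" for j
    using dist_vec_nth_le[of "snd X" j "snd z"] by (simp add: dist_real_def abs_minus_commute)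
  have X0: "0 \<le> snd X $ first" using X by (simp add: O_bar_eq)
  show ?thesis
    unfolding mem_kbox
  proof (intro conjI allI)
    show "\<tau> - r^(2*m) \<le> fst (fold_pt z)" "fst (fold_pt z) \<le> \<tau>" using t \<tau> by (auto simp: fold_pt_def)
    fix j
    show "(if j = first then max 0 (snd X $ j - r) else snd X $ j - r) \<le> snd (fold_pt z) $ j" "snd (fold_pt z) $ j \<le> snd X $ j + r"
      using zj[of j] X0 by (auto simp: fold_pt_def abs_if split: if_splits)
  qed
qed

text \<open>The Euclidean distance to the centre is at most the sum of the coordinate distances, d
  \<rho> \<le> R/2, which stays strictly inside the ball. In time, the offset of \<tau> and the
  length of the box are each bounded by (R/2)^(2m), together at most R^(2m).\<close>

lemma kbox_subset_Q_cyl: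
  fixes X :: "('d::{finite,linorder}) pt"
  assumes R: "R > 0" and \<tau>: "fst X - (R/2)^(2*m) < \<tau>" "\<tau> < fst X" and \<rho>: "0 < \<rho>" "\<rho> * (2 * real CARD('d)) \<le> R" and m: "m \<ge> 1"
  shows "kbox m \<tau> (snd X) \<rho> \<subseteq> Q_cyl m R X"
proof
  fix z assume z: "z \<in> kbox m \<tau> (snd X) \<rho>"
  have d: "1 \<le> real CARD('d)" by simp
  have "\<rho> * (2 * 1) \<le> \<rho> * (2 * real CARD('d))" using \<rho>(1) d by (intro mult_left_mono) auto
  then have \<rho>R: "\<rho> \<le> R/2" using \<rho> by linarith
  have "norm (snd z - snd X) \<le> (\<Sum>j\<in>UNIV. \<bar>(snd z - snd X) $ j\<bar>)" by (rule norm_le_l1_cart)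
  also have "... \<le> (\<Sum>j\<in>(UNIV::'d set). \<rho>)" using kbox_abs[OF z] by (intro sum_mono) auto
  also have "... < R" using \<rho> R by (simp add: algebra_simps)
  finally have 1: "snd z \<in> ball (snd X) R" by (simp add: dist_norm norm_minus_commute)
  have "\<rho>^(2*m) \<le> (R/2)^(2*m)" using \<rho> \<rho>R by (intro power_mono) auto
  moreover have "2 * (R/2)^(2*m) \<le> R^(2*m)"
  proof -
    have "(1/2::real)^(2*m) \<le> (1/2)^1" using m by (intro power_decreasing) auto
    then have "R^(2*m) * (1/2)^(2*m) \<le> R^(2*m) * (1/2)" using R by (intro mult_left_mono) auto
    then show ?thesis by (simp add: power_divide power_one_over mult.commute)
  qed
  moreover have "\<tau> - \<rho>^(2*m) \<le> fst z" "fst z \<le> \<tau>" using z by (auto simp: mem_kbox)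
  ultimately have "fst X - R^(2*m) < fst z" "fst z < fst X" using \<tau> by linarith+
  with 1 show "z \<in> Q_cyl m R X" unfolding Q_cyl_def by (simp add: mem_Times_iff)
qed

lemma energy_le_avg:
  fixes v :: "('d::{finite,linorder}) pt \<Rightarrow> 'b::euclidean_space"
  assumes v: "C_inf_loc v" and g: "continuous_on UNIV g" and vg: "\<And>z. z \<in> O_bar \<Longrightarrow> (norm (v z))\<^sup>2 \<le> g z" and g0: "\<And>z. 0 \<le> g z"
    and R: "R > 0" and sub: "kbox m \<tau> x \<rho> \<subseteq> Q_cyl m R X" and \<rho>: "\<rho> > 0" and x: "x $ first \<ge> 0"
  shows "energy m \<tau> x \<rho> v \<le> R^(2*m + CARD('d)) * unit_ball_vol (real CARD('d)) * avg (Q_cyl m R X) g"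
proof -
  have KO: "kbox m \<tau> x \<rho> \<subseteq> O_bar" using half_box_kbox[OF \<rho> x] by (simp add: half_box_def)
  have gi: "g integrable_on kbox m \<tau> x \<rho>" using g by (intro integrable_continuous) (auto intro: continuous_on_subset)
  have "energy m \<tau> x \<rho> v \<le> integral (kbox m \<tau> x \<rho>) g"
    using vg KO by (intro integral_le gi integrable_continuous continuous_intros continuous_on_kbox[OF \<rho> x v]) auto
  also have "... \<le> integral (Q_cyl m R X) g" using g0 by (intro integral_subset_le sub gi Q_cyl_avg(2)[OF g]) auto
  also have "... = measure lebesgue (Q_cyl m R X) * avg (Q_cyl m R X) g"
    using measure_Q_cyl_pos[OF R, of m X] by (simp add: Q_cyl_avg(1)[OF g])
  finally show ?thesis by (simp add: measure_Q_cyl[OF R])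
qed

section \<open>The coefficient matrix\<close>

lemma norm_matrix_vector_le:
  fixes B :: "complex ^ 'n ^ 'n"
  shows "norm (B *v w) \<le> real CARD('n) * (real CARD('n) * norm B) * norm w"
proof -
  have "norm ((B *v w) $ i) \<le> real CARD('n) * norm B * norm w" for i
  proof -
    have "norm ((B *v w) $ i) \<le> (\<Sum>j\<in>UNIV. norm (B $ i $ j * w $ j))"
      unfolding matrix_vector_mult_def by (simp add: norm_sum)
    also have "... \<le> (\<Sum>j\<in>(UNIV::'n set). norm B * norm w)"
    proof (rule sum_mono)
      fix j
      have "norm (B $ i $ j) \<le> norm B"
        using Finite_Cartesian_Product.norm_nth_le[of "B $ i" j] Finite_Cartesian_Product.norm_nth_le[of B i] by linarith
      then show "norm (B $ i $ j * w $ j) \<le> norm B * norm w"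
        unfolding norm_mult using Finite_Cartesian_Product.norm_nth_le[of w j] by (intro mult_mono) auto
    qed
    finally show ?thesis by simp
  qed
  then have "(\<Sum>i\<in>UNIV. norm ((B *v w) $ i)) \<le> (\<Sum>i\<in>(UNIV::'n set). real CARD('n) * norm B * norm w)" by (intro sum_mono) auto
  moreover have "norm (B *v w) \<le> (\<Sum>i\<in>UNIV. norm ((B *v w) $ i))" unfolding norm_vec_def by (rule L2_set_le_sum) auto
  ultimately show ?thesis by simp
qed

lemma monomial_axis_first:
  fixes \<alpha> :: "('d::{finite,linorder}) \<Rightarrow> nat"
  assumes "\<alpha> \<in> multi_idx m"
  shows "monomial (axis first 1) \<alpha> = (if \<alpha> = alpha_hat m then 1 else 0)"
proof (cases "\<forall>i. i \<noteq> first \<longrightarrow> \<alpha> i = 0")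
  case True
  have "(\<Sum>i\<in>UNIV. \<alpha> i) = \<alpha> first + (\<Sum>i\<in>UNIV - {first}. \<alpha> i)" by (rule sum.remove) auto
  then have "\<alpha> first = m" using assms True by (simp add: multi_idx_def)
  then have "\<alpha> = alpha_hat m" using True by (auto simp: alpha_hat_def)
  moreover have "monomial (axis first 1) \<alpha> = 1"
    unfolding monomial_def using True by (intro prod.neutral) (auto simp: axis_def)
  ultimately show ?thesis by simp
next
  case False
  then obtain i where i: "i \<noteq> first" "\<alpha> i \<noteq> 0" by auto
  then have "monomial (axis first 1) \<alpha> = 0"
    unfolding monomial_def by (intro prod_zero bexI[of _ i]) (auto simp: axis_def)
  moreover have "\<alpha> \<noteq> alpha_hat m" using i by (auto simp: alpha_hat_def)
  ultimately show ?thesis by simp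
qed

text \<open>The Legendre-Hadamard condition is evaluated at \<xi> = e_1, where every monomial except
  that of \<open>alpha_hat m\<close> vanishes. This turns it into coercivity of the one matrix that
  enters the equation.\<close>

lemma admissible_coef:
  fixes A :: "('d::{finite,linorder}, 'n::finite) coeffs"
  assumes A: "admissible m \<delta> A" and \<delta>: "\<delta> > 0"
  shows "coef \<delta> (real CARD('n) * (real CARD('n) * inverse \<delta>)) (\<lambda>t v. A (alpha_hat m) (alpha_hat m) t *v v)"
  unfolding coef_def
proof (intro allI conjI)
  have ah: "(alpha_hat m :: ('d::{finite,linorder}) \<Rightarrow> nat) \<in> multi_idx m" by (simp add: alpha_hat_def multi_idx_def)
  fix t and v :: "complex ^ 'n"
  let ?B = "A (alpha_hat m) (alpha_hat m) t"
  have nB: "norm ?B \<le> inverse \<delta>" using A ah by (simp add: admissible_def)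
  show nv: "norm (?B *v v) \<le> real CARD('n) * (real CARD('n) * inverse \<delta>) * norm v"
    by (rule order_trans[OF norm_matrix_vector_le]) (intro mult_right_mono mult_left_mono nB; simp)
  show "bounded_linear ((*v) ?B)"
  proof (rule bounded_linear_intro)
    show "?B *v (x + y) = ?B *v x + ?B *v y" for x y by (rule matrix_vector_right_distrib)
    show "?B *v (c *\<^sub>R x) = c *\<^sub>R (?B *v x)" for c x
      by (simp add: matrix_vector_mult_def vec_eq_iff scaleR_sum_right)
    show "norm (?B *v x) \<le> norm x * (real CARD('n) * (real CARD('n) * norm ?B))" for x
      using norm_matrix_vector_le[of ?B x] by (simp add: mult_ac)
  qed
  \<comment> \<open>The form has the conjugate in its second slot, while the real inner product of
    \<open>?B *v v\<close> with v conjugates the vector on the left; the conjugate of v reconciles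
    the two.\<close>
  define \<theta> :: "complex ^ 'n" where "\<theta> = (\<chi> i. cnj (v $ i))"
  have n\<theta>: "norm \<theta> = norm v" by (simp add: \<theta>_def norm_vec_def)
  have "\<delta> * norm (axis first 1 :: real ^ ('d::{finite,linorder})) ^ (2*m) * (norm \<theta>)\<^sup>2
      \<le> Re (\<Sum>\<alpha>\<in>multi_idx m. \<Sum>\<beta>\<in>multi_idx m. of_real (monomial (axis first 1 :: real ^ ('d::{finite,linorder})) \<alpha> * monomial (axis first 1) \<beta>) * sesq (A \<alpha> \<beta> t) \<theta>)"
    using A unfolding admissible_def legendre_hadamard_def by blast
  also have "(\<Sum>\<alpha>\<in>multi_idx m. \<Sum>\<beta>\<in>multi_idx m. of_real (monomial (axis first 1 :: real ^ ('d::{finite,linorder})) \<alpha> * monomial (axis first 1) \<beta>) * sesq (A \<alpha> \<beta> t) \<theta>)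
      = (\<Sum>\<alpha>\<in>multi_idx m. if \<alpha> = alpha_hat m then (\<Sum>\<beta>\<in>multi_idx m. if \<beta> = alpha_hat m then sesq (A \<alpha> \<beta> t) \<theta> else 0) else 0)"
    by (intro sum.cong refl) (auto simp: monomial_axis_first intro!: sum.cong sum.neutral)
  also have "... = sesq ?B \<theta>" using ah by (simp add: finite_multi_idx)
  finally have "\<delta> * (norm v)\<^sup>2 \<le> Re (sesq ?B \<theta>)" by (simp add: n\<theta>)
  also have "Re (sesq ?B \<theta>) = (?B *v v) \<bullet> v"
  proof -
    have "(?B *v v) \<bullet> v = (\<Sum>i\<in>UNIV. Re ((\<Sum>j\<in>UNIV. ?B $ i $ j * v $ j) * cnj (v $ i)))"
      unfolding inner_vec_def matrix_vector_mult_def by (simp add: inner_complex_def)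
    also have "... = Re (sesq ?B \<theta>)"
      unfolding sesq_def Re_sum sum_distrib_right \<theta>_def by (simp add: mult_ac)
    finally show ?thesis by simp
  qed
  finally show "\<delta> * (norm v)\<^sup>2 \<le> (?B *v v) \<bullet> v" .
qed

section \<open>The mean oscillation estimates\<close>

lemma avg_Q_cyl_nonneg:
  fixes g :: "('d::{finite,linorder}) pt \<Rightarrow> real"
  assumes "continuous_on UNIV g" "\<And>z. 0 \<le> g z" "r > 0"
  shows "0 \<le> avg (Q_cyl m r X) g"
proof -
  have "avg (Q_cyl m r X) (\<lambda>z. 0) \<le> avg (Q_cyl m r X) g" by (intro Q_cyl_avg_mono assms continuous_intros)
  then show ?thesis unfolding Q_cyl_avg_const[OF assms(3)] .
qed

lemma avg_Q_cyl_le_scaled: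
  fixes g :: "('d::{finite,linorder}) pt \<Rightarrow> real"
  assumes g: "continuous_on UNIV g" and g0: "\<And>z. 0 \<le> g z" and r: "r > 0" and \<kappa>: "\<kappa> \<ge> 1"
  shows "avg (Q_cyl m r X) g \<le> \<kappa>^(2*m + CARD('d)) * avg (Q_cyl m (\<kappa> * r) X) g"
proof -
  let ?q = "2*m + CARD('d)"
  have \<kappa>r: "\<kappa> * r > 0" and le: "r \<le> \<kappa> * r" using r \<kappa> by auto
  have "r^(2*m) \<le> (\<kappa> * r)^(2*m)" using r le by (intro power_mono) auto
  then have "Q_cyl m r X \<subseteq> Q_cyl m (\<kappa> * r) X"
    unfolding Q_cyl_def using le by (intro Sigma_mono) auto
  then have "integral (Q_cyl m r X) g \<le> integral (Q_cyl m (\<kappa> * r) X) g"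
    using g0 by (intro integral_subset_le Q_cyl_avg(2)[OF g]) auto
  then have "inverse (measure lebesgue (Q_cyl m r X)) * integral (Q_cyl m r X) g
      \<le> inverse (measure lebesgue (Q_cyl m r X)) * integral (Q_cyl m (\<kappa> * r) X) g"
    by (intro mult_left_mono) auto
  moreover have "inverse (measure lebesgue (Q_cyl m r X)) = \<kappa>^?q * inverse (measure lebesgue (Q_cyl m (\<kappa> * r) X))"
    unfolding measure_Q_cyl[OF r] measure_Q_cyl[OF \<kappa>r] using \<kappa> by (simp add: power_mult_distrib)
  ultimately have "inverse (measure lebesgue (Q_cyl m r X)) * integral (Q_cyl m r X) g
      \<le> \<kappa>^?q * inverse (measure lebesgue (Q_cyl m (\<kappa> * r) X)) * integral (Q_cyl m (\<kappa> * r) X) g" by (simp only:)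
  then show ?thesis unfolding Q_cyl_avg(1)[OF g] real_scaleR_def mult.assoc .
qed

text \<open>Both ranges of \<kappa> in one inequality: beyond \<kappa>0 the pointwise hypothesis is
  used, below it the cost \<kappa>0^q of enlarging the cylinder is a constant and \<kappa>0/\<kappa>
  \<ge> 1 supplies the missing factor.\<close>

lemma mean_osc_even_ext_le:
  fixes w :: "('d::{finite,linorder}) pt \<Rightarrow> 'b::euclidean_space"
  assumes w: "C_inf_loc w" and g: "continuous_on UNIV g" and wg: "\<And>z. (norm (even_ext w z))\<^sup>2 \<le> g z"
    and r: "r > 0" and \<kappa>: "\<kappa> \<ge> 2" and \<kappa>0: "\<kappa>0 \<ge> 1" and C: "C \<ge> 0" and X: "X \<in> O_bar" and m: "m \<ge> 1"
    and large: "\<And>\<tau> z z'. \<kappa>0 \<le> \<kappa> \<Longrightarrow> fst X - (\<kappa> * r / 2)^(2*m) < \<tau> \<Longrightarrow> \<tau> < fst X \<Longrightarrow>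
      z \<in> kbox m \<tau> (snd X) r \<Longrightarrow> z' \<in> kbox m \<tau> (snd X) r \<Longrightarrow>
      norm (w z - w z') \<le> C * inverse \<kappa> * sqrt (avg (Q_cyl m (\<kappa> * r) X) g)"
  shows "mean_osc (Q_cyl m r X) (even_ext w)
    \<le> (C + 2 * sqrt (\<kappa>0^(2*m + CARD('d))) * \<kappa>0) * inverse \<kappa> * sqrt (avg (Q_cyl m (\<kappa> * r) X) g)"
proof -
  define q where "q = 2*m + CARD('d)"
  define S where "S = sqrt (avg (Q_cyl m (\<kappa> * r) X) g)"
  have E: "continuous_on UNIV (even_ext w)" by (rule continuous_on_even_ext[OF C_inf_locD(1)[OF w]])
  have g0: "0 \<le> g z" for z using wg[of z] zero_le_power2[of "norm (even_ext w z)"] by linarith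
  have \<kappa>r: "\<kappa> * r > 0" using r \<kappa> by auto
  have a0: "0 \<le> avg (Q_cyl m (\<kappa> * r) X) g" by (rule avg_Q_cyl_nonneg[OF g g0 \<kappa>r])
  have S: "S \<ge> 0" by (simp add: S_def a0)
  have i\<kappa>: "0 < inverse \<kappa>" using \<kappa> by simp
  show ?thesis
  proof (cases "\<kappa>0 \<le> \<kappa>")
    case True
    have "mean_osc (Q_cyl m r X) (even_ext w) \<le> C * inverse \<kappa> * S"
    proof (rule mean_osc_le_oscillation[OF E r])
      fix z z' assume z: "z \<in> Q_cyl m r X" "z' \<in> Q_cyl m r X"
      \<comment> \<open>The box depends on the pair of points: its top is the later of their times,
        strictly below that of the centre, and the bound is uniform in \<tau>. As \<kappa> \<ge> 2,
        this top lies in the range required for the larger box.\<close>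
      define \<tau> where "\<tau> = max (fst z) (fst z')"
      have t: "fst X - r^(2*m) < \<tau>" "\<tau> < fst X" using z by (auto simp: \<tau>_def Q_cyl_def)
      have "r * 2 \<le> r * \<kappa>" using r \<kappa> by (intro mult_left_mono) auto
      then have "r^(2*m) \<le> (\<kappa> * r / 2)^(2*m)" using r by (intro power_mono) (auto simp: mult.commute)
      then have t': "fst X - (\<kappa> * r / 2)^(2*m) < \<tau>" using t by linarith
      have "fold_pt z \<in> kbox m \<tau> (snd X) r" "fold_pt z' \<in> kbox m \<tau> (snd X) r"
        using t by (auto intro!: fold_pt_in_kbox z X simp: \<tau>_def)
      then show "norm (even_ext w z - even_ext w z') \<le> C * inverse \<kappa> * S"
        unfolding even_ext_fold S_def by (rule large[OF True t' t(2)])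
    qed
    also have "... \<le> (C + 2 * sqrt (\<kappa>0^q) * \<kappa>0) * inverse \<kappa> * S"
      using S i\<kappa> \<kappa>0 by (intro mult_right_mono) auto
    finally show ?thesis by (simp add: S_def q_def)
  next
    case False
    have n2: "continuous_on UNIV (\<lambda>z. (norm (even_ext w z))\<^sup>2)" by (intro continuous_intros E)
    have "mean_osc (Q_cyl m r X) (even_ext w) \<le> 2 * sqrt (avg (Q_cyl m r X) (\<lambda>z. (norm (even_ext w z))\<^sup>2))"
      by (rule mean_osc_le_avg[OF E r])
    also have "... \<le> 2 * sqrt (\<kappa>0^q * avg (Q_cyl m (\<kappa> * r) X) g)"
    proof -
      have "avg (Q_cyl m r X) (\<lambda>z. (norm (even_ext w z))\<^sup>2) \<le> avg (Q_cyl m r X) g"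
        by (rule Q_cyl_avg_mono[OF n2 g wg])
      also have "... \<le> \<kappa>^q * avg (Q_cyl m (\<kappa> * r) X) g"
        unfolding q_def using \<kappa> by (intro avg_Q_cyl_le_scaled g g0 r) auto
      also have "... \<le> \<kappa>0^q * avg (Q_cyl m (\<kappa> * r) X) g"
        using False \<kappa> a0 by (intro mult_right_mono power_mono) auto
      finally show ?thesis by simp
    qed
    also have "... = 2 * sqrt (\<kappa>0^q) * 1 * S" by (simp add: S_def real_sqrt_mult)
    also have "... \<le> 2 * sqrt (\<kappa>0^q) * (\<kappa>0 * inverse \<kappa>) * S"
      using False \<kappa> \<kappa>0 S by (intro mult_right_mono mult_left_mono) (auto simp: field_simps)
    also have "... \<le> (C + 2 * sqrt (\<kappa>0^q) * \<kappa>0) * inverse \<kappa> * S"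
      using C S i\<kappa> by (simp add: algebra_simps)
    finally show ?thesis by (simp add: S_def q_def)
  qed
qed

lemma foldr_D_x_powers:
  "foldr (\<lambda>i. D_x i ^^ \<gamma> i) xs u = foldr D_x (concat (map (\<lambda>i. replicate (\<gamma> i) i) xs)) u"
  by (induction xs) (simp_all add: foldr_replicate)

text \<open>Since \<open>first\<close> is the least index, the normal derivatives come out as the
  outermost ones; the others flatten into a list of tangential directions, the form used by the
  estimates on boxes.\<close>

lemma D_mult_eq:
  fixes \<gamma> :: "('d::{finite,linorder}) \<Rightarrow> nat"
  assumes "\<gamma> \<in> multi_idx k"
  obtains js where "length js = k - \<gamma> first" "\<gamma> first \<le> k" "first \<notin> set js"
    "\<And>u :: 'd pt \<Rightarrow> 'b::real_normed_vector. D_mult \<gamma> u = (D1 ^^ \<gamma> first) (foldr D_x js u)"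
proof
  let ?xs = "sorted_list_of_set (UNIV - {first :: 'd})"
  let ?js = "concat (map (\<lambda>i. replicate (\<gamma> i) i) ?xs)"
  have "length ?js = sum_list (map \<gamma> ?xs)" by (simp add: length_concat o_def)
  also have "... = (\<Sum>i\<in>UNIV - {first}. \<gamma> i)" by (simp add: sum_list_distinct_conv_sum_set)
  finally have l: "length ?js = (\<Sum>i\<in>UNIV - {first}. \<gamma> i)" .
  have "(\<Sum>i\<in>UNIV. \<gamma> i) = \<gamma> first + (\<Sum>i\<in>UNIV - {first}. \<gamma> i)" by (rule sum.remove) auto
  then have "k = \<gamma> first + length ?js" using assms l by (simp add: multi_idx_def)
  then show "length ?js = k - \<gamma> first" "\<gamma> first \<le> k" by linarith+
  show "first \<notin> set ?js" by auto
  have "sorted_list_of_set (UNIV :: 'd set) = first # ?xs" by (rule sorted_list_of_set_nonempty) auto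
  then show "D_mult \<gamma> u = (D1 ^^ \<gamma> first) (foldr D_x ?js u)" for u :: "'d pt \<Rightarrow> 'b"
    by (simp add: D_mult_def foldr_D_x_powers)
qed

lemma alpha_hat_multi_idx: "(alpha_hat k :: ('d::{finite,linorder}) \<Rightarrow> nat) \<in> multi_idx k"
  by (simp add: alpha_hat_def multi_idx_def)

lemma D_mult_alpha_hat: "D_mult (alpha_hat k) u = (D1 ^^ k) u"
  for u :: "('d::{finite,linorder}) pt \<Rightarrow> 'b::real_normed_vector"
proof (rule D_mult_eq[OF alpha_hat_multi_idx[of k]])
  fix js :: "'d::{finite,linorder} list"
  assume "length js = k - alpha_hat k (first :: 'd)" and e: "\<And>u :: 'd pt \<Rightarrow> 'b. D_mult (alpha_hat k) u = (D1 ^^ alpha_hat k (first :: 'd)) (foldr D_x js u)"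
  then have js: "js = []" by (simp add: alpha_hat_def)
  have "D_mult (alpha_hat k) u = (D1 ^^ alpha_hat k (first :: 'd)) (foldr D_x js u)" by (rule e)
  then show "D_mult (alpha_hat k) u = (D1 ^^ k) u" unfolding js by (simp add: alpha_hat_def)
qed

lemma C_inf_loc_D_mult:
  fixes u :: "('d::{finite,linorder}) pt \<Rightarrow> 'b::real_normed_vector"
  assumes "C_inf_loc u"
  shows "C_inf_loc (D_mult \<gamma> u)"
proof -
  have "C_inf_loc (foldr (\<lambda>i. D_x i ^^ \<gamma> i) xs u)" for xs by (induction xs) (auto intro: C_inf_loc_D_x assms)
  then show ?thesis by (simp add: D_mult_def)
qed

lemma norm_E_Dk_power2: "(norm_E_Dk k u z)\<^sup>2 = (\<Sum>\<gamma>\<in>multi_idx k. (norm (even_ext (D_mult \<gamma> u) z))\<^sup>2)"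
  by (simp add: norm_E_Dk_def L2_set_def sum_nonneg)

lemma continuous_norm_E_Dk_power2:
  fixes u :: "('d::{finite,linorder}) pt \<Rightarrow> 'b::real_normed_vector"
  assumes "C_inf_loc u"
  shows "continuous_on UNIV (\<lambda>z. (norm_E_Dk k u z)\<^sup>2)"
  unfolding norm_E_Dk_power2
  by (intro continuous_intros continuous_on_even_ext C_inf_locD(1) C_inf_loc_D_mult assms)

lemma even_ext_D_mult_le: "\<gamma> \<in> multi_idx k \<Longrightarrow> (norm (even_ext (D_mult \<gamma> u) z))\<^sup>2 \<le> (norm_E_Dk k u z)\<^sup>2"
  unfolding norm_E_Dk_power2 by (rule member_le_sum) (auto simp: finite_multi_idx)

lemma D_mult_le:
  assumes "\<gamma> \<in> multi_idx k" "z \<in> O_bar"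
  shows "(norm (D_mult \<gamma> u z))\<^sup>2 \<le> (norm_E_Dk k u z)\<^sup>2"
  using even_ext_D_mult_le[OF assms(1), of u z] by (simp add: even_ext_fold fold_pt_id[OF assms(2)])

definition half_space_solution :: "nat \<Rightarrow> real \<Rightarrow> ('d::{finite,linorder}, 'n::finite) coeffs \<Rightarrow> real \<Rightarrow> real \<Rightarrow> 'd pt \<Rightarrow>
    ('d pt \<Rightarrow> complex ^ 'n) \<Rightarrow> bool" where
  "half_space_solution m \<delta> A lam R X u \<longleftrightarrow> admissible m \<delta> A \<and> lam \<ge> 0 \<and> X \<in> O_bar \<and> C_inf_loc u \<and>
     (\<forall>j<m. \<forall>t x. x $ first = 0 \<longrightarrow> (D1 ^^ j) u (t, x) = 0) \<and>
     (\<forall>z\<in>Q_cyl_plus m R X. D_t u z + (-1)^m *\<^sub>R L0 m A u z + lam *\<^sub>R u z = 0)"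

definition coef_bound :: "'n::finite itself \<Rightarrow> real \<Rightarrow> real" where
  "coef_bound _ \<delta> = real CARD('n) * (real CARD('n) * inverse \<delta>)"

abbreviation leading_coef :: "nat \<Rightarrow> ('d::{finite,linorder}, 'n::finite) coeffs \<Rightarrow> real \<Rightarrow> complex ^ 'n \<Rightarrow> complex ^ 'n" where
  "leading_coef m A \<equiv> \<lambda>t v. A (alpha_hat m) (alpha_hat m) t *v v"

text \<open>The equation is given in the open half-space only, whereas the box may contain points
  with x_1 = 0; it is carried to them by continuity along the normal direction.\<close>

lemma half_space_solution_admits:
  fixes u :: "('d::{finite,linorder}) pt \<Rightarrow> complex ^ ('n::finite)"
  assumes u: "half_space_solution m \<delta> A lam R X u" and \<delta>: "\<delta> > 0" and m: "m \<ge> 1"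
    and R: "R > 0" and \<tau>: "fst X - (R/2)^(2*m) < \<tau>" "\<tau> < fst X" and \<rho>: "0 < \<rho>" "\<rho> * (2 * real CARD('d)) \<le> R"
  shows "admits \<delta> (coef_bound TYPE('n) \<delta>) m (leading_coef m A) lam \<tau> (snd X) \<rho> u"
proof -
  let ?L = "leading_coef m A" and ?e = "e_x first :: 'd pt"
  let ?a = "lo m \<tau> (snd X) \<rho>" and ?b = "hi \<tau> (snd X) \<rho>"
  note h = u[unfolded half_space_solution_def]
  have C: "C_inf_loc u" and X: "snd X $ first \<ge> 0" and lam: "lam \<ge> 0" using h by (simp_all add: O_bar_eq)
  have L: "coef \<delta> (coef_bound TYPE('n) \<delta>) ?L" unfolding coef_bound_def using h \<delta> by (intro admissible_coef) auto
  have K: "half_box ?a ?b" by (rule half_box_kbox[OF \<rho>(1) X])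
  have sub: "cbox ?a ?b \<subseteq> Q_cyl m R X" by (rule kbox_subset_Q_cyl[OF R \<tau> \<rho> m])
  have pos: "pde m ?L lam u z = 0" if "z \<in> cbox ?a ?b" "snd z $ first > 0" for z
  proof -
    have "z \<in> Q_cyl_plus m R X" using that sub by (auto simp: Q_cyl_plus_def O_plus_def)
    then show ?thesis using h by (simp add: pde_def L0_def)
  qed
  have zero: "pde m ?L lam u z = 0" if z: "z \<in> cbox ?a ?b" and z0: "snd z $ first = 0" for z
  proof -
    define b where "b = snd X $ first + \<rho>"
    have b: "b > 0" using X \<rho> by (simp add: b_def)
    have a0: "max 0 (snd X $ first - \<rho>) = 0"
    proof -
      have "max 0 (snd X $ first - \<rho>) \<le> snd z $ first" using z unfolding mem_kbox by presburger
      then show ?thesis using z0 by linarith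
    qed
    have I: "{?a \<bullet> ?e..?b \<bullet> ?e} = {0..b}" unfolding lo_hi_inner b_def using a0 by simp
    have sl: "slice ?e z s \<in> cbox ?a ?b" if "s \<in> {0..b}" for s
      using slice_in_cbox[OF Basis_pt_simps(2) z, of s first] that unfolding I .
    have c: "continuous_on {0..b} (\<lambda>s. f (slice ?e z s))" if "C_inf_loc f" for f :: "'d pt \<Rightarrow> complex ^ 'n"
      using continuous_on_slice_fun[OF continuous_on_kbox[OF \<rho>(1) X that] Basis_pt_simps(2)[of first] z] unfolding I .
    have fst: "fst (slice ?e z s) = fst z" for s by (rule slice_e_x)
    have bl: "bounded_linear (?L (fst z))" using L unfolding coef_def by blast
    \<comment> \<open>Time does not change along this segment, so the coefficient is a fixed linear
      map, and continuity holds in spite of its mere measurability in t.\<close>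
    have cont: "continuous_on {0..b} (\<lambda>s. pde m ?L lam u (slice ?e z s))"
      unfolding pde_def fst
      by (intro continuous_intros c C_inf_loc_D_t C_inf_loc_D_x C bounded_linear.continuous_on[OF bl])
    have "pde m ?L lam u (slice ?e z 0) = 0"
    proof (rule continuous_constant_on_closure[where S="{0<..<b}" and f="\<lambda>s. pde m ?L lam u (slice ?e z s)"])
      show "continuous_on (closure {0<..<b}) (\<lambda>s. pde m ?L lam u (slice ?e z s))" using cont b by simp
      show "pde m ?L lam u (slice ?e z s) = 0" if "s \<in> {0<..<b}" for s
        using that by (intro pos sl) (auto simp: slice_e_x)
      show "0 \<in> closure {0<..<b}" using b by simp
    qed
    moreover have "slice ?e z 0 = z" using slice_self[of ?e z] z0 unfolding inner_e_x by simp
    ultimately show ?thesis by simp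
  qed
  have "pde m ?L lam u z = 0" if z: "z \<in> cbox ?a ?b" for z
  proof -
    have "z \<in> O_bar" using z K by (auto simp: half_box_def)
    then have "snd z $ first > 0 \<or> snd z $ first = 0" by (auto simp: O_bar_eq)
    then show ?thesis using pos[OF z] zero[OF z] by blast
  qed
  then have s: "solves m ?L lam ?a ?b u" using C by (simp add: solves_def)
  have "(D1 ^^ k) u z = 0" if "snd z $ first = 0" "k < m" for z k
  proof -
    have "(D1 ^^ k) u (fst z, snd z) = 0" using h that by blast
    then show ?thesis by simp
  qed
  then have "dirichlet m ?a ?b u" by (simp add: dirichlet_def)
  then show ?thesis using L lam \<rho> X s by (simp add: admits_def)
qed

lemma solves_foldr_D_x:
  fixes u :: "('d::{finite,linorder}) pt \<Rightarrow> 'b::euclidean_space"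
  assumes "half_box a b" "coef \<delta> M L" "solves m L lam a b u"
  shows "solves m L lam a b (foldr D_x js u)"
  by (induction js) (auto intro: solves_D_x[OF assms(1,2)] assms(3))

text \<open>The passage from boxes to cylinders, common to both estimates. The hypothesis normalises
  the energies of all derivatives of order k at once, so that an application may use that of
  \<open>D_mult \<gamma> u\<close>, of D_1^m u, or of whichever one it requires.\<close>

lemma mean_osc_D_mult:
  fixes \<gamma> :: "('d::{finite,linorder}) \<Rightarrow> nat"
  assumes m: "m \<ge> 1" and \<delta>: "\<delta> > 0" and \<gamma>: "\<gamma> \<in> multi_idx k" and K: "K \<ge> 0" and \<sigma>: "\<sigma> > 0" "\<sigma> \<le> 1"
    and osc: "\<And>(L :: real \<Rightarrow> complex ^ 'n \<Rightarrow> complex ^ ('n::finite)) lam \<tau> (x :: real ^ ('d::{finite,linorder})) \<rho> u A r z z'.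
     admits \<delta> (coef_bound TYPE('n) \<delta>) m L lam \<tau> x \<rho> u \<Longrightarrow> A \<ge> 0 \<Longrightarrow>
     (\<And>\<beta>. \<beta> \<in> multi_idx k \<Longrightarrow> energy m \<tau> x \<rho> (D_mult \<beta> u) \<le> A\<^sup>2 * \<rho>^(2*m + CARD('d))) \<Longrightarrow> 0 < r \<Longrightarrow> r \<le> \<sigma> * \<rho> \<Longrightarrow>
     z \<in> kbox m \<tau> x r \<Longrightarrow> z' \<in> kbox m \<tau> x r \<Longrightarrow>
     norm (D_mult \<gamma> u z - D_mult \<gamma> u z') \<le> K * A * (r / \<rho>)"
  shows "\<exists>N\<ge>0. \<forall>(A :: ('d, 'n) coeffs) r \<kappa> lam X u. r > 0 \<longrightarrow> \<kappa> \<ge> 2 \<longrightarrow> half_space_solution m \<delta> A lam (\<kappa> * r) X u \<longrightarrow>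
    mean_osc (Q_cyl m r X) (even_ext (D_mult \<gamma> u))
      \<le> N * inverse \<kappa> * sqrt (avg (Q_cyl m (\<kappa> * r) X) (\<lambda>z. (norm_E_Dk k u z)\<^sup>2))"
proof -
  define d where "d = real CARD('d)"
  have d: "d \<ge> 1" by (simp add: d_def)
  define q where "q = 2*m + CARD('d)"
  \<comment> \<open>With \<rho> = \<kappa> r/(2d), the volume of the large cylinder is B^2 \<rho>^q.
    Hence B times the root mean square over the cylinder is an admissible A on the box.\<close>
  define B where "B = sqrt ((2*d)^q * unit_ball_vol d)"
  have Bn: "(2*d)^q * unit_ball_vol d \<ge> 0" using d by simp
  have B: "B \<ge> 0" "B\<^sup>2 = (2*d)^q * unit_ball_vol d" using Bn by (simp_all add: B_def)
  \<comment> \<open>Exactly the threshold at which r \<le> \<sigma> \<rho> for the box radius \<rho>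
    = \<kappa> r/(2d).\<close>
  define \<kappa>0 where "\<kappa>0 = 2*d/\<sigma>"
  have \<kappa>0: "\<kappa>0 \<ge> 1" using \<sigma> d by (simp add: \<kappa>0_def field_simps)
  define C where "C = K * B * (2*d)"
  have C: "C \<ge> 0" unfolding C_def using K B d by simp
  show ?thesis
  proof (intro exI[of _ "C + 2 * sqrt (\<kappa>0^(2*m + CARD('d))) * \<kappa>0"] conjI allI impI)
    show "0 \<le> C + 2 * sqrt (\<kappa>0^(2*m + CARD('d))) * \<kappa>0" using C \<kappa>0 by simp
    fix A :: "('d::{finite,linorder}, 'n::finite) coeffs" and r \<kappa> lam and X :: "('d::{finite,linorder}) pt" and u :: "('d::{finite,linorder}) pt \<Rightarrow> complex ^ 'n"
    assume r: "r > 0" and \<kappa>: "\<kappa> \<ge> 2" and u: "half_space_solution m \<delta> A lam (\<kappa> * r) X u"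
    define g where "g = (\<lambda>z. (norm_E_Dk k u z)\<^sup>2)"
    have Cu: "C_inf_loc u" and X: "X \<in> O_bar" using u by (simp_all add: half_space_solution_def)
    have gc: "continuous_on UNIV g" unfolding g_def by (rule continuous_norm_E_Dk_power2[OF Cu])
    have R: "\<kappa> * r > 0" using r \<kappa> by simp
    define S where "S = sqrt (avg (Q_cyl m (\<kappa> * r) X) g)"
    have "0 \<le> avg (Q_cyl m (\<kappa> * r) X) g" by (rule avg_Q_cyl_nonneg[OF gc _ R]) (simp add: g_def)
    then have S: "S \<ge> 0" "S\<^sup>2 = avg (Q_cyl m (\<kappa> * r) X) g" by (simp_all add: S_def)
    have "mean_osc (Q_cyl m r X) (even_ext (D_mult \<gamma> u))
      \<le> (C + 2 * sqrt (\<kappa>0^(2*m + CARD('d))) * \<kappa>0) * inverse \<kappa> * sqrt (avg (Q_cyl m (\<kappa> * r) X) g)"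
    proof (rule mean_osc_even_ext_le[OF C_inf_loc_D_mult[OF Cu] gc _ r \<kappa> \<kappa>0 C X m])
      show "(norm (even_ext (D_mult \<gamma> u) z))\<^sup>2 \<le> g z" for z unfolding g_def by (rule even_ext_D_mult_le[OF \<gamma>])
      fix \<tau> z z' assume big: "\<kappa>0 \<le> \<kappa>" and \<tau>: "fst X - (\<kappa> * r / 2)^(2*m) < \<tau>" "\<tau> < fst X"
        and z: "z \<in> kbox m \<tau> (snd X) r" "z' \<in> kbox m \<tau> (snd X) r"
      define \<rho> where "\<rho> = \<kappa> * r / (2*d)"
      have \<rho>: "\<rho> > 0" "\<rho> * (2 * real CARD('d)) \<le> \<kappa> * r" using R d by (auto simp: \<rho>_def d_def)
      have R\<rho>: "\<kappa> * r = 2*d*\<rho>" using d by (simp add: \<rho>_def)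
      have r\<rho>: "r / \<rho> = 2*d * inverse \<kappa>" using r \<kappa> d by (simp add: \<rho>_def field_simps)
      have "r * (2*d) \<le> r * (\<kappa> * \<sigma>)" using big \<sigma> r by (intro mult_left_mono) (auto simp: \<kappa>0_def field_simps)
      then have small: "r \<le> \<sigma> * \<rho>" using d by (simp add: \<rho>_def field_simps)
      have x: "snd X $ first \<ge> 0" using X by (simp add: O_bar_eq)
      have sub: "kbox m \<tau> (snd X) \<rho> \<subseteq> Q_cyl m (\<kappa> * r) X" by (rule kbox_subset_Q_cyl[OF R \<tau> \<rho> m])
      have en: "energy m \<tau> (snd X) \<rho> (D_mult \<beta> u) \<le> (B * S)\<^sup>2 * \<rho>^(2*m + CARD('d))" if "\<beta> \<in> multi_idx k" for \<beta>
      proof -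
        have "energy m \<tau> (snd X) \<rho> (D_mult \<beta> u) \<le> (\<kappa> * r)^(2*m + CARD('d)) * unit_ball_vol (real CARD('d)) * avg (Q_cyl m (\<kappa> * r) X) g"
          using D_mult_le[OF that] by (intro energy_le_avg C_inf_loc_D_mult Cu gc R sub \<rho> x) (auto simp: g_def)
        also have "... = (B * S)\<^sup>2 * \<rho>^(2*m + CARD('d))"
          unfolding power_mult_distrib S(2) B(2) R\<rho> q_def[symmetric] d_def[symmetric] by (simp add: power_mult_distrib)
        finally show ?thesis .
      qed
      have BS: "B * S \<ge> 0" using B S by simp
      have "norm (D_mult \<gamma> u z - D_mult \<gamma> u z') \<le> K * (B * S) * (r / \<rho>)"
        by (rule osc[OF half_space_solution_admits[OF u \<delta> m R \<tau> \<rho>] BS en r small z])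
      also have "... = C * inverse \<kappa> * S" unfolding r\<rho> C_def by simp
      finally show "norm (D_mult \<gamma> u z - D_mult \<gamma> u z') \<le> C * inverse \<kappa> * sqrt (avg (Q_cyl m (\<kappa> * r) X) g)" by (simp add: S_def)
    qed
    then show "mean_osc (Q_cyl m r X) (even_ext (D_mult \<gamma> u))
      \<le> (C + 2 * sqrt (\<kappa>0^(2*m + CARD('d))) * \<kappa>0) * inverse \<kappa> * sqrt (avg (Q_cyl m (\<kappa> * r) X) (\<lambda>z. (norm_E_Dk k u z)\<^sup>2))"
      by (simp add: g_def)
  qed
qed

lemma oscillation_order_0:
  assumes "\<delta> > 0" "M \<ge> 0" "m \<ge> 1"
  shows "\<exists>C\<ge>0. \<exists>\<sigma>>0. \<sigma> \<le> 1 \<and> (\<forall>(L :: real \<Rightarrow> 'b::euclidean_space \<Rightarrow> 'b) lam \<tau> (x :: real ^ ('d::{finite,linorder})) \<rho> u A r z z'.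
     admits \<delta> M m L lam \<tau> x \<rho> u \<longrightarrow> A \<ge> 0 \<longrightarrow> energy m \<tau> x \<rho> u \<le> A\<^sup>2 * \<rho>^(2*m + CARD('d)) \<longrightarrow> 0 < r \<longrightarrow> r \<le> \<sigma> * \<rho> \<longrightarrow>
     z \<in> kbox m \<tau> x r \<longrightarrow> z' \<in> kbox m \<tau> x r \<longrightarrow> norm (u z - u z') \<le> C * A * (r / \<rho>))"
proof -
  obtain C \<sigma> where C: "C \<ge> 0" "\<sigma> > 0" "\<sigma> \<le> 1" and osc: "\<forall>(L :: real \<Rightarrow> 'b \<Rightarrow> 'b) lam \<tau> (x :: real ^ ('d::{finite,linorder})) \<rho> u js A r z z'.
     admits \<delta> M m L lam \<tau> x \<rho> u \<longrightarrow> length js = 0 \<longrightarrow> first \<notin> set js \<longrightarrow> A \<ge> 0 \<longrightarrow>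
     energy m \<tau> x \<rho> u \<le> A\<^sup>2 * \<rho>^(2*m + CARD('d)) \<longrightarrow> 0 < r \<longrightarrow> r \<le> \<sigma> * \<rho> \<longrightarrow> z \<in> kbox m \<tau> x r \<longrightarrow> z' \<in> kbox m \<tau> x r \<longrightarrow>
     \<rho>^(0+0) * norm ((D1 ^^ 0) (foldr D_x js u) z - (D1 ^^ 0) (foldr D_x js u) z') \<le> C * A * (r / \<rho>)"
    using oscillation[OF assms, where a=0 and n=0 and 'b='b and 'd='d] by blast
  show ?thesis
  proof (rule exI[of _ C], intro conjI C, rule exI[of _ \<sigma>], intro conjI C allI impI)
    fix L :: "real \<Rightarrow> 'b \<Rightarrow> 'b" and lam \<tau> and x :: "real ^ ('d::{finite,linorder})" and \<rho> u A r z z'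
    assume h: "admits \<delta> M m L lam \<tau> x \<rho> u" "A \<ge> 0" "energy m \<tau> x \<rho> u \<le> A\<^sup>2 * \<rho>^(2*m + CARD('d))" "0 < r" "r \<le> \<sigma> * \<rho>"
      "z \<in> kbox m \<tau> x r" "z' \<in> kbox m \<tau> x r"
    have "\<rho>^(0+0) * norm ((D1 ^^ 0) (foldr D_x [] u) z - (D1 ^^ 0) (foldr D_x [] u) z') \<le> C * A * (r / \<rho>)"
      by (rule osc[rule_format, OF h(1) _ _ h(2-7)]) auto
    then show "norm (u z - u z') \<le> C * A * (r / \<rho>)" by simp
  qed
qed

text \<open>Away from the flat boundary \<open>D\<^sup>\<gamma> u\<close> is itself a solution. Near it only \<open>u\<close> satisfies the Dirichlet
  condition, and the Poincare inequality controls \<open>u\<close> by \<open>D_1^m u\<close>.\<close>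

lemma mean_osc_order_m:
  fixes \<gamma> :: "('d::{finite,linorder}) \<Rightarrow> nat"
  assumes m: "m \<ge> 1" and \<delta>: "\<delta> > 0" and \<gamma>: "\<gamma> \<in> multi_idx m"
  shows "\<exists>N\<ge>0. \<forall>(A :: ('d, 'n::finite) coeffs) r \<kappa> lam X u. r > 0 \<longrightarrow> \<kappa> \<ge> 2 \<longrightarrow> half_space_solution m \<delta> A lam (\<kappa> * r) X u \<longrightarrow>
    mean_osc (Q_cyl m r X) (even_ext (D_mult \<gamma> u))
      \<le> N * inverse \<kappa> * sqrt (avg (Q_cyl m (\<kappa> * r) X) (\<lambda>z. (norm_E_Dk m u z)\<^sup>2))"
proof -
  define M where "M = coef_bound TYPE('n) \<delta>"
  have M: "M \<ge> 0" using \<delta> by (simp add: M_def coef_bound_def)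
  define a where "a = \<gamma> first"
  obtain js where js: "length js = m - a" "a \<le> m" "first \<notin> set js"
    and Dm: "\<And>u :: 'd pt \<Rightarrow> complex ^ 'n. D_mult \<gamma> u = (D1 ^^ a) (foldr D_x js u)"
    using D_mult_eq[OF \<gamma>, where 'b="complex ^ 'n"] unfolding a_def by metis
  obtain C0 \<sigma>0 where C0: "C0 \<ge> 0" "\<sigma>0 > 0" "\<sigma>0 \<le> 1" and osc0:
    "\<forall>(L :: real \<Rightarrow> complex ^ 'n \<Rightarrow> complex ^ 'n) lam \<tau> (x :: real ^ ('d::{finite,linorder})) \<rho> u A r z z'.
     admits \<delta> M m L lam \<tau> x \<rho> u \<longrightarrow> A \<ge> 0 \<longrightarrow> energy m \<tau> x \<rho> u \<le> A\<^sup>2 * \<rho>^(2*m + CARD('d)) \<longrightarrow> 0 < r \<longrightarrow> r \<le> \<sigma>0 * \<rho> \<longrightarrow>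
     z \<in> kbox m \<tau> x r \<longrightarrow> z' \<in> kbox m \<tau> x r \<longrightarrow> norm (u z - u z') \<le> C0 * A * (r / \<rho>)"
    using oscillation_order_0[OF \<delta> M m, where 'b="complex ^ 'n" and 'd='d] by blast
  obtain C1 \<sigma>1 where C1: "C1 \<ge> 0" "\<sigma>1 > 0" "\<sigma>1 \<le> 1" and osc1: "\<forall>(L :: real \<Rightarrow> complex ^ 'n \<Rightarrow> complex ^ 'n) lam \<tau> (x :: real ^ ('d::{finite,linorder})) \<rho> u js A r z z'.
     admits \<delta> M m L lam \<tau> x \<rho> u \<longrightarrow> length js = m - a \<longrightarrow> first \<notin> set js \<longrightarrow> A \<ge> 0 \<longrightarrow>
     energy m \<tau> x \<rho> u \<le> A\<^sup>2 * \<rho>^(2*m + CARD('d)) \<longrightarrow> 0 < r \<longrightarrow> r \<le> \<sigma>1 * \<rho> \<longrightarrow> z \<in> kbox m \<tau> x r \<longrightarrow> z' \<in> kbox m \<tau> x r \<longrightarrow>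
     \<rho>^(a+(m-a)) * norm ((D1 ^^ a) (foldr D_x js u) z - (D1 ^^ a) (foldr D_x js u) z') \<le> C1 * A * (r / \<rho>)"
    using oscillation[OF \<delta> M m, where a=a and n="m-a" and 'b="complex ^ 'n" and 'd='d] by blast
  show ?thesis
  proof (rule mean_osc_D_mult[OF m \<delta> \<gamma>, where K="C0 + C1 * 4^m" and \<sigma>="min \<sigma>0 \<sigma>1"])
    show "0 \<le> C0 + C1 * 4^m" "0 < min \<sigma>0 \<sigma>1" "min \<sigma>0 \<sigma>1 \<le> 1" using C0 C1 by auto
    fix L :: "real \<Rightarrow> complex ^ 'n \<Rightarrow> complex ^ 'n" and lam \<tau> and x :: "real ^ ('d::{finite,linorder})" and \<rho> u S r z z'
    assume "admits \<delta> (coef_bound TYPE('n) \<delta>) m L lam \<tau> x \<rho> u" and S: "0 \<le> S"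
      and en: "\<And>\<beta>. \<beta> \<in> multi_idx m \<Longrightarrow> energy m \<tau> x \<rho> (D_mult \<beta> u) \<le> S\<^sup>2 * \<rho>^(2*m + CARD('d))"
      and r: "0 < r" "r \<le> min \<sigma>0 \<sigma>1 * \<rho>" and z: "z \<in> kbox m \<tau> x r" "z' \<in> kbox m \<tau> x r"
    then have adm: "admits \<delta> M m L lam \<tau> x \<rho> u" by (simp add: M_def)
    let ?w = "D_mult \<gamma> u"
    note ad = admitsD[OF adm]
    have \<rho>: "\<rho> > 0" by (rule ad)
    have "min \<sigma>0 \<sigma>1 * \<rho> \<le> \<sigma>0 * \<rho>" "min \<sigma>0 \<sigma>1 * \<rho> \<le> \<sigma>1 * \<rho>" using \<rho> by (auto intro!: mult_right_mono)
    then have s: "r \<le> \<sigma>0 * \<rho>" "r \<le> \<sigma>1 * \<rho>" using r by linarith+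
    show "norm (?w z - ?w z') \<le> (C0 + C1 * 4^m) * S * (r / \<rho>)"
    proof (cases "x $ first > \<rho>")
      case True
      have "\<not> snd y $ first = 0" if "y \<in> kbox m \<tau> x \<rho>" for y
      proof -
        have "max 0 (x $ first - \<rho>) \<le> snd y $ first" using that unfolding mem_kbox by presburger
        then show ?thesis using True by auto
      qed
      \<comment> \<open>The box does not meet x_1 = 0, so the condition is vacuous for every
        function.\<close>
      then have "dirichlet m (lo m \<tau> x \<rho>) (hi \<tau> x \<rho>) ?w" unfolding dirichlet_def by blast
      moreover have "solves m L lam (lo m \<tau> x \<rho>) (hi \<tau> x \<rho>) ?w"
        unfolding Dm by (rule solves_funpow_D_x[OF ad(8,1) solves_foldr_D_x[OF ad(8,1,5)]])
      ultimately have "admits \<delta> M m L lam \<tau> x \<rho> ?w" using ad(1-4) by (simp add: admits_def)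
      then have "norm (?w z - ?w z') \<le> C0 * S * (r / \<rho>)" by (rule osc0[rule_format, OF _ S en[OF \<gamma>] r(1) s(1) z])
      also have "... \<le> (C0 + C1 * 4^m) * S * (r / \<rho>)" using S r \<rho> C1 by (intro mult_right_mono) auto
      finally show ?thesis .
    next
      case False
      \<comment> \<open>The factor \<rho>^m gained here for the normalised size of u cancels the
        factor \<rho>^m in front of the oscillation of a derivative of order m.\<close>
      have "energy m \<tau> x \<rho> u \<le> (16 * \<rho>\<^sup>2)^m * energy m \<tau> x \<rho> ((D1 ^^ m) u)"
        using False ad(4) by (intro energy_poincare[OF ad(7,6,3)]) auto
      also have "... \<le> (16 * \<rho>\<^sup>2)^m * (S\<^sup>2 * \<rho>^(2*m + CARD('d)))"
        using en[OF alpha_hat_multi_idx] \<rho> by (intro mult_left_mono) (auto simp: D_mult_alpha_hat)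
      also have "16 * \<rho>\<^sup>2 = (4 * \<rho>)\<^sup>2" by (simp add: power_mult_distrib)
      also have "((4 * \<rho>)\<^sup>2)^m = ((4 * \<rho>)^m)\<^sup>2" by (simp only: power_mult[symmetric] mult.commute)
      also have "((4 * \<rho>)^m)\<^sup>2 * (S\<^sup>2 * \<rho>^(2*m + CARD('d))) = ((4 * \<rho>)^m * S)\<^sup>2 * \<rho>^(2*m + CARD('d))"
        by (simp only: power_mult_distrib mult.assoc)
      finally have e: "energy m \<tau> x \<rho> u \<le> ((4 * \<rho>)^m * S)\<^sup>2 * \<rho>^(2*m + CARD('d))" .
      have A0: "0 \<le> (4 * \<rho>)^m * S" using S \<rho> by simp
      have "\<rho>^(a+(m-a)) * norm (?w z - ?w z') \<le> C1 * ((4 * \<rho>)^m * S) * (r / \<rho>)"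
        unfolding Dm by (rule osc1[rule_format, OF adm js(1,3) A0 e r(1) s(2) z])
      also have "... = \<rho>^m * (C1 * 4^m * S * (r / \<rho>))" by (simp only: power_mult_distrib mult_ac)
      finally have "\<rho>^m * norm (?w z - ?w z') \<le> \<rho>^m * (C1 * 4^m * S * (r / \<rho>))" using js(2) by simp
      then have "norm (?w z - ?w z') \<le> C1 * 4^m * S * (r / \<rho>)" by (rule mult_left_le_imp_le) (use \<rho> in simp)
      also have "... \<le> (C0 + C1 * 4^m) * S * (r / \<rho>)" using S r \<rho> C0 by (intro mult_right_mono) auto
      finally show ?thesis .
    qed
  qed
qed

lemma mean_osc_order_2m:
  assumes m: "m \<ge> 1" and \<delta>: "\<delta> > 0"
  shows "\<exists>N\<ge>0. \<forall>(A :: ('d::{finite,linorder}, 'n::finite) coeffs) r \<kappa> lam X u. r > 0 \<longrightarrow> \<kappa> \<ge> 2 \<longrightarrow> half_space_solution m \<delta> A lam (\<kappa> * r) X u \<longrightarrow>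
    mean_osc (Q_cyl m r X) (even_ext ((D1 ^^ (2*m)) u))
      \<le> N * inverse \<kappa> * sqrt (avg (Q_cyl m (\<kappa> * r) X) (\<lambda>z. (norm_E_Dk (2*m) u z)\<^sup>2))"
proof -
  define M where "M = coef_bound TYPE('n) \<delta>"
  have M: "M \<ge> 0" using \<delta> by (simp add: M_def coef_bound_def)
  obtain C0 \<sigma>0 where C0: "C0 \<ge> 0" "\<sigma>0 > 0" "\<sigma>0 \<le> 1" and osc0:
    "\<forall>(L :: real \<Rightarrow> complex ^ 'n \<Rightarrow> complex ^ 'n) lam \<tau> (x :: real ^ ('d::{finite,linorder})) \<rho> u A r z z'.
     admits \<delta> M m L lam \<tau> x \<rho> u \<longrightarrow> A \<ge> 0 \<longrightarrow> energy m \<tau> x \<rho> u \<le> A\<^sup>2 * \<rho>^(2*m + CARD('d)) \<longrightarrow> 0 < r \<longrightarrow> r \<le> \<sigma>0 * \<rho> \<longrightarrow>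
     z \<in> kbox m \<tau> x r \<longrightarrow> z' \<in> kbox m \<tau> x r \<longrightarrow> norm (u z - u z') \<le> C0 * A * (r / \<rho>)"
    using oscillation_order_0[OF \<delta> M m, where 'b="complex ^ 'n" and 'd='d] by blast
  have 1: "norm (D_mult (alpha_hat (2*m)) u z - D_mult (alpha_hat (2*m)) u z') \<le> C0 * S * (r / \<rho>)"
    if adm: "admits \<delta> (coef_bound TYPE('n) \<delta>) m L lam \<tau> x \<rho> u" and S: "0 \<le> S"
      and en: "\<And>\<beta>. \<beta> \<in> multi_idx (2*m) \<Longrightarrow> energy m \<tau> x \<rho> (D_mult \<beta> u) \<le> S\<^sup>2 * \<rho>^(2*m + CARD('d))"
      and r: "0 < r" "r \<le> \<sigma>0 * \<rho>" and z: "z \<in> kbox m \<tau> x r" "z' \<in> kbox m \<tau> x r"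
    for L :: "real \<Rightarrow> complex ^ 'n \<Rightarrow> complex ^ 'n" and lam \<tau> and x :: "real ^ ('d::{finite,linorder})" and \<rho> u S r z z'
  proof -
    have "admits \<delta> M m L lam \<tau> x \<rho> ((D1 ^^ (2*m)) u)" unfolding M_def by (rule admits_D1_2m[OF adm \<delta>])
    from osc0[rule_format, OF this S _ r z] show ?thesis using en[OF alpha_hat_multi_idx] by (simp add: D_mult_alpha_hat)
  qed
  show ?thesis
    using mean_osc_D_mult[OF m \<delta> alpha_hat_multi_idx C0 1] unfolding D_mult_alpha_hat .
qed

text \<open>The exponent of \<lambda> vanishes at the last index, where \<open>pow0\<close> gives 1
  even for \<lambda> = 0; the other terms are nonnegative.\<close>

lemma last_term_le_sum:
  fixes S :: "nat \<Rightarrow> real"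
  assumes "\<And>k. 0 \<le> S k" and e: "e n = 0"
  shows "S n \<le> (\<Sum>k=0..n. pow0 lam (e k) * S k)"
proof -
  have "pow0 lam (e n) * S n \<le> (\<Sum>k=0..n. pow0 lam (e k) * S k)"
    using assms by (intro member_le_sum) (auto simp: pow0_def)
  then show ?thesis using e by (simp add: pow0_def)
qed

theorem lemma8p4:
  fixes m :: nat and \<delta> :: real
  assumes "m \<ge> 1" and "\<delta> > 0"
  shows "\<exists>N::real.
    \<forall>(A :: ('d::{finite,linorder}, 'n::finite) coeffs) (r::real) (\<kappa>::real) (lam::real)
      (X0 :: 'd pt) (u :: 'd pt \<Rightarrow> complex ^ 'n).
      admissible m \<delta> A \<longrightarrow> r > 0 \<longrightarrow> \<kappa> \<ge> 64 \<longrightarrow> lam \<ge> 0 \<longrightarrow> X0 \<in> O_bar \<longrightarrow>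
      C_inf_loc u \<longrightarrow>
      (\<forall>j<m. \<forall>t x. x $ first = 0 \<longrightarrow> (D_x first ^^ j) u (t, x) = 0) \<longrightarrow>
      (\<forall>z\<in>Q_cyl_plus m (\<kappa> * r) X0.
         D_t u z + (-1) ^ m *\<^sub>R L0 m A u z + lam *\<^sub>R u z = 0) \<longrightarrow>
      (\<forall>\<gamma>\<in>multi_idx m.
         mean_osc (Q_cyl m r X0) (even_ext (D_mult \<gamma> u))
           \<le> N * inverse \<kappa> * (\<Sum>k=0..m. pow0 lam (1/2 - real k / (2 * real m)) *
               sqrt (avg (Q_cyl m (\<kappa> * r) X0) (\<lambda>z. (norm_E_Dk k u z)\<^sup>2)))) \<and>
      mean_osc (Q_cyl m r X0) (even_ext ((D_x first ^^ (2 * m)) u))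
        \<le> N * inverse \<kappa> * (\<Sum>k=0..2*m. pow0 lam (1 - real k / (2 * real m)) *
            sqrt (avg (Q_cyl m (\<kappa> * r) X0) (\<lambda>z. (norm_E_Dk k u z)\<^sup>2)))"
proof -
  have "\<forall>\<gamma>\<in>multi_idx m. \<exists>N\<ge>0. \<forall>(A :: ('d, 'n) coeffs) r \<kappa> lam X u. r > 0 \<longrightarrow> \<kappa> \<ge> 2 \<longrightarrow> half_space_solution m \<delta> A lam (\<kappa> * r) X u \<longrightarrow>
    mean_osc (Q_cyl m r X) (even_ext (D_mult \<gamma> u))
      \<le> N * inverse \<kappa> * sqrt (avg (Q_cyl m (\<kappa> * r) X) (\<lambda>z. (norm_E_Dk m u z)\<^sup>2))"
    using mean_osc_order_m[OF assms] by blast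
  from bchoice[OF this] obtain N where N': "\<forall>\<gamma>\<in>multi_idx m. N \<gamma> \<ge> 0 \<and> (\<forall>(A :: ('d, 'n) coeffs) r \<kappa> lam X u. r > 0 \<longrightarrow> \<kappa> \<ge> 2 \<longrightarrow> half_space_solution m \<delta> A lam (\<kappa> * r) X u \<longrightarrow>
    mean_osc (Q_cyl m r X) (even_ext (D_mult \<gamma> u))
      \<le> N \<gamma> * inverse \<kappa> * sqrt (avg (Q_cyl m (\<kappa> * r) X) (\<lambda>z. (norm_E_Dk m u z)\<^sup>2)))" by (rule exE)
  have N: "N \<gamma> \<ge> 0"
    "r > 0 \<Longrightarrow> \<kappa> \<ge> 2 \<Longrightarrow> half_space_solution m \<delta> A lam (\<kappa> * r) X u \<Longrightarrow>
     mean_osc (Q_cyl m r X) (even_ext (D_mult \<gamma> u))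
      \<le> N \<gamma> * inverse \<kappa> * sqrt (avg (Q_cyl m (\<kappa> * r) X) (\<lambda>z. (norm_E_Dk m u z)\<^sup>2))"
    if "\<gamma> \<in> multi_idx m" for \<gamma> and A :: "('d, 'n) coeffs" and r \<kappa> lam X u
    using bspec[OF N' that] by (simp_all only: simp_thms)
  obtain N' where N': "N' \<ge> 0" "\<And>(A :: ('d, 'n) coeffs) r \<kappa> lam X u. r > 0 \<Longrightarrow> \<kappa> \<ge> 2 \<Longrightarrow> half_space_solution m \<delta> A lam (\<kappa> * r) X u \<Longrightarrow>
    mean_osc (Q_cyl m r X) (even_ext ((D1 ^^ (2*m)) u))
      \<le> N' * inverse \<kappa> * sqrt (avg (Q_cyl m (\<kappa> * r) X) (\<lambda>z. (norm_E_Dk (2*m) u z)\<^sup>2))"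
    using mean_osc_order_2m[OF assms, where 'd='d and 'n='n] by blast
  \<comment> \<open>The multi-indices of order m are finite in number, so one sum of constants
    serves all of them and the second estimate too.\<close>
  define N0 where "N0 = (\<Sum>\<gamma>\<in>multi_idx m. N \<gamma>) + N'"
  have N\<gamma>: "N \<gamma> \<le> N0" if "\<gamma> \<in> multi_idx m" for \<gamma>
    using member_le_sum[OF that, of N] N(1) N'(1) by (simp add: N0_def finite_multi_idx)
  have N0': "N' \<le> N0" using N(1) by (simp add: N0_def sum_nonneg)
  show ?thesis
  proof (intro exI[of _ N0] allI impI conjI ballI)
    fix A :: "('d, 'n) coeffs" and r \<kappa> lam :: real and X0 :: "'d pt" and u :: "'d pt \<Rightarrow> complex ^ 'n"
    assume h: "admissible m \<delta> A" "r > 0" "\<kappa> \<ge> 64" "lam \<ge> 0" "X0 \<in> O_bar" "C_inf_loc u"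
      "\<forall>j<m. \<forall>t x. x $ first = 0 \<longrightarrow> (D_x first ^^ j) u (t, x) = 0"
      "\<forall>z\<in>Q_cyl_plus m (\<kappa> * r) X0. D_t u z + (-1) ^ m *\<^sub>R L0 m A u z + lam *\<^sub>R u z = 0"
    then have sol: "half_space_solution m \<delta> A lam (\<kappa> * r) X0 u" and \<kappa>: "\<kappa> \<ge> 2" by (simp_all add: half_space_solution_def)
    define S where "S k = sqrt (avg (Q_cyl m (\<kappa> * r) X0) (\<lambda>z. (norm_E_Dk k u z)\<^sup>2))" for k
    have \<kappa>r: "\<kappa> * r > 0" using h by simp
    have S: "0 \<le> S k" for k
      unfolding S_def real_sqrt_ge_0_iff by (rule avg_Q_cyl_nonneg[OF continuous_norm_E_Dk_power2[OF h(6)] _ \<kappa>r]) simp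
    have le: "n * inverse \<kappa> * S k \<le> N0 * inverse \<kappa> * (\<Sum>j=0..k. pow0 lam (e j) * S j)"
      if "0 \<le> n" "n \<le> N0" "e k = 0" for n k and e :: "nat \<Rightarrow> real"
    proof (rule mult_mono)
      show "n * inverse \<kappa> \<le> N0 * inverse \<kappa>" using that \<kappa> by (intro mult_right_mono) auto
      show "S k \<le> (\<Sum>j=0..k. pow0 lam (e j) * S j)" by (rule last_term_le_sum[where S=S and e=e and n=k and lam=lam]) (rule S that(3))+
      show "0 \<le> N0 * inverse \<kappa>" using that \<kappa> by simp
    qed (rule S)
    show "mean_osc (Q_cyl m r X0) (even_ext (D_mult \<gamma> u))
           \<le> N0 * inverse \<kappa> * (\<Sum>k=0..m. pow0 lam (1/2 - real k / (2 * real m)) *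
               sqrt (avg (Q_cyl m (\<kappa> * r) X0) (\<lambda>z. (norm_E_Dk k u z)\<^sup>2)))" if \<gamma>: "\<gamma> \<in> multi_idx m" for \<gamma>
    proof -
      have "mean_osc (Q_cyl m r X0) (even_ext (D_mult \<gamma> u)) \<le> N \<gamma> * inverse \<kappa> * S m"
        unfolding S_def by (rule N(2)[OF \<gamma> h(2) \<kappa> sol])
      also have "... \<le> N0 * inverse \<kappa> * (\<Sum>k=0..m. pow0 lam (1/2 - real k / (2 * real m)) * S k)"
        by (rule le[OF N(1)[OF \<gamma>] N\<gamma>[OF \<gamma>]]) (use assms(1) in simp)
      finally show ?thesis by (simp only: S_def)
    qed
    have "mean_osc (Q_cyl m r X0) (even_ext ((D1 ^^ (2*m)) u)) \<le> N' * inverse \<kappa> * S (2*m)"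
      unfolding S_def by (rule N'(2)[OF h(2) \<kappa> sol])
    also have "... \<le> N0 * inverse \<kappa> * (\<Sum>k=0..2*m. pow0 lam (1 - real k / (2 * real m)) * S k)"
      by (rule le[OF N'(1) N0']) (use assms(1) in simp)
    finally show "mean_osc (Q_cyl m r X0) (even_ext ((D_x first ^^ (2 * m)) u))
        \<le> N0 * inverse \<kappa> * (\<Sum>k=0..2*m. pow0 lam (1 - real k / (2 * real m)) *
            sqrt (avg (Q_cyl m (\<kappa> * r) X0) (\<lambda>z. (norm_E_Dk k u z)\<^sup>2)))"
      by (simp only: S_def)
  qed
qed

end
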